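(* Let $1<p<2$, $n\ge2$, and let $u$ be a weak solution of the problem $$\partial_t u-\mathrm{div}(|\nabla u|^{p-2}\nabla u)=f(x)\ \text{ in } B_1\times(-1,0],\qquad u=\phi(x)\ \text{ on } \partial_{pa}(B_1\times(-1,0]),$$ where $f,\phi\ge0$ are bounded and independent of time. Then for every $-1<s<t\le 0$, $$\|u(\cdot,t)-u(\cdot,s)\|_{L^\infty(B_1)}\le\frac{\mathcal{Q}}{2-p}\,\frac{t-s}{t+1}.$$ In particular, $$|\partial_t u(x,t)|\le\frac{4\mathcal{Q}}{2-p}\qquad\text{for a.e. }(x,t)\in B_1\times\Big(-\frac34,0\Big].$$ Here $$\mathcal{Q}=2\|\phi\|_{L^\infty(B_1)}+\|f\|_{L^\infty(B_1)}+C_1\|f\|_{L^\infty(B_1)}^{\frac{n+p}{(p-1)(n+2)}},$$ with $C_1=C_1(n,p)$ the constant of the global $L^\infty$ bound recalled in the context.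
   Context: $B_\rho$ is the open ball of radius $\rho$ centered at $0$ in $\mathbb{R}^n$. The parabolic boundary is $\partial_{pa}(B_1\times(-1,0])=(B_1\times\{-1\})\cup(\partial B_1\times[-1,0])$. The data $f=f(x)\ge0$ and $\phi=\phi(x)\ge 0$ do not depend on $t$ and satisfy $\|f\|_{L^\infty(B_1)}<\infty$ and $\|\phi\|_{L^\infty(\partial_{pa}(B_1\times(-1,0]))}=\|\phi\|_{L^\infty(B_1)}<\infty$. A weak solution is a function $u\in C([-1,0];L^2(B_1))\cap L^p((-1,0);W^{1,p}(B_1))$ such that for every $-1\le t_1<t_2\le 0$ and every $\varphi\in W^{1,2}((-1,0);L^2(B_1))\cap L^p((-1,0);W^{1,p}_0(B_1))$, $$\int_{B_1}u\varphi\,dx\Big|_{t_1}^{t_2}+\int_{t_1}^{t_2}\int_{B_1}\big(-u\,\partial_t\varphi+|\nabla u|^{p-2}\nabla u\cdot\nabla\varphi\big)\,dxdt=\int_{t_1}^{t_2}\int_{B_1}f(x)\varphi\,dxdt,$$ and such that $u=\phi$ on the parabolic boundary: $u(\cdot,-1)=\phi$ in $L^2(B_1)$ and $u(\cdot,t)=\phi$ on $\partial B_1$ in the Sobolev trace sense for a.e. $t$. $C_1=C_1(n,p)>0$ is a fixed constant, depending only on $n,p$, for which every such weak solution satisfies $\|u\|_{L^\infty(B_1\times(-1,0])}\le\|\phi\|_{L^\infty(B_1)}+C_1\|f\|_{L^\infty(B_1)}^{\frac{n+p}{(p-1)(n+2)}}$. *)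

theory Defs
  imports "HOL-Analysis.Analysis" "HOL-Probability.Essential_Supremum"
begin

primrec Ck :: "nat \<Rightarrow> ('a::real_normed_vector \<Rightarrow> 'b::real_normed_vector) \<Rightarrow> bool" where
  "Ck 0 g \<longleftrightarrow> continuous_on UNIV g"
| "Ck (Suc k) g \<longleftrightarrow>
     (\<forall>x. g differentiable (at x)) \<and> (\<forall>v. Ck k (\<lambda>x. frechet_derivative g (at x) v))"

definition smooth :: "('a::real_normed_vector \<Rightarrow> 'b::real_normed_vector) \<Rightarrow> bool" where
  "smooth g \<longleftrightarrow> (\<forall>k. Ck k g)"

definition test_fun :: "'a::euclidean_space set \<Rightarrow> ('a \<Rightarrow> real) \<Rightarrow> bool" where
  "test_fun \<Omega> \<zeta> \<longleftrightarrow> smooth \<zeta> \<and> compact (closure {x. \<zeta> x \<noteq> 0}) \<and> closure {x. \<zeta> x \<noteq> 0} \<subseteq> \<Omega>"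

definition grad :: "(real ^ 'n \<Rightarrow> real) \<Rightarrow> real ^ 'n \<Rightarrow> real ^ 'n" where
  "grad g x = (\<chi> i. frechet_derivative g (at x) (axis i 1))"

definition Lp_fun :: "real \<Rightarrow> 'a measure \<Rightarrow> ('a \<Rightarrow> 'b::euclidean_space) \<Rightarrow> bool" where
  "Lp_fun q M g \<longleftrightarrow> g \<in> borel_measurable M \<and> integrable M (\<lambda>x. norm (g x) powr q)"

definition Lp_tendsto ::
    "real \<Rightarrow> 'a measure \<Rightarrow> (nat \<Rightarrow> 'a \<Rightarrow> 'b::euclidean_space) \<Rightarrow> ('a \<Rightarrow> 'b) \<Rightarrow> bool" where
  "Lp_tendsto q M w g \<longleftrightarrow> (\<forall>k. Lp_fun q M (w k)) \<and> Lp_fun q M g \<and>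
     (\<lambda>k. LINT x|M. norm (w k x - g x) powr q) \<longlonglongrightarrow> 0"

text \<open>The value is \<open>\<infinity>\<close> if \<open>g\<close> is not measurable, so a finite norm includes measurability.\<close>
definition Linf_norm :: "'a measure \<Rightarrow> ('a \<Rightarrow> real) \<Rightarrow> ereal" where
  "Linf_norm M g = esssup M (\<lambda>x. ereal \<bar>g x\<bar>)"

definition locally_integrable_on :: "('a::euclidean_space \<Rightarrow> real) \<Rightarrow> 'a set \<Rightarrow> bool" where
  "locally_integrable_on g \<Omega> \<longleftrightarrow> (\<forall>K. compact K \<and> K \<subseteq> \<Omega> \<longrightarrow> g absolutely_integrable_on K)"

text \<open>\<open>h\<close> is the weak derivative of \<open>g\<close> in the direction \<open>e\<close> on the open set \<open>\<Omega>\<close>.\<close>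
definition weak_deriv :: "'a::euclidean_space set \<Rightarrow> 'a \<Rightarrow> ('a \<Rightarrow> real) \<Rightarrow> ('a \<Rightarrow> real) \<Rightarrow> bool" where
  "weak_deriv \<Omega> e g h \<longleftrightarrow> locally_integrable_on g \<Omega> \<and> locally_integrable_on h \<Omega> \<and>
     (\<forall>\<zeta>. test_fun \<Omega> \<zeta> \<longrightarrow>
        (LINT x:\<Omega>|lebesgue. g x * frechet_derivative \<zeta> (at x) e) = - (LINT x:\<Omega>|lebesgue. h x * \<zeta> x))"

abbreviation B1 :: "(real ^ 'n) set" where
  "B1 \<equiv> ball 0 1"

text \<open>\<open>g\<close> belongs to \<open>W\<^sup>1\<^sup>,\<^sup>p(B1)\<close> and has the weak gradient \<open>G\<close>.\<close>
definition W1p :: "real \<Rightarrow> (real ^ 'n \<Rightarrow> real) \<Rightarrow> (real ^ 'n \<Rightarrow> real ^ 'n) \<Rightarrow> bool" where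
  "W1p p g G \<longleftrightarrow> Lp_fun p (lebesgue_on B1) g \<and> Lp_fun p (lebesgue_on B1) G \<and>
     (\<forall>i. weak_deriv B1 (axis i 1) g (\<lambda>x. G x $ i))"

definition W1p_0 :: "real \<Rightarrow> (real ^ 'n \<Rightarrow> real) \<Rightarrow> (real ^ 'n \<Rightarrow> real ^ 'n) \<Rightarrow> bool" where
  "W1p_0 p g G \<longleftrightarrow> W1p p g G \<and>
     (\<exists>w. (\<forall>k. test_fun B1 (w k)) \<and>
          Lp_tendsto p (lebesgue_on B1) w g \<and>
          Lp_tendsto p (lebesgue_on B1) (\<lambda>k. grad (w k)) G)"

text \<open>Surface measure on the unit sphere, by the cone formula: the surface area of \<open>A\<close> is \<open>n\<close> times
  the volume of the cone \<open>{x \<in> B1. x \<noteq> 0 \<and> x / |x| \<in> A}\<close>. It is completed, like \<^const>\<open>lebesgue\<close>.\<close>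
definition surface_measure :: "(real ^ 'n) measure" where
  "surface_measure =
     completion (scale_measure (of_nat CARD('n))
       (distr (lebesgue_on (B1 - {0})) (restrict_space borel (sphere 0 1)) sgn))"

text \<open>The trace operator is the continuous extension to \<open>W\<^sup>1\<^sup>,\<^sup>p(B1)\<close> of the restriction to
  the sphere of functions that are smooth up to the boundary. Here \<open>h\<close> is the trace of \<open>g\<close>;
  only the values of \<open>h\<close> on the sphere matter.\<close>
definition has_trace ::
    "real \<Rightarrow> (real ^ 'n \<Rightarrow> real) \<Rightarrow> (real ^ 'n \<Rightarrow> real ^ 'n) \<Rightarrow> (real ^ 'n \<Rightarrow> real) \<Rightarrow> bool" where
  "has_trace p g G h \<longleftrightarrow> W1p p g G \<and>
     (\<exists>w. (\<forall>k. smooth (w k)) \<and>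
          Lp_tendsto p (lebesgue_on B1) w g \<and>
          Lp_tendsto p (lebesgue_on B1) (\<lambda>k. grad (w k)) G \<and>
          Lp_tendsto p surface_measure w h)"

text \<open>A time-dependent function is written \<open>u t x\<close>; its time slice \<open>u t\<close> represents an
  element of a function space on \<open>B1\<close>. In space-time, the time coordinate comes first.\<close>

abbreviation Cyl :: "(real \<times> (real ^ 'n)) set" where
  "Cyl \<equiv> {-1<..<0} \<times> B1"

definition C_L2 :: "(real \<Rightarrow> real ^ 'n \<Rightarrow> real) \<Rightarrow> bool" where
  "C_L2 u \<longleftrightarrow> (\<forall>t\<in>{-1..0}. Lp_fun 2 (lebesgue_on B1) (u t)) \<and>
     (\<forall>t\<in>{-1..0}.
        ((\<lambda>s. LINT x|lebesgue_on B1. (u s x - u t x)\<^sup>2) \<longlongrightarrow> 0) (at t within {-1..0}))"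

text \<open>The Bochner spaces \<open>L\<^sup>p((-1,0); W\<^sup>1\<^sup>,\<^sup>p(B1))\<close> and \<open>L\<^sup>p((-1,0); W\<^sup>1\<^sup>,\<^sup>p\<^sub>0(B1))\<close>,
  with \<open>L\<^sup>p((-1,0); L\<^sup>p(B1))\<close> identified as usual with \<open>L\<^sup>p\<close> of the cylinder;
  \<open>Du\<close> is the spatial gradient.\<close>

definition Lp_W1p ::
    "real \<Rightarrow> (real \<Rightarrow> real ^ 'n \<Rightarrow> real) \<Rightarrow> (real \<Rightarrow> real ^ 'n \<Rightarrow> real ^ 'n) \<Rightarrow> bool" where
  "Lp_W1p p u Du \<longleftrightarrow>
     Lp_fun p (lebesgue_on Cyl) (\<lambda>(t, x). u t x) \<and>
     Lp_fun p (lebesgue_on Cyl) (\<lambda>(t, x). Du t x) \<and>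
     (AE t in lebesgue_on {-1<..<0}. W1p p (u t) (Du t))"

definition Lp_W1p_0 ::
    "real \<Rightarrow> (real \<Rightarrow> real ^ 'n \<Rightarrow> real) \<Rightarrow> (real \<Rightarrow> real ^ 'n \<Rightarrow> real ^ 'n) \<Rightarrow> bool" where
  "Lp_W1p_0 p u Du \<longleftrightarrow> Lp_W1p p u Du \<and>
     (AE t in lebesgue_on {-1<..<0}. W1p_0 p (u t) (Du t))"

definition weak_time_deriv :: "(real \<Rightarrow> real ^ 'n \<Rightarrow> real) \<Rightarrow> (real \<Rightarrow> real ^ 'n \<Rightarrow> real) \<Rightarrow> bool" where
  "weak_time_deriv u ut \<longleftrightarrow> weak_deriv Cyl (1, 0) (\<lambda>(t, x). u t x) (\<lambda>(t, x). ut t x)"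

text \<open>\<open>W\<^sup>1\<^sup>,\<^sup>2((-1,0); L\<^sup>2(B1))\<close>. Each class has a unique representative that is continuous
  from \<open>[-1,0]\<close> to \<open>L\<^sup>2(B1)\<close>; \<open>C_L2\<close> selects it, so that the slice at every time is
  meaningful.\<close>
definition W12_L2 :: "(real \<Rightarrow> real ^ 'n \<Rightarrow> real) \<Rightarrow> (real \<Rightarrow> real ^ 'n \<Rightarrow> real) \<Rightarrow> bool" where
  "W12_L2 v vt \<longleftrightarrow> C_L2 v \<and>
     Lp_fun 2 (lebesgue_on Cyl) (\<lambda>(t, x). v t x) \<and>
     Lp_fun 2 (lebesgue_on Cyl) (\<lambda>(t, x). vt t x) \<and>
     weak_time_deriv v vt"

text \<open>The parabolic boundary consists of the bottom \<open>B1 \<times> {-1}\<close>, with Lebesgue measure, and the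
  lateral part, with surface measure times \<open>dt\<close>. The time variable plays no role in the
  essential supremum of a time-independent function.\<close>
definition Linf_norm_pa :: "(real ^ 'n \<Rightarrow> real) \<Rightarrow> ereal" where
  "Linf_norm_pa \<phi> = max (Linf_norm (lebesgue_on B1) \<phi>) (Linf_norm surface_measure \<phi>)"

text \<open>\<open>\<phi>\<close> lives on the closed unit ball: its values on \<open>B1\<close> are the initial data, those on the
  sphere the lateral boundary data.\<close>
definition admissible_data :: "(real ^ 'n \<Rightarrow> real) \<Rightarrow> (real ^ 'n \<Rightarrow> real) \<Rightarrow> bool" where
  "admissible_data f \<phi> \<longleftrightarrow>
     (AE x in lebesgue_on B1. 0 \<le> f x) \<and>
     (AE x in lebesgue_on B1. 0 \<le> \<phi> x) \<and>
     (AE x in surface_measure. 0 \<le> \<phi> x) \<and>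
     Linf_norm (lebesgue_on B1) f < \<infinity> \<and>
     Linf_norm_pa \<phi> = Linf_norm (lebesgue_on B1) \<phi> \<and>
     Linf_norm (lebesgue_on B1) \<phi> < \<infinity>"

text \<open>Since \<open>0 powr (p - 2) = 0\<close>, the flux is \<open>0\<close> where the gradient vanishes.\<close>
definition weak_solution ::
    "real \<Rightarrow> (real ^ 'n \<Rightarrow> real) \<Rightarrow> (real ^ 'n \<Rightarrow> real) \<Rightarrow> (real \<Rightarrow> real ^ 'n \<Rightarrow> real) \<Rightarrow> bool" where
  "weak_solution p f \<phi> u \<longleftrightarrow> C_L2 u \<and>
     (\<exists>Du. Lp_W1p p u Du \<and>
        (\<forall>t1 t2 v vt Dv. -1 \<le> t1 \<and> t1 < t2 \<and> t2 \<le> 0 \<and> W12_L2 v vt \<and> Lp_W1p_0 p v Dv \<longrightarrow>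
           (LINT x:B1|lebesgue. u t2 x * v t2 x) - (LINT x:B1|lebesgue. u t1 x * v t1 x)
           + (LINT (t, x):{t1<..<t2} \<times> B1|lebesgue.
                - u t x * vt t x + (norm (Du t x) powr (p - 2) *\<^sub>R Du t x) \<bullet> Dv t x)
           = (LINT (t, x):{t1<..<t2} \<times> B1|lebesgue. f x * v t x)) \<and>
        (AE x in lebesgue_on B1. u (-1) x = \<phi> x) \<and>
        (AE t in lebesgue_on {-1<..<0}. has_trace p (u t) (Du t) \<phi>))"

end

(* Scaling turns the statement into a comparison principle. If lam = (s+1)/(t+1) and
   j = lam^(1/(2-p)), then w(r) = j u((r+1)/lam - 1) solves the same equation with data
   j^(p-1) f and j phi, and w(s) = j u(t). Comparing u with w on (-1,s) gives
   |u(s) - j u(t)| <= (1-j)(|phi| + |f|), hence |u(t) - u(s)| <= (1-j) Q, and 1 - j is at most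
   (1-lam)/(2-p).

   For the comparison, u1 - u2 minus the barrier m + c(t+1) is tested with a smooth version of
   its positive part at one fixed time t, which is constant in time and so needs no
   regularity of u in t. Convexity bounds the backward increments of the energy by a space-time
   integral that is monotone up to an L^p translation error; the latter vanishes on average.
   That the positive part lies in W_0^(1,p) follows from a boundary layer estimate obtained by
   integrating along rays.

   The time derivative is the limit of dyadic difference quotients in t, which converge since
   their increments are orthogonal in L^2. *)

theory Submission
  imports Defs "HOL-Computational_Algebra.Polynomial"
begin

section \<open>Smooth functions\<close>

text \<open>The exponent in j is forced: stretching time by 1/lam and multiplying by j scales the
  time term by j/lam and the diffusion by j^(p-1), which agree exactly when j^(2-p) = lam. So a
  shift in time is traded for a factor on the data. The second |phi| in Q, and the term with C1,
  come from the global bound on u, spent on (1-j) u(t); the factor 1/(2-p) is a weighted mean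
  inequality for j^(2-p). The obstacle is regularity. Test functions need a time derivative in L^2,
  so the positive part of a difference of solutions cannot be used while it moves. Freezing it at t
  costs the difference of gradient slices at s and t, which is small only in mean over t; the energy
  is therefore shown to vanish by averaging, not by a differential inequality. The boundary
  condition is known only through smooth functions converging in L^p on the sphere. They become test
  functions after a cutoff in a shell of width about epsilon, whose gradient costs epsilon^(-p); the
  boundary layer estimate, in which the radial part gains exactly epsilon^p, repays this and leaves
  a negative power only on the vanishing surface term.\<close>

lemma Ck_Suc_I:
  assumes "\<And>x. (g has_derivative g' x) (at x)" "\<And>v. Ck k (\<lambda>x. g' x v)"
  shows "Ck (Suc k) g"
proof -
  have "frechet_derivative g (at x) = g' x" for x
    using assms(1) frechet_derivative_at by metis
  then show ?thesis using assms by (auto simp: differentiable_def)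
qed

lemma Ck_Suc_E:
  assumes "Ck (Suc k) g"
  obtains g' where "\<And>x. (g has_derivative g' x) (at x)" "\<And>v. Ck k (\<lambda>x. g' x v)"
  using assms frechet_derivative_works by (auto intro!: that[of "\<lambda>x. frechet_derivative g (at x)"])

lemma Ck_Suc_imp_Ck: "Ck (Suc k) g \<Longrightarrow> Ck k g"
proof (induction k arbitrary: g)
  case 0
  then show ?case
    by (auto simp: continuous_on_eq_continuous_at intro: differentiable_imp_continuous_within)
next
  case (Suc k)
  then show ?case by (metis Ck.simps(2))
qed

lemma Ck_const [simp]: "Ck k (\<lambda>x. c)"
  by (induction k arbitrary: c) (auto simp: frechet_derivative_const)

lemma Ck_linear: "bounded_linear f \<Longrightarrow> Ck k f"
  by (cases k) (auto simp: linear_continuous_on bounded_linear_imp_differentiable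
      frechet_derivative_at[OF bounded_linear_imp_has_derivative, symmetric])

lemma Ck_add: "Ck k f \<Longrightarrow> Ck k g \<Longrightarrow> Ck k (\<lambda>x. f x + g x)"
proof (induction k arbitrary: f g)
  case 0 then show ?case by (auto intro: continuous_intros)
next
  case (Suc k)
  from Suc.prems(1) obtain f' where f: "\<And>x. (f has_derivative f' x) (at x)" "\<And>v. Ck k (\<lambda>x. f' x v)" 
    by (rule Ck_Suc_E) blast
  from Suc.prems(2) obtain g' where g: "\<And>x. (g has_derivative g' x) (at x)" "\<And>v. Ck k (\<lambda>x. g' x v)" 
    by (rule Ck_Suc_E) blast
  show ?case
    by (rule Ck_Suc_I[where g' = "\<lambda>x v. f' x v + g' x v"]) (auto intro!: derivative_intros f g Suc.IH)
qed

lemma Ck_mult: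
  fixes f g :: "'a::real_normed_vector \<Rightarrow> real"
  shows "Ck k f \<Longrightarrow> Ck k g \<Longrightarrow> Ck k (\<lambda>x. f x * g x)"
proof (induction k arbitrary: f g)
  case 0 then show ?case by (auto intro: continuous_intros)
next
  case (Suc k)
  from Suc.prems(1) obtain f' where f: "\<And>x. (f has_derivative f' x) (at x)" "\<And>v. Ck k (\<lambda>x. f' x v)" 
    by (rule Ck_Suc_E) blast
  from Suc.prems(2) obtain g' where g: "\<And>x. (g has_derivative g' x) (at x)" "\<And>v. Ck k (\<lambda>x. g' x v)" 
    by (rule Ck_Suc_E) blast
  show ?case
    by (rule Ck_Suc_I[where g' = "\<lambda>x v. f x * g' x v + f' x v * g x"])
      (auto intro!: derivative_intros f g Suc.IH Ck_add Ck_Suc_imp_Ck[OF Suc.prems(1)] Ck_Suc_imp_Ck[OF Suc.prems(2)])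
qed

text \<open>The induction closes because the outer function lives on the real line: its derivative
  is multiplication by its value at 1, so the chain rule yields a product of a composition and a
  derivative, both one order lower.\<close>

lemma Ck_compose:
  fixes f :: "'a::real_normed_vector \<Rightarrow> real" and g :: "real \<Rightarrow> real"
  shows "Ck k f \<Longrightarrow> Ck k g \<Longrightarrow> Ck k (\<lambda>x. g (f x))"
proof (induction k arbitrary: f g)
  case 0 then show ?case by (auto intro: continuous_on_compose2)
next
  case (Suc k)
  from Suc.prems(1) obtain f' where f: "\<And>x. (f has_derivative f' x) (at x)" "\<And>v. Ck k (\<lambda>x. f' x v)" 
    by (rule Ck_Suc_E) blast
  from Suc.prems(2) obtain g' where g: "\<And>x. (g has_derivative g' x) (at x)" "\<And>v. Ck k (\<lambda>x. g' x v)" 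
    by (rule Ck_Suc_E) blast
  have lin: "g' y v = g' y 1 * v" for y v
    using linear_scale[OF has_derivative_linear[OF g(1)], of y v 1] by (simp add: mult.commute)
  show ?case
  proof (rule Ck_Suc_I[where g' = "\<lambda>x v. g' (f x) 1 * f' x v"])
    fix x
    show "((\<lambda>x. g (f x)) has_derivative (\<lambda>v. g' (f x) 1 * f' x v)) (at x)"
    proof -
      have "(\<lambda>v. g' (f x) (f' x v)) = (\<lambda>v. g' (f x) 1 * f' x v)" by (rule ext, rule lin)
      then show ?thesis using has_derivative_compose[OF f(1) g(1), of x] by metis
    qed
  next
    fix v show "Ck k (\<lambda>x. g' (f x) 1 * f' x v)"
      by (rule Ck_mult[OF Suc.IH[OF Ck_Suc_imp_Ck[OF Suc.prems(1)] g(2)] f(2)])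
  qed
qed

lemma smooth_const [simp]: "smooth (\<lambda>x. c)"
  and smooth_linear: "bounded_linear f \<Longrightarrow> smooth f"
  by (auto simp: smooth_def Ck_linear)

lemma smooth_add: "smooth f \<Longrightarrow> smooth g \<Longrightarrow> smooth (\<lambda>x. f x + g x)"
  by (auto simp: smooth_def Ck_add)

lemma smooth_mult:
  fixes f g :: "'a::real_normed_vector \<Rightarrow> real"
  shows "smooth f \<Longrightarrow> smooth g \<Longrightarrow> smooth (\<lambda>x. f x * g x)"
  by (auto simp: smooth_def Ck_mult)

lemma smooth_compose:
  fixes f :: "'a::real_normed_vector \<Rightarrow> real" and g :: "real \<Rightarrow> real"
  shows "smooth g \<Longrightarrow> smooth f \<Longrightarrow> smooth (\<lambda>x. g (f x))"
  by (auto simp: smooth_def Ck_compose)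

lemma smooth_diff:
  fixes f g :: "'a::real_normed_vector \<Rightarrow> real"
  shows "smooth f \<Longrightarrow> smooth g \<Longrightarrow> smooth (\<lambda>x. f x - g x)"
  using smooth_add[of f "\<lambda>x. (-1) * g x"] smooth_mult[of "\<lambda>x. -1" g] by simp

lemma smooth_norm_sq: "smooth (\<lambda>x::real^'n. (norm x)\<^sup>2)"
proof -
  have "Ck k (\<lambda>x::real^'n. (norm x)\<^sup>2)" for k
  proof (cases k)
    case 0 then show ?thesis by (auto intro!: continuous_intros)
  next
    case (Suc l)
    \<comment> \<open>The derivative 2 (x . v) is linear in x, hence of every class, so no induction
      on the order is needed.\<close>
    have "bounded_linear (\<lambda>x::real^'n. 2 * (x \<bullet> v))" for v
      by (intro bounded_linear_intros)
    then have "Ck (Suc l) (\<lambda>x::real^'n. x \<bullet> x)"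
      by (intro Ck_Suc_I[where g' = "\<lambda>x v. 2 * (x \<bullet> v)"] Ck_linear)
        (auto intro!: derivative_eq_intros simp: inner_commute)
    then show ?thesis by (simp add: Suc power2_norm_eq_inner)
  qed
  then show ?thesis by (simp add: smooth_def)
qed

lemma smooth_has_derivative:
  "smooth f \<Longrightarrow> (f has_derivative frechet_derivative f (at x)) (at x)"
  unfolding smooth_def using frechet_derivative_works Ck.simps(2) by blast

lemma smooth_frechet_derivative:
  "smooth f \<Longrightarrow> smooth (\<lambda>x. frechet_derivative f (at x) v)"
  unfolding smooth_def using Ck.simps(2) by blast

lemma smooth_continuous: "smooth f \<Longrightarrow> continuous_on S f"
  unfolding smooth_def using Ck.simps(1) continuous_on_subset by blast

lemma smooth_deriv:
  assumes "smooth (f :: real \<Rightarrow> real)"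
  shows "(f has_real_derivative deriv f x) (at x)" "smooth (deriv f)"
proof -
  show *: "(f has_real_derivative deriv f x) (at x)" for x
    using smooth_has_derivative[OF assms] by (meson DERIV_deriv_iff_real_differentiable differentiableI)
  have "frechet_derivative f (at x) 1 = deriv f x" for x
    using *[of x] frechet_derivative_at[of f "(*) (deriv f x)" x] unfolding has_field_derivative_def by (metis mult.right_neutral)
  with smooth_frechet_derivative[OF assms, of 1] show "smooth (deriv f)" by simp
qed

lemma grad_nth: "grad f x $ i = frechet_derivative f (at x) (axis i 1)"
  by (simp add: grad_def)

lemma smooth_frechet_grad:
  fixes f :: "real^'n \<Rightarrow> real"
  assumes "smooth f" shows "frechet_derivative f (at x) v = grad f x \<bullet> v"
proof -
  have lin: "linear (frechet_derivative f (at x))"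
    using smooth_has_derivative[OF assms] has_derivative_linear by blast
  have "frechet_derivative f (at x) v = frechet_derivative f (at x) (\<Sum>i\<in>UNIV. v $ i *\<^sub>R axis i 1)"
    by (simp only: basis_expansion flip: scalar_mult_eq_scaleR)
  also have "\<dots> = (\<Sum>i\<in>UNIV. v $ i * frechet_derivative f (at x) (axis i 1))"
    by (simp add: linear_sum[OF lin] linear_scale[OF lin])
  finally show ?thesis by (simp add: inner_vec_def grad_nth mult.commute)
qed

lemma smooth_has_derivative_grad:
  fixes f :: "real^'n \<Rightarrow> real"
  assumes "smooth f" shows "(f has_derivative (\<lambda>v. grad f x \<bullet> v)) (at x)"
  using smooth_has_derivative[OF assms, of x] by (subst (asm) smooth_frechet_grad[OF assms, abs_def])

lemma grad_eqI:
  fixes f :: "real^'n \<Rightarrow> real"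
  assumes "(f has_derivative (\<lambda>v. G \<bullet> v)) (at x)" shows "grad f x = G"
  using frechet_derivative_at[OF assms, symmetric] by (simp add: vec_eq_iff grad_nth inner_axis)

lemma continuous_grad: "smooth (f :: real^'n \<Rightarrow> real) \<Longrightarrow> continuous_on S (grad f)"
  unfolding grad_def
  by (intro continuous_on_vec_lambda smooth_continuous smooth_frechet_derivative)

lemma grad_mult:
  fixes f g :: "real^'n \<Rightarrow> real"
  assumes "smooth f" "smooth g"
  shows "grad (\<lambda>x. f x * g x) x = f x *\<^sub>R grad g x + g x *\<^sub>R grad f x"
  by (rule grad_eqI)
    (auto intro!: derivative_eq_intros smooth_has_derivative_grad assms simp: inner_left_distrib algebra_simps)

lemma grad_diff:
  fixes f g :: "real^'n \<Rightarrow> real"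
  assumes "smooth f" "smooth g"
  shows "grad (\<lambda>x. f x - g x) x = grad f x - grad g x"
  by (rule grad_eqI)
    (auto intro!: derivative_eq_intros smooth_has_derivative_grad assms simp: inner_diff_left)

lemma grad_compose:
  fixes f :: "real^'n \<Rightarrow> real"
  assumes "smooth g" "smooth f"
  shows "grad (\<lambda>x. g (f x)) x = deriv g (f x) *\<^sub>R grad f x"
proof (rule grad_eqI)
  have "(g has_derivative (*) (deriv g (f x))) (at (f x))"
    using smooth_deriv(1)[OF assms(1)] by (simp add: has_field_derivative_def)
  from has_derivative_compose[OF smooth_has_derivative_grad[OF assms(2)] this]
  show "((\<lambda>x. g (f x)) has_derivative (\<lambda>v. (deriv g (f x) *\<^sub>R grad f x) \<bullet> v)) (at x)"
    by simp
qed

text \<open>The functions \<open>q(1/r) exp(-1/r)\<close>, extended by \<open>0\<close> to \<open>r \<le> 0\<close>, are closed under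
  differentiation, hence smooth.\<close>

definition flat :: "real poly \<Rightarrow> real \<Rightarrow> real" where
  "flat q r = (if r \<le> 0 then 0 else poly q (1 / r) * exp (- (1 / r)))"

text \<open>With x = 1/r this concerns q(x) exp(-x) on a half-line: exponential decay beyond some N,
  compactness before it.\<close>

lemma flat_bound: "\<exists>C. \<forall>r. \<bar>flat q r\<bar> \<le> C"
proof -
  have "((\<lambda>x. poly q x * exp (- x)) \<longlongrightarrow> 0) at_top"
  proof -
    have "((\<lambda>x. \<Sum>i\<le>degree q. coeff q i * (x ^ i / exp x)) \<longlongrightarrow> (\<Sum>i\<le>degree q. coeff q i * 0)) at_top"
      by (intro tendsto_sum tendsto_mult tendsto_const tendsto_power_div_exp_0)
    then show ?thesis by (simp add: poly_altdef exp_minus divide_inverse sum_distrib_right mult.assoc)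
  qed
  then have "\<forall>\<^sub>F x in at_top. \<bar>poly q x * exp (- x)\<bar> < 1"
    using order_tendstoD(2)[OF tendsto_rabs_zero, of _ at_top 1] by simp
  then obtain N where N: "\<And>x. x \<ge> N \<Longrightarrow> \<bar>poly q x * exp (- x)\<bar> < 1"
    by (auto simp: eventually_at_top_linorder)
  have "compact ((\<lambda>x. poly q x * exp (-x)) ` {0..max 0 N})"
    by (intro compact_continuous_image continuous_intros compact_Icc)
  then obtain B where B: "\<And>x. x \<in> {0..max 0 N} \<Longrightarrow> \<bar>poly q x * exp (-x)\<bar> \<le> B"
    by (metis (no_types, lifting) bounded_iff compact_imp_bounded imageI real_norm_def)
  have "\<bar>flat q r\<bar> \<le> max 1 (max 0 B)" for r
  proof (cases "r \<le> 0")
    case False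
    show ?thesis
    proof (cases "1 / r \<le> N")
      case True
      then have "\<bar>poly q (1 / r) * exp (- (1 / r))\<bar> \<le> B" using False by (intro B) auto
      then show ?thesis using False by (simp add: flat_def)
    next
      case F: False
      then show ?thesis using False N[of "1/r"] by (simp add: flat_def)
    qed
  qed (simp add: flat_def)
  then show ?thesis by blast
qed

text \<open>For r > 0, differentiating q(1/r) exp(-1/r) brings out (1/r)^2 (q - q')(1/r), and
  \<open>[:0,0,1:]\<close> is the square. At r = 0 the quotient \<open>flat q h / h\<close> is h
  times \<open>flat\<close> of the polynomial x^2 q, and that factor is bounded.\<close>

lemma flat_deriv:
  "(flat q has_real_derivative flat ([:0,0,1:] * (q - pderiv q)) r) (at r)"
proof -
  consider "r < 0" | "r > 0" | "r = 0" by linarith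
  then show ?thesis
  proof cases
    case 1
    have "(flat q has_real_derivative 0) (at r)"
      by (rule DERIV_cong_ev[THEN iffD2, OF refl _ refl, of _ "\<lambda>x. 0"])
        (use 1 in \<open>auto simp: flat_def eventually_at_filter intro!: eventually_mono[OF eventually_nhds_in_open[of "{..<0}"]]\<close>)
    then show ?thesis using 1 by (simp add: flat_def)
  next
    case 2
    have "((\<lambda>r. poly q (1 / r) * exp (- (1 / r))) has_real_derivative
        (poly (pderiv q) (1/r) * (- 1/r^2) * exp (- (1/r)) + poly q (1/r) * (exp (- (1/r)) * (1/r^2)))) (at r)"
      using 2 by (auto intro!: derivative_eq_intros DERIV_chain2[OF poly_DERIV] simp: power2_eq_square field_simps)
    then have "(flat q has_real_derivative
        (poly (pderiv q) (1/r) * (- 1/r^2) * exp (- (1/r)) + poly q (1/r) * (exp (- (1/r)) * (1/r^2)))) (at r)"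
      by (rule DERIV_cong_ev[THEN iffD2, OF refl _ refl, rotated])
        (use 2 in \<open>auto simp: flat_def intro!: eventually_mono[OF eventually_nhds_in_open[of "{0<..}"]]\<close>)
    also have "(poly (pderiv q) (1/r) * (- 1/r^2) * exp (- (1/r)) + poly q (1/r) * (exp (- (1/r)) * (1/r^2)))
      = flat ([:0,0,1:] * (q - pderiv q)) r"
      using 2 by (simp add: flat_def power2_eq_square field_simps)
    finally show ?thesis .
  next
    case 3
    obtain C where C: "\<And>r. \<bar>flat (pCons 0 (pCons 0 q)) r\<bar> \<le> C" using flat_bound by blast
    have "((\<lambda>h. flat q h / h) \<longlongrightarrow> 0) (at 0)"
    proof (rule Lim_null_comparison)
      show "\<forall>\<^sub>F h in at 0. norm (flat q h / h) \<le> C * \<bar>h\<bar>"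
      proof (intro always_eventually allI)
        fix h :: real
        show "norm (flat q h / h) \<le> C * \<bar>h\<bar>"
        proof (cases "h \<le> 0")
          case True
          moreover have "0 \<le> C" using C[of 0] by (simp add: flat_def)
          ultimately show ?thesis by (simp add: flat_def mult_nonneg_nonpos)
        next
          case False
          then have "flat q h / h = flat (pCons 0 (pCons 0 q)) h * h"
            by (simp add: flat_def field_simps)
          then show ?thesis using C[of h] by (simp add: abs_mult mult_right_mono)
        qed
      qed
      show "((\<lambda>h. C * \<bar>h\<bar>) \<longlongrightarrow> 0) (at 0)" by (auto intro!: tendsto_eq_intros)
    qed
    then show ?thesis using 3 by (simp add: DERIV_def flat_def)
  qed
qed

lemma smooth_flat: "smooth (flat q)"
proof -
  have "Ck k (flat q)" for k
  proof (induction k arbitrary: q)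
    case 0
    then show ?case by (metis Ck.simps(1) DERIV_isCont continuous_at_imp_continuous_on flat_deriv)
  next
    case (Suc k)
    show ?case
    proof (rule Ck_Suc_I)
      show "(flat q has_derivative (\<lambda>v. flat ([:0,0,1:] * (q - pderiv q)) x * v)) (at x)" for x
        using flat_deriv[of q x] by (simp only: has_field_derivative_def)
      show "Ck k (\<lambda>x. flat ([:0,0,1:] * (q - pderiv q)) x * v)" for v
        by (intro Ck_mult Suc.IH Ck_const)
    qed
  qed
  then show ?thesis by (simp add: smooth_def)
qed

text \<open>\<open>ramp\<close> is the derivative of the convex function \<open>conv\<close>; it serves as a smooth, bounded
  positive part.\<close>

definition conv :: "real \<Rightarrow> real" where "conv r = (if r \<le> 0 then 0 else r * exp (- (1 / r)))"

definition ramp :: "real \<Rightarrow> real" where "ramp = flat [:1, 1:]"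

lemma ramp_eq: "ramp r = (if r \<le> 0 then 0 else (1 + 1/r) * exp (- (1 / r)))"
  by (simp add: ramp_def flat_def)

lemma smooth_ramp: "smooth ramp"
  by (simp add: ramp_def smooth_flat)

text \<open>Here x^2 ((1 + x) - 1) = x^3 at x = 1/r. The sign of this derivative makes
  \<open>ramp\<close> increasing and thus \<open>conv\<close> convex.\<close>

lemma deriv_ramp: "deriv ramp r = (if r \<le> 0 then 0 else exp (- (1/r)) / r^3)"
proof -
  have "deriv ramp r = flat ([:0,0,1:] * ([:1,1:] - pderiv [:1,1:])) r"
    using DERIV_imp_deriv[OF flat_deriv] by (simp add: ramp_def)
  then show ?thesis by (simp add: flat_def pderiv_pCons power3_eq_cube field_simps)
qed

lemma deriv_ramp_nonneg: "0 \<le> deriv ramp r"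
  by (simp add: deriv_ramp)

lemma deriv_ramp_bound: obtains L where "L > 0" "\<And>r. deriv ramp r \<le> L"
proof -
  obtain C where "\<And>r. \<bar>flat ([:0,0,1:] * ([:1,1:] - pderiv [:1,1:])) r\<bar> \<le> C" using flat_bound by blast
  then have "deriv ramp r \<le> max C 1" for r
    using DERIV_imp_deriv[OF flat_deriv, of "[:1,1:]" r] by (simp add: ramp_def abs_le_iff) (metis max.coboundedI1)
  then show ?thesis using that[of "max C 1"] by auto
qed

lemma ramp_mono: "x \<le> y \<Longrightarrow> ramp x \<le> ramp y"
  using DERIV_nonneg_imp_nondecreasing[of x y ramp] smooth_deriv(1)[OF smooth_ramp] deriv_ramp_nonneg by blast

lemma ramp_nonneg: "0 \<le> ramp r" and ramp_pos: "0 < r \<Longrightarrow> 0 < ramp r" and ramp_0 [simp]: "r \<le> 0 \<Longrightarrow> ramp r = 0"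
  by (auto simp: ramp_eq add_pos_pos)

text \<open>This is 1 + x \<le> exp x at x = 1/r. Boundedness is what puts the truncations used as
  test functions into L^2.\<close>

lemma ramp_le_1: "ramp r \<le> 1"
proof (cases "r \<le> 0")
  case False
  have "1 + 1/r \<le> exp (1/r)" by (rule exp_ge_add_one_self)
  then have "(1 + 1/r) * exp (- (1/r)) \<le> exp (1/r) * exp (- (1/r))" by (intro mult_right_mono) auto
    then show ?thesis using False by (simp add: ramp_eq flip: exp_add)
qed simp

lemma ramp_lipschitz:
  obtains L where "L > 0" "\<And>r. \<bar>deriv ramp r\<bar> \<le> L" "\<And>x y. \<bar>ramp x - ramp y\<bar> \<le> L * \<bar>x - y\<bar>"
proof -
  obtain L where L: "L > 0" "\<And>r. deriv ramp r \<le> L" using deriv_ramp_bound by blast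
  then have *: "\<bar>deriv ramp r\<bar> \<le> L" for r using deriv_ramp_nonneg[of r] by simp
  have "norm (ramp x - ramp y) \<le> L * norm (x - y)" for x y
    by (rule field_differentiable_bound[of UNIV ramp "deriv ramp"])
      (use * smooth_deriv(1)[OF smooth_ramp] in auto)
  then show ?thesis using that[of L] L * by auto
qed

lemma conv_nonneg: "0 \<le> conv r" and conv_pos: "0 < r \<Longrightarrow> 0 < conv r" and conv_0 [simp]: "r \<le> 0 \<Longrightarrow> conv r = 0"
  by (auto simp: conv_def)

lemma conv_deriv: "(conv has_real_derivative ramp r) (at r)"
proof -
  consider "r < 0" | "r > 0" | "r = 0" by linarith
  then show ?thesis
  proof cases
    case 1
    have "(conv has_real_derivative 0) (at r)"
      by (rule DERIV_cong_ev[THEN iffD2, OF refl _ refl, of _ "\<lambda>x. 0"])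
        (use 1 in \<open>auto simp: conv_def intro!: eventually_mono[OF eventually_nhds_in_open[of "{..<0}"]]\<close>)
    then show ?thesis using 1 by simp
  next
    case 2
    have "((\<lambda>r. r * exp (- (1 / r))) has_real_derivative ramp r) (at r)"
      using 2 by (auto intro!: derivative_eq_intros simp: ramp_eq power2_eq_square field_simps)
    then show ?thesis
      by (rule DERIV_cong_ev[THEN iffD2, OF refl _ refl, rotated])
        (use 2 in \<open>auto simp: conv_def intro!: eventually_mono[OF eventually_nhds_in_open[of "{0<..}"]]\<close>)
  next
    case 3
    have "(\<lambda>h. conv h / h) = flat 1"
      by (auto simp: conv_def flat_def)
    moreover have "(flat 1 \<longlongrightarrow> flat 1 0) (at 0)"
      using DERIV_isCont[OF flat_deriv] by (auto simp: isCont_def)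
    ultimately show ?thesis using 3 by (simp add: DERIV_def) (simp add: flat_def)
  qed
qed

text \<open>Mean value theorem with the increasing derivative \<open>ramp\<close>. The tangent is
  taken at a, which will be the value at the later of two times, so that only the test function
  frozen at that time enters.\<close>

lemma conv_convex: "conv a - conv b \<le> (a - b) * ramp a"
proof -
  consider "a = b" | "a < b" | "b < a" by linarith
  then show ?thesis
  proof cases
    case 2
    then obtain z where "a < z" "z < b" "conv b - conv a = (b - a) * ramp z"
      using MVT2[OF 2, of conv ramp] conv_deriv by auto
    then show ?thesis using ramp_mono[of a z] mult_left_mono[of "ramp a" "ramp z" "b - a"] by (simp add: algebra_simps)
  next
    case 3
    then obtain z where "b < z" "z < a" "conv a - conv b = (a - b) * ramp z"
      using MVT2[OF 3, of conv ramp] conv_deriv by auto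
    then show ?thesis using ramp_mono[of z a] mult_left_mono[of "ramp z" "ramp a" "a - b"] by (simp add: algebra_simps)
  qed simp
qed

lemma conv_lipschitz: "\<bar>conv a - conv b\<bar> \<le> \<bar>a - b\<bar>"
proof -
  have "conv a - conv b \<le> \<bar>a - b\<bar>" for a b
  proof -
    have "(a - b) * ramp a \<le> \<bar>a - b\<bar> * 1"
      using ramp_nonneg[of a] ramp_le_1[of a] by (intro mult_mono) auto
    then show ?thesis using conv_convex[of a b] by simp
  qed
  from this[of a b] this[of b a] show ?thesis by (simp add: abs_le_iff abs_minus_commute)
qed

text \<open>Since \<open>ramp\<close> vanishes exactly on \<open>r \<le> 0\<close>, the following function
  vanishes for \<open>r \<le> 1\<close> and equals \<open>1\<close> for \<open>r \<ge> 2\<close>.\<close>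

definition step :: "real \<Rightarrow> real" where
  "step r = ramp (ramp 1 - ramp (2 - r)) * (1 / ramp (ramp 1))"

lemma smooth_step: "smooth step"
  unfolding step_def
  by (intro smooth_mult smooth_compose[OF smooth_ramp] smooth_diff smooth_const smooth_linear bounded_linear_ident)

lemma step_0: "r \<le> 1 \<Longrightarrow> step r = 0"
  using ramp_mono[of 1 "2 - r"] by (simp add: step_def)

lemma step_1: "r \<ge> 2 \<Longrightarrow> step r = 1"
  using ramp_pos[OF ramp_pos[OF zero_less_one]] by (simp add: step_def)

lemma step_bounds: "0 \<le> step r" "step r \<le> 1"
  using ramp_nonneg ramp_mono[of "ramp 1 - ramp (2 - r)" "ramp 1"] ramp_pos[OF ramp_pos[of 1]] ramp_nonneg[of "2-r"]
  by (auto simp: step_def divide_simps)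

lemma step_deriv_bound: obtains L where "L > 0" "\<And>r. \<bar>deriv step r\<bar> \<le> L"
proof -
  obtain L where L: "L > 0" "\<And>r. \<bar>deriv ramp r\<bar> \<le> L" using ramp_lipschitz by metis
  note D = smooth_deriv(1)[OF smooth_ramp]
  have "(step has_real_derivative deriv ramp (ramp 1 - ramp (2 - r)) * deriv ramp (2 - r) / ramp (ramp 1)) (at r)" for r
    unfolding step_def using ramp_pos[OF ramp_pos[OF zero_less_one]]
    by (auto intro!: derivative_eq_intros DERIV_chain2[OF D])
  then have "deriv step r = deriv ramp (ramp 1 - ramp (2 - r)) * deriv ramp (2 - r) / ramp (ramp 1)" for r
    using DERIV_imp_deriv by blast
  moreover have "\<bar>deriv ramp (ramp 1 - ramp (2 - r)) * deriv ramp (2 - r)\<bar> \<le> L * L" for r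
    using L by (simp add: abs_mult mult_mono)
  ultimately have "\<bar>deriv step r\<bar> \<le> L * L / ramp (ramp 1)" for r
    using ramp_pos[OF ramp_pos[of 1]] by (simp add: divide_right_mono)
  then show ?thesis using that[of "L * L / ramp (ramp 1)"] ramp_pos[OF ramp_pos[of 1]] L by simp
qed

section \<open>Elementary inequalities for powers\<close>

lemma powr_norm_add_le:
  fixes a b :: "'a::real_normed_vector"
  assumes "0 \<le> q"
  shows "norm (a + b) powr q \<le> 2 powr q * (norm a powr q + norm b powr q)"
proof -
  have "norm (a + b) powr q \<le> (2 * max (norm a) (norm b)) powr q"
    using norm_triangle_ineq[of a b] by (intro powr_mono2 assms) auto
  also have "\<dots> = 2 powr q * max (norm a) (norm b) powr q"
    by (simp add: powr_mult)
  also have "\<dots> \<le> 2 powr q * (norm a powr q + norm b powr q)"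
    by (intro mult_left_mono) (auto simp: max_def)
  finally show ?thesis .
qed

lemma powr_norm_diff_le:
  fixes a b :: "'a::real_normed_vector"
  assumes "0 \<le> q"
  shows "norm (a - b) powr q \<le> 2 powr q * (norm a powr q + norm b powr q)"
  using powr_norm_add_le[OF assms, of a "- b"] by simp

text \<open>The larger of a and b absorbs the other factor, so no conjugate exponent appears.
  Replacing a by \<eta> a and b by \<eta>^(1-p) b leaves the product unchanged and allows a small
  weight on one of the powers. This takes the place of Hoelder's inequality throughout.\<close>

lemma young_powr:
  fixes a b p \<eta> :: real
  assumes "0 \<le> a" "0 \<le> b" "1 < p" "0 < \<eta>"
  shows "a powr (p - 1) * b \<le> \<eta> powr p * a powr p + \<eta> powr (p * (1 - p)) * b powr p"
proof -
  have y: "a powr (p - 1) * b \<le> a powr p + b powr p" if "0 \<le> a" "0 \<le> b" for a b :: real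
  proof (cases "b \<le> a")
    case True
    then have "a powr (p - 1) * b \<le> a powr (p - 1) * a"
      by (intro mult_left_mono) auto
    also have "\<dots> = a powr p"
    proof (cases "a = 0")
      case False
      then show ?thesis using powr_add[of a "p - 1" 1] that by simp
    qed (use assms in simp)
    finally show ?thesis by (simp add: add_increasing2)
  next
    case False
    then have "a powr (p - 1) * b \<le> b powr (p - 1) * b"
      using that assms by (intro mult_right_mono powr_mono2) auto
    also have "\<dots> = b powr p"
      using powr_add[of b "p - 1" 1] that False by simp
    finally show ?thesis by (simp add: add_increasing)
  qed
  have "a powr (p - 1) * b = (\<eta> * a) powr (p - 1) * (\<eta> powr (1 - p) * b)"
    using assms by (simp add: powr_mult mult_ac flip: powr_add)
  also have "\<dots> \<le> (\<eta> * a) powr p + (\<eta> powr (1 - p) * b) powr p"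
    using assms by (intro y) auto
  also have "\<dots> = \<eta> powr p * a powr p + \<eta> powr (p * (1 - p)) * b powr p"
    using assms by (simp add: powr_mult powr_powr mult.commute)
  finally show ?thesis .
qed

section \<open>Functions with integrable powers\<close>

lemma Lp_fun_measurable [measurable_dest]: "Lp_fun q M g \<Longrightarrow> g \<in> borel_measurable M"
  and Lp_fun_integrable: "Lp_fun q M g \<Longrightarrow> integrable M (\<lambda>x. norm (g x) powr q)"
  by (auto simp: Lp_fun_def)

lemma Lp_fun_dominated:
  assumes "Lp_fun q M h" "g \<in> borel_measurable M" "AE x in M. norm (g x) \<le> norm (h x)" "0 \<le> q"
  shows "Lp_fun q M g"
  unfolding Lp_fun_def
proof
  show "integrable M (\<lambda>x. norm (g x) powr q)"
  proof (rule Bochner_Integration.integrable_bound[OF Lp_fun_integrable[OF assms(1)]])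
    show "AE x in M. norm (norm (g x) powr q) \<le> norm (norm (h x) powr q)"
      using assms(3) by eventually_elim (use assms(4) in \<open>auto intro: powr_mono2\<close>)
  qed (use assms(2) in measurable)
qed fact

lemma Lp_fun_zero [simp]: "Lp_fun q M (\<lambda>x. 0)"
  by (simp add: Lp_fun_def)

lemma Lp_fun_const:
  assumes "finite_measure M" shows "Lp_fun q M (\<lambda>x. c)"
  using assms by (simp add: Lp_fun_def finite_measure.integrable_const)

lemma Lp_fun_bounded:
  fixes g :: "'a \<Rightarrow> 'b::euclidean_space"
  assumes "finite_measure M" "g \<in> borel_measurable M" "AE x in M. norm (g x) \<le> B" "0 \<le> q"
  shows "Lp_fun q M g"
  by (rule Lp_fun_dominated[where h = "\<lambda>x. B"]) (use assms Lp_fun_const in auto)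

lemma Lp_fun_scaleR:
  assumes "Lp_fun q M g" "0 \<le> q" shows "Lp_fun q M (\<lambda>x. c *\<^sub>R g x)"
  using assms by (auto simp: Lp_fun_def powr_mult)

lemma Lp_fun_add:
  assumes "Lp_fun q M g" "Lp_fun q M h" "0 \<le> q" shows "Lp_fun q M (\<lambda>x. g x + h x)"
  unfolding Lp_fun_def
proof
  show "integrable M (\<lambda>x. norm (g x + h x) powr q)"
    by (rule Bochner_Integration.integrable_bound[of M
          "\<lambda>x. 2 powr q * (norm (g x) powr q + norm (h x) powr q)"])
      (use assms powr_norm_add_le in \<open>auto simp: Lp_fun_def\<close>)
qed (use assms in \<open>auto simp: Lp_fun_def\<close>)

lemma Lp_fun_diff:
  assumes "Lp_fun q M g" "Lp_fun q M h" "0 \<le> q" shows "Lp_fun q M (\<lambda>x. g x - h x)"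
  using Lp_fun_add[OF assms(1) Lp_fun_scaleR[OF assms(2,3), of "-1"] assms(3)] by simp

lemma Lp_fun_integrable_norm:
  fixes g :: "'a \<Rightarrow> 'b::euclidean_space"
  assumes "Lp_fun q M g" "1 \<le> q" "finite_measure M"
  shows "integrable M g"
proof (rule Bochner_Integration.integrable_bound[of M "\<lambda>x. 1 + norm (g x) powr q"])
  show "integrable M (\<lambda>x. 1 + norm (g x) powr q)"
    using assms by (auto simp: Lp_fun_def finite_measure.integrable_const)
  have "norm (g x) \<le> 1 + norm (g x) powr q" for x
  proof (cases "norm (g x) \<le> 1")
    case False
    then have "norm (g x) powr 1 \<le> norm (g x) powr q" using assms by (intro powr_mono) auto
    then show ?thesis using False by simp
  qed (simp add: add_increasing2)
  then show "AE x in M. norm (g x) \<le> norm (1 + norm (g x) powr q)" by (simp add: add_increasing)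
qed (use assms in \<open>auto simp: Lp_fun_def\<close>)

text \<open>Young's inequality with a = 1 bounds the norm by \<eta>^p plus a multiple of its p-th
  power. On a finite measure space the first term is made small by the choice of \<eta>, then the
  second by the convergence.\<close>

lemma Lp_tendsto_L1:
  fixes g :: "'a \<Rightarrow> 'b::euclidean_space"
  assumes lim: "Lp_tendsto p M w g" and p: "1 < p" and fin: "finite_measure M"
  shows "(\<lambda>k. LINT x|M. norm (w k x - g x)) \<longlonglongrightarrow> 0"
proof (rule tendstoI)
  fix e :: real assume e: "e > 0"
  interpret finite_measure M by fact
  define m where "m = measure M (space M)"
  obtain \<eta> where \<eta>: "\<eta> > 0" "\<eta> powr p * m < e / 2"
  proof -
    have "m \<ge> 0" by (simp add: m_def)
    \<comment> \<open>The summand 1 keeps the quotient meaningful when the total mass m is zero;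
      with this choice \<eta>^p m is at most e/4.\<close>
    show thesis
    proof (rule that[of "(e / (4 * (m + 1))) powr (1 / p)"])
      show "0 < (e / (4 * (m + 1))) powr (1 / p)" using e \<open>m \<ge> 0\<close> by simp
      have "((e / (4 * (m + 1))) powr (1 / p)) powr p = e / (4 * (m + 1))"
        using e \<open>m \<ge> 0\<close> p by (simp add: powr_powr)
      then show "((e / (4 * (m + 1))) powr (1 / p)) powr p * m < e / 2"
        using e \<open>m \<ge> 0\<close> by (simp only:) (simp add: field_simps add_pos_nonneg)
    qed
  qed
  define C where "C = \<eta> powr (p * (1 - p))"
  have C: "C > 0" using \<eta> by (simp add: C_def)
  have int: "integrable M (\<lambda>x. norm (w k x - g x) powr p)" for k
    using lim p by (intro Lp_fun_integrable Lp_fun_diff) (auto simp: Lp_tendsto_def)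
  have L1: "integrable M (\<lambda>x. norm (w k x - g x))" for k
    using lim p fin by (intro integrable_norm Lp_fun_integrable_norm[of p] Lp_fun_diff) (auto simp: Lp_tendsto_def)
  have bd: "(LINT x|M. norm (w k x - g x)) \<le> \<eta> powr p * m + C * (LINT x|M. norm (w k x - g x) powr p)" for k
  proof -
    have "(LINT x|M. norm (w k x - g x)) \<le> (LINT x|M. \<eta> powr p + C * norm (w k x - g x) powr p)"
    proof (rule integral_mono)
      fix x
      show "norm (w k x - g x) \<le> \<eta> powr p + C * norm (w k x - g x) powr p"
        using young_powr[of 1 "norm (w k x - g x)" p \<eta>] p \<eta> by (simp add: C_def)
    qed (use int L1 in auto)
    also have "\<dots> = \<eta> powr p * m + C * (LINT x|M. norm (w k x - g x) powr p)"
      using int by (subst Bochner_Integration.integral_add) (auto simp: m_def mult.commute)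
    finally show ?thesis .
  qed
  have "(\<lambda>k. LINT x|M. norm (w k x - g x) powr p) \<longlonglongrightarrow> 0" using lim by (simp add: Lp_tendsto_def)
  then have "\<forall>\<^sub>F k in sequentially. (LINT x|M. norm (w k x - g x) powr p) < e / (2 * C)"
    by (rule order_tendstoD) (use e C in simp)
  then show "\<forall>\<^sub>F k in sequentially. dist (LINT x|M. norm (w k x - g x)) 0 < e"
  proof eventually_elim
    case (elim k)
    then have "C * (LINT x|M. norm (w k x - g x) powr p) < e / 2" using C by (simp add: field_simps)
    with bd[of k] \<eta> show ?case by simp
  qed
qed

text \<open>The p-th powers of the distances tend to zero in L^1, which yields an almost everywhere
  convergent subsequence; taking p-th roots returns to the functions.\<close>

lemma Lp_tendsto_AE_subseq:
  fixes g :: "'a \<Rightarrow> 'b::euclidean_space"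
  assumes lim: "Lp_tendsto p M w g" and p: "0 < p"
  obtains r :: "nat \<Rightarrow> nat" where "strict_mono r" "AE x in M. (\<lambda>k. w (r k) x) \<longlonglongrightarrow> g x"
proof -
  have int: "integrable M (\<lambda>x. norm (w k x - g x) powr p)" for k
    using lim p by (intro Lp_fun_integrable Lp_fun_diff) (auto simp: Lp_tendsto_def)
  obtain r where r: "strict_mono r" "AE x in M. (\<lambda>k. norm (w (r k) x - g x) powr p) \<longlonglongrightarrow> 0"
    using tendsto_L1_AE_subseq[of M "\<lambda>k x. norm (w k x - g x) powr p", OF int] lim
    by (auto simp: Lp_tendsto_def)
  from r(2) have "AE x in M. (\<lambda>k. w (r k) x) \<longlonglongrightarrow> g x"
  proof eventually_elim
    case (elim x)
    then have "(\<lambda>k. (norm (w (r k) x - g x) powr p) powr (1 / p)) \<longlonglongrightarrow> 0 powr (1/p)"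
      using p by (intro tendsto_powr') auto
    then have "(\<lambda>k. norm (w (r k) x - g x)) \<longlonglongrightarrow> 0"
      using p by (simp add: powr_powr)
    then show ?case by (rule LIM_zero_cancel[OF tendsto_norm_zero_cancel])
  qed
  with r(1) that show thesis by blast
qed

lemma Lp_tendsto_subseq:
  "Lp_tendsto p M w g \<Longrightarrow> strict_mono r \<Longrightarrow> Lp_tendsto p M (\<lambda>k. w (r k)) g"
  unfolding Lp_tendsto_def using LIMSEQ_subseq_LIMSEQ[of _ _ r] by (auto simp: o_def)

text \<open>The device for modifying approximants: cutoffs and chain-rule factors alter the sequence
  without altering its limit.\<close>

lemma Lp_tendsto_shift:
  fixes g :: "'a \<Rightarrow> 'b::euclidean_space"
  assumes "Lp_tendsto p M w g" "\<And>k. Lp_fun p M (v k)" "0 \<le> p"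
    "(\<lambda>k. LINT x|M. norm (v k x - w k x) powr p) \<longlonglongrightarrow> 0"
  shows "Lp_tendsto p M v g"
proof -
  have L: "Lp_fun p M (w k)" "Lp_fun p M g" for k using assms by (auto simp: Lp_tendsto_def)
  have i: "integrable M (\<lambda>x. norm (v k x - w k x) powr p)" "integrable M (\<lambda>x. norm (w k x - g x) powr p)"
     "integrable M (\<lambda>x. norm (v k x - g x) powr p)" for k
    using assms L by (auto intro!: Lp_fun_integrable Lp_fun_diff)
  have "(\<lambda>k. LINT x|M. norm (v k x - g x) powr p) \<longlonglongrightarrow> 0"
  proof (rule Lim_null_comparison)
    show "\<forall>\<^sub>F k in sequentially. norm (LINT x|M. norm (v k x - g x) powr p) \<le>
       2 powr p * ((LINT x|M. norm (v k x - w k x) powr p) + (LINT x|M. norm (w k x - g x) powr p))"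
    proof (intro always_eventually allI)
      fix k
      have "(LINT x|M. norm (v k x - g x) powr p)
         \<le> (LINT x|M. 2 powr p * (norm (v k x - w k x) powr p + norm (w k x - g x) powr p))"
        by (rule integral_mono)
          (use i assms(3) powr_norm_add_le[of p "v k x - w k x" "w k x - g x" for x] in auto)
      then show "norm (LINT x|M. norm (v k x - g x) powr p) \<le>
       2 powr p * ((LINT x|M. norm (v k x - w k x) powr p) + (LINT x|M. norm (w k x - g x) powr p))"
        using i by simp
    qed
    show "(\<lambda>k. 2 powr p * ((LINT x|M. norm (v k x - w k x) powr p) + (LINT x|M. norm (w k x - g x) powr p))) \<longlonglongrightarrow> 0"
      using assms by (auto intro!: tendsto_eq_intros simp: Lp_tendsto_def)
  qed
  with assms L show ?thesis by (simp add: Lp_tendsto_def)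
qed

lemma Lp_tendsto_dominated:
  fixes g :: "'a \<Rightarrow> 'b::euclidean_space" and h :: "'a \<Rightarrow> 'c::euclidean_space"
  assumes lim: "AE x in M. (\<lambda>k. w k x) \<longlonglongrightarrow> g x"
    and meas [measurable]: "\<And>k. w k \<in> borel_measurable M" "g \<in> borel_measurable M"
    and h: "Lp_fun p M h" and bd: "\<And>k. AE x in M. norm (w k x) \<le> norm (h x)" and p: "0 < p"
  shows "Lp_tendsto p M w g"
proof -
  have bd': "AE x in M. \<forall>k. norm (w k x) \<le> norm (h x)"
    using bd by (simp add: AE_all_countable)
  with lim have gb: "AE x in M. norm (g x) \<le> norm (h x)"
  proof eventually_elim
    case (elim x)
    then show ?case using tendsto_norm[of "\<lambda>k. w k x" "g x"] by (intro Lim_bounded[of _ _ 0]) auto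
  qed
  have "(\<lambda>k. LINT x|M. norm (w k x - g x) powr p) \<longlonglongrightarrow> (LINT x|M. 0)"
  proof (rule integral_dominated_convergence[where w = "\<lambda>x. (2 * norm (h x)) powr p"])
    have "Lp_fun p M (\<lambda>x. 2 *\<^sub>R h x)" using h p by (intro Lp_fun_scaleR) auto
    then show "integrable M (\<lambda>x. (2 * norm (h x)) powr p)" by (simp add: Lp_fun_def)
    show "AE x in M. (\<lambda>k. norm (w k x - g x) powr p) \<longlonglongrightarrow> 0"
      using lim
    proof eventually_elim
      case (elim x)
      then have "(\<lambda>k. norm (w k x - g x)) \<longlonglongrightarrow> 0"
        by (intro tendsto_norm_zero LIM_zero)
      then have "(\<lambda>k. norm (w k x - g x) powr p) \<longlonglongrightarrow> 0 powr p"
        using p by (intro tendsto_powr' tendsto_const) auto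
      then show ?case using p by simp
    qed
    show "AE x in M. norm (norm (w k x - g x) powr p) \<le> (2 * norm (h x)) powr p" for k
      using bd' gb
    proof eventually_elim
      case (elim x)
      then have "norm (w k x - g x) \<le> 2 * norm (h x)"
        using norm_triangle_ineq4[of "w k x" "g x"] by (smt (verit))
      then show ?case using p by (auto intro: powr_mono2)
    qed
  qed auto
  then show ?thesis
    unfolding Lp_tendsto_def using p
    by (intro conjI allI Lp_fun_dominated[OF h meas(1) bd] Lp_fun_dominated[OF h meas(2) gb]) auto
qed

lemma Lp_tendsto_diff:
  fixes g1 g2 :: "'a \<Rightarrow> 'b::euclidean_space"
  assumes "Lp_tendsto p M w1 g1" "Lp_tendsto p M w2 g2" "0 \<le> p"
  shows "Lp_tendsto p M (\<lambda>k x. w1 k x - w2 k x) (\<lambda>x. g1 x - g2 x)"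
proof -
  have L: "Lp_fun p M (w1 k)" "Lp_fun p M g1" "Lp_fun p M (w2 k)" "Lp_fun p M g2" for k
    using assms by (auto simp: Lp_tendsto_def)
  have i: "integrable M (\<lambda>x. norm (w1 k x - g1 x) powr p)" "integrable M (\<lambda>x. norm (w2 k x - g2 x) powr p)"
    "integrable M (\<lambda>x. norm ((w1 k x - w2 k x) - (g1 x - g2 x)) powr p)" for k
    using assms L by (auto intro!: Lp_fun_integrable Lp_fun_diff)
  have "(\<lambda>k. LINT x|M. norm ((w1 k x - w2 k x) - (g1 x - g2 x)) powr p) \<longlonglongrightarrow> 0"
  proof (rule Lim_null_comparison)
    show "\<forall>\<^sub>F k in sequentially. norm (LINT x|M. norm ((w1 k x - w2 k x) - (g1 x - g2 x)) powr p) \<le>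
       2 powr p * ((LINT x|M. norm (w1 k x - g1 x) powr p) + (LINT x|M. norm (w2 k x - g2 x) powr p))"
    proof (intro always_eventually allI)
      fix k
      have "(LINT x|M. norm ((w1 k x - w2 k x) - (g1 x - g2 x)) powr p)
         \<le> (LINT x|M. 2 powr p * (norm (w1 k x - g1 x) powr p + norm (w2 k x - g2 x) powr p))"
        by (rule integral_mono)
          (use i assms(3) powr_norm_diff_le[of p "w1 k x - g1 x" "w2 k x - g2 x" for x] in \<open>auto simp: algebra_simps\<close>)
      then show "norm (LINT x|M. norm ((w1 k x - w2 k x) - (g1 x - g2 x)) powr p) \<le>
       2 powr p * ((LINT x|M. norm (w1 k x - g1 x) powr p) + (LINT x|M. norm (w2 k x - g2 x) powr p))"
        using i by simp
    qed
    show "(\<lambda>k. 2 powr p * ((LINT x|M. norm (w1 k x - g1 x) powr p) + (LINT x|M. norm (w2 k x - g2 x) powr p))) \<longlonglongrightarrow> 0"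
      using assms by (auto intro!: tendsto_eq_intros simp: Lp_tendsto_def)
  qed
  with L assms(3) show ?thesis by (auto simp: Lp_tendsto_def intro!: Lp_fun_diff)
qed

lemma Lp_tendsto_scaleR:
  fixes g :: "'a \<Rightarrow> 'b::euclidean_space"
  assumes "Lp_tendsto p M w g" "0 \<le> p"
  shows "Lp_tendsto p M (\<lambda>k x. c *\<^sub>R w k x) (\<lambda>x. c *\<^sub>R g x)"
proof -
  have "norm (c *\<^sub>R w k x - c *\<^sub>R g x) powr p = \<bar>c\<bar> powr p * norm (w k x - g x) powr p" for k x
    by (simp add: powr_mult flip: scaleR_diff_right)
  moreover have "(\<lambda>k. \<bar>c\<bar> powr p * (LINT x|M. norm (w k x - g x) powr p)) \<longlonglongrightarrow> 0"
    using assms by (auto intro!: tendsto_eq_intros simp: Lp_tendsto_def)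
  ultimately show ?thesis
    using assms by (auto simp: Lp_tendsto_def intro!: Lp_fun_scaleR)
qed

section \<open>Lebesgue measure\<close>

lemma lebesgue_translation: "distr lebesgue lebesgue (\<lambda>x. a + x) = (lebesgue :: 'a::euclidean_space measure)"
  and measurable_lebesgue_translation: "(\<lambda>x. a + x) \<in> lebesgue \<rightarrow>\<^sub>M (lebesgue :: 'a measure)"
proof -
  have T: "(\<lambda>x. a + (\<Sum>j\<in>Basis. (1 * (x \<bullet> j)) *\<^sub>R j)) = (\<lambda>x::'a. a + x)"
    by (simp add: euclidean_representation)
  show "distr lebesgue lebesgue (\<lambda>x. a + x) = (lebesgue :: 'a measure)"
    using lebesgue_affine_euclidean[of "\<lambda>_. 1" a] unfolding T by (simp add: density_1)
  show "(\<lambda>x. a + x) \<in> lebesgue \<rightarrow>\<^sub>M (lebesgue :: 'a measure)"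
    using lebesgue_affine_measurable[of "\<lambda>_. 1" a] unfolding T by simp
qed

lemma integral_lebesgue_translation:
  fixes f :: "'a::euclidean_space \<Rightarrow> real"
  assumes "f \<in> borel_measurable lebesgue"
  shows "(LINT x|lebesgue. f (a + x)) = (LINT x|lebesgue. f x)"
    "integrable lebesgue (\<lambda>x. f (a + x)) \<longleftrightarrow> integrable lebesgue f"
  using integral_distr[OF measurable_lebesgue_translation assms, of a]
    integrable_distr_eq[OF measurable_lebesgue_translation assms, of a]
  by (simp_all add: lebesgue_translation)

lemma LINT_lebesgue_on:
  fixes f :: "'a::euclidean_space \<Rightarrow> 'b::{banach, second_countable_topology}"
  assumes "S \<in> sets lebesgue"
  shows "(LINT x:S|lebesgue. f x) = (LINT x|lebesgue_on S. f x)"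
  using assms by (simp add: set_lebesgue_integral_def integral_restrict_space)

lemma finite_measure_lebesgue_on:
  assumes "S \<in> lmeasurable" shows "finite_measure (lebesgue_on S)"
  using assms by (intro finite_measureI) (auto simp: emeasure_restrict_space fmeasurable_def)

lemma AE_lebesgue_on_iff:
  "S \<in> sets lebesgue \<Longrightarrow> (AE x in lebesgue_on S. P x) \<longleftrightarrow> (AE x in lebesgue. x \<in> S \<longrightarrow> P x)"
  by (simp add: AE_restrict_space_iff)

lemma lmeasurable_B1 [simp]: "B1 \<in> lmeasurable" and sets_B1 [simp]: "B1 \<in> sets lebesgue"
  by (auto simp: lmeasurable_ball)

lemma finite_measure_B1: "finite_measure (lebesgue_on B1)"
  by (simp add: finite_measure_lebesgue_on)

lemma Times_lmeasurable:
  fixes S :: "real set" and B :: "'b::euclidean_space set"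
  assumes "S \<in> sets borel" "B \<in> sets borel" "bounded S" "bounded B"
  shows "S \<times> B \<in> lmeasurable"
proof -
  have "S \<times> B \<in> sets borel" using assms by (simp add: borel_prod[symmetric])
  then have "S \<times> B \<in> sets lebesgue" by auto
  then show ?thesis using assms by (intro bounded_set_imp_lmeasurable bounded_Times) auto
qed

lemma Cyl_slab_lmeasurable [simp]:
  "{a<..<b} \<times> B1 \<in> lmeasurable" "{a<..<b} \<times> B1 \<in> sets lebesgue"
  "{a<..b} \<times> B1 \<in> lmeasurable" "{a<..b} \<times> B1 \<in> sets lebesgue" for a b :: real
  using Times_lmeasurable[of "{a<..<b}" B1] Times_lmeasurable[of "{a<..b}" B1] by (auto simp: fmeasurable_def)

lemma set_integrable_lebesgue_compact:
  fixes u :: "'a::euclidean_space \<Rightarrow> real"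
  assumes "compact K" "continuous_on K u" shows "set_integrable lebesgue K u"
  using borel_integrable_compact[OF assms] by (simp add: set_integrable_def integrable_completion)

section \<open>Test functions\<close>

lemma smooth_has_derivative_line:
  fixes \<zeta> :: "'a::real_normed_vector \<Rightarrow> real"
  assumes "smooth \<zeta>"
  shows "((\<lambda>t. \<zeta> (x + t *\<^sub>R e)) has_real_derivative frechet_derivative \<zeta> (at (x + t *\<^sub>R e)) e) (at t)"
proof -
  let ?D = "frechet_derivative \<zeta> (at (x + t *\<^sub>R e))"
  have "((\<lambda>t. x + t *\<^sub>R e) has_derivative (\<lambda>r. r *\<^sub>R e)) (at t)"
    by (auto intro!: derivative_eq_intros)
  from has_derivative_compose[OF this smooth_has_derivative[OF assms]]
  have "((\<lambda>t. \<zeta> (x + t *\<^sub>R e)) has_derivative (\<lambda>r. ?D (r *\<^sub>R e))) (at t)" .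
  moreover have "(\<lambda>r. ?D (r *\<^sub>R e)) = (*) (?D e)"
    using linear_scale[OF has_derivative_linear[OF smooth_has_derivative[OF assms]]] by (auto simp: mult.commute)
  ultimately show ?thesis by (simp add: has_field_derivative_def)
qed

lemma test_fun_smooth: "test_fun \<Omega> \<zeta> \<Longrightarrow> smooth \<zeta>"
  by (simp add: test_fun_def)

lemma eq_0_outside_support: "x \<notin> closure {x. \<zeta> x \<noteq> 0} \<Longrightarrow> \<zeta> x = 0"
  by (metis (mono_tags, lifting) closure_subset mem_Collect_eq subsetD)

lemma test_fun_deriv_outside:
  assumes "test_fun \<Omega> \<zeta>" "x \<notin> closure {x. \<zeta> x \<noteq> 0}"
  shows "frechet_derivative \<zeta> (at x) e = 0"
proof -
  have "(\<zeta> has_derivative (\<lambda>_. 0)) (at x)"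
  proof (rule has_derivative_transform_within_open[of "\<lambda>_. 0" _ _ _ "- closure {x. \<zeta> x \<noteq> 0}"])
    show "x \<in> - closure {x. \<zeta> x \<noteq> 0}" using assms by simp
    show "\<And>y. y \<in> - closure {x. \<zeta> x \<noteq> 0} \<Longrightarrow> 0 = \<zeta> y"
      by (metis ComplD eq_0_outside_support)
  qed auto
  then show ?thesis using frechet_derivative_at by metis
qed

lemma test_fun_mult:
  assumes "smooth w" "test_fun \<Omega> \<zeta>" shows "test_fun \<Omega> (\<lambda>x. w x * \<zeta> x)"
proof -
  have sub: "closure {x. w x * \<zeta> x \<noteq> 0} \<subseteq> closure {x. \<zeta> x \<noteq> 0}"
    by (intro closure_mono) auto
  moreover have "compact (closure {x. w x * \<zeta> x \<noteq> 0})"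
    using compact_Int_closed[of "closure {x. \<zeta> x \<noteq> 0}" "closure {x. w x * \<zeta> x \<noteq> 0}"] assms(2)
    unfolding Int_absorb1[OF sub] by (simp add: test_fun_def)
  ultimately show ?thesis using assms by (auto simp: test_fun_def smooth_mult)
qed

lemma test_fun_bounds:
  assumes "test_fun \<Omega> \<zeta>"
  obtains B where "B > 0" "\<And>x. \<bar>\<zeta> x\<bar> \<le> B" "\<And>x. \<bar>frechet_derivative \<zeta> (at x) e\<bar> \<le> B"
proof -
  let ?K = "closure {x. \<zeta> x \<noteq> 0}"
  have K: "compact ?K" and s: "smooth \<zeta>" using assms by (auto simp: test_fun_def)
  have "bounded (\<zeta> ` ?K)" "bounded ((\<lambda>x. frechet_derivative \<zeta> (at x) e) ` ?K)"
    by (intro compact_imp_bounded compact_continuous_image K smooth_continuous s smooth_frechet_derivative)+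
  then obtain B1 B2 where B: "\<And>x. x \<in> ?K \<Longrightarrow> \<bar>\<zeta> x\<bar> \<le> B1" "\<And>x. x \<in> ?K \<Longrightarrow> \<bar>frechet_derivative \<zeta> (at x) e\<bar> \<le> B2"
    by (auto simp: bounded_iff)
  have z: "\<zeta> x = 0" if "x \<notin> ?K" for x using that by (rule eq_0_outside_support)
  show thesis
  proof (rule that[of "\<bar>B1\<bar> + \<bar>B2\<bar> + 1"])
    show "\<bar>\<zeta> x\<bar> \<le> \<bar>B1\<bar> + \<bar>B2\<bar> + 1" for x
      using B(1)[of x] z[of x] by (cases "x \<in> ?K") auto
    show "\<bar>frechet_derivative \<zeta> (at x) e\<bar> \<le> \<bar>B1\<bar> + \<bar>B2\<bar> + 1" for x
      using B(2)[of x] test_fun_deriv_outside[OF assms, of x e] by (cases "x \<in> ?K") auto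
  qed auto
qed

text \<open>By translation invariance, the difference quotients of \<open>\<zeta>\<close> times \<open>g\<close> integrate to \<open>0\<close>.\<close>

lemma integral_test_fun_deriv_eq_0:
  fixes g :: "'a::euclidean_space \<Rightarrow> real"
  assumes \<zeta>: "test_fun \<Omega> \<zeta>"
    and g: "g \<in> borel_measurable lebesgue" "\<And>R. set_integrable lebesgue (cball 0 R) g"
    and inv: "\<And>s x. g (s *\<^sub>R e + x) = g x"
  shows "(LINT x|lebesgue. g x * frechet_derivative \<zeta> (at x) e) = 0"
proof -
  note [measurable] = g(1)
  have s: "smooth \<zeta>" using \<zeta> by (rule test_fun_smooth)
  obtain B where B: "B > 0" "\<And>x. \<bar>\<zeta> x\<bar> \<le> B" "\<And>x. \<bar>frechet_derivative \<zeta> (at x) e\<bar> \<le> B"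
    using test_fun_bounds[OF \<zeta>] by blast
  have "bounded {x. \<zeta> x \<noteq> 0}"
    using \<zeta> bounded_subset[OF compact_imp_bounded closure_subset] by (auto simp: test_fun_def)
  then obtain R where R: "\<And>x. \<zeta> x \<noteq> 0 \<Longrightarrow> norm x \<le> R" by (auto simp: bounded_iff)
  define h where "h = (\<lambda>k::nat. inverse (real (Suc k)))"
  have h: "0 < h k" "h k \<le> 1" for k by (auto simp: h_def field_simps)
  have cont: "continuous_on UNIV \<zeta>" by (rule smooth_continuous[OF s])
  have m[measurable]: "\<zeta> \<in> borel_measurable lebesgue" "(\<lambda>x. \<zeta> (a + x)) \<in> borel_measurable lebesgue"
     "(\<lambda>x. frechet_derivative \<zeta> (at x) e) \<in> borel_measurable lebesgue" for a
    using cont smooth_continuous[OF smooth_frechet_derivative[OF s]]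
    by (auto intro!: borel_measurable_continuous_onI measurable_completion continuous_on_compose2[OF cont] continuous_intros)
  have ig: "integrable lebesgue (\<lambda>x. g x * \<zeta> x)"
  proof (rule Bochner_Integration.integrable_bound[of _ "\<lambda>x. B * (indicat_real (cball 0 R) x *\<^sub>R g x)"])
    show "integrable lebesgue (\<lambda>x. B * (indicat_real (cball 0 R) x *\<^sub>R g x))"
      using g(2)[of R] by (auto simp: set_integrable_def)
    show "AE x in lebesgue. norm (g x * \<zeta> x) \<le> norm (B * (indicat_real (cball 0 R) x *\<^sub>R g x))"
    proof (rule AE_I2)
      fix x show "norm (g x * \<zeta> x) \<le> norm (B * (indicat_real (cball 0 R) x *\<^sub>R g x))"
        using R[of x] B(1) mult_right_mono[OF B(2)[of x], of "\<bar>g x\<bar>"]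
        by (cases "\<zeta> x = 0") (auto simp: abs_mult mult_ac)
    qed
  qed auto
  have ish: "integrable lebesgue (\<lambda>x. g x * \<zeta> (s *\<^sub>R e + x))"
    and vsh: "(LINT x|lebesgue. g x * \<zeta> (s *\<^sub>R e + x)) = (LINT x|lebesgue. g x * \<zeta> x)" for s
    using integral_lebesgue_translation[of "\<lambda>x. g x * \<zeta> x" "s *\<^sub>R e"] ig by (simp_all add: inv)
  have zero: "(LINT x|lebesgue. g x * ((\<zeta> (h k *\<^sub>R e + x) - \<zeta> x) / h k)) = 0" for k
  proof -
    have "(LINT x|lebesgue. g x * ((\<zeta> (h k *\<^sub>R e + x) - \<zeta> x) / h k))
        = (LINT x|lebesgue. (g x * \<zeta> (h k *\<^sub>R e + x) - g x * \<zeta> x) / h k)"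
      by (simp add: algebra_simps diff_divide_distrib)
    also have "\<dots> = 0" using ish ig by (simp add: vsh)
    finally show ?thesis .
  qed
  \<comment> \<open>A shift by h k e with h k \<le> 1 moves points by at most \<open>norm e\<close>,
    so all difference quotients vanish outside the ball enlarged by that amount; inside, the mean
    value bound limits them by B.\<close>
  have "(\<lambda>k. LINT x|lebesgue. g x * ((\<zeta> (h k *\<^sub>R e + x) - \<zeta> x) / h k))
     \<longlonglongrightarrow> (LINT x|lebesgue. g x * frechet_derivative \<zeta> (at x) e)"
  proof (rule integral_dominated_convergence[where w = "\<lambda>x. B * (indicat_real (cball 0 (R + norm e)) x *\<^sub>R \<bar>g x\<bar>)"])
    show "integrable lebesgue (\<lambda>x. B * (indicat_real (cball 0 (R + norm e)) x *\<^sub>R \<bar>g x\<bar>))"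
      using set_integrable_abs[OF g(2)[of "R + norm e"]] by (auto simp: set_integrable_def)
    show "AE x in lebesgue. (\<lambda>k. g x * ((\<zeta> (h k *\<^sub>R e + x) - \<zeta> x) / h k))
          \<longlonglongrightarrow> g x * frechet_derivative \<zeta> (at x) e"
    proof (intro AE_I2 tendsto_mult tendsto_const)
      fix x
      have "((\<lambda>t. \<zeta> (x + t *\<^sub>R e)) has_real_derivative frechet_derivative \<zeta> (at x) e) (at 0)"
        using smooth_has_derivative_line[OF s, of x e 0] by simp
      then have "((\<lambda>t. (\<zeta> (x + t *\<^sub>R e) - \<zeta> x) / t) \<longlongrightarrow> frechet_derivative \<zeta> (at x) e) (at 0)"
        by (simp add: DERIV_def)
      moreover have "filterlim h (at 0) sequentially"
        unfolding h_def filterlim_at using LIMSEQ_inverse_real_of_nat by auto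
      ultimately have "(\<lambda>k. (\<zeta> (x + h k *\<^sub>R e) - \<zeta> x) / h k) \<longlonglongrightarrow> frechet_derivative \<zeta> (at x) e"
        by (rule filterlim_compose)
      then show "(\<lambda>k. (\<zeta> (h k *\<^sub>R e + x) - \<zeta> x) / h k) \<longlonglongrightarrow> frechet_derivative \<zeta> (at x) e"
        by (simp add: add.commute)
    qed
    show "AE x in lebesgue. norm (g x * ((\<zeta> (h k *\<^sub>R e + x) - \<zeta> x) / h k))
        \<le> B * (indicat_real (cball 0 (R + norm e)) x *\<^sub>R \<bar>g x\<bar>)" for k
    proof (rule AE_I2)
      fix x
      show "norm (g x * ((\<zeta> (h k *\<^sub>R e + x) - \<zeta> x) / h k)) \<le> B * (indicat_real (cball 0 (R + norm e)) x *\<^sub>R \<bar>g x\<bar>)"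
      proof (cases "x \<in> cball 0 (R + norm e)")
        case True
        have "norm (\<zeta> (h k *\<^sub>R e + x) - \<zeta> (0 *\<^sub>R e + x)) \<le> B * norm (h k - 0)"
        proof (rule field_differentiable_bound[of UNIV "\<lambda>t. \<zeta> (t *\<^sub>R e + x)" "\<lambda>t. frechet_derivative \<zeta> (at (t *\<^sub>R e + x)) e"])
          show "((\<lambda>t. \<zeta> (t *\<^sub>R e + x)) has_field_derivative frechet_derivative \<zeta> (at (t *\<^sub>R e + x)) e) (at t within UNIV)" for t
            using smooth_has_derivative_line[OF s, of x e t] by (simp add: add.commute)
        qed (use B in auto)
        then have "\<bar>(\<zeta> (h k *\<^sub>R e + x) - \<zeta> x) / h k\<bar> \<le> B"
          using h[of k] by (simp add: abs_divide field_simps)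
        then have "\<bar>g x\<bar> * \<bar>(\<zeta> (h k *\<^sub>R e + x) - \<zeta> x) / h k\<bar> \<le> \<bar>g x\<bar> * B" by (intro mult_left_mono) auto
        then show ?thesis using True by (simp only: real_norm_def abs_mult) (simp add: mult.commute)
      next
        case False
        then have "R + norm e < norm x" by simp
        moreover have "norm x \<le> norm (h k *\<^sub>R e + x) + norm (h k *\<^sub>R e)" using norm_triangle_ineq4[of "h k *\<^sub>R e + x" "h k *\<^sub>R e"] by simp
        moreover have "norm (h k *\<^sub>R e) \<le> norm e" using h[of k] by (simp add: mult_left_le_one_le)
        ultimately have "\<not> norm (h k *\<^sub>R e + x) \<le> R" "\<not> norm x \<le> R" using norm_ge_zero[of e] by linarith+
        then have "\<zeta> (h k *\<^sub>R e + x) = 0" "\<zeta> x = 0" using R by blast+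
        then show ?thesis using B(1) by simp
      qed
    qed
  qed auto
  then show ?thesis unfolding zero by (simp add: LIMSEQ_const_iff)
qed

text \<open>The product of w and \<zeta> is again a test function, and the integral of its
  derivative vanishes by translation invariance with constant weight 1; the product rule does the
  rest.\<close>

lemma integral_by_parts_smooth:
  fixes w \<zeta> :: "real^'n \<Rightarrow> real"
  assumes w: "smooth w" and \<zeta>: "test_fun \<Omega> \<zeta>" and \<Omega>: "\<Omega> \<in> sets lebesgue"
  shows "(LINT x:\<Omega>|lebesgue. w x * frechet_derivative \<zeta> (at x) e)
       = - (LINT x:\<Omega>|lebesgue. frechet_derivative w (at x) e * \<zeta> x)"
proof -
  have s: "smooth \<zeta>" using \<zeta> by (rule test_fun_smooth)
  define K where "K = closure {x. \<zeta> x \<noteq> 0}"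
  have K: "compact K" and sub: "K \<subseteq> \<Omega>" using \<zeta> by (simp_all add: test_fun_def K_def)
  have o: "\<zeta> x = 0" "frechet_derivative \<zeta> (at x) e = 0" if "x \<notin> K" for x
    using that eq_0_outside_support test_fun_deriv_outside[OF \<zeta>] unfolding K_def by blast+
  have int: "integrable lebesgue u" if c: "continuous_on UNIV u" and z: "\<And>x. x \<notin> K \<Longrightarrow> u x = 0" for u :: "real^'n \<Rightarrow> real"
  proof -
    have "set_integrable lebesgue (K) u"
      using set_integrable_lebesgue_compact[OF K] continuous_on_subset[OF c] by blast
    moreover have "(\<lambda>x. indicat_real (K) x *\<^sub>R u x) = u"
    proof (rule ext)
      fix x show "indicat_real (K) x *\<^sub>R u x = u x"
        using z[of x] by (cases "x \<in> K") auto
    qed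
    ultimately show ?thesis by (simp add: set_integrable_def)
  qed
  have red: "(LINT x:\<Omega>|lebesgue. u x) = (LINT x|lebesgue. u x)" if z: "\<And>x. x \<notin> K \<Longrightarrow> u x = 0" for u :: "real^'n \<Rightarrow> real"
    unfolding set_lebesgue_integral_def
    by (rule Bochner_Integration.integral_cong) (use z sub in \<open>auto simp: indicator_def\<close>)
  have i: "integrable lebesgue (\<lambda>x. w x * frechet_derivative \<zeta> (at x) e)" "integrable lebesgue (\<lambda>x. frechet_derivative w (at x) e * \<zeta> x)"
    by (rule int; use o in \<open>auto intro!: continuous_on_mult smooth_continuous[OF w] smooth_continuous[OF s]
        smooth_continuous[OF smooth_frechet_derivative[OF w]] smooth_continuous[OF smooth_frechet_derivative[OF s]]\<close>)+
  have "(LINT x|lebesgue. 1 * frechet_derivative (\<lambda>x. w x * \<zeta> x) (at x) e) = 0"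
    by (rule integral_test_fun_deriv_eq_0[OF test_fun_mult[OF w \<zeta>]]) (auto intro!: set_integrable_lebesgue_compact)
  moreover have "frechet_derivative (\<lambda>x. w x * \<zeta> x) (at x) e = w x * frechet_derivative \<zeta> (at x) e + frechet_derivative w (at x) e * \<zeta> x" for x
    using fun_cong[OF frechet_derivative_at[OF has_derivative_mult[OF smooth_has_derivative[OF w] smooth_has_derivative[OF s]]], of x e]
    by (rule sym)
  ultimately have "(LINT x|lebesgue. w x * frechet_derivative \<zeta> (at x) e) + (LINT x|lebesgue. frechet_derivative w (at x) e * \<zeta> x) = 0"
    using i by simp
  then show ?thesis using red[of "\<lambda>x. w x * frechet_derivative \<zeta> (at x) e"] red[of "\<lambda>x. frechet_derivative w (at x) e * \<zeta> x"]
      o by simp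
qed

lemma smooth_Lp_fun:
  fixes w :: "real^'n \<Rightarrow> real"
  assumes "smooth w" "0 \<le> q" shows "Lp_fun q (lebesgue_on B1) w" "Lp_fun q (lebesgue_on B1) (grad w)"
proof -
  have *: "Lp_fun q (lebesgue_on B1) u" if c: "continuous_on UNIV u" for u :: "real^'n \<Rightarrow> 'c::euclidean_space"
  proof -
    have "bounded (u ` cball 0 1)"
      by (intro compact_imp_bounded compact_continuous_image continuous_on_subset[OF c]) auto
    then obtain B where B: "\<forall>x\<in>cball 0 1. norm (u x) \<le> B" unfolding bounded_iff by auto
    show ?thesis
    proof (rule Lp_fun_bounded[OF finite_measure_B1, of _ B])
      show "u \<in> borel_measurable (lebesgue_on B1)"
        using c by (intro measurable_restrict_space1 measurable_completion) (simp add: borel_measurable_continuous_onI)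
    qed (use B assms in \<open>auto simp: AE_lebesgue_on_iff\<close>)
  qed
  show "Lp_fun q (lebesgue_on B1) w" "Lp_fun q (lebesgue_on B1) (grad w)"
    using assms by (auto intro!: * smooth_continuous continuous_grad)
qed

lemma integrable_bounded_mult:
  fixes g h :: "'a \<Rightarrow> real"
  assumes "integrable M g" "h \<in> borel_measurable M" "AE x in M. \<bar>h x\<bar> \<le> B"
  shows "integrable M (\<lambda>x. g x * h x)"
proof (rule Bochner_Integration.integrable_bound[of M "\<lambda>x. B * g x"])
  show "AE x in M. norm (g x * h x) \<le> norm (B * g x)"
    using assms(3)
  proof eventually_elim
    case (elim x)
    then have "\<bar>h x\<bar> * \<bar>g x\<bar> \<le> \<bar>B\<bar> * \<bar>g x\<bar>" by (intro mult_right_mono) auto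
    then show ?case by (simp add: abs_mult mult.commute)
  qed
qed (use assms in auto)

lemma tendsto_integral_mult_bounded:
  fixes g h :: "'a \<Rightarrow> real"
  assumes lim: "(\<lambda>k. LINT x|M. norm (w k x - g x)) \<longlonglongrightarrow> 0"
    and int: "\<And>k. integrable M (w k)" "integrable M g"
    and h [measurable]: "h \<in> borel_measurable M" and B: "\<And>x. \<bar>h x\<bar> \<le> B"
  shows "(\<lambda>k. LINT x|M. w k x * h x) \<longlonglongrightarrow> (LINT x|M. g x * h x)"
proof -
  have i: "integrable M (\<lambda>x. w k x * h x)" "integrable M (\<lambda>x. g x * h x)" for k
    using B by (auto intro!: integrable_bounded_mult[OF int(1) h] integrable_bounded_mult[OF int(2) h])
  have "(\<lambda>k. (LINT x|M. w k x * h x) - (LINT x|M. g x * h x)) \<longlonglongrightarrow> 0"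
  proof (rule Lim_null_comparison)
    show "\<forall>\<^sub>F k in sequentially. norm ((LINT x|M. w k x * h x) - (LINT x|M. g x * h x))
        \<le> B * (LINT x|M. norm (w k x - g x))"
    proof (intro always_eventually allI)
      fix k
      have "(LINT x|M. w k x * h x) - (LINT x|M. g x * h x) = (LINT x|M. (w k x - g x) * h x)"
        using i by (simp add: algebra_simps)
      also have "norm \<dots> \<le> (LINT x|M. norm ((w k x - g x) * h x))" by (rule integral_norm_bound)
      also have "\<dots> \<le> (LINT x|M. B * norm (w k x - g x))"
      proof (rule integral_mono)
        show "integrable M (\<lambda>x. norm ((w k x - g x) * h x))" using i by (simp add: algebra_simps)
        show "norm ((w k x - g x) * h x) \<le> B * norm (w k x - g x)" for x
          using mult_right_mono[OF B[of x], of "\<bar>w k x - g x\<bar>"] by (simp add: abs_mult mult.commute)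
      qed (use int in auto)
      finally show "norm ((LINT x|M. w k x * h x) - (LINT x|M. g x * h x)) \<le> B * (LINT x|M. norm (w k x - g x))"
        by simp
    qed
    show "(\<lambda>k. B * (LINT x|M. norm (w k x - g x))) \<longlonglongrightarrow> 0"
      using tendsto_mult_left[OF lim, of B] by simp
  qed
  then show ?thesis by (simp add: LIM_zero_iff)
qed

lemma Lp_fun_locally_integrable:
  fixes \<Omega> :: "'a::euclidean_space set"
  assumes "Lp_fun p (lebesgue_on \<Omega>) g" "1 \<le> p" "\<Omega> \<in> lmeasurable"
  shows "locally_integrable_on g \<Omega>"
  unfolding locally_integrable_on_def
proof safe
  fix K assume K: "compact K" "K \<subseteq> \<Omega>"
  have "integrable (lebesgue_on \<Omega>) g"
    using Lp_fun_integrable_norm[OF assms(1,2) finite_measure_lebesgue_on] assms by blast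
  then have "set_integrable lebesgue \<Omega> g"
    using assms by (auto simp: set_integrable_def integrable_restrict_space fmeasurable_def)
  then show "g absolutely_integrable_on K"
    by (rule set_integrable_subset) (use K in \<open>auto simp: lmeasurable_compact fmeasurableD\<close>)
qed

lemma Lp_tendsto_nth:
  assumes "Lp_tendsto p M w (G :: 'a \<Rightarrow> real^'n)" "0 \<le> p"
  shows "Lp_tendsto p M (\<lambda>k x. w k x $ i) (\<lambda>x. G x $ i)"
proof -
  have L: "Lp_fun p M (\<lambda>x. h x $ i)" if "Lp_fun p M h" for h :: "'a \<Rightarrow> real^'n"
    by (rule Lp_fun_dominated[OF that])
      (use that assms component_le_norm_cart in \<open>auto simp: Lp_fun_def intro!: measurable_compose[OF _ borel_measurable_nth]\<close>)
  have Lk: "Lp_fun p M (w k)" "Lp_fun p M G" for k using assms by (auto simp: Lp_tendsto_def)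
  have "(\<lambda>k. LINT x|M. norm (w k x $ i - G x $ i) powr p) \<longlonglongrightarrow> 0"
  proof (rule Lim_null_comparison)
    show "\<forall>\<^sub>F k in sequentially. norm (LINT x|M. norm (w k x $ i - G x $ i) powr p) \<le> (LINT x|M. norm (w k x - G x) powr p)"
    proof (intro always_eventually allI)
      fix k
      have "norm (w k x $ i - G x $ i) powr p \<le> norm (w k x - G x) powr p" for x
        using component_le_norm_cart[of "w k x - G x" i] assms by (intro powr_mono2) auto
      then have "(LINT x|M. norm (w k x $ i - G x $ i) powr p) \<le> (LINT x|M. norm (w k x - G x) powr p)"
        by (intro integral_mono Lp_fun_integrable Lp_fun_diff L Lk assms)
      then show "norm (LINT x|M. norm (w k x $ i - G x $ i) powr p) \<le> (LINT x|M. norm (w k x - G x) powr p)"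
        by simp
    qed
  qed (use assms in \<open>auto simp: Lp_tendsto_def\<close>)
  with L Lk show ?thesis by (auto simp: Lp_tendsto_def)
qed

text \<open>The weak derivative identity passes to the limit, since test functions and their
  derivatives are bounded and L^p convergence on the ball implies L^1 convergence. Thus the
  membership in \<open>W1p\<close> demanded by the definition of \<open>W1p_0\<close> follows from
  the approximation itself.\<close>

lemma W1p_0_I:
  assumes p: "1 < p" and w: "\<And>k. test_fun B1 (w k)" and lim: "Lp_tendsto p (lebesgue_on B1) w g"
    and limG: "Lp_tendsto p (lebesgue_on B1) (\<lambda>k. grad (w k)) G"
  shows "W1p_0 p g G"
proof -
  note fin = finite_measure_B1
  have wd: "weak_deriv B1 (axis i 1) g (\<lambda>x. G x $ i)" for i
  proof -
    have limi: "Lp_tendsto p (lebesgue_on B1) (\<lambda>k x. grad (w k) x $ i) (\<lambda>x. G x $ i)"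
      using Lp_tendsto_nth[OF limG] p by simp
    have "(LINT x:B1|lebesgue. g x * frechet_derivative \<zeta> (at x) (axis i 1)) = - (LINT x:B1|lebesgue. G x $ i * \<zeta> x)"
      if \<zeta>: "test_fun B1 \<zeta>" for \<zeta>
    proof -
      obtain B where B: "B > 0" "\<And>x. \<bar>\<zeta> x\<bar> \<le> B" "\<And>x. \<bar>frechet_derivative \<zeta> (at x) (axis i 1)\<bar> \<le> B"
        using test_fun_bounds[OF \<zeta>] by blast
      have m: "\<zeta> \<in> borel_measurable (lebesgue_on B1)"
         "(\<lambda>x. frechet_derivative \<zeta> (at x) (axis i 1)) \<in> borel_measurable (lebesgue_on B1)"
        using test_fun_smooth[OF \<zeta>]
        by (auto intro!: measurable_restrict_space1 measurable_completion borel_measurable_continuous_onI smooth_continuous smooth_frechet_derivative)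
      have int: "integrable (lebesgue_on B1) (w k)" "integrable (lebesgue_on B1) g" 
        "integrable (lebesgue_on B1) (\<lambda>x. grad (w k) x $ i)" "integrable (lebesgue_on B1) (\<lambda>x. G x $ i)" for k
        using lim limi p by (auto simp: Lp_tendsto_def intro!: Lp_fun_integrable_norm[OF _ _ fin, of p])
      have 1: "(\<lambda>k. LINT x|lebesgue_on B1. w k x * frechet_derivative \<zeta> (at x) (axis i 1)) \<longlonglongrightarrow> (LINT x|lebesgue_on B1. g x * frechet_derivative \<zeta> (at x) (axis i 1))"
        by (rule tendsto_integral_mult_bounded[OF Lp_tendsto_L1[OF lim p fin] int(1,2) m(2) B(3)])
      have 2: "(\<lambda>k. LINT x|lebesgue_on B1. grad (w k) x $ i * \<zeta> x) \<longlonglongrightarrow> (LINT x|lebesgue_on B1. G x $ i * \<zeta> x)"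
        by (rule tendsto_integral_mult_bounded[OF Lp_tendsto_L1[OF limi p fin] int(3,4) m(1) B(2)])
      have "(LINT x|lebesgue_on B1. w k x * frechet_derivative \<zeta> (at x) (axis i 1)) = - (LINT x|lebesgue_on B1. grad (w k) x $ i * \<zeta> x)" for k
        using integral_by_parts_smooth[OF test_fun_smooth[OF w[of k]] \<zeta> sets_B1, of "axis i 1"]
        by (simp add: LINT_lebesgue_on grad_nth)
      then have "(LINT x|lebesgue_on B1. g x * frechet_derivative \<zeta> (at x) (axis i 1)) = - (LINT x|lebesgue_on B1. G x $ i * \<zeta> x)"
        using LIMSEQ_unique[OF 1] tendsto_minus[OF 2] by simp
      then show ?thesis by (simp add: LINT_lebesgue_on)
    qed
    then show ?thesis
      using lim limi p by (auto simp: weak_deriv_def Lp_tendsto_def intro!: Lp_fun_locally_integrable[of p])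
  qed
  have "Lp_fun p (lebesgue_on B1) g" "Lp_fun p (lebesgue_on B1) G"
    using lim limG by (auto simp: Lp_tendsto_def)
  with wd lim limG w show ?thesis unfolding W1p_0_def W1p_def by blast
qed

section \<open>The boundary layer estimate\<close>

text \<open>The fundamental theorem of calculus, followed by Hoelder's inequality in the guise of
  Young's with an optimized weight; the factor 2^p is the price of that detour.\<close>

lemma powr_increment_le:
  fixes \<phi> \<phi>' :: "real \<Rightarrow> real"
  assumes ab: "a \<le> b" and p: "1 < p"
    and der: "\<And>x. a \<le> x \<Longrightarrow> x \<le> b \<Longrightarrow> (\<phi> has_real_derivative \<phi>' x) (at x)"
    and cont: "continuous_on {a..b} \<phi>'"
  shows "ennreal (\<bar>\<phi> b - \<phi> a\<bar> powr p)
    \<le> ennreal (2 powr p * (b - a) powr (p - 1)) * (\<integral>\<^sup>+x. ennreal (\<bar>\<phi>' x\<bar> powr p) * indicator {a..b} x \<partial>lborel)"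
proof (cases "a = b")
  case False
  define L where "L = b - a"
  have L: "L > 0" using ab False by (simp add: L_def)
  define I where "I = (LINT x|lborel. indicator {a..b} x *\<^sub>R (\<bar>\<phi>' x\<bar> powr p))"
  have int: "integrable lborel (\<lambda>x. indicator {a..b} x *\<^sub>R (\<bar>\<phi>' x\<bar> powr p))"
    "integrable lborel (\<lambda>x. indicator {a..b} x *\<^sub>R \<phi>' x)"
    "integrable lborel (\<lambda>x. indicator {a..b} x *\<^sub>R \<bar>\<phi>' x\<bar>)"
    using p by (intro borel_integrable_compact continuous_intros continuous_on_powr' cont; auto)+
  have [simp]: "integrable lborel (indicat_real {a..b})"
    by (rule integrable_real_indicator) (auto simp: emeasure_lborel_Icc_eq)
  have I0: "0 \<le> I" unfolding I_def by (intro integral_nonneg_AE) auto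
  have step: "\<bar>\<phi> b - \<phi> a\<bar> \<le> \<eta> powr p * L + \<eta> powr (p * (1 - p)) * I" if \<eta>: "\<eta> > 0" for \<eta>
  proof -
    have "\<phi> b - \<phi> a = (LINT x|lborel. indicator {a..b} x *\<^sub>R \<phi>' x)"
      using ab der cont
      by (intro integral_FTC_Icc[symmetric]) (auto simp: has_real_derivative_iff_has_vector_derivative[symmetric] intro: DERIV_subset)
    also have "\<bar>\<dots>\<bar> \<le> (LINT x|lborel. norm (indicator {a..b} x *\<^sub>R \<phi>' x))"
      using integral_norm_bound[of lborel "\<lambda>x. indicator {a..b} x *\<^sub>R \<phi>' x"] by simp
    also have "\<dots> \<le> (LINT x|lborel. indicator {a..b} x * \<eta> powr p + \<eta> powr (p * (1 - p)) * (indicator {a..b} x *\<^sub>R (\<bar>\<phi>' x\<bar> powr p)))"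
    proof (rule integral_mono)
      show "integrable lborel (\<lambda>x. norm (indicator {a..b} x *\<^sub>R \<phi>' x))"
        using int(2) by (rule integrable_norm)
      show "integrable lborel (\<lambda>x. indicator {a..b} x * \<eta> powr p + \<eta> powr (p * (1 - p)) * (indicator {a..b} x *\<^sub>R (\<bar>\<phi>' x\<bar> powr p)))"
        using int(1) by (intro Bochner_Integration.integrable_add integrable_mult_right integrable_mult_left) auto
      show "norm (indicator {a..b} x *\<^sub>R \<phi>' x) \<le> indicator {a..b} x * \<eta> powr p + \<eta> powr (p * (1 - p)) * (indicator {a..b} x *\<^sub>R (\<bar>\<phi>' x\<bar> powr p))" for x
        using young_powr[of 1 "\<bar>\<phi>' x\<bar>" p \<eta>] p \<eta> by (auto simp: indicator_def)
    qed
    also have "\<dots> = (LINT x|lborel. indicator {a..b} x * \<eta> powr p) + \<eta> powr (p * (1 - p)) * I"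
      unfolding I_def using int
      by (subst Bochner_Integration.integral_add) (auto intro!: integrable_mult_left)
    also have "(LINT x|lborel. indicator {a..b} x * \<eta> powr p) = \<eta> powr p * L"
      using ab by (simp add: L_def mult.commute)
    finally show ?thesis .
  qed
  \<comment> \<open>The weight needs a positive quotient J / L, whereas the integral I may vanish;
    hence a bound for every positive J above I, with J sent to I afterwards.\<close>
  have J: "\<bar>\<phi> b - \<phi> a\<bar> powr p \<le> 2 powr p * L powr (p - 1) * J" if "I \<le> J" "0 < J" for J
  proof -
    \<comment> \<open>The exponent 1/p^2 balances the two terms: with \<eta>^p = (J/L)^(1/p) each of
      them equals L (J/L)^(1/p).\<close>
    define \<eta> where "\<eta> = (J / L) powr (1 / p / p)"
    have \<eta>: "\<eta> > 0" using that L by (simp add: \<eta>_def)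
    have e1: "\<eta> powr p = (J / L) powr (1 / p)" using p by (simp add: \<eta>_def powr_powr)
    have e2: "\<eta> powr (p * (1 - p)) = (J / L) powr (1 / p) * (L / J)"
    proof -
      have "1 / p / p * (p * (1 - p)) = 1 / p - 1" using p by (simp add: field_simps)
      then have "\<eta> powr (p * (1 - p)) = (J / L) powr (1 / p - 1)"
        by (simp only: \<eta>_def powr_powr)
      also have "\<dots> = (J / L) powr (1 / p) / (J / L) powr 1"
        by (rule powr_diff)
      finally show ?thesis using that L by simp
    qed
    have "\<bar>\<phi> b - \<phi> a\<bar> \<le> \<eta> powr p * L + \<eta> powr (p * (1 - p)) * J"
      using step[OF \<eta>] mult_left_mono[OF that(1), of "\<eta> powr (p * (1 - p))"] by simp
    also have "\<dots> = 2 * L * (J / L) powr (1 / p)"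
      unfolding e1 e2 using that L by (simp add: field_simps)
    finally have "\<bar>\<phi> b - \<phi> a\<bar> powr p \<le> (2 * L * (J / L) powr (1 / p)) powr p"
      using p by (intro powr_mono2) auto
    also have "\<dots> = 2 powr p * L powr p * (J / L)"
      using p L that by (simp add: powr_mult powr_powr)
    also have "\<dots> = 2 powr p * L powr (p - 1) * J"
      using L powr_add[of L "p - 1" 1] by simp
    finally show ?thesis .
  qed
  have "\<bar>\<phi> b - \<phi> a\<bar> powr p \<le> 2 powr p * L powr (p - 1) * I"
  proof (rule field_le_epsilon)
    fix e :: real assume e: "e > 0"
    define c where "c = 2 powr p * L powr (p - 1)"
    have c: "c > 0" using L by (simp add: c_def)
    have "\<bar>\<phi> b - \<phi> a\<bar> powr p \<le> c * (I + e / c)"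
      unfolding c_def by (rule J) (use e c I0 in \<open>auto simp: c_def[symmetric] intro: add_nonneg_pos\<close>)
    also have "\<dots> = c * I + e" using c by (simp add: field_simps)
    finally show "\<bar>\<phi> b - \<phi> a\<bar> powr p \<le> 2 powr p * L powr (p - 1) * I + e" by (simp add: c_def)
  qed
  then have "ennreal (\<bar>\<phi> b - \<phi> a\<bar> powr p) \<le> ennreal (2 powr p * L powr (p - 1)) * ennreal I"
    using L I0 by (simp add: ennreal_mult[symmetric] ennreal_leI)
  also have "ennreal I = (\<integral>\<^sup>+x. ennreal (indicator {a..b} x *\<^sub>R (\<bar>\<phi>' x\<bar> powr p)) \<partial>lborel)"
    unfolding I_def by (rule nn_integral_eq_integral[symmetric, OF int(1)]) auto
  also have "\<dots> = (\<integral>\<^sup>+x. ennreal (\<bar>\<phi>' x\<bar> powr p) * indicator {a..b} x \<partial>lborel)"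
    by (intro nn_integral_cong) (auto simp: indicator_def)
  finally show ?thesis by (simp add: L_def)
qed (use p in simp)

lemma nn_integral_scale:
  fixes f :: "'a::euclidean_space \<Rightarrow> ennreal"
  assumes [measurable]: "f \<in> borel_measurable borel" and c: "0 < c"
  shows "(\<integral>\<^sup>+x. f x \<partial>lborel) = ennreal (c ^ DIM('a)) * (\<integral>\<^sup>+x. f (c *\<^sub>R x) \<partial>lborel)"
  using c by (subst lborel_affine[of c 0])
     (auto simp: nn_integral_density nn_integral_distr nn_integral_cmult)

lemma sgn_scaleR_pos: "0 < c \<Longrightarrow> sgn (c *\<^sub>R x) = sgn (x :: 'a::real_normed_vector)"
  by (simp add: sgn_div_norm)

lemma borel_measurable_sgn_vec [measurable]: "(sgn :: 'a::euclidean_space \<Rightarrow> 'a) \<in> borel_measurable borel"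
proof -
  have "(\<lambda>x::'a. x /\<^sub>R norm x) \<in> borel_measurable borel" by measurable
  then show ?thesis by (simp add: sgn_div_norm[abs_def])
qed

abbreviation shell :: "real \<Rightarrow> (real ^ 'n) set" where
  "shell \<delta> \<equiv> ball 0 1 - ball 0 (1 - \<delta>)"

text \<open>For a function homogeneous of degree zero, dilation shows that the smaller ball carries
  exactly the fraction (1-\<delta>)^n of the integral over \<open>B1\<close>, so the shell carries 1
  - (1-\<delta>)^n \<le> n \<delta> of it by Bernoulli. It is applied to boundary values extended
  along rays.\<close>

lemma nn_integral_shell_homogeneous:
  fixes g :: "real^'n \<Rightarrow> real" and \<delta> B :: real
  assumes g[measurable]: "g \<in> borel_measurable borel" and bd: "\<And>x. 0 \<le> g x" "\<And>x. g x \<le> B"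
    and hom: "\<And>c x. 0 < c \<Longrightarrow> g (c *\<^sub>R x) = g x" and \<delta>: "0 < \<delta>" "\<delta> < 1"
  shows "(\<integral>\<^sup>+x. ennreal (g x) * indicator (shell \<delta>) x \<partial>lborel)
    \<le> ennreal (CARD('n) * \<delta>) * (\<integral>\<^sup>+x. ennreal (g x) * indicator B1 x \<partial>lborel)"
proof -
  let ?n = "CARD('n)"
  have [measurable]: "ball (0::real^'n) (1 - \<delta>) \<in> sets borel" "B1 \<in> sets (borel :: (real^'n) measure)"
    "shell \<delta> \<in> sets (borel :: (real^'n) measure)" by auto
  define T where "T = (\<integral>\<^sup>+x. ennreal (g x) * indicator B1 x \<partial>lborel)"
  have "B \<ge> 0" using bd[of 0] by linarith
  \<comment> \<open>Finiteness of T is what allows the subtraction further down, where T occurs on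
    both sides of an equation in \<open>ennreal\<close>.\<close>
  have "T \<le> (\<integral>\<^sup>+x. ennreal B * indicator (B1::(real^'n) set) x \<partial>lborel)"
    unfolding T_def using bd by (intro nn_integral_mono mult_right_mono ennreal_leI) auto
  also have "\<dots> = ennreal B * emeasure lborel (B1::(real^'n) set)" by (simp add: nn_integral_cmult_indicator)
  also have "\<dots> < \<infinity>"
    using emeasure_lborel_ball_finite[of "0::real^'n" 1] by (auto simp: ennreal_mult_less_top)
  finally have fin: "T < \<infinity>" .
  have small: "(\<integral>\<^sup>+x. ennreal (g x) * indicator (ball 0 (1 - \<delta>)) x \<partial>lborel) = ennreal ((1 - \<delta>) ^ ?n) * T"
  proof -
    have "(\<integral>\<^sup>+x. ennreal (g x) * indicator (ball 0 (1 - \<delta>)) x \<partial>lborel)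
       = ennreal ((1 - \<delta>) ^ DIM(real^'n)) * (\<integral>\<^sup>+x. ennreal (g ((1 - \<delta>) *\<^sub>R x)) * indicator (ball 0 (1 - \<delta>)) ((1 - \<delta>) *\<^sub>R x) \<partial>lborel)"
    proof (rule nn_integral_scale)
      show "(\<lambda>x. ennreal (g x) * indicator (ball 0 (1 - \<delta>)) x) \<in> borel_measurable borel" by measurable
    qed (use \<delta> in simp)
    also have "(\<integral>\<^sup>+x. ennreal (g ((1 - \<delta>) *\<^sub>R x)) * indicator (ball 0 (1 - \<delta>)) ((1 - \<delta>) *\<^sub>R x) \<partial>lborel) = T"
      unfolding T_def using \<delta> hom by (intro nn_integral_cong) (auto simp: indicator_def)
    finally show ?thesis by simp
  qed
  have "T = (\<integral>\<^sup>+x. ennreal (g x) * indicator (shell \<delta>) x + ennreal (g x) * indicator (ball 0 (1 - \<delta>)) x \<partial>lborel)"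
    unfolding T_def using \<delta> by (intro nn_integral_cong) (auto simp: indicator_def)
  also have "\<dots> = (\<integral>\<^sup>+x. ennreal (g x) * indicator (shell \<delta>) x \<partial>lborel) + ennreal ((1 - \<delta>) ^ ?n) * T"
    by (subst nn_integral_add) (auto simp: small)
  finally have eq: "(\<integral>\<^sup>+x. ennreal (g x) * indicator (shell \<delta>) x \<partial>lborel) + ennreal ((1 - \<delta>) ^ ?n) * T = T" ..
  obtain t where t: "T = ennreal t" "t \<ge> 0" using fin by (cases T) auto
  obtain s where s: "(\<integral>\<^sup>+x. ennreal (g x) * indicator (shell \<delta>) x \<partial>lborel) = ennreal s" "s \<ge> 0"
    using eq fin by (cases "\<integral>\<^sup>+x. ennreal (g x) * indicator (shell \<delta>) x \<partial>lborel") (auto simp: top_unique)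
  have "s + (1 - \<delta>) ^ ?n * t = t"
    using eq s t \<delta> by (simp add: ennreal_mult[symmetric] ennreal_plus[symmetric] del: ennreal_plus)
  moreover have "1 - ?n * \<delta> \<le> (1 - \<delta>) ^ ?n" using Bernoulli_inequality[of "- \<delta>" ?n] \<delta> by simp
  ultimately have "s \<le> (?n * \<delta>) * t"
    using mult_right_mono[of "1 - ?n * \<delta>" "(1 - \<delta>) ^ ?n" t] t by (simp add: algebra_simps)
  then show ?thesis using s t \<delta> unfolding T_def[symmetric] by (simp add: ennreal_mult[symmetric] ennreal_leI)
qed

text \<open>The increment from x to \<open>sgn x\<close> is an integral of the radial derivative
  over \<sigma> in [1, 1/|x|]. After Fubini each dilation by \<sigma> \<ge> 1 can only decrease the
  space integral, so just the length 2\<delta> of the parameter interval remains; with the power p -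
  1 from \<open>powr_increment_le\<close> this totals \<delta>^p.\<close>

lemma nn_integral_shell_radial_increment:
  fixes w :: "real^'n \<Rightarrow> real"
  assumes w: "smooth w" and p: "1 < p" and \<delta>: "0 < \<delta>" "\<delta> \<le> 1 / 2"
  shows "(\<integral>\<^sup>+x. ennreal (\<bar>w x - w (sgn x)\<bar> powr p) * indicator (shell \<delta>) x \<partial>lborel)
    \<le> ennreal (4 powr p * \<delta> powr p) * (\<integral>\<^sup>+x. ennreal (norm (grad w x) powr p) * indicator (shell \<delta>) x \<partial>lborel)"
proof -
  note [measurable] = borel_measurable_continuous_onI[OF smooth_continuous[OF w]]
    borel_measurable_continuous_onI[OF continuous_grad[OF w]]
  \<comment> \<open>Closed on the outer side, because the rays end on the sphere; the sphere is null
    and is discarded at the end.\<close>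
  define S where "S = cball (0::real^'n) 1 - ball 0 (1 - \<delta>)"
  have [measurable]: "S \<in> sets borel" by (simp add: S_def)
  define c where "c = ennreal (2 powr p * (2 * \<delta>) powr (p - 1))"
  define G where "G = (\<lambda>x. ennreal (norm (grad w x) powr p) * indicator S x)"
  have [measurable]: "G \<in> borel_measurable borel" unfolding G_def by measurable
  have pt: "ennreal (\<bar>w x - w (sgn x)\<bar> powr p) \<le> c * (\<integral>\<^sup>+\<sigma>. G (\<sigma> *\<^sub>R x) * indicator {1..1+2*\<delta>} \<sigma> \<partial>lborel)"
    if x: "x \<in> shell \<delta>" for x
  proof -
    define r where "r = norm x"
    have r: "1 - \<delta> \<le> r" "r < 1" "1/2 \<le> r" using x \<delta> by (auto simp: r_def)
    have r1: "1 / r \<le> 1 + 2 * \<delta>"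
    proof -
      \<comment> \<open>The product is 1 + \<delta> - 2\<delta>^2, which is at least 1 for 0 <
        \<delta> \<le> 1/2.\<close>
      have "1 \<le> (1 + 2 * \<delta>) * (1 - \<delta>)" using \<delta> mult_mono[of \<delta> "1/2" \<delta> \<delta>] by (simp add: algebra_simps)
      also have "\<dots> \<le> (1 + 2 * \<delta>) * r" using r \<delta> by (intro mult_left_mono) auto
      finally show ?thesis using r by (simp add: field_simps)
    qed
    have ge: "1 \<le> 1 / r" using r by (simp add: field_simps)
    have sg: "sgn x = (1 / r) *\<^sub>R x" by (simp add: sgn_div_norm r_def divide_inverse)
    have "ennreal (\<bar>w ((1 / r) *\<^sub>R x) - w (1 *\<^sub>R x)\<bar> powr p)
      \<le> ennreal (2 powr p * (1 / r - 1) powr (p - 1)) *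
        (\<integral>\<^sup>+\<sigma>. ennreal (\<bar>grad w (\<sigma> *\<^sub>R x) \<bullet> x\<bar> powr p) * indicator {1..1/r} \<sigma> \<partial>lborel)"
    proof (rule powr_increment_le[OF ge p])
      show "((\<lambda>\<sigma>. w (\<sigma> *\<^sub>R x)) has_real_derivative grad w (\<sigma> *\<^sub>R x) \<bullet> x) (at \<sigma>)" for \<sigma>
        using smooth_has_derivative_line[OF w, of 0 x \<sigma>] by (simp add: smooth_frechet_grad[OF w])
      show "continuous_on {1..1 / r} (\<lambda>\<sigma>. grad w (\<sigma> *\<^sub>R x) \<bullet> x)"
        by (intro continuous_intros continuous_on_compose2[OF continuous_grad[OF w, of UNIV]]) auto
    qed
    also have "\<dots> \<le> c * (\<integral>\<^sup>+\<sigma>. G (\<sigma> *\<^sub>R x) * indicator {1..1+2*\<delta>} \<sigma> \<partial>lborel)"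
    proof (rule mult_mono)
      show "ennreal (2 powr p * (1 / r - 1) powr (p - 1)) \<le> c"
        unfolding c_def using ge r1 p by (intro ennreal_leI mult_left_mono powr_mono2) auto
      show "(\<integral>\<^sup>+\<sigma>. ennreal (\<bar>grad w (\<sigma> *\<^sub>R x) \<bullet> x\<bar> powr p) * indicator {1..1/r} \<sigma> \<partial>lborel)
        \<le> (\<integral>\<^sup>+\<sigma>. G (\<sigma> *\<^sub>R x) * indicator {1..1+2*\<delta>} \<sigma> \<partial>lborel)"
      proof (rule nn_integral_mono)
      fix \<sigma> :: real
      show "ennreal (\<bar>grad w (\<sigma> *\<^sub>R x) \<bullet> x\<bar> powr p) * indicator {1..1/r} \<sigma> \<le> G (\<sigma> *\<^sub>R x) * indicator {1..1+2*\<delta>} \<sigma>"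
      proof (cases "\<sigma> \<in> {1..1/r}")
        case True
        have "\<sigma> * r \<le> 1" "r \<le> \<sigma> * r"
          using True r by (auto simp: field_simps)
        then have mem: "\<sigma> *\<^sub>R x \<in> S" using True r by (auto simp: S_def r_def)
        have "\<bar>grad w (\<sigma> *\<^sub>R x) \<bullet> x\<bar> \<le> norm (grad w (\<sigma> *\<^sub>R x)) * norm x" by (rule Cauchy_Schwarz_ineq2)
        also have "\<dots> \<le> norm (grad w (\<sigma> *\<^sub>R x)) * 1" using r by (intro mult_left_mono) (auto simp: r_def)
        finally have "\<bar>grad w (\<sigma> *\<^sub>R x) \<bullet> x\<bar> powr p \<le> norm (grad w (\<sigma> *\<^sub>R x)) powr p"
          using p by (intro powr_mono2) auto
        then show ?thesis using mem True r1 by (auto simp: G_def ennreal_leI)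
      qed simp
      qed
    qed auto
    finally show ?thesis by (simp add: sg abs_minus_commute)
  qed
  have "(\<integral>\<^sup>+x. ennreal (\<bar>w x - w (sgn x)\<bar> powr p) * indicator (shell \<delta>) x \<partial>lborel)
    \<le> (\<integral>\<^sup>+x. c * (\<integral>\<^sup>+\<sigma>. G (\<sigma> *\<^sub>R x) * indicator {1..1+2*\<delta>} \<sigma> \<partial>lborel) \<partial>lborel)"
    by (intro nn_integral_mono) (use pt in \<open>auto simp: indicator_def\<close>)
  also have "\<dots> = c * (\<integral>\<^sup>+x. (\<integral>\<^sup>+\<sigma>. G (\<sigma> *\<^sub>R x) * indicator {1..1+2*\<delta>} \<sigma> \<partial>lborel) \<partial>lborel)"
    by (intro nn_integral_cmult) measurable
  also have "(\<integral>\<^sup>+x. (\<integral>\<^sup>+\<sigma>. G (\<sigma> *\<^sub>R x) * indicator {1..1+2*\<delta>} \<sigma> \<partial>lborel) \<partial>lborel)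
     = (\<integral>\<^sup>+\<sigma>. (\<integral>\<^sup>+x. G (\<sigma> *\<^sub>R x) * indicator {1..1+2*\<delta>} \<sigma> \<partial>lborel) \<partial>lborel)"
    by (rule lborel_pair.Fubini'[symmetric]) measurable
  also have "\<dots> \<le> (\<integral>\<^sup>+\<sigma>. (\<integral>\<^sup>+x. G x \<partial>lborel) * indicator {1..1+2*\<delta>} \<sigma> \<partial>lborel)"
  proof (intro nn_integral_mono)
    fix \<sigma> :: real
    show "(\<integral>\<^sup>+x. G (\<sigma> *\<^sub>R x) * indicator {1..1+2*\<delta>} \<sigma> \<partial>lborel) \<le> (\<integral>\<^sup>+x. G x \<partial>lborel) * indicator {1..1+2*\<delta>} \<sigma>"
    proof (cases "\<sigma> \<in> {1..1+2*\<delta>}")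
      case True
      then have "1 \<le> \<sigma>" by simp
      have "(\<integral>\<^sup>+x. G (\<sigma> *\<^sub>R x) \<partial>lborel) \<le> ennreal (\<sigma> ^ DIM(real^'n)) * (\<integral>\<^sup>+x. G (\<sigma> *\<^sub>R x) \<partial>lborel)"
        using mult_right_mono[of 1 "ennreal (\<sigma> ^ DIM(real^'n))"] one_le_power[OF \<open>1 \<le> \<sigma>\<close>] by simp
      also have "\<dots> = (\<integral>\<^sup>+x. G x \<partial>lborel)"
        using \<open>1 \<le> \<sigma>\<close> by (intro nn_integral_scale[symmetric]) auto
      finally show ?thesis using True by simp
    qed simp
  qed
  also have "\<dots> = (\<integral>\<^sup>+x. G x \<partial>lborel) * ennreal (2 * \<delta>)"
    using \<delta> by (subst nn_integral_cmult_indicator) auto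
  also have "(\<integral>\<^sup>+x. G x \<partial>lborel) = (\<integral>\<^sup>+x. ennreal (norm (grad w x) powr p) * indicator (shell \<delta>) x \<partial>lborel)"
  proof (rule nn_integral_cong_AE)
    have "sphere (0::real^'n) 1 \<in> null_sets lborel"
      using negligible_sphere[of "0::real^'n" 1] by (simp add: negligible_iff_null_sets null_sets_completion_iff)
    then have "AE x in lborel. x \<notin> sphere (0::real^'n) 1" by (rule AE_not_in)
    then show "AE x in lborel. G x = ennreal (norm (grad w x) powr p) * indicator (shell \<delta>) x"
      by eventually_elim (auto simp: G_def S_def indicator_def)
  qed
  finally have *: "(\<integral>\<^sup>+x. ennreal (\<bar>w x - w (sgn x)\<bar> powr p) * indicator (shell \<delta>) x \<partial>lborel)
    \<le> c * ((\<integral>\<^sup>+x. ennreal (norm (grad w x) powr p) * indicator (shell \<delta>) x \<partial>lborel) * ennreal (2 * \<delta>))"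
    by (simp add: mult_left_mono)
  have "c * ennreal (2 * \<delta>) = ennreal (4 powr p * \<delta> powr p)"
  proof -
    have "2 powr p * (2 * \<delta>) powr (p - 1) * (2 * \<delta>) = 2 powr p * (2 * \<delta>) powr p"
      using \<delta> powr_add[of "2 * \<delta>" "p - 1" 1] by simp
    also have "\<dots> = (2 * 2) powr p * \<delta> powr p" using \<delta> powr_mult[of 2 2 p] by (simp add: powr_mult)
    finally show ?thesis using \<delta> by (simp add: c_def ennreal_mult[symmetric])
  qed
  moreover have "(\<integral>\<^sup>+x. ennreal (\<bar>w x - w (sgn x)\<bar> powr p) * indicator (shell \<delta>) x \<partial>lborel)
    \<le> (c * ennreal (2 * \<delta>)) * (\<integral>\<^sup>+x. ennreal (norm (grad w x) powr p) * indicator (shell \<delta>) x \<partial>lborel)"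
    using * by (simp only: mult_ac)
  ultimately show ?thesis by (simp only:)
qed

text \<open>The cone formula unfolded: a surface integral is a volume integral of the extension
  constant along rays, the form in which \<open>nn_integral_shell_homogeneous\<close> delivers it.
  Adding the origin to the punctured ball changes nothing, a point being null.\<close>

lemma nn_integral_surface_measure:
  fixes h :: "real^'n \<Rightarrow> ennreal"
  assumes [measurable]: "h \<in> borel_measurable borel"
  shows "(\<integral>\<^sup>+x. h x \<partial>surface_measure) = of_nat CARD('n) * (\<integral>\<^sup>+x. h (sgn x) * indicator B1 x \<partial>lborel)"
proof -
  have B: "B1 - {0::real^'n} \<in> sets lebesgue" by simp
  have sgn: "sgn \<in> lebesgue_on (B1 - {0::real^'n}) \<rightarrow>\<^sub>M restrict_space borel (sphere 0 1)"
  proof (rule measurable_restrict_space2)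
    show "sgn \<in> space (lebesgue_on (B1 - {0::real^'n})) \<rightarrow> sphere 0 1"
      by (auto simp: norm_sgn space_restrict_space)
    show "sgn \<in> lebesgue_on (B1 - {0::real^'n}) \<rightarrow>\<^sub>M borel"
      by (intro measurable_restrict_space1 measurable_completion) measurable
  qed
  have h: "h \<in> borel_measurable (restrict_space borel (sphere 0 1))"
    by (intro measurable_restrict_space1 assms)
  have "(\<integral>\<^sup>+x. h x \<partial>surface_measure) = of_nat CARD('n) * (\<integral>\<^sup>+x. h (sgn x) \<partial>lebesgue_on (B1 - {0::real^'n}))"
    using h sgn by (simp add: surface_measure_def nn_integral_completion nn_integral_scale_measure nn_integral_distr)
  also have "(\<integral>\<^sup>+x. h (sgn x) \<partial>lebesgue_on (B1 - {0::real^'n})) = (\<integral>\<^sup>+x. h (sgn x) * indicator (B1 - {0}) x \<partial>lborel)"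
    using B by (simp add: nn_integral_restrict_space nn_integral_completion)
  also have "\<dots> = (\<integral>\<^sup>+x. h (sgn x) * indicator B1 x \<partial>lborel)"
  proof (rule nn_integral_cong_AE)
    have "AE x in lborel. x \<noteq> (0::real^'n)" by (rule AE_lborel_singleton)
    then show "AE x in lborel. h (sgn x) * indicator (B1 - {0}) x = h (sgn x) * indicator B1 x"
      by eventually_elim (auto simp: indicator_def)
  qed
  finally show ?thesis .
qed

text \<open>Splits w(x) into the boundary value w(sgn x), which is constant along rays and costs
  \<delta> times its surface integral, and the radial increment, which costs \<delta>^p times the
  gradient term. The gradient is integrated over the shell only, so this term still tends to zero
  after \<delta>^p has been used up against a cutoff.\<close>

lemma boundary_layer_estimate:
  fixes w :: "real^'n \<Rightarrow> real"
  assumes w: "smooth w" and p: "1 < p" and \<delta>: "0 < \<delta>" "\<delta> \<le> 1 / 2"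
  shows "(\<integral>\<^sup>+x. ennreal (\<bar>w x\<bar> powr p) * indicator (shell \<delta>) x \<partial>lborel)
    \<le> ennreal (2 powr p * \<delta>) * (\<integral>\<^sup>+x. ennreal (\<bar>w x\<bar> powr p) \<partial>surface_measure)
     + ennreal (8 powr p * \<delta> powr p) * (\<integral>\<^sup>+x. ennreal (norm (grad w x) powr p) * indicator (shell \<delta>) x \<partial>lborel)"
proof -
  note [measurable] = borel_measurable_continuous_onI[OF smooth_continuous[OF w]]
    borel_measurable_continuous_onI[OF continuous_grad[OF w]]
  have [measurable]: "B1 \<in> sets (borel :: (real^'n) measure)"
    "shell \<delta> \<in> sets (borel :: (real^'n) measure)" by auto
  have "bounded (w ` cball 0 1)"
    by (intro compact_imp_bounded compact_continuous_image smooth_continuous w) auto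
  then obtain B where B: "\<forall>x\<in>cball 0 1. \<bar>w x\<bar> \<le> B" unfolding bounded_iff by auto
  have sg: "\<bar>w (sgn x)\<bar> \<le> B" for x using B by (auto simp: norm_sgn)
  let ?I = "\<lambda>f. \<integral>\<^sup>+x. ennreal (f x) * indicator (shell \<delta>) x \<partial>lborel"
  let ?T = "\<integral>\<^sup>+x. ennreal (\<bar>w (sgn x)\<bar> powr p) * indicator B1 x \<partial>lborel"
  have "?I (\<lambda>x. \<bar>w x\<bar> powr p) \<le> ?I (\<lambda>x. 2 powr p * (\<bar>w x - w (sgn x)\<bar> powr p + \<bar>w (sgn x)\<bar> powr p))"
    using powr_norm_add_le[of p "w x - w (sgn x)" "w (sgn x)" for x] p
    by (intro nn_integral_mono mult_right_mono ennreal_leI) auto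
  also have "\<dots> = ennreal (2 powr p) * (?I (\<lambda>x. \<bar>w x - w (sgn x)\<bar> powr p) + ?I (\<lambda>x. \<bar>w (sgn x)\<bar> powr p))"
  proof -
    have "?I (\<lambda>x. \<bar>w x - w (sgn x)\<bar> powr p) + ?I (\<lambda>x. \<bar>w (sgn x)\<bar> powr p)
       = (\<integral>\<^sup>+x. ennreal (\<bar>w x - w (sgn x)\<bar> powr p) * indicator (shell \<delta>) x
           + ennreal (\<bar>w (sgn x)\<bar> powr p) * indicator (shell \<delta>) x \<partial>lborel)"
      by (rule nn_integral_add[symmetric]) measurable
    then have "ennreal (2 powr p) * (?I (\<lambda>x. \<bar>w x - w (sgn x)\<bar> powr p) + ?I (\<lambda>x. \<bar>w (sgn x)\<bar> powr p))
       = (\<integral>\<^sup>+x. ennreal (2 powr p) * (ennreal (\<bar>w x - w (sgn x)\<bar> powr p) * indicator (shell \<delta>) x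
           + ennreal (\<bar>w (sgn x)\<bar> powr p) * indicator (shell \<delta>) x) \<partial>lborel)"
      by (simp only:) (rule nn_integral_cmult[symmetric], measurable)
    then show ?thesis
      by (simp only:) (auto intro!: nn_integral_cong simp: ennreal_mult indicator_def)
  qed
  also have "?I (\<lambda>x. \<bar>w (sgn x)\<bar> powr p) \<le> ennreal (CARD('n) * \<delta>) * ?T"
    by (rule nn_integral_shell_homogeneous[where B = "B powr p"])
      (use \<delta> p sg in \<open>auto simp: sgn_scaleR_pos intro!: powr_mono2\<close>)
  also have "?I (\<lambda>x. \<bar>w x - w (sgn x)\<bar> powr p) \<le> ennreal (4 powr p * \<delta> powr p) * ?I (\<lambda>x. norm (grad w x) powr p)"
    by (rule nn_integral_shell_radial_increment[OF assms])
  also have "ennreal (2 powr p) * (ennreal (4 powr p * \<delta> powr p) * ?I (\<lambda>x. norm (grad w x) powr p) + ennreal (CARD('n) * \<delta>) * ?T)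
    = ennreal (2 powr p * \<delta>) * (of_nat CARD('n) * ?T) + ennreal (8 powr p * \<delta> powr p) * ?I (\<lambda>x. norm (grad w x) powr p)"
  proof -
    have "ennreal (2 powr p) * ennreal (4 powr p * \<delta> powr p) = ennreal (8 powr p * \<delta> powr p)"
      using powr_mult[of 2 4 p] by (simp add: ennreal_mult[symmetric])
    moreover have "ennreal (2 powr p) * ennreal (CARD('n) * \<delta>) = ennreal (2 powr p * \<delta>) * of_nat CARD('n)"
      using \<delta> by (simp add: ennreal_of_nat_eq_real_of_nat ennreal_mult[symmetric] mult_ac)
    ultimately show ?thesis by (simp add: distrib_left add.commute mult.assoc[symmetric])
  qed
  also have "of_nat CARD('n) * ?T = (\<integral>\<^sup>+x. ennreal (\<bar>w x\<bar> powr p) \<partial>surface_measure)"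
    by (rule nn_integral_surface_measure[symmetric]) simp
  finally show ?thesis by (simp add: add_left_mono add_right_mono mult_left_mono)
qed

section \<open>Functions with vanishing trace\<close>

lemma deriv_step_0: "2 < r \<Longrightarrow> deriv step r = 0"
proof (rule DERIV_imp_deriv)
  assume "2 < r"
  show "(step has_real_derivative 0) (at r)"
    by (rule DERIV_cong_ev[THEN iffD2, OF refl _ refl, of _ "\<lambda>x. 1"])
      (use \<open>2 < r\<close> in \<open>auto simp: step_1 intro!: eventually_mono[OF eventually_nhds_in_open[of "{2<..}"]]\<close>)
qed

text \<open>The squared norm avoids the singularity of the norm at the origin. For \<epsilon> > 0
  the transition happens where 1 - |x|^2 runs from \<epsilon> to 2\<epsilon>, so the support stays
  away from the sphere.\<close>

definition cut :: "real \<Rightarrow> real ^ 'n \<Rightarrow> real" where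
  "cut \<epsilon> x = step ((1 - (norm x)\<^sup>2) * (1 / \<epsilon>))"

lemma smooth_cut: "smooth (cut \<epsilon> :: real ^ 'n \<Rightarrow> real)"
  unfolding cut_def
  by (intro smooth_compose[OF smooth_step] smooth_mult smooth_diff smooth_const smooth_norm_sq)

lemma grad_cut: "grad (cut \<epsilon>) x = deriv step ((1 - (norm x)\<^sup>2) * (1 / \<epsilon>)) *\<^sub>R ((- 2 / \<epsilon>) *\<^sub>R (x :: real ^ 'n))"
proof -
  have s: "smooth (\<lambda>x :: real ^ 'n. (1 - (norm x)\<^sup>2) * (1 / \<epsilon>))"
    by (intro smooth_mult smooth_diff smooth_const smooth_norm_sq)
  have "grad (\<lambda>x :: real ^ 'n. (1 - (norm x)\<^sup>2) * (1 / \<epsilon>)) x = (- 2 / \<epsilon>) *\<^sub>R x"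
    unfolding power2_norm_eq_inner
    by (rule grad_eqI, cases "\<epsilon> = 0") (auto intro!: derivative_eq_intros simp: inner_commute)
  then show ?thesis
    using grad_compose[OF smooth_step s, of x] by (simp add: cut_def[abs_def])
qed

lemma cut_interior:
  fixes x :: "real ^ 'n"
  assumes "0 < \<epsilon>" "norm x < 1 - 2 * \<epsilon>"
  shows "cut \<epsilon> x = 1" "grad (cut \<epsilon>) x = 0"
proof -
  \<comment> \<open>|x|^2 \<le> |x| turns the condition on |x| into 1 - |x|^2 > 2\<epsilon>, where
    \<open>step\<close> is locally constant.\<close>
  have "(norm x)\<^sup>2 \<le> norm x * 1"
    unfolding power2_eq_square using assms by (intro mult_left_mono) auto
  then have "2 < (1 - (norm x)\<^sup>2) * (1 / \<epsilon>)" using assms by (simp add: field_simps)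
  then show "cut \<epsilon> x = 1" "grad (cut \<epsilon>) x = 0"
    unfolding grad_cut by (auto simp: cut_def step_1 deriv_step_0)
qed

lemma test_fun_cut:
  fixes w :: "real ^ 'n \<Rightarrow> real"
  assumes "smooth w" "0 < \<epsilon>" "\<epsilon> < 1"
  shows "test_fun B1 (\<lambda>x. w x * cut \<epsilon> x)"
proof -
  have "norm x \<le> sqrt (1 - \<epsilon>)" if "cut \<epsilon> x \<noteq> 0" for x :: "real ^ 'n"
  proof -
    have "1 < (1 - (norm x)\<^sup>2) * (1 / \<epsilon>)" by (rule ccontr) (use that step_0 in \<open>auto simp: cut_def not_less\<close>)
    then have "(norm x)\<^sup>2 \<le> 1 - \<epsilon>" using assms by (simp add: field_simps)
    then show ?thesis by (rule real_le_rsqrt)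
  qed
  then have "{x. w x * cut \<epsilon> x \<noteq> 0} \<subseteq> cball 0 (sqrt (1 - \<epsilon>))" by auto
  then have sub: "closure {x. w x * cut \<epsilon> x \<noteq> 0} \<subseteq> cball 0 (sqrt (1 - \<epsilon>))"
    by (rule closure_minimal) simp
  have "compact (closure {x. w x * cut \<epsilon> x \<noteq> 0})"
    using bounded_subset[OF bounded_cball sub] by (simp add: compact_eq_bounded_closed)
  moreover have "sqrt (1 - \<epsilon>) < 1" using assms by simp
  then have "cball 0 (sqrt (1 - \<epsilon>)) \<subseteq> (B1 :: (real ^ 'n) set)" by (auto simp del: real_sqrt_lt_1_iff)
  ultimately show ?thesis
    using sub assms by (auto simp: test_fun_def intro!: smooth_mult smooth_cut)
qed

text \<open>Both errors live in \<open>shell (2 * \<epsilon>)\<close>. The gradient of the cutoff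
  costs \<epsilon>^(-p) in front of the integral of |w|^p over the shell; the boundary layer
  estimate bounds that integral by \<epsilon> times the surface integral plus \<epsilon>^p times the
  gradient term. A negative power therefore survives only in front of the surface integral, which
  can be made small afterwards.\<close>

lemma cutoff_error:
  assumes p: "1 < p"
  obtains C where "C > 0"
    "\<And>\<epsilon> (w :: real ^ 'n \<Rightarrow> real). 0 < \<epsilon> \<Longrightarrow> \<epsilon> \<le> 1/4 \<Longrightarrow> smooth w \<Longrightarrow>
      (\<integral>\<^sup>+x. ennreal (\<bar>w x * cut \<epsilon> x - w x\<bar> powr p) * indicator B1 x \<partial>lborel)
      \<le> ennreal C * ((\<integral>\<^sup>+x. ennreal (norm (grad w x) powr p) * indicator (shell (2 * \<epsilon>)) x \<partial>lborel)
          + ennreal (\<epsilon> powr (- p)) * (\<integral>\<^sup>+x. ennreal (\<bar>w x\<bar> powr p) \<partial>surface_measure))"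
    "\<And>\<epsilon> (w :: real ^ 'n \<Rightarrow> real). 0 < \<epsilon> \<Longrightarrow> \<epsilon> \<le> 1/4 \<Longrightarrow> smooth w \<Longrightarrow>
      (\<integral>\<^sup>+x. ennreal (norm (grad (\<lambda>x. w x * cut \<epsilon> x) x - grad w x) powr p) * indicator B1 x \<partial>lborel)
      \<le> ennreal C * ((\<integral>\<^sup>+x. ennreal (norm (grad w x) powr p) * indicator (shell (2 * \<epsilon>)) x \<partial>lborel)
          + ennreal (\<epsilon> powr (- p)) * (\<integral>\<^sup>+x. ennreal (\<bar>w x\<bar> powr p) \<partial>surface_measure))"
proof -
  obtain L where L: "L > 0" "\<And>r. \<bar>deriv step r\<bar> \<le> L" using step_deriv_bound by blast
  \<comment> \<open>A crude product whose expansion dominates each of the four constants met below,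
    those listed in \<open>C0a\<close>.\<close>
  define C0 where "C0 = 2 powr p * (1 + (2 * L) powr p) * (16 powr p + 2 * 2 powr p + 1)"
  have C0: "C0 > 0" by (simp add: C0_def add_pos_nonneg add_pos_pos)
  have C0a: "16 powr p \<le> C0" "2 * 2 powr p \<le> C0"
    "2 powr p * (1 + (2 * L) powr p * 16 powr p) \<le> C0" "2 powr p * (2 * L) powr p * (2 * 2 powr p) \<le> C0"
  proof -
    define a b where "a = (2 * L) powr p" and "b = (16 :: real) powr p"
    define c where "c = (2 :: real) powr p"
    have abc: "0 \<le> a" "0 \<le> b" "1 \<le> c" using p by (auto simp: a_def b_def c_def ge_one_powr_ge_zero)
    have e: "C0 = c * b + c * (2 * c) + c + c * a * b + c * a * (2 * c) + c * a"
      by (simp add: C0_def a_def b_def c_def algebra_simps)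
    have "b \<le> c * b" "2 * c \<le> c * (2 * c)" using abc mult_right_mono[of 1 c b] mult_right_mono[of 1 c "2 * c"] by auto
    moreover have "0 \<le> c * b" "0 \<le> c * (2 * c)" "0 \<le> c * a * b" "0 \<le> c * a * (2 * c)" "0 \<le> c * a" using abc by auto
    ultimately show "16 powr p \<le> C0" "2 * 2 powr p \<le> C0" "2 powr p * (1 + (2 * L) powr p * 16 powr p) \<le> C0" "2 powr p * (2 * L) powr p * (2 * 2 powr p) \<le> C0"
      unfolding e a_def[symmetric] b_def[symmetric] c_def[symmetric] distrib_left mult.assoc mult_1_right
      using abc by linarith+
  qed
  have main: "(\<integral>\<^sup>+x. ennreal (\<bar>w x * cut \<epsilon> x - w x\<bar> powr p) * indicator B1 x \<partial>lborel) \<le> ennreal C0 * (\<Gamma> + ennreal (\<epsilon> powr (- p)) * s)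
     \<and> (\<integral>\<^sup>+x. ennreal (norm (grad (\<lambda>x. w x * cut \<epsilon> x) x - grad w x) powr p) * indicator B1 x \<partial>lborel) \<le> ennreal C0 * (\<Gamma> + ennreal (\<epsilon> powr (- p)) * s)"
    if \<epsilon>: "0 < \<epsilon>" "\<epsilon> \<le> 1/4" and w: "smooth w"
      and \<Gamma>: "\<Gamma> = (\<integral>\<^sup>+x. ennreal (norm (grad w x) powr p) * indicator (shell (2 * \<epsilon>)) x \<partial>lborel)"
      and s: "s = (\<integral>\<^sup>+x. ennreal (\<bar>w x\<bar> powr p) \<partial>surface_measure)"
    for \<epsilon> and w :: "real ^ 'n \<Rightarrow> real" and \<Gamma> s
  proof -
    note [measurable] = borel_measurable_continuous_onI[OF smooth_continuous[OF w]]
      borel_measurable_continuous_onI[OF continuous_grad[OF w]]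
    have [measurable]: "shell (2 * \<epsilon>) \<in> sets (borel :: (real^'n) measure)" by auto
    let ?W = "\<integral>\<^sup>+x. ennreal (\<bar>w x\<bar> powr p) * indicator (shell (2 * \<epsilon>)) x \<partial>lborel"
    \<comment> \<open>The assumption \<epsilon> \<le> 1/4 makes the shell width 2\<epsilon> at most
      1/2, as the boundary layer estimate requires.\<close>
    have W: "?W \<le> ennreal (2 powr p * (2 * \<epsilon>)) * s + ennreal (8 powr p * (2 * \<epsilon>) powr p) * \<Gamma>"
      unfolding \<Gamma> s by (rule boundary_layer_estimate) (use w p \<epsilon> in auto)
    have e1: "1 \<le> \<epsilon> powr (- p)"
      using powr_mono2'[of "-p" \<epsilon> 1] \<epsilon> p by simp
    have e16: "8 powr p * (2 * \<epsilon>) powr p = 16 powr p * \<epsilon> powr p"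
      using \<epsilon> by (simp add: powr_mult[symmetric])
    have ep: "\<epsilon> powr p \<le> 1" using \<epsilon> p powr_mono2[of p \<epsilon> 1] by simp
    have "(\<integral>\<^sup>+x. ennreal (\<bar>w x * cut \<epsilon> x - w x\<bar> powr p) * indicator B1 x \<partial>lborel) \<le> ?W"
    proof (rule nn_integral_mono)
      fix x :: "real ^ 'n"
      show "ennreal (\<bar>w x * cut \<epsilon> x - w x\<bar> powr p) * indicator B1 x \<le> ennreal (\<bar>w x\<bar> powr p) * indicator (shell (2 * \<epsilon>)) x"
      proof (cases "x \<in> shell (2 * \<epsilon>)")
        case True
        have "w x * cut \<epsilon> x - w x = w x * (cut \<epsilon> x - 1)" by (simp add: algebra_simps)
        then have "\<bar>w x * cut \<epsilon> x - w x\<bar> = \<bar>w x\<bar> * \<bar>cut \<epsilon> x - 1\<bar>" by (simp add: abs_mult)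
        also have "\<dots> \<le> \<bar>w x\<bar> * 1" using step_bounds[of "(1 - (norm x)\<^sup>2) * (1 / \<epsilon>)"] by (intro mult_left_mono) (auto simp: cut_def)
        finally have "\<bar>w x * cut \<epsilon> x - w x\<bar> powr p \<le> \<bar>w x\<bar> powr p" using p by (intro powr_mono2) auto
        then show ?thesis using True by (simp add: ennreal_leI)
      next
        case False
        then show ?thesis using cut_interior[of \<epsilon> x] \<epsilon> p by (auto simp: indicator_def)
      qed
    qed
    also note W
    also have "ennreal (2 powr p * (2 * \<epsilon>)) * s + ennreal (8 powr p * (2 * \<epsilon>) powr p) * \<Gamma>
      \<le> ennreal (C0 * \<epsilon> powr (- p)) * s + ennreal C0 * \<Gamma>"
    proof (intro add_mono mult_right_mono ennreal_leI)
      have "2 powr p * (2 * \<epsilon>) \<le> (2 * 2 powr p) * 1" using \<epsilon> by simp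
      also have "\<dots> \<le> C0 * \<epsilon> powr (- p)" using C0a(2) e1 C0 by (intro mult_mono) auto
      finally show "2 powr p * (2 * \<epsilon>) \<le> C0 * \<epsilon> powr (- p)" .
      show "8 powr p * (2 * \<epsilon>) powr p \<le> C0" unfolding e16 by (rule order_trans[OF _ C0a(1)]) (use mult_left_mono[OF ep, of "16 powr p"] in simp)
    qed auto
    also have "\<dots> = ennreal C0 * (\<Gamma> + ennreal (\<epsilon> powr (- p)) * s)"
      using C0 by (simp add: ennreal_mult distrib_left mult.assoc add.commute)
    finally have 1: "(\<integral>\<^sup>+x. ennreal (\<bar>w x * cut \<epsilon> x - w x\<bar> powr p) * indicator B1 x \<partial>lborel) \<le> ennreal C0 * (\<Gamma> + ennreal (\<epsilon> powr (- p)) * s)" .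
    define a where "a = (2 * L / \<epsilon>) powr p"
    have "(\<integral>\<^sup>+x. ennreal (norm (grad (\<lambda>x. w x * cut \<epsilon> x) x - grad w x) powr p) * indicator B1 x \<partial>lborel)
       \<le> (\<integral>\<^sup>+x. ennreal (2 powr p) * (ennreal (norm (grad w x) powr p) * indicator (shell (2 * \<epsilon>)) x)
            + ennreal (2 powr p * a) * (ennreal (\<bar>w x\<bar> powr p) * indicator (shell (2 * \<epsilon>)) x) \<partial>lborel)"
    proof (rule nn_integral_mono)
      fix x :: "real ^ 'n"
      have eq: "grad (\<lambda>x. w x * cut \<epsilon> x) x - grad w x = w x *\<^sub>R grad (cut \<epsilon>) x + (cut \<epsilon> x - 1) *\<^sub>R grad w x"
        by (simp add: grad_mult[OF w smooth_cut] algebra_simps)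
      show "ennreal (norm (grad (\<lambda>x. w x * cut \<epsilon> x) x - grad w x) powr p) * indicator B1 x
         \<le> ennreal (2 powr p) * (ennreal (norm (grad w x) powr p) * indicator (shell (2 * \<epsilon>)) x)
            + ennreal (2 powr p * a) * (ennreal (\<bar>w x\<bar> powr p) * indicator (shell (2 * \<epsilon>)) x)"
      proof (cases "x \<in> shell (2 * \<epsilon>)")
        case True
        have "norm (grad (cut \<epsilon>) x) = \<bar>deriv step ((1 - (norm x)\<^sup>2) * (1 / \<epsilon>))\<bar> * (2 / \<epsilon> * norm x)"
          unfolding grad_cut using \<epsilon> by (simp add: abs_mult)
        also have "\<dots> \<le> L * (2 / \<epsilon> * 1)"
          using True \<epsilon> L by (intro mult_mono mult_left_mono) auto
        finally have "norm (w x *\<^sub>R grad (cut \<epsilon>) x) \<le> (2 * L / \<epsilon>) * \<bar>w x\<bar>"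
          using mult_left_mono[of "norm (grad (cut \<epsilon>) x)" "L * (2 / \<epsilon> * 1)" "\<bar>w x\<bar>"] by (simp add: mult_ac)
        then have b1: "norm (w x *\<^sub>R grad (cut \<epsilon>) x) powr p \<le> a * \<bar>w x\<bar> powr p"
          using p L \<epsilon> powr_mono2[of p "norm (w x *\<^sub>R grad (cut \<epsilon>) x)" "(2 * L / \<epsilon>) * \<bar>w x\<bar>"]
          by (simp only: a_def powr_mult[symmetric]) simp
        have "norm ((cut \<epsilon> x - 1) *\<^sub>R grad w x) \<le> 1 * norm (grad w x)"
          unfolding norm_scaleR using step_bounds[of "(1 - (norm x)\<^sup>2) * (1 / \<epsilon>)"] by (intro mult_right_mono) (auto simp: cut_def)
        then have b2: "norm ((cut \<epsilon> x - 1) *\<^sub>R grad w x) powr p \<le> norm (grad w x) powr p"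
          using p by (intro powr_mono2) auto
        have "norm (grad (\<lambda>x. w x * cut \<epsilon> x) x - grad w x) powr p \<le> 2 powr p * (a * \<bar>w x\<bar> powr p + norm (grad w x) powr p)"
          unfolding eq using powr_norm_add_le[of p "w x *\<^sub>R grad (cut \<epsilon>) x" "(cut \<epsilon> x - 1) *\<^sub>R grad w x"] b1 b2 p
          by (smt (verit) mult_left_mono powr_ge_zero)
        also have "\<dots> = 2 powr p * norm (grad w x) powr p + 2 powr p * a * \<bar>w x\<bar> powr p" by (simp add: algebra_simps)
        finally have "ennreal (norm (grad (\<lambda>x. w x * cut \<epsilon> x) x - grad w x) powr p) \<le> ennreal (2 powr p * norm (grad w x) powr p + 2 powr p * a * \<bar>w x\<bar> powr p)"
          by (rule ennreal_leI)
        also have "\<dots> = ennreal (2 powr p) * ennreal (norm (grad w x) powr p) + ennreal (2 powr p * a) * ennreal (\<bar>w x\<bar> powr p)"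
          by (simp add: a_def ennreal_mult ennreal_plus)
        finally show ?thesis using True by simp
      next
        case False
        then show ?thesis unfolding eq using cut_interior[of \<epsilon> x] \<epsilon> p by (auto simp: indicator_def)
      qed
    qed
    also have "\<dots> = ennreal (2 powr p) * \<Gamma> + ennreal (2 powr p * a) * ?W"
      unfolding \<Gamma> by (subst nn_integral_add) (auto simp: nn_integral_cmult)
    also have "\<dots> \<le> ennreal (2 powr p) * \<Gamma> + ennreal (2 powr p * a) * (ennreal (2 powr p * (2 * \<epsilon>)) * s + ennreal (8 powr p * (2 * \<epsilon>) powr p) * \<Gamma>)"
      by (intro add_left_mono mult_left_mono W) auto
    also have "\<dots> = ennreal (2 powr p + 2 powr p * a * (16 powr p * \<epsilon> powr p)) * \<Gamma> + ennreal (2 powr p * a * (2 powr p * (2 * \<epsilon>))) * s"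
    proof -
      have e: "\<And>P A Q R S :: ennreal. P * A + Q * (R * s + S * A) = (P + Q * S) * A + (Q * R) * s"
        by (simp add: distrib_left distrib_right mult.assoc add_ac)
      have f: "ennreal (2 powr p) + ennreal (2 powr p * a) * ennreal (16 powr p * \<epsilon> powr p)
         = ennreal (2 powr p + 2 powr p * a * (16 powr p * \<epsilon> powr p))"
        "ennreal (2 powr p * a) * ennreal (2 powr p * (2 * \<epsilon>)) = ennreal (2 powr p * a * (2 powr p * (2 * \<epsilon>)))"
        using \<epsilon> by (simp_all add: a_def ennreal_mult[symmetric] ennreal_plus[symmetric] del: ennreal_plus)
      show ?thesis unfolding e16 by (subst e, subst f(1), subst f(2), rule refl)
    qed
    also have "\<dots> \<le> ennreal C0 * \<Gamma> + ennreal (C0 * \<epsilon> powr (- p)) * s"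
    proof (intro add_mono mult_right_mono ennreal_leI)
      have a: "a = (2 * L) powr p * \<epsilon> powr (- p)"
        unfolding a_def using L \<epsilon> by (subst powr_divide) (auto simp: powr_minus_divide)
      \<comment> \<open>The decisive cancellation: the cost \<epsilon>^(-p) of the cutoff gradient
        against the gain \<epsilon>^p of the radial increment.\<close>
      have "a * \<epsilon> powr p = (2 * L) powr p"
        using \<epsilon> by (simp add: a mult.assoc powr_add[symmetric])
      then have "2 powr p + 2 powr p * a * (16 powr p * \<epsilon> powr p) = 2 powr p * (1 + (2 * L) powr p * 16 powr p)"
        by (simp add: algebra_simps)
      then show "2 powr p + 2 powr p * a * (16 powr p * \<epsilon> powr p) \<le> C0" using C0a(3) by simp
      have "2 powr p * a * (2 powr p * (2 * \<epsilon>)) = (2 powr p * (2 * L) powr p * (2 * 2 powr p)) * (\<epsilon> powr (- p)) * \<epsilon>"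
        by (simp add: a)
      also have "\<dots> \<le> (2 powr p * (2 * L) powr p * (2 * 2 powr p)) * (\<epsilon> powr (- p)) * 1"
        using \<epsilon> by (intro mult_left_mono) auto
      also have "\<dots> \<le> C0 * \<epsilon> powr (- p)" using C0a(4) by (simp add: mult_right_mono)
      finally show "2 powr p * a * (2 powr p * (2 * \<epsilon>)) \<le> C0 * \<epsilon> powr (- p)" .
    qed auto
    also have "\<dots> = ennreal C0 * (\<Gamma> + ennreal (\<epsilon> powr (- p)) * s)"
      using C0 by (simp add: ennreal_mult distrib_left mult.assoc)
    finally show ?thesis using 1 by blast
  qed
  show thesis
    by (rule that[OF C0]) (use main in blast)+
qed

lemma nn_integral_lebesgue_on_B1:
  "(\<integral>\<^sup>+x. h x \<partial>lebesgue_on B1) = (\<integral>\<^sup>+x. h x * indicator B1 x \<partial>lborel)"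
  by (simp add: nn_integral_restrict_space nn_integral_completion)

text \<open>A diagonal choice. The cutoff width is fixed first, because the error carries
  \<epsilon>^(-p) times the surface integral; only then is an approximant taken so late that its
  surface integral beats that power. The remaining gradient term tends to zero because the shells
  shrink while the gradients converge in L^p.\<close>

lemma trace_zero_imp_W1p_0:
  fixes w :: "nat \<Rightarrow> real ^ 'n \<Rightarrow> real"
  assumes p: "1 < p" and w: "\<And>k. smooth (w k)"
    and lim: "Lp_tendsto p (lebesgue_on B1) w g" and limG: "Lp_tendsto p (lebesgue_on B1) (\<lambda>k. grad (w k)) G"
    and tr: "(\<lambda>k. \<integral>\<^sup>+x. ennreal (\<bar>w k x\<bar> powr p) \<partial>surface_measure) \<longlonglongrightarrow> 0"
  shows "W1p_0 p g G"
proof -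
  obtain C where C: "C > 0"
    "\<And>\<epsilon> (w :: real ^ 'n \<Rightarrow> real). 0 < \<epsilon> \<Longrightarrow> \<epsilon> \<le> 1/4 \<Longrightarrow> smooth w \<Longrightarrow>
      (\<integral>\<^sup>+x. ennreal (\<bar>w x * cut \<epsilon> x - w x\<bar> powr p) * indicator B1 x \<partial>lborel)
      \<le> ennreal C * ((\<integral>\<^sup>+x. ennreal (norm (grad w x) powr p) * indicator (shell (2 * \<epsilon>)) x \<partial>lborel)
          + ennreal (\<epsilon> powr (- p)) * (\<integral>\<^sup>+x. ennreal (\<bar>w x\<bar> powr p) \<partial>surface_measure))"
    "\<And>\<epsilon> (w :: real ^ 'n \<Rightarrow> real). 0 < \<epsilon> \<Longrightarrow> \<epsilon> \<le> 1/4 \<Longrightarrow> smooth w \<Longrightarrow>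
      (\<integral>\<^sup>+x. ennreal (norm (grad (\<lambda>x. w x * cut \<epsilon> x) x - grad w x) powr p) * indicator B1 x \<partial>lborel)
      \<le> ennreal C * ((\<integral>\<^sup>+x. ennreal (norm (grad w x) powr p) * indicator (shell (2 * \<epsilon>)) x \<partial>lborel)
          + ennreal (\<epsilon> powr (- p)) * (\<integral>\<^sup>+x. ennreal (\<bar>w x\<bar> powr p) \<partial>surface_measure))"
    using cutoff_error[OF p, where ?'n = 'n] by blast
  define \<epsilon> where "\<epsilon> = (\<lambda>m::nat. 1 / (real m + 4))"
  have \<epsilon>: "0 < \<epsilon> m" "\<epsilon> m \<le> 1 / 4" "\<epsilon> m < 1" for m by (auto simp: \<epsilon>_def field_simps)
  let ?M = "lebesgue_on (B1 :: (real ^ 'n) set)"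
  define s where "s = (\<lambda>k. \<integral>\<^sup>+x. ennreal (\<bar>w k x\<bar> powr p) \<partial>surface_measure)"
  define b where "b = (\<lambda>k. LINT x|?M. norm (grad (w k) x - G x) powr p)"
  have b: "b \<longlonglongrightarrow> 0" using limG by (simp add: b_def Lp_tendsto_def)
  define a where "a = (\<lambda>m. LINT x|?M. norm (G x) powr p * indicator (shell (2 * \<epsilon> m)) x)"
  have G: "Lp_fun p ?M G" and Gk: "Lp_fun p ?M (grad (w k))" for k using limG by (auto simp: Lp_tendsto_def)
  note [measurable] = Lp_fun_measurable[OF G] Lp_fun_measurable[OF Gk]
  have sh[measurable]: "shell \<delta> \<in> sets ?M" for \<delta>
    by (auto simp: sets_restrict_space intro!: image_eqI[of _ _ "shell \<delta>"])
  have aint: "integrable ?M (\<lambda>x. norm (G x) powr p * indicator (shell \<delta>) x)" for \<delta>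
    by (rule integrable_mult_indicator[of _ _ "\<lambda>x. norm (G x) powr p", simplified mult.commute[of "indicat_real _ _"] real_scaleR_def])
      (auto intro: Lp_fun_integrable[OF G])
  \<comment> \<open>Dominated convergence: a fixed x in the open ball eventually leaves the
    shrinking shells.\<close>
  have "a \<longlonglongrightarrow> (LINT x|?M. 0)"
    unfolding a_def
  proof (rule integral_dominated_convergence[where w = "\<lambda>x. norm (G x) powr p"])
    show "AE x in ?M. (\<lambda>m. norm (G x) powr p * indicator (shell (2 * \<epsilon> m)) x) \<longlonglongrightarrow> 0"
    proof (rule AE_I2)
      fix x assume "x \<in> space ?M"
      then have x: "norm x < 1" by (simp add: space_restrict_space)
      have "(\<lambda>m. 2 * \<epsilon> m) \<longlonglongrightarrow> 2 * 0"
        using LIMSEQ_ignore_initial_segment[OF LIMSEQ_inverse_real_of_nat, of 3]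
        by (intro tendsto_intros) (simp add: \<epsilon>_def inverse_eq_divide add.commute)
      then have "\<forall>\<^sub>F m in sequentially. 2 * \<epsilon> m < 1 - norm x"
        using order_tendstoD(2)[of "\<lambda>m. 2 * \<epsilon> m" 0 sequentially "1 - norm x"] x by simp
      then have "\<forall>\<^sub>F m in sequentially. norm (G x) powr p * indicator (shell (2 * \<epsilon> m)) x = 0"
        by eventually_elim auto
      then show "(\<lambda>m. norm (G x) powr p * indicator (shell (2 * \<epsilon> m)) x) \<longlonglongrightarrow> 0"
        by (rule tendsto_eventually)
    qed
    show "(\<lambda>x. norm (G x) powr p * indicator (shell (2 * \<epsilon> m)) x) \<in> borel_measurable ?M" for m
      using aint by (rule borel_measurable_integrable)
  qed (use Lp_fun_integrable[OF G] in \<open>auto simp: indicator_def\<close>)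
  then have a: "a \<longlonglongrightarrow> 0" by simp
  have "\<exists>k\<ge>m. b k \<le> 1 / (real m + 1) \<and> ennreal (\<epsilon> m powr (- p)) * s k \<le> ennreal (1 / (real m + 1))" for m
  proof -
    have "\<forall>\<^sub>F k in sequentially. b k < 1 / (real m + 1)" by (rule order_tendstoD(2)[OF b]) auto
    moreover have "(\<lambda>k. ennreal (\<epsilon> m powr (- p)) * s k) \<longlonglongrightarrow> ennreal (\<epsilon> m powr (- p)) * 0"
      using tr unfolding s_def[symmetric] by (intro ennreal_tendsto_cmult) auto
    then have "\<forall>\<^sub>F k in sequentially. ennreal (\<epsilon> m powr (- p)) * s k < ennreal (1 / (real m + 1))"
      by (intro order_tendstoD(2)) auto
    ultimately have "\<forall>\<^sub>F k in sequentially. m \<le> k \<and> b k \<le> 1 / (real m + 1) \<and> ennreal (\<epsilon> m powr (- p)) * s k \<le> ennreal (1 / (real m + 1))"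
      using eventually_ge_at_top[of m] by eventually_elim auto
    then show ?thesis using eventually_happens by fastforce
  qed
  then obtain K where K: "\<And>m. K m \<ge> m" "\<And>m. b (K m) \<le> 1 / (real m + 1)"
     "\<And>m. ennreal (\<epsilon> m powr (- p)) * s (K m) \<le> ennreal (1 / (real m + 1))" by metis
  \<comment> \<open>K is merely chosen with K m \<ge> m; divergence to infinity, rather than
    monotonicity, carries the limits over.\<close>
  have Ktop: "filterlim K at_top sequentially"
    using K(1) by (auto intro: filterlim_at_top_mono[OF filterlim_ident])
  have sub: "Lp_tendsto p ?M (\<lambda>m. h (K m)) h'" if "Lp_tendsto p ?M h h'" for h and h' :: "real ^ 'n \<Rightarrow> 'c::euclidean_space"
    using that filterlim_compose[OF _ Ktop] by (fastforce simp: Lp_tendsto_def)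
  \<comment> \<open>Collects the whole error: the gradient of the approximant on the shell, split
    into its distance from G and the mass of G there, and the weighted surface integral.\<close>
  define c where "c = (\<lambda>m. C * (2 powr p * (1 / (real m + 1) + a m) + 1 / (real m + 1)))"
  have a0: "0 \<le> a m" for m unfolding a_def by (intro integral_nonneg_AE) auto
  have c0: "0 \<le> c m" for m using a0[of m] C by (simp add: c_def)
  have "(\<lambda>m. 1 / (real m + 1)) \<longlonglongrightarrow> 0"
    using LIMSEQ_inverse_real_of_nat by (simp add: inverse_eq_divide add.commute)
  then have "c \<longlonglongrightarrow> C * (2 powr p * (0 + 0) + 0)"
    unfolding c_def by (intro tendsto_intros a)
  then have c: "c \<longlonglongrightarrow> 0" by simp
  have bound: "ennreal C * ((\<integral>\<^sup>+x. ennreal (norm (grad (w (K m)) x) powr p) * indicator (shell (2 * \<epsilon> m)) x \<partial>lborel)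
          + ennreal (\<epsilon> m powr (- p)) * s (K m)) \<le> ennreal (c m)" for m
  proof -
    have "(\<integral>\<^sup>+x. ennreal (norm (grad (w (K m)) x) powr p) * indicator (shell (2 * \<epsilon> m)) x \<partial>lborel)
      = (\<integral>\<^sup>+x. ennreal (norm (grad (w (K m)) x) powr p) * indicator (shell (2 * \<epsilon> m)) x \<partial>?M)"
      unfolding nn_integral_lebesgue_on_B1 by (intro nn_integral_cong) (auto simp: indicator_def)
    also have "\<dots> \<le> (\<integral>\<^sup>+x. ennreal (2 powr p * (norm (grad (w (K m)) x - G x) powr p + norm (G x) powr p * indicator (shell (2 * \<epsilon> m)) x)) \<partial>?M)"
    proof (intro nn_integral_mono)
      fix x
      show "ennreal (norm (grad (w (K m)) x) powr p) * indicator (shell (2 * \<epsilon> m)) x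
         \<le> ennreal (2 powr p * (norm (grad (w (K m)) x - G x) powr p + norm (G x) powr p * indicator (shell (2 * \<epsilon> m)) x))"
        using powr_norm_add_le[of p "grad (w (K m)) x - G x" "G x"] p by (auto simp: indicator_def intro!: ennreal_leI)
    qed
    also have "\<dots> = ennreal (LINT x|?M. 2 powr p * (norm (grad (w (K m)) x - G x) powr p + norm (G x) powr p * indicator (shell (2 * \<epsilon> m)) x))"
      using aint p by (intro nn_integral_eq_integral integrable_mult_right Bochner_Integration.integrable_add Lp_fun_integrable Lp_fun_diff G Gk) auto
    also have "(LINT x|?M. 2 powr p * (norm (grad (w (K m)) x - G x) powr p + norm (G x) powr p * indicator (shell (2 * \<epsilon> m)) x))
       = 2 powr p * (b (K m) + a m)"
      unfolding a_def b_def using aint p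
      by (simp, subst Bochner_Integration.integral_add) (auto intro!: Lp_fun_integrable Lp_fun_diff G Gk)
    also have "ennreal (2 powr p * (b (K m) + a m)) \<le> ennreal (2 powr p * (1 / (real m + 1) + a m))"
      using K(2)[of m] by (intro ennreal_leI mult_left_mono) auto
    finally have "(\<integral>\<^sup>+x. ennreal (norm (grad (w (K m)) x) powr p) * indicator (shell (2 * \<epsilon> m)) x \<partial>lborel) + ennreal (\<epsilon> m powr (- p)) * s (K m)
       \<le> ennreal (2 powr p * (1 / (real m + 1) + a m)) + ennreal (1 / (real m + 1))"
      by (intro add_mono K(3))
    also have "\<dots> = ennreal (2 powr p * (1 / (real m + 1) + a m) + 1 / (real m + 1))"
      using a0[of m] by (intro ennreal_plus[symmetric]) auto
    finally show ?thesis
      unfolding c_def using C a0[of m] by (subst ennreal_mult) (auto intro!: mult_left_mono)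
  qed
  define v where "v = (\<lambda>m x. w (K m) x * cut (\<epsilon> m) x)"
  have vs: "smooth (v m)" for m unfolding v_def by (intro smooth_mult w smooth_cut)
  have conv: "(\<lambda>m. LINT x|?M. norm (h m x) powr p) \<longlonglongrightarrow> 0"
    if h: "\<And>m. Lp_fun p ?M (h m)" and le: "\<And>m. (\<integral>\<^sup>+x. ennreal (norm (h m x) powr p) * indicator B1 x \<partial>lborel) \<le> ennreal (c m)"
    for h :: "nat \<Rightarrow> real ^ 'n \<Rightarrow> 'c::euclidean_space"
  proof (rule Lim_null_comparison[OF always_eventually c], rule allI)
    fix m
    have "ennreal (LINT x|?M. norm (h m x) powr p) = (\<integral>\<^sup>+x. ennreal (norm (h m x) powr p) \<partial>?M)"
      by (rule nn_integral_eq_integral[symmetric]) (use Lp_fun_integrable[OF h] in auto)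
    with le[of m] have "ennreal (LINT x|?M. norm (h m x) powr p) \<le> ennreal (c m)" by (simp add: nn_integral_lebesgue_on_B1)
    then show "norm (LINT x|?M. norm (h m x) powr p) \<le> c m" using c0 by simp
  qed
  show ?thesis
  proof (rule W1p_0_I[OF p])
    show "test_fun B1 (v m)" for m unfolding v_def by (rule test_fun_cut[OF w]) (use \<epsilon> in auto)
    show "Lp_tendsto p ?M v g"
    proof (rule Lp_tendsto_shift[OF sub[OF lim]])
      show "(\<lambda>m. LINT x|?M. norm (v m x - w (K m) x) powr p) \<longlonglongrightarrow> 0"
      proof (rule conv)
        fix m
        show "Lp_fun p ?M (\<lambda>x. v m x - w (K m) x)"
          using p by (intro smooth_Lp_fun(1) smooth_diff vs w) auto
        show "(\<integral>\<^sup>+x. ennreal (norm (v m x - w (K m) x) powr p) * indicator B1 x \<partial>lborel) \<le> ennreal (c m)"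
          using order_trans[OF C(2)[OF \<epsilon>(1,2) w] bound[unfolded s_def]] by (simp add: v_def)
      qed
    qed (use p in \<open>auto intro!: smooth_Lp_fun(1) vs\<close>)
    show "Lp_tendsto p ?M (\<lambda>m. grad (v m)) G"
    proof (rule Lp_tendsto_shift[OF sub[OF limG]])
      show "(\<lambda>m. LINT x|?M. norm (grad (v m) x - grad (w (K m)) x) powr p) \<longlonglongrightarrow> 0"
      proof (rule conv)
        fix m
        show "Lp_fun p ?M (\<lambda>x. grad (v m) x - grad (w (K m)) x)"
          using p by (intro Lp_fun_diff smooth_Lp_fun(2) vs w) auto
        show "(\<integral>\<^sup>+x. ennreal (norm (grad (v m) x - grad (w (K m)) x) powr p) * indicator B1 x \<partial>lborel) \<le> ennreal (c m)"
          using order_trans[OF C(3)[OF \<epsilon>(1,2) w] bound[unfolded s_def]] by (simp add: v_def)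
      qed
    qed (use p in \<open>auto intro!: smooth_Lp_fun(2) vs\<close>)
  qed
qed

text \<open>Because \<open>ramp\<close> is smooth, truncating smooth approximants keeps them smooth.
  On the sphere the truncations tend to \<open>ramp\<close> of h1 - h2 - \<kappa>, which is zero by
  hypothesis, so the criterion for vanishing trace applies.\<close>

lemma ramp_truncation_W1p_0:
  fixes g1 g2 h1 h2 :: "real ^ 'n \<Rightarrow> real"
  assumes p: "1 < p" and tr: "has_trace p g1 G1 h1" "has_trace p g2 G2 h2"
    and le: "AE x in surface_measure. h1 x - h2 x \<le> \<kappa>"
  shows "W1p_0 p (\<lambda>x. ramp (g1 x - g2 x - \<kappa>)) (\<lambda>x. deriv ramp (g1 x - g2 x - \<kappa>) *\<^sub>R (G1 x - G2 x))"
proof -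
  let ?M = "lebesgue_on (B1 :: (real ^ 'n) set)"
  obtain L where L: "L > 0" "\<And>r. \<bar>deriv ramp r\<bar> \<le> L" "\<And>x y. \<bar>ramp x - ramp y\<bar> \<le> L * \<bar>x - y\<bar>"
    using ramp_lipschitz by blast
  obtain w1 where w1: "\<And>k. smooth (w1 k)" "Lp_tendsto p ?M w1 g1" "Lp_tendsto p ?M (\<lambda>k. grad (w1 k)) G1" "Lp_tendsto p surface_measure w1 h1"
    using tr(1) unfolding has_trace_def by blast
  obtain w2 where w2: "\<And>k. smooth (w2 k)" "Lp_tendsto p ?M w2 g2" "Lp_tendsto p ?M (\<lambda>k. grad (w2 k)) G2" "Lp_tendsto p surface_measure w2 h2"
    using tr(2) unfolding has_trace_def by blast
  define d0 D DG where "d0 = (\<lambda>k x. w1 k x - w2 k x)" and "D = (\<lambda>x. g1 x - g2 x)" and "DG = (\<lambda>x. G1 x - G2 x)"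
  have s0: "smooth (d0 k)" for k unfolding d0_def by (intro smooth_diff w1 w2)
  have l0: "Lp_tendsto p ?M d0 D" unfolding d0_def D_def using p by (intro Lp_tendsto_diff w1 w2) auto
  have lg0: "Lp_tendsto p ?M (\<lambda>k. grad (d0 k)) DG"
    unfolding d0_def DG_def using Lp_tendsto_diff[OF w1(3) w2(3)] p by (simp add: grad_diff[OF w1(1) w2(1), abs_def])
  have ls0: "Lp_tendsto p surface_measure d0 (\<lambda>x. h1 x - h2 x)"
    unfolding d0_def using p by (intro Lp_tendsto_diff w1 w2) auto
  \<comment> \<open>The factor \<open>deriv ramp\<close> can be followed to the limit only
    pointwise, hence the passage to an almost everywhere convergent subsequence.\<close>
  obtain r where r: "strict_mono r" "AE x in ?M. (\<lambda>k. d0 (r k) x) \<longlonglongrightarrow> D x"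
    using Lp_tendsto_AE_subseq[OF l0] p by auto
  define d where "d = (\<lambda>k. d0 (r k))"
  have s: "smooth (d k)" for k by (simp add: d_def s0)
  have l: "Lp_tendsto p ?M d D" and lg: "Lp_tendsto p ?M (\<lambda>k. grad (d k)) DG" and ls: "Lp_tendsto p surface_measure d (\<lambda>x. h1 x - h2 x)"
    and ae: "AE x in ?M. (\<lambda>k. d k x) \<longlonglongrightarrow> D x"
    unfolding d_def using Lp_tendsto_subseq[OF l0 r(1)] Lp_tendsto_subseq[OF lg0 r(1)] Lp_tendsto_subseq[OF ls0 r(1)] r(2) by auto
  have Lf: "Lp_fun p ?M D" "Lp_fun p ?M DG" "Lp_fun p ?M (d k)" "Lp_fun p ?M (grad (d k))"
     "Lp_fun p surface_measure (d k)" "Lp_fun p surface_measure (\<lambda>x. h1 x - h2 x)" for k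
    using l lg ls by (auto simp: Lp_tendsto_def)
  note rc = smooth_continuous[OF smooth_ramp, of UNIV]
  note dc = smooth_continuous[OF smooth_deriv(2)[OF smooth_ramp], of UNIV]
  note [measurable] = borel_measurable_continuous_onI[OF rc] borel_measurable_continuous_onI[OF dc]
    Lf[THEN Lp_fun_measurable]
  have shk: "smooth (\<lambda>x. ramp (d k x - \<kappa>))" for k
    by (intro smooth_compose[OF smooth_ramp] smooth_diff s smooth_const)
  have gr: "grad (\<lambda>x. ramp (d k x - \<kappa>)) x = deriv ramp (d k x - \<kappa>) *\<^sub>R grad (d k) x" for k x
    using grad_compose[OF smooth_ramp smooth_diff[OF s smooth_const], of k \<kappa> x]
    by (simp add: grad_diff[OF s smooth_const] grad_eqI[of "\<lambda>x. \<kappa>" 0])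
  show ?thesis
    unfolding D_def[symmetric] 
  proof (rule trace_zero_imp_W1p_0[OF p shk])
    show "Lp_tendsto p ?M (\<lambda>k x. ramp (d k x - \<kappa>)) (\<lambda>x. ramp (g1 x - g2 x - \<kappa>))"
    proof (rule Lp_tendsto_dominated[where h = "\<lambda>x. 1 :: real"])
      show "AE x in ?M. (\<lambda>k. ramp (d k x - \<kappa>)) \<longlonglongrightarrow> ramp (g1 x - g2 x - \<kappa>)"
        using ae unfolding D_def
        by eventually_elim (intro continuous_on_tendsto_compose[OF rc] tendsto_intros, auto)
      show "(\<lambda>x. ramp (g1 x - g2 x - \<kappa>)) \<in> borel_measurable ?M"
        using Lf(1)[THEN Lp_fun_measurable] unfolding D_def by measurable
    qed (use p ramp_nonneg ramp_le_1 finite_measure_B1 in \<open>auto intro: Lp_fun_const\<close>)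
    \<comment> \<open>Two errors are separated: the bounded factor times the gradient error is small
      in L^p, and with the gradient replaced by its limit dominated convergence handles the
      factor.\<close>
    show "Lp_tendsto p ?M (\<lambda>k. grad (\<lambda>x. ramp (d k x - \<kappa>))) (\<lambda>x. deriv ramp (g1 x - g2 x - \<kappa>) *\<^sub>R (G1 x - G2 x))"
      unfolding gr[abs_def] DG_def[symmetric, THEN fun_cong] D_def[symmetric, THEN fun_cong]
    proof (rule Lp_tendsto_shift[where w = "\<lambda>k x. deriv ramp (d k x - \<kappa>) *\<^sub>R DG x"])
      have Lb: "Lp_fun p ?M (\<lambda>x. c x *\<^sub>R h x)" if "Lp_fun p ?M h" "c \<in> borel_measurable ?M" "\<And>x. \<bar>c x\<bar> \<le> L" for c and h :: "real ^ 'n \<Rightarrow> real ^ 'n"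
      proof (rule Lp_fun_dominated[OF Lp_fun_scaleR[OF that(1), of L]])
        show "(\<lambda>x. c x *\<^sub>R h x) \<in> borel_measurable ?M" using that Lp_fun_measurable[OF that(1)] by measurable
        show "AE x in ?M. norm (c x *\<^sub>R h x) \<le> norm (L *\<^sub>R h x)"
          using that(3) L(1) by (intro AE_I2) (simp add: mult_right_mono)
      qed (use p in auto)
      show "Lp_fun p ?M (\<lambda>x. deriv ramp (d k x - \<kappa>) *\<^sub>R grad (d k) x)" for k
        by (intro Lb Lf L) measurable
      show "Lp_tendsto p ?M (\<lambda>k x. deriv ramp (d k x - \<kappa>) *\<^sub>R DG x) (\<lambda>x. deriv ramp (D x - \<kappa>) *\<^sub>R DG x)"
      proof (rule Lp_tendsto_dominated[where h = "\<lambda>x. L *\<^sub>R DG x"])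
        show "AE x in ?M. (\<lambda>k. deriv ramp (d k x - \<kappa>) *\<^sub>R DG x) \<longlonglongrightarrow> deriv ramp (D x - \<kappa>) *\<^sub>R DG x"
          using ae by eventually_elim (intro tendsto_scaleR continuous_on_tendsto_compose[OF dc] tendsto_intros, auto)
        show "AE x in ?M. norm (deriv ramp (d k x - \<kappa>) *\<^sub>R DG x) \<le> norm (L *\<^sub>R DG x)" for k
          using L by (intro AE_I2) (simp add: mult_right_mono)
        show "Lp_fun p ?M (\<lambda>x. L *\<^sub>R DG x)" using Lf p by (intro Lp_fun_scaleR) auto
      qed (use p in auto)
      have le': "norm (deriv ramp (d k x - \<kappa>) *\<^sub>R grad (d k) x - deriv ramp (d k x - \<kappa>) *\<^sub>R DG x) powr p \<le> L powr p * norm (grad (d k) x - DG x) powr p" for k x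
      proof -
        have "norm (deriv ramp (d k x - \<kappa>) *\<^sub>R grad (d k) x - deriv ramp (d k x - \<kappa>) *\<^sub>R DG x) \<le> L * norm (grad (d k) x - DG x)"
          using L(2)[of "d k x - \<kappa>"] by (simp add: mult_right_mono flip: scaleR_diff_right)
        then show ?thesis using p L powr_mono2 by (fastforce simp: powr_mult[symmetric])
      qed
      have z: "(\<lambda>k. L powr p * (LINT x|?M. norm (grad (d k) x - DG x) powr p)) \<longlonglongrightarrow> 0"
        using lg by (auto intro!: tendsto_eq_intros simp: Lp_tendsto_def)
      show "(\<lambda>k. LINT x|?M. norm (deriv ramp (d k x - \<kappa>) *\<^sub>R grad (d k) x - deriv ramp (d k x - \<kappa>) *\<^sub>R DG x) powr p) \<longlonglongrightarrow> 0"
      proof (rule Lim_null_comparison[OF always_eventually z], rule allI)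
        fix k
        have "(LINT x|?M. norm (deriv ramp (d k x - \<kappa>) *\<^sub>R grad (d k) x - deriv ramp (d k x - \<kappa>) *\<^sub>R DG x) powr p)
          \<le> (LINT x|?M. L powr p * norm (grad (d k) x - DG x) powr p)"
          by (intro integral_mono le' Lp_fun_integrable Lp_fun_diff Lb Lf L integrable_mult_right) (use p in auto)
        then show "norm (LINT x|?M. norm (deriv ramp (d k x - \<kappa>) *\<^sub>R grad (d k) x - deriv ramp (d k x - \<kappa>) *\<^sub>R DG x) powr p)
          \<le> L powr p * (LINT x|?M. norm (grad (d k) x - DG x) powr p)" by simp
      qed
    qed (use p in auto)
    show "(\<lambda>k. \<integral>\<^sup>+x. ennreal (\<bar>ramp (d k x - \<kappa>)\<bar> powr p) \<partial>surface_measure) \<longlonglongrightarrow> 0"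
    proof (rule tendsto_sandwich[OF always_eventually always_eventually tendsto_const], rule allI, simp, rule allI)
      fix k
      have "AE x in surface_measure. \<bar>ramp (d k x - \<kappa>)\<bar> powr p \<le> L powr p * norm (d k x - (h1 x - h2 x)) powr p"
        using le
      proof eventually_elim
        case (elim x)
        \<comment> \<open>\<open>ramp\<close> vanishes at h1 x - h2 x - \<kappa>, so its Lipschitz
          bound measures the distance of the truncation from zero.\<close>
        then have "\<bar>ramp (d k x - \<kappa>)\<bar> \<le> L * \<bar>d k x - (h1 x - h2 x)\<bar>"
          using L(3)[of "d k x - \<kappa>" "h1 x - h2 x - \<kappa>"] by (simp add: algebra_simps)
        then show ?case using p L powr_mono2 by (fastforce simp: powr_mult[symmetric])
      qed
      then have "(\<integral>\<^sup>+x. ennreal (\<bar>ramp (d k x - \<kappa>)\<bar> powr p) \<partial>surface_measure)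
         \<le> (\<integral>\<^sup>+x. ennreal (L powr p * norm (d k x - (h1 x - h2 x)) powr p) \<partial>surface_measure)"
        by (intro nn_integral_mono_AE) (auto elim!: eventually_mono intro: ennreal_leI)
      also have "\<dots> = ennreal (LINT x|surface_measure. L powr p * norm (d k x - (h1 x - h2 x)) powr p)"
        using p by (intro nn_integral_eq_integral integrable_mult_right Lp_fun_integrable Lp_fun_diff Lf) auto
      finally show "(\<integral>\<^sup>+x. ennreal (\<bar>ramp (d k x - \<kappa>)\<bar> powr p) \<partial>surface_measure)
         \<le> ennreal (L powr p * (LINT x|surface_measure. norm (d k x - (h1 x - h2 x)) powr p))" by simp
    next
      have "(\<lambda>k. L powr p * (LINT x|surface_measure. norm (d k x - (h1 x - h2 x)) powr p)) \<longlonglongrightarrow> L powr p * 0"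
        using ls by (intro tendsto_intros) (auto simp: Lp_tendsto_def)
      then show "(\<lambda>k. ennreal (L powr p * (LINT x|surface_measure. norm (d k x - (h1 x - h2 x)) powr p))) \<longlonglongrightarrow> 0"
        using tendsto_ennrealI by fastforce
    qed
  qed
qed

section \<open>Lebesgue measure on a product\<close>

text \<open>Slicing and Fubini are used for \<open>lborel\<close>, which is a product measure;
  \<open>lebesgue\<close> on a product is a completion, whose functions have measurable slices only
  almost everywhere. Borel representatives bridge the two. They are found coordinate by
  coordinate.\<close>

lemma lebesgue_borel_rep:
  fixes f :: "'a::euclidean_space \<Rightarrow> 'b::euclidean_space"
  assumes f: "f \<in> borel_measurable lebesgue"
  obtains g where "g \<in> borel_measurable borel" "AE x in lborel. f x = g x"
proof -
  have "\<exists>g\<in>borel_measurable lborel. AE x in lborel. f x \<bullet> i = g x" for i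
    by (rule completion_ex_borel_measurable_real) (use f in measurable)
  then obtain G where G: "\<And>i. G i \<in> borel_measurable lborel" "\<And>i. AE x in lborel. f x \<bullet> i = (G i x :: real)" by metis
  show thesis
  proof (rule that[of "\<lambda>x. \<Sum>i\<in>Basis. G i x *\<^sub>R i"])
    have [measurable]: "G i \<in> borel_measurable borel" for i using G(1)[of i] by simp
    show "(\<lambda>x. \<Sum>i\<in>Basis. G i x *\<^sub>R i) \<in> borel_measurable borel" by measurable
    have "AE x in lborel. \<forall>i\<in>Basis. f x \<bullet> i = G i x" by (rule AE_finite_allI) (auto intro: G)
    then show "AE x in lborel. f x = (\<Sum>i\<in>Basis. G i x *\<^sub>R i)"
    proof eventually_elim
      case (elim x)
      have "f x = (\<Sum>i\<in>Basis. (f x \<bullet> i) *\<^sub>R i)" by (simp add: euclidean_representation)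
      also have "\<dots> = (\<Sum>i\<in>Basis. G i x *\<^sub>R i)" using elim by (intro sum.cong) auto
      finally show ?case .
    qed
  qed
qed

lemma lebesgue_measurable_of_AE_borel:
  fixes f g :: "'a::euclidean_space \<Rightarrow> 'b::euclidean_space"
  assumes "g \<in> borel_measurable borel" "AE x in lborel. f x = g x"
  shows "f \<in> borel_measurable lebesgue"
proof (rule borel_measurable_AE)
  show "g \<in> borel_measurable lebesgue" using assms(1) by (intro measurable_completion) simp
  show "AE x in lebesgue. g x = f x" using AE_completion[OF assms(2)] by (simp add: eq_commute)
qed

lemma AE_lborel_slice:
  assumes "AE z in (lborel :: (real \<times> 'b::euclidean_space) measure). P z"
  shows "AE t in lborel. AE x in lborel. P (t, x)"
  using assms unfolding lborel_prod[symmetric] by (rule lborel_pair.AE_pair)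

text \<open>The cylinder over a null set is null. This lifts facts about a frozen time slice to
  space-time.\<close>

lemma AE_lborel_snd:
  assumes "AE x in (lborel :: 'b::euclidean_space measure). P x"
  shows "AE z in (lborel :: (real \<times> 'b) measure). P (snd z)"
proof -
  obtain N where N: "{x. \<not> P x} \<subseteq> N" "N \<in> sets borel" "emeasure lborel N = 0"
    using assms by (auto elim!: AE_E)
  have "emeasure (lborel \<Otimes>\<^sub>M lborel) ((UNIV :: real set) \<times> N) = 0"
    using N by (subst lborel.emeasure_pair_measure_Times) auto
  then have "emeasure lborel ((UNIV :: real set) \<times> N) = 0" by (simp add: lborel_prod)
  moreover have "(UNIV :: real set) \<times> N \<in> sets lborel"
    using N(2) by (simp add: borel_prod[symmetric])
  ultimately show ?thesis using N(1) by (intro AE_I[of _ _ "UNIV \<times> N"]) auto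
qed

lemma nn_integral_lborel_slices:
  fixes f :: "real \<times> 'b::euclidean_space \<Rightarrow> ennreal"
  assumes "f \<in> borel_measurable borel"
  shows "(\<integral>\<^sup>+z. f z \<partial>lborel) = (\<integral>\<^sup>+t. \<integral>\<^sup>+x. f (t, x) \<partial>lborel \<partial>lborel)"
  using lborel.nn_integral_fst[of f lborel] assms by (simp add: lborel_prod)

text \<open>Moves integrability to nonnegative integrals over \<open>lborel\<close>, where Tonelli
  can be applied; measurability is expressed for the extension by zero.\<close>

lemma Lp_fun_lebesgue_on_iff:
  fixes g :: "'a::euclidean_space \<Rightarrow> 'b::euclidean_space"
  assumes "S \<in> sets lebesgue"
  shows "Lp_fun q (lebesgue_on S) g \<longleftrightarrow>
    (\<lambda>x. indicator S x *\<^sub>R g x) \<in> borel_measurable lebesgue \<and> (\<integral>\<^sup>+x. ennreal (norm (g x) powr q) * indicator S x \<partial>lborel) < \<infinity>"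
proof -
  have m: "g \<in> borel_measurable (lebesgue_on S) \<longleftrightarrow> (\<lambda>x. indicator S x *\<^sub>R g x) \<in> borel_measurable lebesgue"
    using assms by (simp add: borel_measurable_restrict_space_iff)
  have "(\<integral>\<^sup>+x. ennreal (norm (g x) powr q) \<partial>lebesgue_on S) = (\<integral>\<^sup>+x. ennreal (norm (g x) powr q) * indicator S x \<partial>lborel)"
    using assms by (simp add: nn_integral_restrict_space nn_integral_completion)
  moreover have "integrable (lebesgue_on S) (\<lambda>x. norm (g x) powr q) \<longleftrightarrow> (\<integral>\<^sup>+x. ennreal (norm (g x) powr q) \<partial>lebesgue_on S) < \<infinity>"
    if "g \<in> borel_measurable (lebesgue_on S)"
    using that by (simp add: integrable_iff_bounded)
  ultimately show ?thesis unfolding Lp_fun_def m[symmetric] by auto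
qed

lemma Lp_fun_snd:
  fixes \<psi> :: "real ^ 'n \<Rightarrow> 'b::euclidean_space"
  assumes \<psi>: "Lp_fun q (lebesgue_on B1) \<psi>"
  shows "Lp_fun q (lebesgue_on ({a<..<b::real} \<times> B1)) (\<lambda>z. \<psi> (snd z))"
proof -
  let ?\<psi> = "\<lambda>x. indicator B1 x *\<^sub>R \<psi> x"
  have \<psi>m: "?\<psi> \<in> borel_measurable lebesgue" and fin: "(\<integral>\<^sup>+x. ennreal (norm (\<psi> x) powr q) * indicator B1 x \<partial>lborel) < \<infinity>"
    using \<psi> by (auto simp: Lp_fun_lebesgue_on_iff)
  obtain g where g[measurable]: "g \<in> borel_measurable borel" and ae: "AE x in lborel. ?\<psi> x = g x"
    using lebesgue_borel_rep[OF \<psi>m] by blast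
  have [measurable]: "{a<..<b} \<times> (B1 :: (real ^ 'n) set) \<in> sets borel" "B1 \<in> sets (borel :: (real ^ 'n) measure)"
    by (auto simp: borel_prod[symmetric])
  have [measurable]: "(\<lambda>z :: real \<times> (real ^ 'n). g (snd z)) \<in> borel_measurable borel"
    by (intro measurable_compose[OF _ g] borel_measurable_continuous_onI continuous_intros)
  note ae2 = AE_lborel_snd[OF ae]
  have "(\<lambda>z. indicator ({a<..<b} \<times> B1) z *\<^sub>R \<psi> (snd z)) \<in> borel_measurable lebesgue"
  proof (rule lebesgue_measurable_of_AE_borel)
    show "(\<lambda>z. indicator ({a<..<b} \<times> B1) z *\<^sub>R g (snd z)) \<in> borel_measurable borel"
      by measurable
    show "AE z in lborel. indicator ({a<..<b} \<times> B1) z *\<^sub>R \<psi> (snd z) = indicator ({a<..<b} \<times> B1) z *\<^sub>R g (snd z)"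
      using ae2 by eventually_elim (auto simp: indicator_def split: if_splits)
  qed
  moreover have "(\<integral>\<^sup>+z. ennreal (norm (\<psi> (snd z)) powr q) * indicator ({a<..<b} \<times> B1) z \<partial>lborel) < \<infinity>"
  proof -
    have "(\<integral>\<^sup>+z. ennreal (norm (\<psi> (snd z)) powr q) * indicator ({a<..<b} \<times> B1) z \<partial>lborel)
       = (\<integral>\<^sup>+z. ennreal (norm (g (snd z)) powr q) * indicator ({a<..<b} \<times> B1) z \<partial>lborel)"
      by (rule nn_integral_cong_AE, use ae2 in eventually_elim) (auto simp: indicator_def split: if_splits)
    also have "\<dots> = (\<integral>\<^sup>+t. \<integral>\<^sup>+x. ennreal (norm (g x) powr q) * indicator ({a<..<b} \<times> B1) (t, x) \<partial>lborel \<partial>lborel)"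
      by (subst nn_integral_lborel_slices) auto
    also have "\<dots> = (\<integral>\<^sup>+t. (\<integral>\<^sup>+x. ennreal (norm (g x) powr q) * indicator B1 x \<partial>lborel) * indicator {a<..<b} t \<partial>lborel)"
      by (intro nn_integral_cong) (auto simp: indicator_def intro!: nn_integral_cong)
    also have "\<dots> = (\<integral>\<^sup>+x. ennreal (norm (g x) powr q) * indicator B1 x \<partial>lborel) * emeasure lborel {a<..<b}"
      by (subst nn_integral_cmult_indicator) auto
    also have "(\<integral>\<^sup>+x. ennreal (norm (g x) powr q) * indicator B1 x \<partial>lborel) = (\<integral>\<^sup>+x. ennreal (norm (\<psi> x) powr q) * indicator B1 x \<partial>lborel)"
      by (rule nn_integral_cong_AE, use ae in eventually_elim) (auto simp: indicator_def split: if_splits)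
    also have "\<dots> * emeasure lborel {a<..<b} < \<infinity>"
      using fin by (cases "a \<le> b") (auto simp: ennreal_mult_less_top)
    finally show ?thesis .
  qed
  ultimately show ?thesis by (simp add: Lp_fun_lebesgue_on_iff)
qed

section \<open>Mean continuity in time\<close>

text \<open>Values are first truncated at height N. The truncation is an almost everywhere limit of
  continuous functions, and projecting those onto the ball of radius N keeps them continuous and
  makes them uniformly bounded, so dominated convergence gives closeness in L^p.\<close>

lemma Lp_continuous_approximation:
  fixes V :: "'a::euclidean_space \<Rightarrow> 'b::euclidean_space"
  assumes V: "Lp_fun p (lebesgue_on Q) V" and p: "1 < p" and Q: "Q \<in> lmeasurable" and e: "0 < e"
  obtains C where "continuous_on UNIV C" "Lp_fun p (lebesgue_on Q) C" "(LINT z|lebesgue_on Q. norm (V z - C z) powr p) < e"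
proof -
  let ?M = "lebesgue_on Q"
  have Qs: "Q \<in> sets lebesgue" using Q by blast
  note fin = finite_measure_lebesgue_on[OF Q]
  note [measurable] = Lp_fun_measurable[OF V]
  define U where "U = (\<lambda>N::nat. \<lambda>z. if norm (V z) \<le> real N then V z else 0)"
  have Um[measurable]: "U N \<in> borel_measurable ?M" for N unfolding U_def by measurable
  have Ulim: "Lp_tendsto p ?M U V"
  proof (rule Lp_tendsto_dominated[OF _ Um _ V])
    show "AE z in ?M. (\<lambda>N. U N z) \<longlonglongrightarrow> V z"
    proof (intro AE_I2 tendsto_eventually)
      fix z
      obtain N0 :: nat where "norm (V z) \<le> real N0" using real_arch_simple by blast
      then have "\<forall>N\<ge>N0. U N z = V z" unfolding U_def by auto
      then show "\<forall>\<^sub>F N in sequentially. U N z = V z" by (auto simp: eventually_sequentially)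
    qed
  qed (use p in \<open>auto simp: U_def\<close>)
  then have "(\<lambda>N. LINT z|?M. norm (U N z - V z) powr p) \<longlonglongrightarrow> 0" by (simp add: Lp_tendsto_def)
  \<comment> \<open>The two approximations are joined by \<open>powr_norm_add_le\<close> at the
    price 2^p, and 2^p (e' + e') = e.\<close>
  define e' where "e' = e / (2 powr p * 2)"
  have e': "e' > 0" using e by (simp add: e'_def)
  have "\<forall>\<^sub>F N in sequentially. (LINT z|?M. norm (U N z - V z) powr p) < e'"
    by (rule order_tendstoD(2)[OF \<open>(\<lambda>N. LINT z|?M. norm (U N z - V z) powr p) \<longlonglongrightarrow> 0\<close> e'])
  then obtain N where N: "(LINT z|?M. norm (U N z - V z) powr p) < e'" using eventually_happens by fastforce
  have "U N measurable_on Q" using Um[of N] Qs by (simp add: measurable_on_iff_borel_measurable)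
  then obtain E g where E: "negligible E" "\<And>n. continuous_on UNIV (g n)"
    "\<And>x. x \<notin> E \<Longrightarrow> (\<lambda>n. g n x) \<longlonglongrightarrow> (if x \<in> Q then U N x else 0)"
    unfolding measurable_on_def by (metis)
  let ?c = "closest_point (cball (0::'b) (real N))"
  have cc: "continuous_on S ?c" for S by (rule continuous_on_closest_point) auto
  have cb: "norm (?c y) \<le> real N" for y
    using closest_point_in_set[of "cball (0::'b) (real N)" y] by auto
  have Lb: "Lp_fun p ?M (\<lambda>z. real N)" by (rule Lp_fun_const[OF fin])
  have cont: "continuous_on UNIV (\<lambda>z. ?c (g n z))" for n
    by (rule continuous_on_compose2[OF cc E(2)]) auto
  have cm: "(\<lambda>z. ?c (g n z)) \<in> borel_measurable ?M" for n
    using cont[of n] by (intro measurable_restrict_space1 measurable_completion) (simp add: borel_measurable_continuous_onI)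
  have "Lp_tendsto p ?M (\<lambda>n z. ?c (g n z)) (U N)"
  proof (rule Lp_tendsto_dominated[OF _ cm Um Lb])
    have "E \<in> null_sets lebesgue" using E(1) by (simp add: negligible_iff_null_sets)
    then have "AE z in lebesgue. z \<notin> E" by (rule AE_not_in)
    then have "AE z in lebesgue. z \<in> Q \<longrightarrow> (\<lambda>n. ?c (g n z)) \<longlonglongrightarrow> U N z"
    proof eventually_elim
      case (elim z)
      show ?case
      proof
        assume "z \<in> Q"
        then have "(\<lambda>n. g n z) \<longlonglongrightarrow> U N z" using E(3)[OF elim] by simp
        then have "(\<lambda>n. ?c (g n z)) \<longlonglongrightarrow> ?c (U N z)"
          by (rule continuous_on_tendsto_compose[OF cc[of UNIV]]) auto
        moreover have "?c (U N z) = U N z" by (rule closest_point_self) (simp add: U_def)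
        ultimately show "(\<lambda>n. ?c (g n z)) \<longlonglongrightarrow> U N z" by simp
      qed
    qed
    then show "AE z in ?M. (\<lambda>n. ?c (g n z)) \<longlonglongrightarrow> U N z" using Qs by (simp add: AE_lebesgue_on_iff)
  qed (use p cb in auto)
  then have "(\<lambda>n. LINT z|?M. norm (?c (g n z) - U N z) powr p) \<longlonglongrightarrow> 0" by (simp add: Lp_tendsto_def)
  then have "\<forall>\<^sub>F n in sequentially. (LINT z|?M. norm (?c (g n z) - U N z) powr p) < e'"
    using e' by (rule order_tendstoD(2))
  then obtain n where n: "(LINT z|?M. norm (?c (g n z) - U N z) powr p) < e'" using eventually_happens by fastforce
  have LU: "Lp_fun p ?M (U N)" using Ulim by (simp add: Lp_tendsto_def)
  have LC: "Lp_fun p ?M (\<lambda>z. ?c (g n z))"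
    by (rule Lp_fun_dominated[OF Lb cm]) (use cb p in auto)
  have i: "integrable ?M (\<lambda>z. norm (?c (g n z) - U N z) powr p)" "integrable ?M (\<lambda>z. norm (U N z - V z) powr p)"
    "integrable ?M (\<lambda>z. norm (V z - ?c (g n z)) powr p)"
    using p by (auto intro!: Lp_fun_integrable Lp_fun_diff LU LC V)
  have "(LINT z|?M. norm (V z - ?c (g n z)) powr p)
     \<le> (LINT z|?M. 2 powr p * (norm (?c (g n z) - U N z) powr p + norm (U N z - V z) powr p))"
  proof (rule integral_mono)
    show "norm (V z - ?c (g n z)) powr p \<le> 2 powr p * (norm (?c (g n z) - U N z) powr p + norm (U N z - V z) powr p)" for z
      using powr_norm_add_le[of p "?c (g n z) - U N z" "U N z - V z"] p by (simp add: norm_minus_commute)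
  qed (use i in auto)
  also have "\<dots> = 2 powr p * ((LINT z|?M. norm (?c (g n z) - U N z) powr p) + (LINT z|?M. norm (U N z - V z) powr p))"
    using i by simp
  also have "\<dots> < 2 powr p * (e' + e')" using n N by (intro mult_strict_left_mono) auto
  also have "\<dots> = e" by (simp add: e'_def)
  finally show thesis using that[OF cont LC] by blast
qed

text \<open>Three terms for each pair of times: the errors of a continuous approximation C at s and
  at t, and the oscillation of C. Integration over a window of length h contributes the factor h to
  each, which is the order at which energy increments over steps of length h must be
  controlled.\<close>

lemma Lp_mean_continuity:
  fixes V :: "real \<times> (real ^ 'n) \<Rightarrow> real ^ 'n"
  assumes V[measurable]: "V \<in> borel_measurable borel"
    and L: "Lp_fun p (lebesgue_on ({a<..<b} \<times> B1)) V" and p: "1 < p" and e: "0 < e" and ab: "a < b"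
  obtains h0 where "h0 > 0" "\<And>h. 0 < h \<Longrightarrow> h < h0 \<Longrightarrow>
    (\<integral>\<^sup>+t. \<integral>\<^sup>+s. \<integral>\<^sup>+x. ennreal (norm (V (s, x) - V (t, x)) powr p) * indicator B1 x
        * indicator {max a (t - h)<..<t} s * indicator {a<..<b} t \<partial>lborel \<partial>lborel \<partial>lborel) \<le> ennreal (e * h)"
proof -
  let ?Q = "{a<..<b} \<times> (B1 :: (real ^ 'n) set)"
  define m where "m = measure lborel (B1 :: (real ^ 'n) set)"
  have m0: "m \<ge> 0" by (simp add: m_def)
  have em: "emeasure lborel (B1 :: (real ^ 'n) set) = ennreal m"
    unfolding m_def using emeasure_lborel_ball_finite[of "0::real^'n" 1] by (intro emeasure_eq_ennreal_measure) auto
  \<comment> \<open>4^p comes from splitting three terms by two applications of the 2^p inequality;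
    the 3 in \<open>e1\<close> shares e among the three terms.\<close>
  define K where "K = (4::real) powr p"
  have K: "K > 0" by (simp add: K_def)
  define e1 where "e1 = e / (3 * K)"
  have e1: "e1 > 0" using e K by (simp add: e1_def)
  obtain C where C: "continuous_on UNIV C" "Lp_fun p (lebesgue_on ?Q) C" "(LINT z|lebesgue_on ?Q. norm (V z - C z) powr p) < e1"
    using Lp_continuous_approximation[OF L p _ e1] by auto
  have [measurable]: "C \<in> borel_measurable borel" using C(1) by (rule borel_measurable_continuous_onI)
  have [measurable]: "B1 \<in> sets (borel :: (real ^ 'n) measure)" by auto
  have [measurable]: "?Q \<in> sets borel" by (simp add: borel_prod[symmetric])
  define k where "k = (\<lambda>t. \<integral>\<^sup>+x. ennreal (norm (V (t, x) - C (t, x)) powr p) * indicator B1 x \<partial>lborel)"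
  have [measurable]: "k \<in> borel_measurable borel" unfolding k_def by measurable
  have kint: "(\<integral>\<^sup>+t. k t * indicator {a<..<b} t \<partial>lborel) \<le> ennreal e1"
  proof -
    have "(\<integral>\<^sup>+t. k t * indicator {a<..<b} t \<partial>lborel)
      = (\<integral>\<^sup>+t. \<integral>\<^sup>+x. ennreal (norm (V (t, x) - C (t, x)) powr p) * indicator ?Q (t, x) \<partial>lborel \<partial>lborel)"
      unfolding k_def by (intro nn_integral_cong) (auto simp: indicator_def intro!: nn_integral_cong)
    also have "\<dots> = (\<integral>\<^sup>+z. ennreal (norm (V z - C z) powr p) * indicator ?Q z \<partial>lborel)"
      by (subst nn_integral_lborel_slices) auto
    also have "\<dots> = (\<integral>\<^sup>+z. ennreal (norm (V z - C z) powr p) \<partial>lebesgue_on ?Q)"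
      by (simp add: nn_integral_restrict_space nn_integral_completion)
    also have "\<dots> = ennreal (LINT z|lebesgue_on ?Q. norm (V z - C z) powr p)"
      using p by (intro nn_integral_eq_integral Lp_fun_integrable Lp_fun_diff L C) auto
    finally show ?thesis using C(3) by (simp add: ennreal_leI)
  qed
  \<comment> \<open>An oscillation whose p-th power is \<eta> contributes at most \<open>e1\<close>
    when integrated over the slab; m + 1 replaces m to avoid division by zero.\<close>
  define \<eta> where "\<eta> = e1 / ((b - a) * (m + 1))"
  have \<eta>: "\<eta> > 0" "\<eta> * (b - a) * m \<le> e1"
  proof -
    show "\<eta> > 0" using e1 ab m0 by (auto simp: \<eta>_def intro!: divide_pos_pos mult_pos_pos add_nonneg_pos)
    have "\<eta> * (b - a) * m = e1 * (m / (m + 1))" using ab m0 by (simp add: \<eta>_def)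
    also have "\<dots> \<le> e1 * 1" using e1 m0 by (intro mult_left_mono) auto
    finally show "\<eta> * (b - a) * m \<le> e1" by simp
  qed
  have "uniformly_continuous_on ({a..b} \<times> cball 0 1) C"
    by (rule compact_uniformly_continuous[OF continuous_on_subset[OF C(1)]]) (auto intro: compact_Times)
  moreover have "\<eta> powr (1 / p) > 0" using \<eta> by simp
  ultimately obtain h0 where h0: "h0 > 0" "\<And>y z. y \<in> {a..b} \<times> cball 0 1 \<Longrightarrow> z \<in> {a..b} \<times> cball 0 1 \<Longrightarrow> dist z y < h0 \<Longrightarrow> dist (C z) (C y) < \<eta> powr (1 / p)"
    unfolding uniformly_continuous_on_def by metis
  show thesis
  proof (rule that[OF h0(1)])
    fix h :: real assume h: "0 < h" "h < h0"
    let ?I = "\<lambda>t s. indicator {max a (t - h)<..<t} s * indicator {a<..<b} t :: ennreal"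
    \<comment> \<open>Conditions on t, s and t - s replace the moving endpoints of the window, which
      exhibits joint measurability.\<close>
    let ?J = "\<lambda>t s. indicator {t. t < b} t * (indicator {t. a < t} s * (indicator {t. t < h} (t - s) * indicator {t. 0 < t} (t - s))) :: ennreal"
    have IJ: "?I t s = ?J t s" for t s by (auto simp: indicator_def)
    have [measurable]: "(\<lambda>x. ?I (f x) (g x)) \<in> borel_measurable M" if [measurable]: "f \<in> borel_measurable M" "g \<in> borel_measurable M" for M :: "'z measure" and f g
      unfolding IJ by measurable
    have pt: "ennreal (norm (V (s, x) - V (t, x)) powr p) * indicator B1 x * indicator {max a (t - h)<..<t} s * indicator {a<..<b} t
      \<le> ennreal K * (ennreal (norm (V (s, x) - C (s, x)) powr p) * indicator B1 x * ?I t s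
           + ennreal (norm (V (t, x) - C (t, x)) powr p) * indicator B1 x * ?I t s + ennreal \<eta> * indicator B1 x * ?I t s)" for t s x
    proof (cases "x \<in> B1 \<and> a < s \<and> t - h < s \<and> s < t \<and> t < b")
      case True
      define A B D where "A = V (s, x) - C (s, x)" and "B = V (t, x) - C (t, x)" and "D = C (s, x) - C (t, x)"
      have "dist (C (s, x)) (C (t, x)) < \<eta> powr (1 / p)"
        using True h by (intro h0(2)) (auto simp: dist_Pair_Pair dist_real_def)
      then have D: "norm D powr p \<le> \<eta>"
        using powr_mono2[of p "norm D" "\<eta> powr (1 / p)"] p \<eta> by (simp add: D_def dist_norm powr_powr)
      have "norm (V (s, x) - V (t, x)) powr p = norm (D + (A - B)) powr p" by (simp add: A_def B_def D_def algebra_simps)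
      also have "\<dots> \<le> 2 powr p * (norm D powr p + norm (A - B) powr p)" using p by (intro powr_norm_add_le) auto
      also have "\<dots> \<le> 2 powr p * (norm D powr p + 2 powr p * (norm A powr p + norm B powr p))"
        using p powr_norm_diff_le[of p A B] by (intro mult_left_mono add_left_mono) auto
      also have "\<dots> \<le> 2 powr p * (2 powr p * norm D powr p + 2 powr p * (norm A powr p + norm B powr p))"
        using p ge_one_powr_ge_zero[of 2 p] mult_right_mono[of 1 "2 powr p" "norm D powr p"] by (intro mult_left_mono add_right_mono) auto
      also have "\<dots> = K * (norm A powr p + norm B powr p + norm D powr p)"
        using powr_mult[of 2 2 p] by (simp add: K_def algebra_simps)
      also have "\<dots> \<le> K * (norm A powr p + norm B powr p + \<eta>)" using D K by (intro mult_left_mono) auto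
      finally have "ennreal (norm (V (s, x) - V (t, x)) powr p) \<le> ennreal (K * (norm A powr p + norm B powr p + \<eta>))" by (rule ennreal_leI)
      also have "\<dots> = ennreal K * (ennreal (norm A powr p) + ennreal (norm B powr p) + ennreal \<eta>)"
        using K \<eta> by (simp add: ennreal_mult ennreal_plus)
      finally show ?thesis using True by (simp add: A_def B_def)
    qed (auto simp: indicator_def)
    have hI: "(\<integral>\<^sup>+s. ?I t s \<partial>lborel) \<le> ennreal h * indicator {a<..<b} t" for t
    proof -
      have "(\<integral>\<^sup>+s. ?I t s \<partial>lborel) \<le> (\<integral>\<^sup>+s. indicator {t - h<..<t} s \<partial>lborel) * indicator {a<..<b} t"
        by (subst nn_integral_multc[symmetric], simp) (intro nn_integral_mono, auto simp: indicator_def)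
      also have "\<dots> = ennreal h * indicator {a<..<b} t" using h by simp
      finally show ?thesis .
    qed
    have hI': "(\<integral>\<^sup>+t. ?I t s \<partial>lborel) \<le> ennreal h * indicator {a<..<b} s" for s
    proof -
      have "(\<integral>\<^sup>+t. ?I t s \<partial>lborel) \<le> (\<integral>\<^sup>+t. indicator {s<..<s+h} t \<partial>lborel) * indicator {a<..<b} s"
        by (subst nn_integral_multc[symmetric], simp) (intro nn_integral_mono, auto simp: indicator_def)
      also have "\<dots> = ennreal h * indicator {a<..<b} s" using h by simp
      finally show ?thesis .
    qed
    \<comment> \<open>After exchanging the integrals a fixed s is met only by t in (s, s + h), hence
      again the factor h.\<close>
    have A1: "(\<integral>\<^sup>+t. \<integral>\<^sup>+s. k s * ?I t s \<partial>lborel \<partial>lborel) \<le> ennreal (h * e1)"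
    proof -
      have "(\<integral>\<^sup>+t. \<integral>\<^sup>+s. k s * ?I t s \<partial>lborel \<partial>lborel) = (\<integral>\<^sup>+s. \<integral>\<^sup>+t. k s * ?I t s \<partial>lborel \<partial>lborel)"
        by (rule lborel_pair.Fubini') measurable
      also have "\<dots> = (\<integral>\<^sup>+s. k s * (\<integral>\<^sup>+t. ?I t s \<partial>lborel) \<partial>lborel)"
        by (intro nn_integral_cong nn_integral_cmult) measurable
      also have "\<dots> \<le> (\<integral>\<^sup>+s. k s * (ennreal h * indicator {a<..<b} s) \<partial>lborel)"
        by (intro nn_integral_mono mult_left_mono hI') auto
      also have "\<dots> = ennreal h * (\<integral>\<^sup>+s. k s * indicator {a<..<b} s \<partial>lborel)"
        by (subst nn_integral_cmult[symmetric]) (auto simp: mult_ac)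
      also have "\<dots> \<le> ennreal h * ennreal e1" by (intro mult_left_mono kint) auto
      finally show ?thesis using h e1 by (simp add: ennreal_mult)
    qed
    have A2: "(\<integral>\<^sup>+t. \<integral>\<^sup>+s. k t * ?I t s \<partial>lborel \<partial>lborel) \<le> ennreal (h * e1)"
    proof -
      have "(\<integral>\<^sup>+t. \<integral>\<^sup>+s. k t * ?I t s \<partial>lborel \<partial>lborel) = (\<integral>\<^sup>+t. k t * (\<integral>\<^sup>+s. ?I t s \<partial>lborel) \<partial>lborel)"
        by (intro nn_integral_cong nn_integral_cmult) measurable
      also have "\<dots> \<le> (\<integral>\<^sup>+t. k t * (ennreal h * indicator {a<..<b} t) \<partial>lborel)"
        by (intro nn_integral_mono mult_left_mono hI) auto
      also have "\<dots> = ennreal h * (\<integral>\<^sup>+s. k s * indicator {a<..<b} s \<partial>lborel)"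
        by (subst nn_integral_cmult[symmetric]) (auto simp: mult_ac)
      also have "\<dots> \<le> ennreal h * ennreal e1" by (intro mult_left_mono kint) auto
      finally show ?thesis using h e1 by (simp add: ennreal_mult)
    qed
    have A3: "(\<integral>\<^sup>+t. \<integral>\<^sup>+s. ennreal (\<eta> * m) * ?I t s \<partial>lborel \<partial>lborel) \<le> ennreal (h * e1)"
    proof -
      have "(\<integral>\<^sup>+t. \<integral>\<^sup>+s. ennreal (\<eta> * m) * ?I t s \<partial>lborel \<partial>lborel) = (\<integral>\<^sup>+t. ennreal (\<eta> * m) * (\<integral>\<^sup>+s. ?I t s \<partial>lborel) \<partial>lborel)"
        by (intro nn_integral_cong nn_integral_cmult) measurable
      also have "\<dots> \<le> (\<integral>\<^sup>+t. ennreal (\<eta> * m) * (ennreal h * indicator {a<..<b} t) \<partial>lborel)"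
        by (intro nn_integral_mono mult_left_mono hI) auto
      also have "\<dots> = (\<integral>\<^sup>+t. (ennreal (\<eta> * m) * ennreal h) * indicator {a<..<b} t \<partial>lborel)"
        by (simp add: mult_ac)
      also have "\<dots> = (ennreal (\<eta> * m) * ennreal h) * ennreal (b - a)"
        using ab by (subst nn_integral_cmult_indicator) auto
      also have "\<dots> = ennreal (h * (\<eta> * (b - a) * m))"
        using \<eta> m0 h ab by (simp add: ennreal_mult[symmetric] mult_ac)
      also have "\<dots> \<le> ennreal (h * e1)" using \<eta> h by (intro ennreal_leI mult_left_mono) auto
      finally show ?thesis .
    qed
    have "(\<integral>\<^sup>+t. \<integral>\<^sup>+s. \<integral>\<^sup>+x. ennreal (norm (V (s, x) - V (t, x)) powr p) * indicator B1 x
        * indicator {max a (t - h)<..<t} s * indicator {a<..<b} t \<partial>lborel \<partial>lborel \<partial>lborel)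
      \<le> (\<integral>\<^sup>+t. \<integral>\<^sup>+s. \<integral>\<^sup>+x. ennreal K * (ennreal (norm (V (s, x) - C (s, x)) powr p) * indicator B1 x * ?I t s
           + ennreal (norm (V (t, x) - C (t, x)) powr p) * indicator B1 x * ?I t s + ennreal \<eta> * indicator B1 x * ?I t s) \<partial>lborel \<partial>lborel \<partial>lborel)"
      by (intro nn_integral_mono pt)
    also have "\<dots> = (\<integral>\<^sup>+t. \<integral>\<^sup>+s. ennreal K * (k s * ?I t s + k t * ?I t s + ennreal (\<eta> * m) * ?I t s) \<partial>lborel \<partial>lborel)"
    proof (intro nn_integral_cong)
      fix t s :: real
      have c: "(\<integral>\<^sup>+x. ennreal (norm (V (r, x) - C (r, x)) powr p) * indicator B1 x * ?I t s \<partial>lborel) = k r * ?I t s" for r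
        unfolding k_def by (rule nn_integral_multc) measurable
      have d: "(\<integral>\<^sup>+x. ennreal \<eta> * indicator (B1 :: (real ^ 'n) set) x * ?I t s \<partial>lborel) = ennreal (\<eta> * m) * ?I t s"
        using \<eta> m0 by (subst nn_integral_multc) (auto simp: nn_integral_cmult_indicator em ennreal_mult)
      show "(\<integral>\<^sup>+x. ennreal K * (ennreal (norm (V (s, x) - C (s, x)) powr p) * indicator B1 x * ?I t s
           + ennreal (norm (V (t, x) - C (t, x)) powr p) * indicator B1 x * ?I t s + ennreal \<eta> * indicator B1 x * ?I t s) \<partial>lborel)
        = ennreal K * (k s * ?I t s + k t * ?I t s + ennreal (\<eta> * m) * ?I t s)"
        by (subst nn_integral_cmult, measurable, subst nn_integral_add, measurable, subst nn_integral_add, measurable)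
          (simp only: c d)
    qed
    also have "\<dots> = ennreal K * ((\<integral>\<^sup>+t. \<integral>\<^sup>+s. k s * ?I t s \<partial>lborel \<partial>lborel) + (\<integral>\<^sup>+t. \<integral>\<^sup>+s. k t * ?I t s \<partial>lborel \<partial>lborel)
        + (\<integral>\<^sup>+t. \<integral>\<^sup>+s. ennreal (\<eta> * m) * ?I t s \<partial>lborel \<partial>lborel))"
    proof -
      have "(\<integral>\<^sup>+s. ennreal K * (k s * ?I t s + k t * ?I t s + ennreal (\<eta> * m) * ?I t s) \<partial>lborel)
        = ennreal K * ((\<integral>\<^sup>+s. k s * ?I t s \<partial>lborel) + (\<integral>\<^sup>+s. k t * ?I t s \<partial>lborel) + (\<integral>\<^sup>+s. ennreal (\<eta> * m) * ?I t s \<partial>lborel))" for t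
        by (subst nn_integral_cmult, measurable, subst nn_integral_add, measurable, subst nn_integral_add, measurable)
      then show ?thesis
        by (simp only:) (subst nn_integral_cmult, measurable, subst nn_integral_add, measurable, subst nn_integral_add, measurable)
    qed
    also have "\<dots> \<le> ennreal K * (ennreal (h * e1) + ennreal (h * e1) + ennreal (h * e1))"
      by (intro mult_left_mono add_mono A1 A2 A3) auto
    also have "\<dots> = ennreal (K * (3 * (h * e1)))"
      using K h e1 by (simp add: ennreal_mult[symmetric] ennreal_plus[symmetric] del: ennreal_plus)
    also have "K * (3 * (h * e1)) = e * h" using K by (simp add: e1_def)
    finally show "(\<integral>\<^sup>+t. \<integral>\<^sup>+s. \<integral>\<^sup>+x. ennreal (norm (V (s, x) - V (t, x)) powr p) * indicator B1 x
        * indicator {max a (t - h)<..<t} s * indicator {a<..<b} t \<partial>lborel \<partial>lborel \<partial>lborel) \<le> ennreal (e * h)" .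
  qed
qed

section \<open>Comparison of weak solutions\<close>

definition flux :: "real \<Rightarrow> real ^ 'n \<Rightarrow> real ^ 'n" where
  "flux p v = norm v powr (p - 2) *\<^sub>R v"

lemma norm_flux: "norm (flux p v) = norm v powr (p - 1)"
proof (cases "v = 0")
  case False
  then show ?thesis using powr_add[of "norm v" "p - 2" 1] by (simp add: flux_def)
qed (simp add: flux_def)

lemma flux_measurable [measurable]: "flux p \<in> borel_measurable borel"
  unfolding flux_def by measurable

text \<open>By Cauchy-Schwarz the vector inequality reduces to (|a|^(p-1) - |b|^(p-1)) (|a| - |b|)
  \<ge> 0, which holds because r^(p-1) is increasing.\<close>

lemma flux_monotone:
  assumes "1 < p"
  shows "0 \<le> (flux p a - flux p b) \<bullet> (a - b)"
proof -
  have sq: "norm v powr (p - 2) * (v \<bullet> v) = norm v powr (p - 1) * norm v" for v :: "real ^ 'n"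
  proof (cases "v = 0")
    case False
    then have "norm v powr (p - 1) = norm v powr (p - 2) * norm v"
      using powr_add[of "norm v" "p - 2" 1] by simp
    then show ?thesis by (simp add: dot_square_norm power2_eq_square)
  qed simp
  have cs: "flux p v \<bullet> w \<le> norm v powr (p - 1) * norm w" for v w :: "real ^ 'n"
    using norm_cauchy_schwarz[of "flux p v" w] by (simp add: norm_flux)
  have "(flux p a - flux p b) \<bullet> (a - b) = norm a powr (p - 1) * norm a + norm b powr (p - 1) * norm b - flux p a \<bullet> b - flux p b \<bullet> a"
    using sq[of a] sq[of b] by (simp add: inner_diff_left inner_diff_right flux_def algebra_simps)
  also have "\<dots> \<ge> norm a powr (p - 1) * norm a + norm b powr (p - 1) * norm b - norm a powr (p - 1) * norm b - norm b powr (p - 1) * norm a"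
    using cs[of a b] cs[of b a] by simp
  also have "norm a powr (p - 1) * norm a + norm b powr (p - 1) * norm b - norm a powr (p - 1) * norm b - norm b powr (p - 1) * norm a
     = (norm a powr (p - 1) - norm b powr (p - 1)) * (norm a - norm b)" by (simp add: algebra_simps)
  also have "0 \<le> \<dots>"
  proof (cases "norm a \<le> norm b")
    case True
    then have "norm a powr (p - 1) \<le> norm b powr (p - 1)" using assms by (intro powr_mono2) auto
    then show ?thesis using True by (simp add: mult_nonpos_nonpos)
  next
    case False
    then have "norm b powr (p - 1) \<le> norm a powr (p - 1)" using assms by (intro powr_mono2) auto
    then show ?thesis using False by simp
  qed
  finally show ?thesis .
qed

lemma integrable_flux:
  fixes G \<Psi> :: "'a \<Rightarrow> real ^ 'n"
  assumes "Lp_fun p N G" "Lp_fun p N \<Psi>" "1 < p"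
  shows "integrable N (\<lambda>z. flux p (G z) \<bullet> \<Psi> z)"
proof (rule Bochner_Integration.integrable_bound[of N "\<lambda>z. norm (G z) powr p + norm (\<Psi> z) powr p"])
  note [measurable] = Lp_fun_measurable[OF assms(1)] Lp_fun_measurable[OF assms(2)]
  show "integrable N (\<lambda>z. norm (G z) powr p + norm (\<Psi> z) powr p)"
    using assms by (intro Bochner_Integration.integrable_add Lp_fun_integrable)
  show "(\<lambda>z. flux p (G z) \<bullet> \<Psi> z) \<in> borel_measurable N" by measurable
  show "AE z in N. norm (flux p (G z) \<bullet> \<Psi> z) \<le> norm (norm (G z) powr p + norm (\<Psi> z) powr p)"
  proof (rule AE_I2)
    fix z
    have "norm (flux p (G z) \<bullet> \<Psi> z) \<le> norm (G z) powr (p - 1) * norm (\<Psi> z)"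
      using Cauchy_Schwarz_ineq2[of "flux p (G z)" "\<Psi> z"] by (simp add: norm_flux)
    also have "\<dots> \<le> norm (G z) powr p + norm (\<Psi> z) powr p"
      using young_powr[of "norm (G z)" "norm (\<Psi> z)" p 1] assms(3) by simp
    finally show "norm (flux p (G z) \<bullet> \<Psi> z) \<le> norm (norm (G z) powr p + norm (\<Psi> z) powr p)" by simp
  qed
qed

lemma Lp_fun_subset:
  fixes g :: "'a::euclidean_space \<Rightarrow> 'b::euclidean_space"
  assumes L: "Lp_fun q (lebesgue_on S) g" and sub: "S' \<subseteq> S" and S: "S \<in> sets lebesgue" "S' \<in> sets lebesgue"
  shows "Lp_fun q (lebesgue_on S') g"
proof -
  have "(\<lambda>x. indicator S' x *\<^sub>R (indicator S x *\<^sub>R g x)) \<in> borel_measurable lebesgue"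
    by (rule borel_measurable_scaleR[OF borel_measurable_indicator]) (use L S in \<open>auto simp: Lp_fun_lebesgue_on_iff\<close>)
  moreover have "(\<lambda>x. indicator S' x *\<^sub>R (indicator S x *\<^sub>R g x)) = (\<lambda>x. indicator S' x *\<^sub>R g x)"
    using sub by (intro ext) (auto simp: indicator_def)
  moreover have "(\<integral>\<^sup>+x. ennreal (norm (g x) powr q) * indicator S' x \<partial>lborel) \<le> (\<integral>\<^sup>+x. ennreal (norm (g x) powr q) * indicator S x \<partial>lborel)"
    using sub by (intro nn_integral_mono) (auto simp: indicator_def)
  then have "(\<integral>\<^sup>+x. ennreal (norm (g x) powr q) * indicator S' x \<partial>lborel) < \<infinity>"
    using L S by (auto simp: Lp_fun_lebesgue_on_iff elim: le_less_trans)
  ultimately show ?thesis using S by (simp add: Lp_fun_lebesgue_on_iff)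
qed

text \<open>\<open>ennreal\<close> cuts off the negative part, and a nonintegrable function has
  integral 0 by convention; so the bound holds for every f.\<close>

lemma ennreal_integral_le_nn_integral: "ennreal (LINT x|M. f x) \<le> (\<integral>\<^sup>+x. ennreal (f x) \<partial>M)"
proof (cases "integrable M f")
  case True
  then have i: "integrable M (\<lambda>x. max 0 (f x))" by (intro integrable_max) auto
  have "(LINT x|M. f x) \<le> (LINT x|M. max 0 (f x))" by (intro integral_mono True i) auto
  then have "ennreal (LINT x|M. f x) \<le> ennreal (LINT x|M. max 0 (f x))" by (rule ennreal_leI)
  also have "\<dots> = (\<integral>\<^sup>+x. ennreal (max 0 (f x)) \<partial>M)" by (intro nn_integral_eq_integral[symmetric] i) auto
  also have "\<dots> = (\<integral>\<^sup>+x. ennreal (f x) \<partial>M)" by (intro nn_integral_cong) (auto simp: max_def ennreal_neg)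
  finally show ?thesis .
qed (simp add: not_integrable_integral_eq)

lemma ennreal_le_plusI:
  assumes "a \<le> b + c" "0 \<le> b" shows "ennreal a \<le> ennreal b + ennreal c"
proof (cases "0 \<le> c")
  case True
  then show ?thesis using assms by (simp add: ennreal_plus[symmetric] ennreal_leI del: ennreal_plus)
next
  case False
  then have "a \<le> b" using assms by simp
  then have "ennreal a \<le> ennreal b" by (rule ennreal_leI)
  then show ?thesis by (rule add_increasing2[rotated]) simp
qed

text \<open>A discrete substitute for integrating the energy inequality, which is not available
  because solutions need not be differentiable in time.\<close>

lemma vanishes_of_small_mean_increments:
  fixes E :: "real \<Rightarrow> real"
  assumes ab: "a < b" and cont: "continuous_on {a..b} E" and nonneg: "\<And>t. t \<in> {a..b} \<Longrightarrow> 0 \<le> E t" and init: "E a = 0"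
    and inc: "\<And>\<epsilon>. 0 < \<epsilon> \<Longrightarrow> \<exists>h0>0. \<forall>h. 0 < h \<and> h < h0 \<longrightarrow> (\<exists>R\<in>borel_measurable lborel.
       (AE t in lborel. a + h < t \<and> t < b \<longrightarrow> ennreal (E t) \<le> ennreal (E (t - h)) + R t) \<and>
       (\<integral>\<^sup>+t. R t * indicator {a + h<..<b} t \<partial>lborel) \<le> ennreal (\<epsilon> * h))"
  shows "E b = 0"
proof (rule ccontr)
  assume "E b \<noteq> 0"
  then have Eb: "E b > 0" using nonneg[of b] ab by simp
  \<comment> \<open>Near b the energy then exceeds 3\<epsilon>, near a it stays below \<epsilon>.
    Integrating the increments over steps of length h will leave at least 3\<epsilon>h on one side
    and at most 2\<epsilon>h on the other.\<close>
  define \<epsilon> where "\<epsilon> = E b / 4"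
  have \<epsilon>: "\<epsilon> > 0" using Eb by (simp add: \<epsilon>_def)
  obtain d1 where d1: "d1 > 0" "\<And>t. t \<in> {a..b} \<Longrightarrow> dist t b < d1 \<Longrightarrow> dist (E t) (E b) < \<epsilon>"
    using cont ab \<epsilon> unfolding continuous_on_iff by (metis atLeastAtMost_iff less_eq_real_def)
  obtain d2 where d2: "d2 > 0" "\<And>t. t \<in> {a..b} \<Longrightarrow> dist t a < d2 \<Longrightarrow> dist (E t) (E a) < \<epsilon>"
    using cont ab \<epsilon> unfolding continuous_on_iff by (metis atLeastAtMost_iff less_eq_real_def)
  obtain h0 where h0: "h0 > 0" "\<forall>h. 0 < h \<and> h < h0 \<longrightarrow> (\<exists>R\<in>borel_measurable lborel.
       (AE t in lborel. a + h < t \<and> t < b \<longrightarrow> ennreal (E t) \<le> ennreal (E (t - h)) + R t) \<and>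
       (\<integral>\<^sup>+t. R t * indicator {a + h<..<b} t \<partial>lborel) \<le> ennreal (\<epsilon> * h))"
    using inc[OF \<epsilon>] by blast
  define h where "h = min (min h0 d1) (min d2 ((b - a) / 2)) / 2"
  have h: "0 < h" "h < h0" "h < d1" "h < d2" "h < (b - a) / 2"
    using h0(1) d1(1) d2(1) ab by (auto simp: h_def min_def)
  obtain R where R: "R \<in> borel_measurable lborel" "AE t in lborel. a + h < t \<and> t < b \<longrightarrow> ennreal (E t) \<le> ennreal (E (t - h)) + R t"
      "(\<integral>\<^sup>+t. R t * indicator {a + h<..<b} t \<partial>lborel) \<le> ennreal (\<epsilon> * h)"
    using h0(2) h by blast
  have [measurable]: "R \<in> borel_measurable borel" using R(1) by simp
  define e where "e = (\<lambda>t. ennreal (indicator {a..b} t *\<^sub>R E t))"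
  have "(\<lambda>t. indicator {a..b} t *\<^sub>R E t) \<in> borel_measurable borel"
    by (rule borel_measurable_continuous_on_indicator[OF _ cont]) auto
  then have [measurable]: "e \<in> borel_measurable borel" unfolding e_def by measurable
  have e: "e t = ennreal (E t)" if "t \<in> {a..b}" for t using that by (simp add: e_def)
  let ?I = "\<lambda>S. \<integral>\<^sup>+t. e t * indicator S t \<partial>lborel"
  obtain B where B: "\<And>t. t \<in> {a..b} \<Longrightarrow> E t \<le> B"
  proof -
    have "bounded (E ` {a..b})" by (intro compact_imp_bounded compact_continuous_image cont) auto
    then obtain B where "\<forall>t\<in>{a..b}. norm (E t) \<le> B" unfolding bounded_iff by auto
    then show thesis by (intro that[of B]) (auto simp: abs_le_iff)
  qed
  \<comment> \<open>The integral over the common middle part must be finite in order to be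
    cancelled.\<close>
  have "?I {a+h<..<b-h} \<le> (\<integral>\<^sup>+t. ennreal (max B 0) * indicator {a+h<..<b-h} t \<partial>lborel)"
    using B h by (intro nn_integral_mono) (auto simp: e indicator_def intro!: ennreal_leI max.coboundedI1)
  also have "\<dots> < \<infinity>" using h by (subst nn_integral_cmult_indicator) (auto simp: ennreal_mult_less_top)
  finally have fin: "?I {a+h<..<b-h} < \<infinity>" .
  have "?I {a+h<..<b-h} + ennreal (3 * \<epsilon>) * ennreal h \<le> ?I {a+h<..<b-h} + ?I {b-h..<b}"
  proof (rule add_left_mono)
    have "ennreal (3 * \<epsilon>) * ennreal h = (\<integral>\<^sup>+t. ennreal (3 * \<epsilon>) * indicator {b-h..<b} t \<partial>lborel)"
      using h by (subst nn_integral_cmult_indicator) auto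
    also have "\<dots> \<le> ?I {b-h..<b}"
    proof (rule nn_integral_mono)
      fix t
      have "3 * \<epsilon> \<le> E t" if "t \<in> {b-h..<b}"
      proof -
        have "\<bar>E t - E b\<bar> < \<epsilon>" using d1(2)[of t] that h by (auto simp: dist_real_def)
        then show ?thesis unfolding \<epsilon>_def by linarith
      qed
      then show "ennreal (3 * \<epsilon>) * indicator {b-h..<b} t \<le> e t * indicator {b-h..<b} t"
        using h by (auto simp: indicator_def e intro!: ennreal_leI)
    qed
    finally show "ennreal (3 * \<epsilon>) * ennreal h \<le> ?I {b-h..<b}" .
  qed
  also have "\<dots> = ?I {a+h<..<b}"
    using h by (subst nn_integral_add[symmetric]) (auto intro!: nn_integral_cong simp: indicator_def)
  also have "\<dots> \<le> (\<integral>\<^sup>+t. e (t - h) * indicator {a+h<..<b} t + R t * indicator {a+h<..<b} t \<partial>lborel)"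
  proof (rule nn_integral_mono_AE)
    show "AE t in lborel. e t * indicator {a+h<..<b} t \<le> e (t - h) * indicator {a+h<..<b} t + R t * indicator {a+h<..<b} t"
      using R(2) by eventually_elim (use h in \<open>auto simp: indicator_def e\<close>)
  qed
  also have "\<dots> = (\<integral>\<^sup>+t. e (t - h) * indicator {a+h<..<b} t \<partial>lborel) + (\<integral>\<^sup>+t. R t * indicator {a+h<..<b} t \<partial>lborel)"
    by (rule nn_integral_add) measurable
  \<comment> \<open>The shift by h carries (a+h, b) to (a, b-h); the overlap of the two intervals is
    the part that cancels.\<close>
  also have "(\<integral>\<^sup>+t. e (t - h) * indicator {a+h<..<b} t \<partial>lborel) = ?I {a<..<b-h}"
    by (subst nn_integral_real_affine[where c = 1 and t = h]) (auto intro!: nn_integral_cong simp: indicator_def)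
  also have "?I {a<..<b-h} = ?I {a+h<..<b-h} + ?I {a<..a+h}"
    using h by (subst nn_integral_add[symmetric]) (auto intro!: nn_integral_cong simp: indicator_def)
  also have "?I {a+h<..<b-h} + ?I {a<..a+h} + (\<integral>\<^sup>+t. R t * indicator {a+h<..<b} t \<partial>lborel)
    \<le> ?I {a+h<..<b-h} + ennreal \<epsilon> * ennreal h + ennreal (\<epsilon> * h)"
  proof (intro add_mono R order.refl)
    have "?I {a<..a+h} \<le> (\<integral>\<^sup>+t. ennreal \<epsilon> * indicator {a<..a+h} t \<partial>lborel)"
    proof (rule nn_integral_mono)
      fix t
      have "E t \<le> \<epsilon>" if "t \<in> {a<..a+h}"
        using d2(2)[of t] that h init by (auto simp: dist_real_def)
      then show "e t * indicator {a<..a+h} t \<le> ennreal \<epsilon> * indicator {a<..a+h} t"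
        using h by (auto simp: indicator_def e intro!: ennreal_leI)
    qed
    also have "\<dots> = ennreal \<epsilon> * ennreal h" using h by (subst nn_integral_cmult_indicator) auto
    finally show "?I {a<..a+h} \<le> ennreal \<epsilon> * ennreal h" .
  qed
  finally have "?I {a+h<..<b-h} + ennreal (3 * \<epsilon>) * ennreal h \<le> ?I {a+h<..<b-h} + (ennreal \<epsilon> * ennreal h + ennreal (\<epsilon> * h))"
    by (simp add: add.assoc)
  then have "ennreal (3 * \<epsilon>) * ennreal h \<le> ennreal \<epsilon> * ennreal h + ennreal (\<epsilon> * h)"
    using fin by (subst (asm) ennreal_add_left_cancel_le) auto
  then have "3 * \<epsilon> * h \<le> \<epsilon> * h + \<epsilon> * h"
    using \<epsilon> h by (simp add: ennreal_mult[symmetric] ennreal_plus[symmetric] del: ennreal_plus)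
  then show False using \<epsilon> h by simp
qed

text \<open>The weak formulation on the slab \<open>B1 \<times> (-1,b]\<close>, tested with time-independent functions only.\<close>

definition slab_sol ::
    "real \<Rightarrow> real \<Rightarrow> (real ^ 'n \<Rightarrow> real) \<Rightarrow> (real ^ 'n \<Rightarrow> real) \<Rightarrow> (real \<Rightarrow> real ^ 'n \<Rightarrow> real) \<Rightarrow> (real \<Rightarrow> real ^ 'n \<Rightarrow> real ^ 'n) \<Rightarrow> bool" where
  "slab_sol p b F \<phi> u G \<longleftrightarrow>
     (\<forall>t\<in>{-1..b}. Lp_fun 2 (lebesgue_on B1) (u t)) \<and>
     (\<forall>t\<in>{-1..b}. ((\<lambda>s. LINT x|lebesgue_on B1. (u s x - u t x)\<^sup>2) \<longlongrightarrow> 0) (at t within {-1..b})) \<and>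
     (\<lambda>z. u (fst z) (snd z)) \<in> borel_measurable (lebesgue_on ({-1<..<b} \<times> B1)) \<and>
     Lp_fun p (lebesgue_on ({-1<..<b} \<times> B1)) (\<lambda>z. G (fst z) (snd z)) \<and>
     (\<forall>s t \<psi> D\<psi>. -1 \<le> s \<and> s < t \<and> t \<le> b \<and> W1p_0 p \<psi> D\<psi> \<and> Lp_fun 2 (lebesgue_on B1) \<psi> \<longrightarrow>
        (LINT x|lebesgue_on B1. u t x * \<psi> x) - (LINT x|lebesgue_on B1. u s x * \<psi> x)
        + (LINT z|lebesgue_on ({s<..<t} \<times> B1). flux p (G (fst z) (snd z)) \<bullet> D\<psi> (snd z))
        = (t - s) * (LINT x|lebesgue_on B1. F x * \<psi> x)) \<and>
     (AE x in lebesgue_on B1. u (-1) x = \<phi> x) \<and>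
     (AE t in lebesgue_on {-1<..<b}. has_trace p (u t) (G t) \<phi>)"

lemma L2_path_diff:
  fixes u v :: "real \<Rightarrow> 'b \<Rightarrow> real"
  assumes "\<forall>t\<in>T. Lp_fun 2 M (u t)" "\<forall>t\<in>T. ((\<lambda>s. LINT x|M. (u s x - u t x)\<^sup>2) \<longlongrightarrow> (0::real)) (at t within T)"
    "\<forall>t\<in>T. Lp_fun 2 M (v t)" "\<forall>t\<in>T. ((\<lambda>s. LINT x|M. (v s x - v t x)\<^sup>2) \<longlongrightarrow> (0::real)) (at t within T)"
    and X: "\<And>n. X n \<in> T" "X \<longlonglongrightarrow> t" "t \<in> T"
  shows "Lp_tendsto 2 M (\<lambda>n x. u (X n) x - v (X n) x) (\<lambda>x. u t x - v t x)"
proof -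
  have "Lp_tendsto 2 M (\<lambda>n. w (X n)) (w t)"
    if w: "\<forall>t\<in>T. Lp_fun 2 M (w t)" "\<forall>t\<in>T. ((\<lambda>s. LINT x|M. (w s x - w t x)\<^sup>2) \<longlongrightarrow> 0) (at t within T)"
    for w :: "real \<Rightarrow> 'b \<Rightarrow> real"
  proof -
    have "continuous (at t within T) (\<lambda>s. LINT x|M. (w s x - w t x)\<^sup>2)"
      using w(2) X(3) by (simp add: continuous_within)
    then have "(\<lambda>n. LINT x|M. (w (X n) x - w t x)\<^sup>2) \<longlonglongrightarrow> (LINT x|M. (w t x - w t x)\<^sup>2)"
      by (rule continuous_within_tendsto_compose') (use X in auto)
    moreover have "norm r powr 2 = r\<^sup>2" for r :: real by (simp add: powr_numeral)
    ultimately show ?thesis using w(1) X by (simp add: Lp_tendsto_def)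
  qed
  then show ?thesis using assms by (intro Lp_tendsto_diff) auto
qed

text \<open>The barrier m + c(t+1) is constant in space, hence invisible to the diffusion. Its slope
  c pays for the difference of the sources, its initial value m for the initial data, and as it
  never falls below m it also covers the lateral boundary.\<close>

lemma comparison:
  fixes u1 u2 :: "real \<Rightarrow> real ^ 'n \<Rightarrow> real"
  assumes p: "1 < p" and b: "-1 < b"
    and sol1: "slab_sol p b F1 \<phi>1 u1 G1" and sol2: "slab_sol p b F2 \<phi>2 u2 G2"
    and int: "integrable (lebesgue_on B1) F1" "integrable (lebesgue_on B1) F2"
    and F: "AE x in lebesgue_on B1. F1 x - F2 x \<le> c" and c: "0 \<le> c"
    and \<phi>: "AE x in lebesgue_on B1. \<phi>1 x - \<phi>2 x \<le> m" "AE x in surface_measure. \<phi>1 x - \<phi>2 x \<le> m"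
  shows "AE x in lebesgue_on B1. u1 b x - u2 b x \<le> m + c * (b + 1)"
proof -
  let ?M = "lebesgue_on (B1 :: (real ^ 'n) set)"
  interpret M: finite_measure ?M by (rule finite_measure_B1)
  let ?T = "{-1..b}"
  let ?Q = "{-1<..<b} \<times> (B1 :: (real ^ 'n) set)"
  have L2: "\<forall>t\<in>?T. Lp_fun 2 ?M (u1 t)" "\<forall>t\<in>?T. Lp_fun 2 ?M (u2 t)"
    and C2: "\<forall>t\<in>?T. ((\<lambda>s. LINT x|?M. (u1 s x - u1 t x)\<^sup>2) \<longlongrightarrow> 0) (at t within ?T)"
      "\<forall>t\<in>?T. ((\<lambda>s. LINT x|?M. (u2 s x - u2 t x)\<^sup>2) \<longlongrightarrow> 0) (at t within ?T)"
    and um: "(\<lambda>z. u1 (fst z) (snd z)) \<in> borel_measurable (lebesgue_on ?Q)" "(\<lambda>z. u2 (fst z) (snd z)) \<in> borel_measurable (lebesgue_on ?Q)"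
    and LG: "Lp_fun p (lebesgue_on ?Q) (\<lambda>z. G1 (fst z) (snd z))" "Lp_fun p (lebesgue_on ?Q) (\<lambda>z. G2 (fst z) (snd z))"
    and init: "AE x in ?M. u1 (-1) x = \<phi>1 x" "AE x in ?M. u2 (-1) x = \<phi>2 x"
    and tr: "AE t in lebesgue_on {-1<..<b}. has_trace p (u1 t) (G1 t) \<phi>1" "AE t in lebesgue_on {-1<..<b}. has_trace p (u2 t) (G2 t) \<phi>2"
    using sol1 sol2 unfolding slab_sol_def by blast+
  have weak1: "(LINT x|?M. u1 t x * \<psi> x) - (LINT x|?M. u1 s x * \<psi> x)
        + (LINT z|lebesgue_on ({s<..<t} \<times> B1). flux p (G1 (fst z) (snd z)) \<bullet> D\<psi> (snd z)) = (t - s) * (LINT x|?M. F1 x * \<psi> x)"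
    if "-1 \<le> s" "s < t" "t \<le> b" "W1p_0 p \<psi> D\<psi>" "Lp_fun 2 ?M \<psi>" for s t \<psi> D\<psi>
    using sol1 that unfolding slab_sol_def by blast
  have weak2: "(LINT x|?M. u2 t x * \<psi> x) - (LINT x|?M. u2 s x * \<psi> x)
        + (LINT z|lebesgue_on ({s<..<t} \<times> B1). flux p (G2 (fst z) (snd z)) \<bullet> D\<psi> (snd z)) = (t - s) * (LINT x|?M. F2 x * \<psi> x)"
    if "-1 \<le> s" "s < t" "t \<le> b" "W1p_0 p \<psi> D\<psi>" "Lp_fun 2 ?M \<psi>" for s t \<psi> D\<psi>
    using sol2 that unfolding slab_sol_def by blast
  define \<kappa> where "\<kappa> = (\<lambda>t. m + c * (t + 1))"
  define Y where "Y = (\<lambda>t x. u1 t x - u2 t x - \<kappa> t)"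
  \<comment> \<open>The gradient of the truncation \<open>ramp (Y t x)\<close>. It is a nonnegative
    multiple of G1 - G2, which is what monotonicity of the flux needs.\<close>
  define V where "V = (\<lambda>t x. deriv ramp (Y t x) *\<^sub>R (G1 t x - G2 t x))"
  define E where "E = (\<lambda>t. LINT x|?M. conv (Y t x))"
  obtain L where L: "L > 0" "\<And>r. \<bar>deriv ramp r\<bar> \<le> L" using ramp_lipschitz by metis
  have contc: "continuous_on UNIV conv"
    using conv_deriv by (meson DERIV_continuous continuous_at_imp_continuous_on)
  note [measurable] = borel_measurable_continuous_onI[OF smooth_continuous[OF smooth_ramp]]
    borel_measurable_continuous_onI[OF smooth_continuous[OF smooth_deriv(2)[OF smooth_ramp]]]
    borel_measurable_continuous_onI[OF contc]
  have Lu: "Lp_fun 2 ?M (\<lambda>x. u1 t x - u2 t x)" if "t \<in> ?T" for t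
    using L2 that by (intro Lp_fun_diff) auto
  have iY: "integrable ?M (Y t)" and iu: "integrable ?M (u1 t)" "integrable ?M (u2 t)" if "t \<in> ?T" for t
    using Lp_fun_integrable_norm[OF Lu[OF that] _ finite_measure_B1] L2 that unfolding Y_def
    by (auto intro!: Lp_fun_integrable_norm[of 2] finite_measure_B1)
  have ic: "integrable ?M (\<lambda>x. conv (Y t x))" if "t \<in> ?T" for t
  proof (rule Bochner_Integration.integrable_bound[OF iY[OF that]])
    show "(\<lambda>x. conv (Y t x)) \<in> borel_measurable ?M" using iY[OF that] by measurable
    show "AE x in ?M. norm (conv (Y t x)) \<le> norm (Y t x)"
      using conv_lipschitz[of _ 0] by (intro AE_I2) simp
  qed
  have E0: "0 \<le> E t" for t unfolding E_def by (intro integral_nonneg_AE) (auto simp: conv_nonneg)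
  \<comment> \<open>\<open>conv\<close> is 1-Lipschitz, so continuity of the paths in L^1, implied
    by that in L^2, is enough.\<close>
  have contE: "continuous_on ?T E"
    unfolding continuous_on_sequentially
  proof (intro allI ballI impI, elim conjE)
    fix X :: "nat \<Rightarrow> real" and t assume t: "t \<in> ?T" and X: "\<forall>n. X n \<in> ?T" "X \<longlonglongrightarrow> t"
    have "Lp_tendsto 2 ?M (\<lambda>n x. u1 (X n) x - u2 (X n) x) (\<lambda>x. u1 t x - u2 t x)"
      by (rule L2_path_diff[OF L2(1) C2(1) L2(2) C2(2)]) (use X t in auto)
    from Lp_tendsto_L1[OF this _ finite_measure_B1]
    have l: "(\<lambda>n. LINT x|?M. norm ((u1 (X n) x - u2 (X n) x) - (u1 t x - u2 t x))) \<longlonglongrightarrow> 0" by simp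
    have k: "(\<lambda>n. \<kappa> (X n)) \<longlonglongrightarrow> \<kappa> t" unfolding \<kappa>_def using X(2) by (intro tendsto_intros)
    have "(\<lambda>n. E (X n) - E t) \<longlonglongrightarrow> 0"
    proof (rule Lim_null_comparison)
      let ?d = "\<lambda>n x. norm ((u1 (X n) x - u2 (X n) x) - (u1 t x - u2 t x))"
      show "\<forall>\<^sub>F n in sequentially. norm (E (X n) - E t) \<le> (LINT x|?M. ?d n x) + \<bar>\<kappa> (X n) - \<kappa> t\<bar> * measure ?M (space ?M)"
      proof (intro always_eventually allI)
        fix n
        have Xn: "X n \<in> ?T" using X by blast
        have id: "integrable ?M (?d n)"
          using iu[OF Xn] iu[OF t] by auto
        have "norm (E (X n) - E t) = norm (LINT x|?M. conv (Y (X n) x) - conv (Y t x))"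
          unfolding E_def using ic[OF Xn] ic[OF t] by simp
        also have "\<dots> \<le> (LINT x|?M. norm (conv (Y (X n) x) - conv (Y t x)))" by (rule integral_norm_bound)
        also have "\<dots> \<le> (LINT x|?M. ?d n x + \<bar>\<kappa> (X n) - \<kappa> t\<bar>)"
        proof (rule integral_mono)
          show "norm (conv (Y (X n) x) - conv (Y t x)) \<le> ?d n x + \<bar>\<kappa> (X n) - \<kappa> t\<bar>" for x
            using conv_lipschitz[of "Y (X n) x" "Y t x"] by (simp add: Y_def)
        qed (use ic[OF Xn] ic[OF t] id in auto)
        also have "\<dots> = (LINT x|?M. ?d n x) + \<bar>\<kappa> (X n) - \<kappa> t\<bar> * measure ?M (space ?M)"
          using id by simp
        finally show "norm (E (X n) - E t) \<le> (LINT x|?M. ?d n x) + \<bar>\<kappa> (X n) - \<kappa> t\<bar> * measure ?M (space ?M)" .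
      qed
      have "(\<lambda>n. (LINT x|?M. ?d n x) + \<bar>\<kappa> (X n) - \<kappa> t\<bar> * measure ?M (space ?M)) \<longlonglongrightarrow> 0 + \<bar>\<kappa> t - \<kappa> t\<bar> * measure ?M (space ?M)"
        by (intro tendsto_intros l k)
      then show "(\<lambda>n. (LINT x|?M. ?d n x) + \<bar>\<kappa> (X n) - \<kappa> t\<bar> * measure ?M (space ?M)) \<longlonglongrightarrow> 0" by simp
    qed
    then show "(E \<circ> X) \<longlonglongrightarrow> E t" by (simp add: LIM_zero_iff o_def)
  qed
  have initE: "E (-1) = 0"
  proof -
    have "AE x in ?M. conv (Y (-1) x) = 0"
      using init \<phi>(1) by eventually_elim (simp add: Y_def \<kappa>_def)
    then show ?thesis unfolding E_def by (subst integral_cong_AE[of _ _ "\<lambda>x. 0"]) (use ic[of "-1"] b in auto)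
  qed
  define P where "P = (\<lambda>z. norm (G1 (fst z) (snd z)) powr p + norm (G2 (fst z) (snd z)) powr p)"
  define VQ where "VQ = (\<lambda>z. V (fst z) (snd z))"
  have Vm: "VQ \<in> borel_measurable (lebesgue_on ?Q)"
  proof -
    have [measurable]: "fst \<in> borel_measurable (lebesgue_on ?Q)"
      by (intro measurable_restrict_space1 measurable_completion) (simp add: borel_measurable_continuous_onI continuous_on_fst)
    note [measurable] = um LG[THEN Lp_fun_measurable]
    show ?thesis unfolding VQ_def V_def Y_def \<kappa>_def by measurable
  qed
  have LV: "Lp_fun p (lebesgue_on ?Q) VQ"
  proof (rule Lp_fun_dominated[OF Lp_fun_scaleR[OF Lp_fun_diff[OF LG], of L] Vm])
    show "AE z in lebesgue_on ?Q. norm (VQ z) \<le> norm (L *\<^sub>R (G1 (fst z) (snd z) - G2 (fst z) (snd z)))"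
      using L by (intro AE_I2) (simp add: VQ_def V_def mult_right_mono)
  qed (use p in auto)
  have PI: "integrable (lebesgue_on ?Q) P"
    unfolding P_def by (intro Bochner_Integration.integrable_add Lp_fun_integrable LG)
  have ext: "(\<lambda>z. indicator ?Q z *\<^sub>R VQ z) \<in> borel_measurable lebesgue" "(\<lambda>z. indicator ?Q z *\<^sub>R P z) \<in> borel_measurable lebesgue"
    using Vm borel_measurable_integrable[OF PI] by (simp_all add: borel_measurable_restrict_space_iff)
  \<comment> \<open>A Borel version of V makes it possible to compare the slice at a frozen time t
    with the slices at other times s under iterated integrals.\<close>
  obtain Vb where Vb[measurable]: "Vb \<in> borel_measurable borel" and Vae: "AE z in lborel. indicator ?Q z *\<^sub>R VQ z = Vb z"
    using lebesgue_borel_rep[OF ext(1)] by blast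
  obtain Pb where Pb[measurable]: "Pb \<in> borel_measurable borel" and Pae: "AE z in lborel. indicator ?Q z *\<^sub>R P z = Pb z"
    using lebesgue_borel_rep[OF ext(2)] by blast
  have LVb: "Lp_fun p (lebesgue_on ?Q) Vb"
  proof (rule Lp_fun_dominated[OF LV])
    show "Vb \<in> borel_measurable (lebesgue_on ?Q)"
      by (intro measurable_restrict_space1 measurable_completion) simp
    have "AE z in lebesgue. z \<in> ?Q \<longrightarrow> norm (Vb z) \<le> norm (VQ z)"
      using AE_completion[OF Vae] by eventually_elim (auto simp: indicator_def split: if_splits)
    then show "AE z in lebesgue_on ?Q. norm (Vb z) \<le> norm (VQ z)" by (subst AE_lebesgue_on_iff) auto
  qed (use p in auto)
  define PP where "PP = (\<integral>\<^sup>+z. ennreal (Pb z) \<partial>lborel)"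
  have PP: "PP < \<infinity>"
  proof -
    have "PP = (\<integral>\<^sup>+z. ennreal (P z) * indicator ?Q z \<partial>lborel)"
      unfolding PP_def
    proof (rule nn_integral_cong_AE, use Pae in eventually_elim)
      case (elim z)
      then show ?case by (cases "z \<in> ?Q") simp_all
    qed
    also have "\<dots> = (\<integral>\<^sup>+z. ennreal (norm (P z)) \<partial>lebesgue_on ?Q)"
      by (simp add: nn_integral_restrict_space nn_integral_completion P_def)
    also have "\<dots> < \<infinity>" using PI by (simp add: integrable_iff_bounded)
    finally show ?thesis .
  qed
  obtain PPr where PPr: "PP = ennreal PPr" "0 \<le> PPr" using PP by (cases PP) auto
  have Vslice: "AE t in lborel. t \<in> {-1<..<b} \<longrightarrow> (AE x in lborel. x \<in> B1 \<longrightarrow> V t x = Vb (t, x))"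
    using AE_lborel_slice[OF Vae]
  proof eventually_elim
    case (elim t)
    show ?case
    proof
      assume t: "t \<in> {-1<..<b}"
      show "AE x in lborel. x \<in> B1 \<longrightarrow> V t x = Vb (t, x)"
        using elim by eventually_elim (use t in \<open>auto simp: VQ_def\<close>)
    qed
  qed
  have tr': "AE t in lborel. t \<in> {-1<..<b} \<longrightarrow> has_trace p (u1 t) (G1 t) \<phi>1 \<and> has_trace p (u2 t) (G2 t) \<phi>2"
  proof -
    have "AE t in lborel. t \<in> {-1<..<b} \<longrightarrow> has_trace p (u1 t) (G1 t) \<phi>1" "AE t in lborel. t \<in> {-1<..<b} \<longrightarrow> has_trace p (u2 t) (G2 t) \<phi>2"
      using tr by (simp_all add: AE_lebesgue_on_iff AE_completion_iff)
    then show ?thesis by eventually_elim simp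
  qed
  \<comment> \<open>\<eta> is the weight in Young's inequality: a small factor goes to the
    integrable gradient powers, a large one to the time oscillation of V, which is small in mean.
    The indicators are written in the form in which \<open>Lp_mean_continuity\<close> has
    them.\<close>
  have incr: "ennreal (E t) \<le> ennreal (E (t - h)) + (\<integral>\<^sup>+s. \<integral>\<^sup>+x. (ennreal (\<eta> powr p) * ennreal (Pb (s, x)) + ennreal (2 * \<eta> powr (p * (1 - p))) * ennreal (norm (Vb (s, x) - Vb (t, x)) powr p))
       * indicator B1 x * indicator {max (-1) (t - h)<..<t} s * indicator {-1<..<b} t \<partial>lborel \<partial>lborel)"
    if t: "t \<in> {-1<..<b}" "-1 + h < t" "0 < h" and \<eta>: "0 < \<eta>" and Vt: "AE x in lborel. x \<in> B1 \<longrightarrow> V t x = Vb (t, x)"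
      and trt: "has_trace p (u1 t) (G1 t) \<phi>1" "has_trace p (u2 t) (G2 t) \<phi>2" for t h \<eta>
  proof -
    have tT: "t \<in> ?T" "t - h \<in> ?T" using t by auto
    let ?S = "{t-h<..<t} \<times> (B1 :: (real ^ 'n) set)"
    have SQ: "?S \<subseteq> ?Q" using t by auto
    define \<psi> where "\<psi> = (\<lambda>x. ramp (Y t x))"
    have W: "W1p_0 p \<psi> (V t)"
      unfolding \<psi>_def V_def Y_def
    proof (rule ramp_truncation_W1p_0[OF p trt])
      show "AE x in surface_measure. \<phi>1 x - \<phi>2 x \<le> \<kappa> t"
        using \<phi>(2) by eventually_elim (use t c in \<open>simp add: \<kappa>_def add_increasing2\<close>)
    qed
    have \<psi>b: "\<bar>\<psi> x\<bar> \<le> 1" "0 \<le> \<psi> x" for x using ramp_nonneg ramp_le_1 by (auto simp: \<psi>_def)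
    have \<psi>m[measurable]: "\<psi> \<in> borel_measurable ?M" unfolding \<psi>_def using iY[OF tT(1)] by measurable
    have L\<psi>: "Lp_fun 2 ?M \<psi>" by (rule Lp_fun_bounded[OF finite_measure_B1 \<psi>m, of 1]) (use \<psi>b in auto)
    have LVt: "Lp_fun p (lebesgue_on ?S) (\<lambda>z. V t (snd z))"
      by (rule Lp_fun_snd) (use W in \<open>auto simp: W1p_0_def W1p_def\<close>)
    have i1: "integrable (lebesgue_on ?S) (\<lambda>z. flux p (G1 (fst z) (snd z)) \<bullet> V t (snd z))"
      and i2: "integrable (lebesgue_on ?S) (\<lambda>z. flux p (G2 (fst z) (snd z)) \<bullet> V t (snd z))"
      by (intro integrable_flux LVt p Lp_fun_subset[OF LG(1) SQ] Lp_fun_subset[OF LG(2) SQ]; simp)+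
    have im: "integrable ?M (\<lambda>x. g x * \<psi> x)" if "integrable ?M g" for g :: "real ^ 'n \<Rightarrow> real"
      by (rule integrable_bounded_mult[OF that \<psi>m, of 1]) (use \<psi>b in auto)
    have w1: "(LINT x|?M. u1 t x * \<psi> x) - (LINT x|?M. u1 (t - h) x * \<psi> x)
        + (LINT z|lebesgue_on ?S. flux p (G1 (fst z) (snd z)) \<bullet> V t (snd z)) = h * (LINT x|?M. F1 x * \<psi> x)"
      using weak1[of "t - h" t, OF _ _ _ W L\<psi>] t by simp
    have w2: "(LINT x|?M. u2 t x * \<psi> x) - (LINT x|?M. u2 (t - h) x * \<psi> x)
        + (LINT z|lebesgue_on ?S. flux p (G2 (fst z) (snd z)) \<bullet> V t (snd z)) = h * (LINT x|?M. F2 x * \<psi> x)"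
      using weak2[of "t - h" t, OF _ _ _ W L\<psi>] t by simp
    have "E t - E (t - h) = (LINT x|?M. conv (Y t x) - conv (Y (t - h) x))"
      unfolding E_def using ic[OF tT(1)] ic[OF tT(2)] by simp
    \<comment> \<open>Convexity is used at the later time t, so both solutions can be tested on
      (t-h, t) with the single function \<psi> of x.\<close>
    also have "\<dots> \<le> (LINT x|?M. (Y t x - Y (t - h) x) * \<psi> x)"
      unfolding \<psi>_def using ic tT iY im[unfolded \<psi>_def] conv_convex by (intro integral_mono) auto
    also have "\<dots> = (LINT x|?M. (u1 t x * \<psi> x - u1 (t - h) x * \<psi> x) - (u2 t x * \<psi> x - u2 (t - h) x * \<psi> x) - (c * h) * \<psi> x)"
      by (intro Bochner_Integration.integral_cong) (auto simp: Y_def \<kappa>_def algebra_simps)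
    also have "\<dots> = ((LINT x|?M. u1 t x * \<psi> x) - (LINT x|?M. u1 (t - h) x * \<psi> x)) - ((LINT x|?M. u2 t x * \<psi> x) - (LINT x|?M. u2 (t - h) x * \<psi> x)) - (c * h) * (LINT x|?M. \<psi> x)"
      using im[OF iu(1)] im[OF iu(2)] tT im[of "\<lambda>x. 1"] by simp
    also have "\<dots> = (LINT z|lebesgue_on ?S. flux p (G2 (fst z) (snd z)) \<bullet> V t (snd z)) - (LINT z|lebesgue_on ?S. flux p (G1 (fst z) (snd z)) \<bullet> V t (snd z))
        + h * ((LINT x|?M. F1 x * \<psi> x) - (LINT x|?M. F2 x * \<psi> x) - c * (LINT x|?M. \<psi> x))"
      using w1 w2 by (simp add: algebra_simps)
    \<comment> \<open>The slope of the barrier compensates the sources: the combined integrand is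
      (F1 - F2 - c) \<psi> with \<psi> nonnegative.\<close>
    also have "(LINT x|?M. F1 x * \<psi> x) - (LINT x|?M. F2 x * \<psi> x) - c * (LINT x|?M. \<psi> x) \<le> 0"
    proof -
      have "(LINT x|?M. F1 x * \<psi> x) - (LINT x|?M. F2 x * \<psi> x) - c * (LINT x|?M. \<psi> x) = (LINT x|?M. F1 x * \<psi> x - F2 x * \<psi> x - c * \<psi> x)"
        using im[OF int(1)] im[OF int(2)] im[of "\<lambda>x. 1"] by simp
      also have "\<dots> \<le> (LINT x|?M. 0)"
      proof (rule integral_mono_AE)
        show "integrable ?M (\<lambda>x. F1 x * \<psi> x - F2 x * \<psi> x - c * \<psi> x)"
          using im[OF int(1)] im[OF int(2)] im[of "\<lambda>x. 1"] by simp
        show "AE x in ?M. F1 x * \<psi> x - F2 x * \<psi> x - c * \<psi> x \<le> 0"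
          using F
        proof eventually_elim
          case (elim x)
          then have "(F1 x - F2 x - c) * \<psi> x \<le> 0" using \<psi>b(2)[of x] by (intro mult_nonpos_nonneg) auto
          then show ?case by (simp add: algebra_simps)
        qed
      qed simp
      finally show ?thesis by simp
    qed
    finally have "E t - E (t - h) \<le> (LINT z|lebesgue_on ?S. flux p (G2 (fst z) (snd z)) \<bullet> V t (snd z)) - (LINT z|lebesgue_on ?S. flux p (G1 (fst z) (snd z)) \<bullet> V t (snd z))"
      using t(3) by (simp add: mult_left_mono mult_nonneg_nonpos)
    also have "\<dots> = (LINT z|lebesgue_on ?S. (flux p (G2 (fst z) (snd z)) - flux p (G1 (fst z) (snd z))) \<bullet> V t (snd z))"
      using i1 i2 by (simp add: inner_diff_left)
    finally have "E t \<le> E (t - h) + (LINT z|lebesgue_on ?S. (flux p (G2 (fst z) (snd z)) - flux p (G1 (fst z) (snd z))) \<bullet> V t (snd z))" by simp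
    from ennreal_le_plusI[OF this E0]
    have "ennreal (E t) \<le> ennreal (E (t - h)) + ennreal (LINT z|lebesgue_on ?S. (flux p (G2 (fst z) (snd z)) - flux p (G1 (fst z) (snd z))) \<bullet> V t (snd z))" .
    also have "ennreal (LINT z|lebesgue_on ?S. (flux p (G2 (fst z) (snd z)) - flux p (G1 (fst z) (snd z))) \<bullet> V t (snd z))
       \<le> (\<integral>\<^sup>+z. ennreal ((flux p (G2 (fst z) (snd z)) - flux p (G1 (fst z) (snd z))) \<bullet> V t (snd z)) \<partial>lebesgue_on ?S)"
      by (rule ennreal_integral_le_nn_integral)
    also have "\<dots> = (\<integral>\<^sup>+z. ennreal ((flux p (G2 (fst z) (snd z)) - flux p (G1 (fst z) (snd z))) \<bullet> V t (snd z)) * indicator ?S z \<partial>lborel)"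
      by (simp add: nn_integral_restrict_space nn_integral_completion)
    also have "\<dots> \<le> (\<integral>\<^sup>+z. (ennreal (\<eta> powr p) * ennreal (Pb z) + ennreal (2 * \<eta> powr (p * (1 - p))) * ennreal (norm (Vb z - Vb (t, snd z)) powr p)) * indicator ?S z \<partial>lborel)"
    proof (rule nn_integral_mono_AE)
      show "AE z in lborel. ennreal ((flux p (G2 (fst z) (snd z)) - flux p (G1 (fst z) (snd z))) \<bullet> V t (snd z)) * indicator ?S z
        \<le> (ennreal (\<eta> powr p) * ennreal (Pb z) + ennreal (2 * \<eta> powr (p * (1 - p))) * ennreal (norm (Vb z - Vb (t, snd z)) powr p)) * indicator ?S z"
        using Vae Pae AE_lborel_snd[OF Vt]
      proof eventually_elim
        case (elim z)
        show ?case
        proof (cases "z \<in> ?S")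
          case True
          then have zQ: "z \<in> ?Q" using SQ by blast
          obtain s x where z: "z = (s, x)" by (cases z)
          have xB: "x \<in> B1" using True z by simp
          have eqs: "V s x = Vb z" "P z = Pb z" "V t x = Vb (t, x)"
            using elim zQ xB by (auto simp: z VQ_def)
          have mono: "0 \<le> (flux p (G1 s x) - flux p (G2 s x)) \<bullet> V s x"
            unfolding V_def using flux_monotone[OF p, of "G1 s x" "G2 s x"] deriv_ramp_nonneg by simp
          have cs: "flux p v \<bullet> w \<le> \<eta> powr p * norm v powr p + \<eta> powr (p * (1 - p)) * norm w powr p" for v w :: "real ^ 'n"
            using norm_cauchy_schwarz[of "flux p v" w] young_powr[of "norm v" "norm w" p \<eta>] p \<eta> by (simp add: norm_flux)
          have "(flux p (G2 s x) - flux p (G1 s x)) \<bullet> V t x \<le> flux p (G2 s x) \<bullet> (V t x - V s x) + flux p (G1 s x) \<bullet> (V s x - V t x)"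
            using mono by (simp add: inner_diff_left inner_diff_right)
          also have "\<dots> \<le> \<eta> powr p * P z + 2 * \<eta> powr (p * (1 - p)) * norm (V s x - V t x) powr p"
            using cs[of "G2 s x" "V t x - V s x"] cs[of "G1 s x" "V s x - V t x"]
            by (simp add: P_def z norm_minus_commute algebra_simps)
          finally have "ennreal ((flux p (G2 s x) - flux p (G1 s x)) \<bullet> V t x) \<le> ennreal (\<eta> powr p * Pb z + 2 * \<eta> powr (p * (1 - p)) * norm (Vb z - Vb (t, x)) powr p)"
            unfolding eqs by (rule ennreal_leI)
          also have "0 \<le> Pb z" using eqs(2) by (simp add: P_def flip: eqs(2))
          then have "ennreal (\<eta> powr p * Pb z + 2 * \<eta> powr (p * (1 - p)) * norm (Vb z - Vb (t, x)) powr p)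
            = ennreal (\<eta> powr p) * ennreal (Pb z) + ennreal (2 * \<eta> powr (p * (1 - p))) * ennreal (norm (Vb z - Vb (t, x)) powr p)"
            by (simp add: ennreal_plus ennreal_mult)
          finally show ?thesis using True by (simp add: z)
        qed simp
      qed
    qed
    also have "\<dots> = (\<integral>\<^sup>+s. \<integral>\<^sup>+x. (ennreal (\<eta> powr p) * ennreal (Pb (s, x)) + ennreal (2 * \<eta> powr (p * (1 - p))) * ennreal (norm (Vb (s, x) - Vb (t, x)) powr p))
       * indicator B1 x * indicator {max (-1) (t - h)<..<t} s * indicator {-1<..<b} t \<partial>lborel \<partial>lborel)"
    proof -
      have [measurable]: "?S \<in> sets borel" by (simp add: borel_prod[symmetric])
      have [measurable]: "(\<lambda>z :: real \<times> (real ^ 'n). Vb (t, snd z)) \<in> borel_measurable borel"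
        by (intro measurable_compose[OF _ Vb] borel_measurable_continuous_onI continuous_intros)
      show ?thesis
        by (subst nn_integral_lborel_slices, measurable)
          (intro nn_integral_cong, use t in \<open>auto simp: indicator_def\<close>)
    qed
    finally show ?thesis by (simp add: add_left_mono)
  qed
  have "E b = 0"
  proof (rule vanishes_of_small_mean_increments[OF b contE E0 initE])
    fix \<epsilon> :: real assume \<epsilon>: "0 < \<epsilon>"
    \<comment> \<open>\<eta> makes the gradient term at most \<epsilon>h/2. The tolerance
      \<epsilon>/(2K) in mean continuity, with K the large Young factor, then does the same for the
      oscillation term.\<close>
    define \<eta> where "\<eta> = (\<epsilon> / (2 * (PPr + 1))) powr (1 / p)"
    have \<eta>: "\<eta> > 0" using \<epsilon> PPr by (simp add: \<eta>_def)
    have "\<eta> powr p * PPr = \<epsilon> / 2 * (PPr / (PPr + 1))" using \<epsilon> PPr p by (simp add: \<eta>_def powr_powr)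
    also have "\<dots> \<le> \<epsilon> / 2 * 1" using \<epsilon> PPr by (intro mult_left_mono) auto
    finally have \<eta>P: "\<eta> powr p * PPr \<le> \<epsilon> / 2" by simp
    define K where "K = 2 * \<eta> powr (p * (1 - p))"
    have K: "K > 0" using \<eta> by (simp add: K_def)
    obtain h0 where h0: "h0 > 0" "\<And>h. 0 < h \<Longrightarrow> h < h0 \<Longrightarrow>
      (\<integral>\<^sup>+t. \<integral>\<^sup>+s. \<integral>\<^sup>+x. ennreal (norm (Vb (s, x) - Vb (t, x)) powr p) * indicator B1 x
        * indicator {max (-1) (t - h)<..<t} s * indicator {-1<..<b} t \<partial>lborel \<partial>lborel \<partial>lborel) \<le> ennreal (\<epsilon> / (2 * K) * h)"
      using Lp_mean_continuity[OF Vb LVb p, of "\<epsilon> / (2 * K)"] \<epsilon> K b by auto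
    show "\<exists>h0>0. \<forall>h. 0 < h \<and> h < h0 \<longrightarrow> (\<exists>R\<in>borel_measurable lborel.
       (AE t in lborel. -1 + h < t \<and> t < b \<longrightarrow> ennreal (E t) \<le> ennreal (E (t - h)) + R t) \<and>
       (\<integral>\<^sup>+t. R t * indicator {-1 + h<..<b} t \<partial>lborel) \<le> ennreal (\<epsilon> * h))"
    proof (intro exI[of _ h0] conjI h0(1) allI impI, elim conjE)
      fix h :: real assume h: "0 < h" "h < h0"
      let ?I = "\<lambda>t s. indicator {max (-1) (t - h)<..<t} s * indicator {-1<..<b} t :: ennreal"
      let ?J = "\<lambda>t s. indicator {t. t < b} t * (indicator {t. -1 < t} s * (indicator {t. t < h} (t - s) * indicator {t. 0 < t} (t - s))) :: ennreal"
      have IJ: "?I t s = ?J t s" for t s by (auto simp: indicator_def)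
      have [measurable]: "(\<lambda>x. ?I (f x) (g x)) \<in> borel_measurable N" if [measurable]: "f \<in> borel_measurable N" "g \<in> borel_measurable N" for N :: "'z measure" and f g
        unfolding IJ by measurable
      have [measurable]: "B1 \<in> sets (borel :: (real ^ 'n) measure)" by auto
      define k where "k = (\<lambda>s. \<integral>\<^sup>+x. ennreal (Pb (s, x)) * indicator B1 x \<partial>lborel)"
      define q where "q = (\<lambda>t s. \<integral>\<^sup>+x. ennreal (norm (Vb (s, x) - Vb (t, x)) powr p) * indicator B1 x \<partial>lborel)"
      have [measurable]: "k \<in> borel_measurable borel" unfolding k_def by measurable
      have [measurable]: "(\<lambda>x. q (f x) (g x)) \<in> borel_measurable N" if [measurable]: "f \<in> borel_measurable N" "g \<in> borel_measurable N" for N :: "'z measure" and f g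
        unfolding q_def by measurable
      define R where "R = (\<lambda>t. \<integral>\<^sup>+s. (ennreal (\<eta> powr p) * k s + ennreal K * q t s) * ?I t s \<partial>lborel)"
      have Rm: "R \<in> borel_measurable lborel" unfolding R_def by measurable
      have Req: "(\<integral>\<^sup>+s. \<integral>\<^sup>+x. (ennreal (\<eta> powr p) * ennreal (Pb (s, x)) + ennreal (2 * \<eta> powr (p * (1 - p))) * ennreal (norm (Vb (s, x) - Vb (t, x)) powr p))
       * indicator B1 x * indicator {max (-1) (t - h)<..<t} s * indicator {-1<..<b} t \<partial>lborel \<partial>lborel) = R t" for t
        unfolding R_def
      proof (rule nn_integral_cong)
        fix s
        have "(\<integral>\<^sup>+x. (ennreal (\<eta> powr p) * ennreal (Pb (s, x)) + ennreal (2 * \<eta> powr (p * (1 - p))) * ennreal (norm (Vb (s, x) - Vb (t, x)) powr p))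
           * indicator B1 x * indicator {max (-1) (t - h)<..<t} s * indicator {-1<..<b} t \<partial>lborel)
          = (\<integral>\<^sup>+x. (ennreal (\<eta> powr p) * (ennreal (Pb (s, x)) * indicator B1 x) + ennreal K * (ennreal (norm (Vb (s, x) - Vb (t, x)) powr p) * indicator B1 x)) * ?I t s \<partial>lborel)"
          by (intro nn_integral_cong) (auto simp: indicator_def K_def)
        also have "\<dots> = (ennreal (\<eta> powr p) * k s + ennreal K * q t s) * ?I t s"
          unfolding k_def q_def
          by (subst nn_integral_multc, measurable, subst nn_integral_add, measurable, subst nn_integral_cmult, measurable, subst nn_integral_cmult, measurable)
        finally show "(\<integral>\<^sup>+x. (ennreal (\<eta> powr p) * ennreal (Pb (s, x)) + ennreal (2 * \<eta> powr (p * (1 - p))) * ennreal (norm (Vb (s, x) - Vb (t, x)) powr p))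
           * indicator B1 x * indicator {max (-1) (t - h)<..<t} s * indicator {-1<..<b} t \<partial>lborel) = (ennreal (\<eta> powr p) * k s + ennreal K * q t s) * ?I t s" .
      qed
      have kint: "(\<integral>\<^sup>+s. k s \<partial>lborel) \<le> ennreal PPr"
      proof -
        have "(\<integral>\<^sup>+s. k s \<partial>lborel) \<le> (\<integral>\<^sup>+s. \<integral>\<^sup>+x. ennreal (Pb (s, x)) \<partial>lborel \<partial>lborel)"
          unfolding k_def by (intro nn_integral_mono) (auto simp: indicator_def)
        also have "\<dots> = PP" unfolding PP_def by (rule nn_integral_lborel_slices[symmetric]) measurable
        finally show ?thesis by (simp add: PPr)
      qed
      have hI': "(\<integral>\<^sup>+t. ?I t s \<partial>lborel) \<le> ennreal h" for s
      proof -
        have "(\<integral>\<^sup>+t. ?I t s \<partial>lborel) \<le> (\<integral>\<^sup>+t. indicator {s<..<s+h} t \<partial>lborel)"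
          by (intro nn_integral_mono) (auto simp: indicator_def)
        also have "\<dots> = ennreal h" using h by simp
        finally show ?thesis .
      qed
      have A1: "(\<integral>\<^sup>+t. \<integral>\<^sup>+s. k s * ?I t s \<partial>lborel \<partial>lborel) \<le> ennreal PPr * ennreal h"
      proof -
        have "(\<integral>\<^sup>+t. \<integral>\<^sup>+s. k s * ?I t s \<partial>lborel \<partial>lborel) = (\<integral>\<^sup>+s. \<integral>\<^sup>+t. k s * ?I t s \<partial>lborel \<partial>lborel)"
          by (rule lborel_pair.Fubini') measurable
        also have "\<dots> = (\<integral>\<^sup>+s. k s * (\<integral>\<^sup>+t. ?I t s \<partial>lborel) \<partial>lborel)"
          by (intro nn_integral_cong nn_integral_cmult) measurable
        also have "\<dots> \<le> (\<integral>\<^sup>+s. k s * ennreal h \<partial>lborel)"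
          by (intro nn_integral_mono mult_left_mono hI') auto
        also have "\<dots> = (\<integral>\<^sup>+s. k s \<partial>lborel) * ennreal h"
          by (rule nn_integral_multc) measurable
        also have "\<dots> \<le> ennreal PPr * ennreal h" by (intro mult_right_mono kint) auto
        finally show ?thesis .
      qed
      have A2: "(\<integral>\<^sup>+t. \<integral>\<^sup>+s. q t s * ?I t s \<partial>lborel \<partial>lborel) \<le> ennreal (\<epsilon> / (2 * K) * h)"
      proof -
        have "(\<integral>\<^sup>+t. \<integral>\<^sup>+s. q t s * ?I t s \<partial>lborel \<partial>lborel) = (\<integral>\<^sup>+t. \<integral>\<^sup>+s. \<integral>\<^sup>+x. ennreal (norm (Vb (s, x) - Vb (t, x)) powr p) * indicator B1 x
        * indicator {max (-1) (t - h)<..<t} s * indicator {-1<..<b} t \<partial>lborel \<partial>lborel \<partial>lborel)"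
          unfolding q_def mult.assoc[of "_ * indicator B1 _"]
          by (intro nn_integral_cong nn_integral_multc[symmetric]) measurable
        then show ?thesis using h0(2)[OF h] by simp
      qed
      have "(\<integral>\<^sup>+t. R t * indicator {-1 + h<..<b} t \<partial>lborel) \<le> (\<integral>\<^sup>+t. R t \<partial>lborel)"
        by (intro nn_integral_mono) (auto simp: indicator_def)
      also have "\<dots> = ennreal (\<eta> powr p) * (\<integral>\<^sup>+t. \<integral>\<^sup>+s. k s * ?I t s \<partial>lborel \<partial>lborel) + ennreal K * (\<integral>\<^sup>+t. \<integral>\<^sup>+s. q t s * ?I t s \<partial>lborel \<partial>lborel)"
      proof -
        have "R t = ennreal (\<eta> powr p) * (\<integral>\<^sup>+s. k s * ?I t s \<partial>lborel) + ennreal K * (\<integral>\<^sup>+s. q t s * ?I t s \<partial>lborel)" for t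
          unfolding R_def distrib_right mult.assoc
          by (subst nn_integral_add, measurable, subst nn_integral_cmult, measurable, subst nn_integral_cmult, measurable)
        then show ?thesis
          by (simp only:) (subst nn_integral_add, measurable, subst nn_integral_cmult, measurable, subst nn_integral_cmult, measurable)
      qed
      also have "\<dots> \<le> ennreal (\<eta> powr p) * (ennreal PPr * ennreal h) + ennreal K * ennreal (\<epsilon> / (2 * K) * h)"
        by (intro add_mono mult_left_mono A1 A2) auto
      also have "\<dots> = ennreal (\<eta> powr p * PPr * h + K * (\<epsilon> / (2 * K) * h))"
        using h K \<epsilon> PPr by (simp add: ennreal_mult[symmetric] ennreal_plus[symmetric] mult.assoc del: ennreal_plus)
      also have "\<dots> \<le> ennreal (\<epsilon> * h)"
      proof (rule ennreal_leI)
        have "\<eta> powr p * PPr * h \<le> \<epsilon> / 2 * h" using \<eta>P h by (intro mult_right_mono) auto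
        then show "\<eta> powr p * PPr * h + K * (\<epsilon> / (2 * K) * h) \<le> \<epsilon> * h" using K by (simp add: field_simps)
      qed
      finally have Rint: "(\<integral>\<^sup>+t. R t * indicator {-1 + h<..<b} t \<partial>lborel) \<le> ennreal (\<epsilon> * h)" .
      have "AE t in lborel. -1 + h < t \<and> t < b \<longrightarrow> ennreal (E t) \<le> ennreal (E (t - h)) + R t"
        using Vslice tr'
      proof eventually_elim
        case (elim t)
        show ?case
        proof
          assume t: "-1 + h < t \<and> t < b"
          then have tt: "t \<in> {-1<..<b}" using h by auto
          then have v: "AE x in lborel. x \<in> B1 \<longrightarrow> V t x = Vb (t, x)" and h12: "has_trace p (u1 t) (G1 t) \<phi>1" "has_trace p (u2 t) (G2 t) \<phi>2"
            using elim by blast+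
          show "ennreal (E t) \<le> ennreal (E (t - h)) + R t"
            using incr[OF tt _ h(1) \<eta> v h12] t unfolding Req by simp
        qed
      qed
      with Rm Rint show "\<exists>R\<in>borel_measurable lborel. (AE t in lborel. -1 + h < t \<and> t < b \<longrightarrow> ennreal (E t) \<le> ennreal (E (t - h)) + R t) \<and>
       (\<integral>\<^sup>+t. R t * indicator {-1 + h<..<b} t \<partial>lborel) \<le> ennreal (\<epsilon> * h)" by blast
    qed
  qed
  \<comment> \<open>The integral of a nonnegative function vanishes; \<open>conv\<close> is positive
    on positive arguments, so Y b has no positive values off a null set.\<close>
  then have "AE x in ?M. conv (Y b x) = 0"
    unfolding E_def using integral_nonneg_eq_0_iff_AE[OF ic[of b]] b by (simp add: conv_nonneg)
  then show ?thesis
  proof eventually_elim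
    case (elim x)
    then have "Y b x \<le> 0" using conv_pos[of "Y b x"] by fastforce
    then show ?case by (simp add: Y_def \<kappa>_def)
  qed
qed

section \<open>Weak solutions and their rescalings\<close>

lemma measurable_snd_ball:
  fixes \<psi> :: "real ^ 'n \<Rightarrow> 'b::euclidean_space"
  assumes "\<psi> \<in> borel_measurable (lebesgue_on B1)"
  shows "(\<lambda>z :: real \<times> (real ^ 'n). indicator B1 (snd z) *\<^sub>R \<psi> (snd z)) \<in> borel_measurable lebesgue"
proof -
  have "(\<lambda>x. indicator B1 x *\<^sub>R \<psi> x) \<in> borel_measurable lebesgue"
    using assms by (simp add: borel_measurable_restrict_space_iff)
  then obtain g where g: "g \<in> borel_measurable borel" "AE x in lborel. indicator B1 x *\<^sub>R \<psi> x = g x"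
    using lebesgue_borel_rep by blast
  show ?thesis
  proof (rule lebesgue_measurable_of_AE_borel[where g = "\<lambda>z. g (snd z)"])
    show "(\<lambda>z :: real \<times> (real ^ 'n). g (snd z)) \<in> borel_measurable borel"
      by (intro measurable_compose[OF _ g(1)] borel_measurable_continuous_onI continuous_intros)
  qed (rule AE_lborel_snd[OF g(2)])
qed

text \<open>Fubini for a Borel representative of the extension by zero, which splits into an
  indicator of time and a function of space.\<close>

lemma integral_snd_slab:
  fixes k :: "real ^ 'n \<Rightarrow> real"
  assumes k: "integrable (lebesgue_on B1) k" and ab: "a < b"
  shows "(LINT z|lebesgue_on ({a<..<b} \<times> B1). k (snd z)) = (b - a) * (LINT x|lebesgue_on B1. k x)"
proof -
  let ?k = "\<lambda>x. indicator B1 x *\<^sub>R k x"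
  let ?Q = "{a<..<b} \<times> (B1 :: (real ^ 'n) set)"
  have L1: "Lp_fun 1 (lebesgue_on B1) k" using k by (auto simp: Lp_fun_def)
  have "integrable (lebesgue_on ?Q) (\<lambda>z. k (snd z))"
    using Lp_fun_integrable_norm[OF Lp_fun_snd[OF L1]] by (simp add: finite_measure_lebesgue_on)
  then have iQ: "integrable lebesgue (\<lambda>z. indicator ?Q z *\<^sub>R k (snd z))"
    by (simp add: integrable_restrict_space)
  obtain g where g: "g \<in> borel_measurable borel" "AE x in lborel. ?k x = g x"
    using lebesgue_borel_rep[of ?k] borel_measurable_integrable[OF k] by (auto simp: borel_measurable_restrict_space_iff)
  note [measurable] = g(1)
  define h where "h = (\<lambda>z :: real \<times> (real ^ 'n). indicator {a<..<b} (fst z) *\<^sub>R g (snd z))"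
  have hm: "h \<in> borel_measurable borel"
    unfolding h_def by (intro borel_measurable_scaleR measurable_compose[OF _ g(1)] measurable_compose[of fst _ borel "indicator {a<..<b}"]
        borel_measurable_continuous_onI continuous_intros borel_measurable_indicator) auto
  have ae: "AE z in lborel. indicator ?Q z *\<^sub>R k (snd z) = h z"
    using AE_lborel_snd[OF g(2)]
  proof eventually_elim
    case (elim z)
    have "indicator ?Q z = (indicator {a<..<b} (fst z) * indicator B1 (snd z) :: real)" by (cases z) (simp add: indicator_times)
    then show ?case using elim by (simp add: h_def)
  qed
  have aeL: "AE z in lebesgue. indicator ?Q z *\<^sub>R k (snd z) = h z" using ae by (rule AE_completion)
  have hmL: "h \<in> borel_measurable lebesgue" using hm by (intro measurable_completion) simp
  have "integrable lebesgue h"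
    by (rule integrable_cong_AE_imp[OF iQ hmL]) (use aeL in auto)
  then have hi: "integrable lborel h" using hm by (simp add: integrable_completion)
  have "(LINT z|lebesgue_on ?Q. k (snd z)) = (LINT z|lebesgue. indicator ?Q z *\<^sub>R k (snd z))"
    by (simp add: integral_restrict_space)
  also have "\<dots> = (LINT z|lebesgue. h z)"
    using borel_measurable_integrable[OF iQ] hmL aeL by (rule integral_cong_AE)
  also have "\<dots> = (LINT z|lborel. h z)" using hm by (simp add: integral_completion)
  also have "\<dots> = (LINT t|lborel. LINT x|lborel. h (t, x))"
    using lborel_pair.integral_fst'[of h] hi by (simp add: lborel_prod)
  also have "\<dots> = (LINT t|lborel. indicator {a<..<b} t * (LINT x|lborel. g x))" by (simp add: h_def)
  also have "\<dots> = (b - a) * (LINT x|lborel. g x)" using ab by simp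
  also have "(LINT x|lborel. g x) = (LINT x|lebesgue. g x)" by (simp add: integral_completion)
  also have "\<dots> = (LINT x|lebesgue. ?k x)"
    by (rule integral_cong_AE) (use borel_measurable_integrable[OF k] AE_completion[OF g(2)] g(1) in
        \<open>auto simp: borel_measurable_restrict_space_iff eq_commute intro: measurable_completion\<close>)
  also have "\<dots> = (LINT x|lebesgue_on B1. k x)" by (simp add: integral_restrict_space)
  finally show ?thesis .
qed

text \<open>That the weak time derivative is zero is invariance under translation in the direction
  (1, 0). With such test functions the term pairing u with a time derivative drops out of the weak
  formulation.\<close>

lemma W12_L2_time_independent:
  fixes \<psi> :: "real ^ 'n \<Rightarrow> real"
  assumes L: "Lp_fun 2 (lebesgue_on B1) \<psi>"
  shows "W12_L2 (\<lambda>t. \<psi>) (\<lambda>t x. 0)"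
proof -
  have LC: "Lp_fun 2 (lebesgue_on ({a<..<b} \<times> B1)) (\<lambda>z. \<psi> (snd z))" for a b :: real by (rule Lp_fun_snd[OF L])
  \<comment> \<open>Extended to all times instead of being cut to \<open>Cyl\<close>, so that it is
    invariant under every time shift; the test function restores the restriction.\<close>
  define g where "g = (\<lambda>z :: real \<times> (real ^ 'n). indicator B1 (snd z) *\<^sub>R \<psi> (snd z))"
  have gm[measurable]: "g \<in> borel_measurable lebesgue"
    unfolding g_def by (rule measurable_snd_ball) (rule Lp_fun_measurable[OF L])
  have gi: "set_integrable lebesgue (cball 0 R) g" for R
  proof -
    let ?Q = "{-R-1<..<R+1} \<times> (B1 :: (real ^ 'n) set)"
    have "integrable (lebesgue_on ?Q) (\<lambda>z. \<psi> (snd z))"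
      using Lp_fun_integrable_norm[OF LC] by (simp add: finite_measure_lebesgue_on)
    then have i: "integrable lebesgue (\<lambda>z. indicator ?Q z *\<^sub>R \<psi> (snd z))" by (simp add: integrable_restrict_space)
    show ?thesis
      unfolding set_integrable_def
    proof (rule Bochner_Integration.integrable_bound[OF i])
      show "(\<lambda>z. indicat_real (cball 0 R) z *\<^sub>R g z) \<in> borel_measurable lebesgue"
        by (intro borel_measurable_scaleR borel_measurable_indicator gm) (simp add: lmeasurable_cball fmeasurableD)
      show "AE z in lebesgue. norm (indicat_real (cball 0 R) z *\<^sub>R g z) \<le> norm (indicat_real ?Q z *\<^sub>R \<psi> (snd z))"
      proof (rule AE_I2)
        fix z :: "real \<times> (real ^ 'n)"
        have "\<bar>fst z\<bar> \<le> norm z" using norm_fst_le[of "fst z" "snd z"] by simp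
        then have "z \<in> cball 0 R \<Longrightarrow> snd z \<in> B1 \<Longrightarrow> z \<in> ?Q" by (cases z) auto
        then show "norm (indicat_real (cball 0 R) z *\<^sub>R g z) \<le> norm (indicat_real ?Q z *\<^sub>R \<psi> (snd z))"
          by (auto simp: g_def indicator_def)
      qed
    qed
  qed
  have "weak_deriv Cyl (1, 0) (\<lambda>(t, x). \<psi> x) (\<lambda>(t, x). 0)"
    unfolding weak_deriv_def
  proof (intro conjI allI impI)
    show "locally_integrable_on (\<lambda>(t, x). \<psi> x) Cyl"
      using Lp_fun_locally_integrable[OF LC, of "-1" 0] by (simp add: case_prod_beta')
    show "locally_integrable_on (\<lambda>(t, x). 0) Cyl"
      using Lp_fun_locally_integrable[of 2 Cyl "\<lambda>_. 0"] by (simp add: case_prod_beta')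
    fix \<zeta> :: "real \<times> (real ^ 'n) \<Rightarrow> real" assume \<zeta>: "test_fun Cyl \<zeta>"
    have d0: "frechet_derivative \<zeta> (at z) (1, 0) = 0" if "z \<notin> Cyl" for z
      using that test_fun_deriv_outside[OF \<zeta>, of z] \<zeta> unfolding test_fun_def by blast
    have "(LINT z:Cyl|lebesgue. (case z of (t, x) \<Rightarrow> \<psi> x) * frechet_derivative \<zeta> (at z) (1, 0))
      = (LINT z|lebesgue. g z * frechet_derivative \<zeta> (at z) (1, 0))"
      unfolding set_lebesgue_integral_def
    proof (rule Bochner_Integration.integral_cong)
      fix z :: "real \<times> (real ^ 'n)"
      show "indicat_real Cyl z *\<^sub>R ((case z of (t, x) \<Rightarrow> \<psi> x) * frechet_derivative \<zeta> (at z) (1, 0)) = g z * frechet_derivative \<zeta> (at z) (1, 0)"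
        using d0[of z] by (cases "z \<in> Cyl"; cases z) (auto simp: g_def)
    qed simp
    also have "\<dots> = 0"
      by (rule integral_test_fun_deriv_eq_0[OF \<zeta> gm gi]) (simp add: g_def)
    finally show "(LINT z:Cyl|lebesgue. (case z of (t, x) \<Rightarrow> \<psi> x) * frechet_derivative \<zeta> (at z) (1, 0))
      = - (LINT z:Cyl|lebesgue. (case z of (t, x) \<Rightarrow> 0) * \<zeta> z)"
      by (simp add: case_prod_beta')
  qed
  then show ?thesis
    using L LC[of "-1" 0] by (auto simp: W12_L2_def C_L2_def weak_time_deriv_def case_prod_beta')
qed

lemma Lp_W1p_0_time_independent:
  fixes \<psi> :: "real ^ 'n \<Rightarrow> real"
  assumes "W1p_0 p \<psi> D\<psi>" shows "Lp_W1p_0 p (\<lambda>t. \<psi>) (\<lambda>t. D\<psi>)"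
proof -
  have "W1p p \<psi> D\<psi>" using assms by (simp add: W1p_0_def)
  then have "Lp_fun p (lebesgue_on B1) \<psi>" "Lp_fun p (lebesgue_on B1) D\<psi>" by (auto simp: W1p_def)
  from Lp_fun_snd[OF this(1), of "-1" 0] Lp_fun_snd[OF this(2), of "-1" 0] \<open>W1p p \<psi> D\<psi>\<close> assms
  show ?thesis by (simp add: Lp_W1p_0_def Lp_W1p_def case_prod_beta')
qed

text \<open>Freezing the test function in time is all that the comparison argument asks for. The
  source integral over a slab then factors into the length of the time interval and a space
  integral.\<close>

lemma weak_solution_slab_sol:
  fixes f \<phi> :: "real ^ 'n \<Rightarrow> real"
  assumes p: "1 < p" and f: "f \<in> borel_measurable (lebesgue_on B1)" "AE x in lebesgue_on B1. \<bar>f x\<bar> \<le> B"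
    and sol: "weak_solution p f \<phi> u"
  obtains Du where "slab_sol p 0 f \<phi> u Du"
proof -
  obtain Du where C: "C_L2 u" and Du: "Lp_W1p p u Du" and weak: "\<And>t1 t2 v vt Dv. -1 \<le> t1 \<Longrightarrow> t1 < t2 \<Longrightarrow> t2 \<le> 0 \<Longrightarrow> W12_L2 v vt \<Longrightarrow> Lp_W1p_0 p v Dv \<Longrightarrow>
           (LINT x:B1|lebesgue. u t2 x * v t2 x) - (LINT x:B1|lebesgue. u t1 x * v t1 x)
           + (LINT (t, x):{t1<..<t2} \<times> B1|lebesgue.
                - u t x * vt t x + (norm (Du t x) powr (p - 2) *\<^sub>R Du t x) \<bullet> Dv t x)
           = (LINT (t, x):{t1<..<t2} \<times> B1|lebesgue. f x * v t x)"
    and init: "AE x in lebesgue_on B1. u (-1) x = \<phi> x"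
    and tr: "AE t in lebesgue_on {-1<..<0}. has_trace p (u t) (Du t) \<phi>"
    using sol unfolding weak_solution_def by blast
  have "slab_sol p 0 f \<phi> u Du"
    unfolding slab_sol_def
  proof (intro conjI allI impI)
    show "\<forall>t\<in>{-1..0}. Lp_fun 2 (lebesgue_on B1) (u t)"
      "\<forall>t\<in>{-1..0}. ((\<lambda>s. LINT x|lebesgue_on B1. (u s x - u t x)\<^sup>2) \<longlongrightarrow> 0) (at t within {-1..0})"
      using C unfolding C_L2_def by blast+
    show "(\<lambda>z. u (fst z) (snd z)) \<in> borel_measurable (lebesgue_on Cyl)" "Lp_fun p (lebesgue_on Cyl) (\<lambda>z. Du (fst z) (snd z))"
      using Du unfolding Lp_W1p_def by (auto simp: case_prod_beta' Lp_fun_def)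
    show "AE x in lebesgue_on B1. u (-1) x = \<phi> x" "AE t in lebesgue_on {-1<..<0}. has_trace p (u t) (Du t) \<phi>"
      by fact+
    fix s t :: real and \<psi> :: "real ^ 'n \<Rightarrow> real" and D\<psi> assume as: "-1 \<le> s \<and> s < t \<and> t \<le> 0 \<and> W1p_0 p \<psi> D\<psi> \<and> Lp_fun 2 (lebesgue_on B1) \<psi>"
    have i\<psi>: "integrable (lebesgue_on B1) \<psi>" using as by (auto intro: Lp_fun_integrable_norm[of 2] finite_measure_B1)
    have "integrable (lebesgue_on B1) (\<lambda>x. \<psi> x * f x)" by (rule integrable_bounded_mult[OF i\<psi> f])
    then have if\<psi>: "integrable (lebesgue_on B1) (\<lambda>x. f x * \<psi> x)" by (simp add: mult.commute)
    have "(LINT (r, x):{s<..<t} \<times> B1|lebesgue. f x * \<psi> x) = (LINT z|lebesgue_on ({s<..<t} \<times> B1). f (snd z) * \<psi> (snd z))"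
      by (simp add: LINT_lebesgue_on case_prod_beta')
    also have "\<dots> = (t - s) * (LINT x|lebesgue_on B1. f x * \<psi> x)" using integral_snd_slab[OF if\<psi>] as by simp
    finally have r: "(LINT (r, x):{s<..<t} \<times> B1|lebesgue. f x * \<psi> x) = (t - s) * (LINT x|lebesgue_on B1. f x * \<psi> x)" .
    show "(LINT x|lebesgue_on B1. u t x * \<psi> x) - (LINT x|lebesgue_on B1. u s x * \<psi> x)
        + (LINT z|lebesgue_on ({s<..<t} \<times> B1). flux p (Du (fst z) (snd z)) \<bullet> D\<psi> (snd z))
        = (t - s) * (LINT x|lebesgue_on B1. f x * \<psi> x)"
      using weak[OF _ _ _ W12_L2_time_independent Lp_W1p_0_time_independent, of s t \<psi> D\<psi>] as r
      by (simp add: LINT_lebesgue_on case_prod_beta' flux_def)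
  qed
  then show thesis by (rule that)
qed

section \<open>Affine changes of time\<close>

lemma lebesgue_time_affine:
  fixes \<mu> \<beta> :: real
  assumes \<mu>: "0 < \<mu>"
  defines "T \<equiv> (\<lambda>z :: real \<times> 'b::euclidean_space. (\<beta> + \<mu> * fst z, snd z))"
  shows "T \<in> lebesgue \<rightarrow>\<^sub>M lebesgue" (is ?m)
    and "lebesgue = density (distr lebesgue lebesgue T) (\<lambda>_. ennreal \<mu>)" (is ?d)
proof -
  \<comment> \<open>The only basis vector with zero space component is (1, 0), so just the time axis
    is stretched and the determinant is \<mu>.\<close>
  define c where "c = (\<lambda>j :: real \<times> 'b. if snd j = 0 then \<mu> else 1)"
  have c: "c j \<noteq> 0" for j using \<mu> by (simp add: c_def)
  have B: "(\<Sum>j\<in>Basis. f j) = f (1, 0) + (\<Sum>i\<in>Basis. f (0, i))" for f :: "real \<times> 'b \<Rightarrow> real \<times> 'b"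
    by (simp add: sum_Basis_prod_eq)
  have T: "(\<lambda>z. (\<beta>, 0) + (\<Sum>j\<in>Basis. (c j * (z \<bullet> j)) *\<^sub>R j)) = T"
  proof
    fix z :: "real \<times> 'b"
    have "(\<Sum>i\<in>Basis. (c (0, i) * (z \<bullet> (0, i))) *\<^sub>R (0 :: real, i)) = (\<Sum>i\<in>Basis. (0 :: real, (snd z \<bullet> i) *\<^sub>R i))"
      by (intro sum.cong) (auto simp: c_def inner_prod_def nonzero_Basis)
    also have "\<dots> = (0, snd z)" by (simp add: sum_prod euclidean_representation)
    finally show "(\<beta>, 0) + (\<Sum>j\<in>Basis. (c j * (z \<bullet> j)) *\<^sub>R j) = T z"
      by (simp add: B c_def T_def inner_prod_def)
  qed
  have "(\<Prod>j\<in>Basis. \<bar>c j\<bar>) = \<mu>"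
  proof -
    have "(\<Prod>j\<in>(Basis :: (real \<times> 'b) set). \<bar>c j\<bar>) = (\<Prod>j\<in>{(1, 0)}. \<bar>c j\<bar>)"
      by (rule prod.mono_neutral_right) (auto simp: c_def Basis_prod_def nonzero_Basis)
    then show ?thesis using \<mu> by (simp add: c_def)
  qed
  with lebesgue_affine_euclidean[of c "(\<beta>, 0)", OF c] lebesgue_affine_measurable[of c "(\<beta>, 0)", OF c]
  show ?m ?d unfolding T by simp_all
qed

lemma integral_time_affine:
  fixes \<mu> \<beta> :: real and f :: "real \<times> 'b::euclidean_space \<Rightarrow> real"
  assumes \<mu>: "0 < \<mu>" and f: "f \<in> borel_measurable lebesgue"
  shows "(LINT z|lebesgue. f z) = \<mu> * (LINT z|lebesgue. f (\<beta> + \<mu> * fst z, snd z))"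
    and "integrable lebesgue f \<Longrightarrow> integrable lebesgue (\<lambda>z. f (\<beta> + \<mu> * fst z, snd z))"
proof -
  let ?T = "\<lambda>z :: real \<times> 'b. (\<beta> + \<mu> * fst z, snd z)"
  note T = lebesgue_time_affine[OF \<mu>, where \<beta> = \<beta> and 'b = 'b]
  have fd: "f \<in> borel_measurable (distr lebesgue lebesgue ?T)" using f by simp
  have "(LINT z|lebesgue. f z) = (LINT z|density (distr lebesgue lebesgue ?T) (\<lambda>_. ennreal \<mu>). f z)"
    using T(2) by simp
  also have "\<dots> = \<mu> * (LINT z|distr lebesgue lebesgue ?T. f z)"
    using \<mu> fd by (subst integral_density) auto
  also have "(LINT z|distr lebesgue lebesgue ?T. f z) = (LINT z|lebesgue. f (?T z))"
    by (rule integral_distr[OF T(1) f])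
  finally show "(LINT z|lebesgue. f z) = \<mu> * (LINT z|lebesgue. f (\<beta> + \<mu> * fst z, snd z))" .
  assume "integrable lebesgue f"
  then have "integrable (density (distr lebesgue lebesgue ?T) (\<lambda>_. ennreal \<mu>)) f" using T(2) by simp
  then have "integrable (distr lebesgue lebesgue ?T) (\<lambda>z. \<mu> *\<^sub>R f z)"
    using \<mu> fd by (subst (asm) integrable_density) auto
  then have "integrable (distr lebesgue lebesgue ?T) f" using \<mu> by simp
  then show "integrable lebesgue (\<lambda>z. f (\<beta> + \<mu> * fst z, snd z))"
    by (subst (asm) integrable_distr_eq[OF T(1) f])
qed

lemma has_trace_scale:
  fixes g h :: "real ^ 'n \<Rightarrow> real"
  assumes p: "1 < p" and tr: "has_trace p g G h"
  shows "has_trace p (\<lambda>x. j * g x) (\<lambda>x. j *\<^sub>R G x) (\<lambda>x. j * h x)"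
proof -
  obtain w where w: "\<And>k. smooth (w k)" "Lp_tendsto p (lebesgue_on B1) w g" "Lp_tendsto p (lebesgue_on B1) (\<lambda>k. grad (w k)) G"
      "Lp_tendsto p surface_measure w h" and W: "W1p p g G"
    using tr unfolding has_trace_def by blast
  have sw: "smooth (\<lambda>x. j * w k x)" for k by (intro smooth_mult smooth_const w)
  have gw: "grad (\<lambda>x. j * w k x) = (\<lambda>x. j *\<^sub>R grad (w k) x)" for k
    using grad_mult[OF smooth_const w(1), of j k] by (auto simp: grad_eqI[of "\<lambda>x. j" 0])
  have "W1p p (\<lambda>x. j * g x) (\<lambda>x. j *\<^sub>R G x)"
  proof -
    have li: "locally_integrable_on (\<lambda>x. j * k x) B1" if "locally_integrable_on k B1" for k :: "real ^ 'n \<Rightarrow> real"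
      using that unfolding locally_integrable_on_def by (auto intro!: set_integrable_mult_right)
    have "weak_deriv B1 (axis i 1) (\<lambda>x. j * g x) (\<lambda>x. (j *\<^sub>R G x) $ i)" for i
    proof -
      have wd: "weak_deriv B1 (axis i 1) g (\<lambda>x. G x $ i)" using W by (auto simp: W1p_def)
      have "(LINT x:B1|lebesgue. j * g x * frechet_derivative \<zeta> (at x) (axis i 1)) = - (LINT x:B1|lebesgue. j * G x $ i * \<zeta> x)"
        if "test_fun B1 \<zeta>" for \<zeta>
        using wd that by (simp add: weak_deriv_def mult.assoc)
      then show ?thesis using wd li by (simp add: weak_deriv_def)
    qed
    moreover have "Lp_fun p (lebesgue_on B1) (\<lambda>x. j * g x)" "Lp_fun p (lebesgue_on B1) (\<lambda>x. j *\<^sub>R G x)"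
      using W p Lp_fun_scaleR[of p "lebesgue_on B1" g j] Lp_fun_scaleR[of p "lebesgue_on B1" G j] by (auto simp: W1p_def)
    ultimately show ?thesis by (simp add: W1p_def)
  qed
  then show ?thesis
    unfolding has_trace_def
    using sw Lp_tendsto_scaleR[OF w(2), of j] Lp_tendsto_scaleR[OF w(3), of j] Lp_tendsto_scaleR[OF w(4), of j] p
    by (intro conjI exI[of _ "\<lambda>k x. j * w k x"]) (auto simp: gw)
qed

lemma flux_scaleR: "0 < j \<Longrightarrow> flux p (j *\<^sub>R v) = j powr (p - 1) *\<^sub>R flux p v"
  using powr_add[of j "p - 2" 1] by (simp add: flux_def powr_mult)

text \<open>The exponent of \<open>j\<close> is dictated by the homogeneity of the equation.\<close>

lemma slab_sol_rescale:
  fixes u :: "real \<Rightarrow> real ^ 'n \<Rightarrow> real"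
  assumes p: "1 < p" "p < 2" and lam: "0 < l" "l < 1" and j: "j = l powr (1 / (2 - p))"
    and sol: "slab_sol p 0 F \<phi> u G"
  shows "slab_sol p (l - 1) (\<lambda>x. j powr (p - 1) * F x) (\<lambda>x. j * \<phi> x)
    (\<lambda>t x. j * u ((t + 1) / l - 1) x) (\<lambda>t x. j *\<^sub>R G ((t + 1) / l - 1) x)"
proof -
  let ?M = "lebesgue_on (B1 :: (real ^ 'n) set)"
  define \<tau> where "\<tau> = (\<lambda>t. (t + 1) / l - 1)"
  define \<mu> \<beta> where "\<mu> = 1 / l" and "\<beta> = 1 / l - 1"
  have \<mu>: "0 < \<mu>" using lam by (simp add: \<mu>_def)
  have \<tau>: "\<tau> t = \<beta> + \<mu> * t" for t by (simp add: \<tau>_def \<mu>_def \<beta>_def add_divide_distrib)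
  have jp: "0 < j" using lam j by simp
  \<comment> \<open>The relation that fixes j: it yields j^(p-1) l = j, so the time term and the
    flux term of the equation acquire the same factor.\<close>
  have jl: "j powr (2 - p) = l" using lam p by (simp add: j powr_powr)
  have jl': "j powr (p - 1) * l = j"
    using jp powr_add[of j "p - 1" "2 - p"] by (simp add: jl)
  have rng: "\<tau> t \<in> {-1..0} \<longleftrightarrow> t \<in> {-1..l - 1}" "\<tau> t \<in> {-1<..<0} \<longleftrightarrow> t \<in> {-1<..<l - 1}" for t
    using lam by (auto simp: \<tau>_def field_simps)
  have mono: "\<tau> s < \<tau> t \<longleftrightarrow> s < t" for s t using lam by (auto simp: \<tau>_def divide_strict_right_mono field_simps)
  have L2: "\<forall>t\<in>{-1..0}. Lp_fun 2 ?M (u t)"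
    and C2: "\<forall>t\<in>{-1..0}. ((\<lambda>s. LINT x|?M. (u s x - u t x)\<^sup>2) \<longlongrightarrow> 0) (at t within {-1..0})"
    and um: "(\<lambda>z. u (fst z) (snd z)) \<in> borel_measurable (lebesgue_on Cyl)"
    and LG: "Lp_fun p (lebesgue_on Cyl) (\<lambda>z. G (fst z) (snd z))"
    and init: "AE x in ?M. u (-1) x = \<phi> x"
    and tr: "AE t in lebesgue_on {-1<..<0}. has_trace p (u t) (G t) \<phi>"
    and weak: "\<And>s t \<psi> D\<psi>. -1 \<le> s \<Longrightarrow> s < t \<Longrightarrow> t \<le> 0 \<Longrightarrow> W1p_0 p \<psi> D\<psi> \<Longrightarrow> Lp_fun 2 ?M \<psi> \<Longrightarrow>
        (LINT x|?M. u t x * \<psi> x) - (LINT x|?M. u s x * \<psi> x)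
        + (LINT z|lebesgue_on ({s<..<t} \<times> B1). flux p (G (fst z) (snd z)) \<bullet> D\<psi> (snd z)) = (t - s) * (LINT x|?M. F x * \<psi> x)"
    using sol unfolding slab_sol_def by blast+
  let ?Q = "{-1<..<l - 1} \<times> (B1 :: (real ^ 'n) set)"
  let ?T = "\<lambda>z :: real \<times> (real ^ 'n). (\<beta> + \<mu> * fst z, snd z)"
  note Tm = lebesgue_time_affine(1)[OF \<mu>, where \<beta> = \<beta> and 'b = "real ^ 'n"]
  have TQ: "?T z \<in> {\<tau> s<..<\<tau> t} \<times> B1 \<longleftrightarrow> z \<in> {s<..<t} \<times> B1" for s t z
    using mono[of s "fst z"] mono[of "fst z" t] by (cases z) (auto simp: \<tau>[symmetric])
  have indT: "indicat_real ({\<tau> s<..<\<tau> t} \<times> B1) (?T z) = indicat_real ({s<..<t} \<times> B1) z" for s t z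
    using TQ[of z s t] unfolding indicator_def by (simp only:)
  \<comment> \<open>The change of time fixes -1 and carries l - 1 to 0, so initial data remain
    initial data.\<close>
  have \<tau>m1: "\<tau> (-1) = -1" and \<tau>l: "\<tau> (l - 1) = 0" using lam by (auto simp: \<tau>_def)
  have indQ: "indicat_real ?Q z = indicat_real Cyl (?T z)" for z
    using indT[of "-1" "l - 1" z] by (simp only: \<tau>m1 \<tau>l)
  have "slab_sol p (l - 1) (\<lambda>x. j powr (p - 1) * F x) (\<lambda>x. j * \<phi> x) (\<lambda>t x. j * u (\<tau> t) x) (\<lambda>t x. j *\<^sub>R G (\<tau> t) x)"
    unfolding slab_sol_def
  proof (intro conjI allI impI ballI)
    fix t assume t: "t \<in> {-1..l - 1}"
    show "Lp_fun 2 ?M (\<lambda>x. j * u (\<tau> t) x)"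
      using L2 t rng Lp_fun_scaleR[of 2 ?M "u (\<tau> t)" j] by simp
    have "filterlim \<tau> (at (\<tau> t) within {-1..0}) (at t within {-1..l - 1})"
      unfolding filterlim_at
    proof
      show "\<forall>\<^sub>F s in at t within {-1..l - 1}. \<tau> s \<in> {-1..0} \<and> \<tau> s \<noteq> \<tau> t"
        unfolding eventually_at_filter
      proof (intro always_eventually allI impI)
        fix s assume "s \<noteq> t" "s \<in> {-1..l - 1}"
        then show "\<tau> s \<in> {-1..0} \<and> \<tau> s \<noteq> \<tau> t"
          using rng(1)[of s] lam by (auto simp: \<tau>_def)
      qed
      show "(\<tau> \<longlongrightarrow> \<tau> t) (at t within {-1..l - 1})" unfolding \<tau>_def using lam by (intro tendsto_intros) auto
    qed
    with C2 t rng have "((\<lambda>s. LINT x|?M. (u (\<tau> s) x - u (\<tau> t) x)\<^sup>2) \<longlongrightarrow> 0) (at t within {-1..l - 1})"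
      by (intro filterlim_compose[where f = \<tau> and g = "\<lambda>r. LINT x|?M. (u r x - u (\<tau> t) x)\<^sup>2"]) auto
    then have "((\<lambda>s. j\<^sup>2 * (LINT x|?M. (u (\<tau> s) x - u (\<tau> t) x)\<^sup>2)) \<longlongrightarrow> j\<^sup>2 * 0) (at t within {-1..l - 1})"
      by (intro tendsto_intros)
    then show "((\<lambda>s. LINT x|?M. (j * u (\<tau> s) x - j * u (\<tau> t) x)\<^sup>2) \<longlongrightarrow> 0) (at t within {-1..l - 1})"
      by (simp add: power_mult_distrib flip: right_diff_distrib)
  next
    have "(\<lambda>z. indicat_real Cyl z *\<^sub>R u (fst z) (snd z)) \<in> borel_measurable lebesgue"
      using um by (simp add: borel_measurable_restrict_space_iff)
    from measurable_compose[OF Tm this]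
    have "(\<lambda>z. indicat_real ?Q z *\<^sub>R u (\<tau> (fst z)) (snd z)) \<in> borel_measurable lebesgue"
      by (simp add: indQ \<tau>)
    then have "(\<lambda>z. j *\<^sub>R (indicat_real ?Q z *\<^sub>R u (\<tau> (fst z)) (snd z))) \<in> borel_measurable lebesgue"
      by (rule borel_measurable_scaleR[OF borel_measurable_const])
    then show "(\<lambda>z. j * u (\<tau> (fst z)) (snd z)) \<in> borel_measurable (lebesgue_on ?Q)"
      by (simp add: borel_measurable_restrict_space_iff mult.left_commute)
  next
    have "(\<lambda>z. indicat_real Cyl z *\<^sub>R G (fst z) (snd z)) \<in> borel_measurable lebesgue"
      using Lp_fun_measurable[OF LG] by (simp add: borel_measurable_restrict_space_iff)
    from measurable_compose[OF Tm this]
    have "(\<lambda>z. indicat_real ?Q z *\<^sub>R G (\<tau> (fst z)) (snd z)) \<in> borel_measurable lebesgue"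
      by (simp add: indQ \<tau>)
    then have m: "(\<lambda>z. G (\<tau> (fst z)) (snd z)) \<in> borel_measurable (lebesgue_on ?Q)"
      by (simp add: borel_measurable_restrict_space_iff)
    have "integrable lebesgue (\<lambda>z. indicat_real Cyl z *\<^sub>R (norm (G (fst z) (snd z)) powr p))"
      using Lp_fun_integrable[OF LG] by (simp add: integrable_restrict_space)
    from integral_time_affine(2)[OF \<mu> borel_measurable_integrable[OF this] this, of \<beta>]
    have "integrable (lebesgue_on ?Q) (\<lambda>z. norm (G (\<tau> (fst z)) (snd z)) powr p)"
      by (simp add: integrable_restrict_space indQ \<tau>)
    with m have "Lp_fun p (lebesgue_on ?Q) (\<lambda>z. G (\<tau> (fst z)) (snd z))" by (simp add: Lp_fun_def)
    then show "Lp_fun p (lebesgue_on ?Q) (\<lambda>z. j *\<^sub>R G (\<tau> (fst z)) (snd z))" using p by (intro Lp_fun_scaleR) auto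
  next
    fix s t \<psi> D\<psi> assume as: "-1 \<le> s \<and> s < t \<and> t \<le> l - 1 \<and> W1p_0 p \<psi> D\<psi> \<and> Lp_fun 2 ?M \<psi>"
    then have r: "-1 \<le> \<tau> s" "\<tau> s < \<tau> t" "\<tau> t \<le> 0" using rng(1)[of s] rng(1)[of t] mono by auto
    let ?S = "{s<..<t} \<times> (B1 :: (real ^ 'n) set)" and ?S' = "{\<tau> s<..<\<tau> t} \<times> (B1 :: (real ^ 'n) set)"
    have LD: "Lp_fun p (lebesgue_on ?S') (\<lambda>z. D\<psi> (snd z))"
      by (rule Lp_fun_snd) (use as in \<open>auto simp: W1p_0_def W1p_def\<close>)
    have "?S' \<subseteq> Cyl" using r by auto
    then have "integrable (lebesgue_on ?S') (\<lambda>z. flux p (G (fst z) (snd z)) \<bullet> D\<psi> (snd z))"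
      using LD p by (intro integrable_flux Lp_fun_subset[OF LG]) auto
    then have m: "(\<lambda>z. indicat_real ?S' z *\<^sub>R (flux p (G (fst z) (snd z)) \<bullet> D\<psi> (snd z))) \<in> borel_measurable lebesgue"
      by (subst borel_measurable_restrict_space_iff[symmetric]) (auto dest: borel_measurable_integrable)
    let ?I = "LINT z|lebesgue_on ?S'. flux p (G (fst z) (snd z)) \<bullet> D\<psi> (snd z)"
    have "?I = (LINT z|lebesgue. indicat_real ?S' z *\<^sub>R (flux p (G (fst z) (snd z)) \<bullet> D\<psi> (snd z)))"
      by (simp add: integral_restrict_space)
    also have "\<dots> = \<mu> * (LINT z|lebesgue. indicat_real ?S z *\<^sub>R (flux p (G (\<tau> (fst z)) (snd z)) \<bullet> D\<psi> (snd z)))"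
      by (subst integral_time_affine(1)[OF \<mu> m, of \<beta>]) (simp only: \<tau>[symmetric] indT[unfolded \<tau>[symmetric]] fst_conv snd_conv)
    also have "\<dots> = \<mu> * (LINT z|lebesgue_on ?S. flux p (G (\<tau> (fst z)) (snd z)) \<bullet> D\<psi> (snd z))"
      by (simp add: integral_restrict_space)
    finally have I: "(LINT z|lebesgue_on ?S. flux p (G (\<tau> (fst z)) (snd z)) \<bullet> D\<psi> (snd z)) = l * ?I"
      using lam by (simp add: \<mu>_def)
    have "(LINT x|?M. j * u (\<tau> t) x * \<psi> x) - (LINT x|?M. j * u (\<tau> s) x * \<psi> x)
        + (LINT z|lebesgue_on ?S. flux p (j *\<^sub>R G (\<tau> (fst z)) (snd z)) \<bullet> D\<psi> (snd z))
      = j * ((LINT x|?M. u (\<tau> t) x * \<psi> x) - (LINT x|?M. u (\<tau> s) x * \<psi> x)) + j powr (p - 1) * (l * ?I)"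
      by (simp add: flux_scaleR[OF jp] I[symmetric] mult.assoc right_diff_distrib)
    \<comment> \<open>By j^(p-1) l = j the left side is j times the original identity on (\<tau> s,
      \<tau> t).\<close>
    also have "\<dots> = j * ((\<tau> t - \<tau> s) * (LINT x|?M. F x * \<psi> x))"
      using weak[OF r, of \<psi> D\<psi>] as by (simp add: mult.assoc[symmetric] jl' flip: distrib_left)
    also have "\<dots> = (t - s) * (LINT x|?M. j powr (p - 1) * F x * \<psi> x)"
    proof -
      have "j * (\<tau> t - \<tau> s) = (t - s) * (j / l)" using lam by (simp add: \<tau>_def field_simps)
      also have "j / l = j powr (p - 1)" using jl' lam by (simp add: field_simps)
      finally show ?thesis by (simp add: mult.assoc[symmetric]) (simp add: mult.assoc)
    qed
    finally show "(LINT x|?M. j * u (\<tau> t) x * \<psi> x) - (LINT x|?M. j * u (\<tau> s) x * \<psi> x)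
        + (LINT z|lebesgue_on ({s<..<t} \<times> B1). flux p (j *\<^sub>R G (\<tau> (fst z)) (snd z)) \<bullet> D\<psi> (snd z))
      = (t - s) * (LINT x|?M. j powr (p - 1) * F x * \<psi> x)" .
  next
    show "AE x in ?M. j * u (\<tau> (-1)) x = j * \<phi> x" using init unfolding \<tau>m1 by eventually_elim simp
  next
    \<comment> \<open>The exceptional times are enclosed in a Borel null set, which is then pulled
      back through the affine map.\<close>
    have "AE t in lborel. t \<in> {-1<..<0} \<longrightarrow> has_trace p (u t) (G t) \<phi>"
      using tr by (simp add: AE_lebesgue_on_iff AE_completion_iff)
    then obtain N where N: "{t. \<not> (t \<in> {-1<..<0} \<longrightarrow> has_trace p (u t) (G t) \<phi>)} \<subseteq> N" "N \<in> sets borel" "emeasure lborel N = 0"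
      by (auto elim!: AE_E)
    then have "AE t in lborel. t \<notin> N" by (intro AE_not_in) (auto simp: null_sets_def)
    from AE_borel_affine[OF _ _ this, of \<mu> \<beta>] \<mu> N(2) have "AE t in lborel. \<tau> t \<notin> N" by (simp add: \<tau>)
    then have "AE t in lborel. t \<in> {-1<..<l - 1} \<longrightarrow> has_trace p (\<lambda>x. j * u (\<tau> t) x) (\<lambda>x. j *\<^sub>R G (\<tau> t) x) (\<lambda>x. j * \<phi> x)"
    proof eventually_elim
      case (elim t)
      then show ?case using N(1) rng(2)[of t] by (auto intro!: has_trace_scale[OF p(1)])
    qed
    then show "AE t in lebesgue_on {-1<..<l - 1}. has_trace p (\<lambda>x. j * u (\<tau> t) x) (\<lambda>x. j *\<^sub>R G (\<tau> t) x) (\<lambda>x. j * \<phi> x)"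
      by (simp add: AE_lebesgue_on_iff AE_completion_iff)
  qed
  then show ?thesis by (simp add: \<tau>_def)
qed

section \<open>Time derivatives of Lipschitz paths\<close>

definition dyad :: "real \<Rightarrow> real \<Rightarrow> nat \<Rightarrow> int \<Rightarrow> real" where
  "dyad a c k i = a + of_int i * (c / 2 ^ k)"

text \<open>The slope at t of the piecewise linear interpolant of v at the nodes of level k. For
  Lipschitz v these slopes form a bounded martingale in k for the dyadic filtration, whose limit is
  the derivative of v.\<close>

definition dslope :: "real \<Rightarrow> real \<Rightarrow> nat \<Rightarrow> (real \<Rightarrow> real) \<Rightarrow> real \<Rightarrow> real" where
  "dslope a c k v t = (v (dyad a c k (\<lfloor>(t - a) / (c / 2 ^ k)\<rfloor> + 1)) - v (dyad a c k \<lfloor>(t - a) / (c / 2 ^ k)\<rfloor>)) / (c / 2 ^ k)"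

lemma dyad_mono: "0 < c \<Longrightarrow> i \<le> j \<Longrightarrow> dyad a c k i \<le> dyad a c k j"
  by (auto simp: dyad_def divide_right_mono mult_right_mono)

lemma dyad_diff: "dyad a c k (i + 1) - dyad a c k i = c / 2 ^ k"
  by (simp add: dyad_def algebra_simps add_divide_distrib)

lemma dyad_refine: "k \<le> m \<Longrightarrow> dyad a c k i = dyad a c m (i * 2 ^ (m - k))"
proof -
  assume "k \<le> m"
  then have "(2 :: real) ^ m = 2 ^ k * 2 ^ (m - k)" by (metis le_add_diff_inverse power_add)
  then show ?thesis by (simp add: dyad_def)
qed

lemma dslope_cell:
  assumes "0 < c" "t \<in> {dyad a c k i..<dyad a c k (i + 1)}"
  shows "dslope a c k v t = (v (dyad a c k (i + 1)) - v (dyad a c k i)) / (c / 2 ^ k)"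
proof -
  have "\<lfloor>(t - a) / (c / 2 ^ k)\<rfloor> = i"
    using assms by (intro floor_unique) (auto simp: dyad_def field_simps)
  then show ?thesis by (simp add: dslope_def)
qed

text \<open>Joint measurability arises from measurability at separate times: for fixed k the cell
  index is a countably valued function of t, so only countably many of the functions W t
  occur.\<close>

lemma dslope_measurable2:
  fixes W :: "real \<Rightarrow> 'b::euclidean_space \<Rightarrow> real"
  assumes [measurable]: "\<And>t. W t \<in> borel_measurable borel"
  shows "(\<lambda>z. dslope a c k (\<lambda>t. W t (snd z)) (fst z)) \<in> borel_measurable borel"
proof -
  have [measurable]: "(\<lambda>z :: real \<times> 'b. W t (snd z)) \<in> borel_measurable borel" for t
    by (intro measurable_compose[OF _ assms] borel_measurable_continuous_onI continuous_intros)
  have [measurable]: "(fst :: real \<times> 'b \<Rightarrow> real) \<in> borel_measurable borel"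
    by (intro borel_measurable_continuous_onI continuous_intros)
  have f: "(\<lambda>z :: real \<times> 'b. \<lfloor>(fst z - a) / (c / 2 ^ k)\<rfloor>) \<in> borel \<rightarrow>\<^sub>M count_space UNIV"
    by measurable
  show ?thesis
    unfolding dslope_def
    by (rule measurable_compose_countable[OF _ f, where f = "\<lambda>i z. (W (dyad a c k (i + 1)) (snd z) - W (dyad a c k i) (snd z)) / (c / 2 ^ k)"]) measurable
qed

lemma dslope_measurable [measurable]: "dslope a c k v \<in> borel_measurable borel"
proof -
  have f: "(\<lambda>t. \<lfloor>(t - a) / (c / 2 ^ k)\<rfloor>) \<in> borel \<rightarrow>\<^sub>M count_space UNIV" by measurable
  show ?thesis
    unfolding dslope_def[abs_def]
    by (rule measurable_compose_countable[OF _ f, where f = "\<lambda>i z. (v (dyad a c k (i + 1)) - v (dyad a c k i)) / (c / 2 ^ k)"]) measurable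
qed

lemma integrable_bounded_Ico:
  fixes f :: "real \<Rightarrow> real"
  assumes f: "f \<in> borel_measurable borel" "\<And>t. \<bar>f t\<bar> \<le> B"
  shows "integrable lborel (\<lambda>t. indicator {s..<t'} t * f t)"
proof (rule integrable_bounded_mult)
  show "integrable lborel (indicator {s..<t'} :: real \<Rightarrow> real)"
    by (cases "s \<le> t'") (auto intro!: integrable_real_indicator)
qed (use f in auto)

lemma integral_Ico_split:
  fixes f :: "real \<Rightarrow> real"
  assumes f: "f \<in> borel_measurable borel" "\<And>t. \<bar>f t\<bar> \<le> B" and le: "r \<le> s" "s \<le> t"
  shows "(LINT x|lborel. indicator {r..<t} x * f x) = (LINT x|lborel. indicator {r..<s} x * f x) + (LINT x|lborel. indicator {s..<t} x * f x)"
proof -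
  have "(LINT x|lborel. indicator {r..<t} x * f x) = (LINT x|lborel. indicator {r..<s} x * f x + indicator {s..<t} x * f x)"
    using le by (intro Bochner_Integration.integral_cong) (auto simp: indicator_def)
  then show ?thesis using integrable_bounded_Ico[OF f] by simp
qed

context
  fixes a c L :: real and v :: "real \<Rightarrow> real"
  assumes c: "0 < c" and lip: "\<And>k i. \<bar>v (dyad a c k (i + 1)) - v (dyad a c k i)\<bar> \<le> L * (c / 2 ^ k)"
begin

lemma dslope_bound: "\<bar>dslope a c k v t\<bar> \<le> L"
proof -
  define h where "h = c / 2 ^ k"
  have h: "0 < h" using c by (simp add: h_def)
  show ?thesis
    unfolding dslope_def h_def[symmetric] abs_divide abs_of_pos[OF h] pos_divide_le_eq[OF h]
    unfolding h_def by (rule lip)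
qed

text \<open>On a cell the slope times the cell length is the increment of v, and the increments
  telescope.\<close>

lemma integral_dslope_same:
  "(LINT t|lborel. indicator {dyad a c k i..<dyad a c k (i + int n)} t * dslope a c k v t) = v (dyad a c k (i + int n)) - v (dyad a c k i)"
proof (induction n)
  case (Suc n)
  let ?j = "i + int n"
  have "(LINT t|lborel. indicator {dyad a c k ?j..<dyad a c k (?j + 1)} t * dslope a c k v t)
     = (LINT t|lborel. indicator {dyad a c k ?j..<dyad a c k (?j + 1)} t * ((v (dyad a c k (?j + 1)) - v (dyad a c k ?j)) / (c / 2 ^ k)))"
    using dslope_cell[OF c, of _ a k ?j v] by (intro Bochner_Integration.integral_cong) (auto simp: indicator_def)
  also have "\<dots> = (c / 2 ^ k) * ((v (dyad a c k (?j + 1)) - v (dyad a c k ?j)) / (c / 2 ^ k))"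
    using dyad_mono[OF c, of ?j "?j + 1" a k] dyad_diff[of a c k ?j] by simp
  also have "\<dots> = v (dyad a c k (?j + 1)) - v (dyad a c k ?j)" using c by simp
  finally have cell: "(LINT t|lborel. indicator {dyad a c k ?j..<dyad a c k (?j + 1)} t * dslope a c k v t) = v (dyad a c k (?j + 1)) - v (dyad a c k ?j)" .
  have e: "i + int (Suc n) = ?j + 1" by simp
  show ?case
    unfolding e using Suc cell integral_Ico_split[OF dslope_measurable dslope_bound, of "dyad a c k i" "dyad a c k ?j" "dyad a c k (?j + 1)" k]
      dyad_mono[OF c, of i ?j a k] dyad_mono[OF c, of ?j "?j + 1" a k] by simp
qed simp

text \<open>Nodes of level k are nodes of every finer level m, so telescoping at level m ends at the
  same two points. This is the martingale property.\<close>

lemma integral_dslope: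
  assumes "k \<le> m" "i \<le> j"
  shows "(LINT t|lborel. indicator {dyad a c k i..<dyad a c k j} t * dslope a c m v t) = v (dyad a c k j) - v (dyad a c k i)"
proof -
  have "j * 2 ^ (m - k) = i * 2 ^ (m - k) + int (nat ((j - i) * 2 ^ (m - k)))"
    using assms by (simp add: algebra_simps mult_right_mono)
  then show ?thesis
    using integral_dslope_same[of m "i * 2 ^ (m - k)" "nat ((j - i) * 2 ^ (m - k))"]
    by (simp only: dyad_refine[OF assms(1)])
qed

text \<open>Averaging the finer slope over a coarse cell gives the coarse slope; hence dyadic slopes
  have orthogonal increments.\<close>

lemma integral_dslope_mult:
  assumes km: "k \<le> m"
  shows "(LINT t|lborel. indicator {dyad a c k 0..<dyad a c k (int n)} t * (dslope a c k v t * dslope a c m v t))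
    = (\<Sum>j<n. (v (dyad a c k (int j + 1)) - v (dyad a c k (int j)))\<^sup>2 / (c / 2 ^ k))"
proof (induction n)
  case (Suc n)
  let ?f = "\<lambda>t. dslope a c k v t * dslope a c m v t"
  have fb: "\<bar>?f t\<bar> \<le> L * L" for t unfolding abs_mult using dslope_bound[of k t] dslope_bound[of m t] by (intro mult_mono) auto
  have fm: "?f \<in> borel_measurable borel" by measurable
  let ?\<sigma> = "(v (dyad a c k (int n + 1)) - v (dyad a c k (int n))) / (c / 2 ^ k)"
  have "(LINT t|lborel. indicator {dyad a c k (int n)..<dyad a c k (int n + 1)} t * ?f t)
    = (LINT t|lborel. ?\<sigma> * (indicator {dyad a c k (int n)..<dyad a c k (int n + 1)} t * dslope a c m v t))"
    using dslope_cell[OF c, of _ a k "int n" v] by (intro Bochner_Integration.integral_cong) (auto simp: indicator_def)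
  also have "\<dots> = ?\<sigma> * (v (dyad a c k (int n + 1)) - v (dyad a c k (int n)))"
    using integral_dslope[OF km, of "int n" "int n + 1"] by simp
  also have "\<dots> = (v (dyad a c k (int n + 1)) - v (dyad a c k (int n)))\<^sup>2 / (c / 2 ^ k)"
    by (simp add: power2_eq_square)
  finally have cell: "(LINT t|lborel. indicator {dyad a c k (int n)..<dyad a c k (int n + 1)} t * ?f t) = \<dots>" .
  have e: "int (Suc n) = int n + 1" by simp
  show ?case
    unfolding e using Suc cell integral_Ico_split[OF fm fb, of "dyad a c k 0" "dyad a c k (int n)" "dyad a c k (int n + 1)"]
      dyad_mono[OF c, of 0 "int n" a k] dyad_mono[OF c, of "int n" "int n + 1" a k] by simp
qed simp

lemma integral_dslope_orthogonal:
  assumes km: "k \<le> m"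
  shows "(LINT t|lborel. indicator {a..<a + c} t * (dslope a c k v t * dslope a c m v t))
    = (LINT t|lborel. indicator {a..<a + c} t * (dslope a c k v t * dslope a c k v t))"
  using integral_dslope_mult[OF km, of "2 ^ k"] integral_dslope_mult[OF order.refl, of k "2 ^ k"]
  by (simp add: dyad_def)

end

text \<open>Orthogonality makes the squared L^2 distance of g m and g k the difference of their
  squared norms, which increase with the index and are bounded by L^2 times the total mass. The L^1
  statement follows from |x| \<le> d + x^2 / d.\<close>

lemma Cauchy_of_orthogonal_increments:
  fixes g :: "nat \<Rightarrow> 'a \<Rightarrow> real"
  assumes fin: "finite_measure N" and m[measurable]: "\<And>k. g k \<in> borel_measurable N" and b: "\<And>k z. \<bar>g k z\<bar> \<le> L"
    and orth: "\<And>k m. k \<le> m \<Longrightarrow> (LINT z|N. g k z * g m z) = (LINT z|N. g k z * g k z)"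
    and e: "0 < e"
  shows "\<exists>K. \<forall>i\<ge>K. \<forall>j\<ge>K. (LINT z|N. norm (g i z - g j z)) < e"
proof -
  interpret finite_measure N by fact
  have ip[simp]: "integrable N (\<lambda>z. g i z * g j z)" for i j
  proof (rule integrable_const_bound[where B = "L * L"])
    have "\<bar>g i z * g j z\<bar> \<le> L * L" for z unfolding abs_mult using b[of i z] b[of j z] by (intro mult_mono) auto
    then show "AE z in N. norm (g i z * g j z) \<le> L * L" by simp
  qed simp
  have i1[simp]: "integrable N (g i)" for i by (rule integrable_const_bound[where B = L]) (use b in auto)
  define B where "B = (\<lambda>k. LINT z|N. g k z * g k z)"
  have sq: "(LINT z|N. (g m z - g k z)\<^sup>2) = B m - B k" if "k \<le> m" for k m
  proof -
    have "(LINT z|N. (g m z - g k z)\<^sup>2) = (LINT z|N. g m z * g m z - 2 * (g k z * g m z) + g k z * g k z)"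
      by (intro Bochner_Integration.integral_cong) (auto simp: power2_eq_square algebra_simps)
    then show ?thesis using orth[OF that] by (simp add: B_def)
  qed
  have "incseq B"
  proof (rule incseq_SucI)
    fix k
    have "0 \<le> (LINT z|N. (g (Suc k) z - g k z)\<^sup>2)" by (intro integral_nonneg_AE) auto
    then show "B k \<le> B (Suc k)" using sq[of k "Suc k"] by simp
  qed
  moreover have "B k \<le> (LINT z|N. L * L)" for k
    unfolding B_def
  proof (rule integral_mono)
    show "g k z * g k z \<le> L * L" for z using b[of k z] abs_le_square_iff[of "g k z" L] by (simp add: power2_eq_square)
  qed auto
  ultimately obtain l where l: "B \<longlonglongrightarrow> l" using incseq_convergent by blast
  define \<mu> where "\<mu> = measure N (space N)"
  have \<mu>: "0 \<le> \<mu>" by (simp add: \<mu>_def)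
  \<comment> \<open>The constant d integrates to at most e/2; the other half of e is left for the
    differences of B, which must be below d e / 2.\<close>
  define d where "d = e / (2 * (\<mu> + 1))"
  have d: "d > 0" using e \<mu> by (simp add: d_def)
  have "d * \<mu> \<le> d * (\<mu> + 1)" using d by simp
  also have "\<dots> = e / 2" using \<mu> by (simp add: d_def field_simps)
  finally have d\<mu>: "d * \<mu> \<le> e / 2" .
  have "0 < d * (e / 2)" using d e by simp
  with LIMSEQ_imp_Cauchy[OF l] obtain K where K: "\<And>i j. i \<ge> K \<Longrightarrow> j \<ge> K \<Longrightarrow> dist (B i) (B j) < d * (e / 2)"
    unfolding Cauchy_def by metis
  have "(LINT z|N. norm (g m z - g k z)) < e" if "K \<le> k" "k \<le> m" for k m
  proof -
    have "(LINT z|N. norm (g m z - g k z)) \<le> (LINT z|N. d + (g m z - g k z)\<^sup>2 / d)"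
    proof (rule integral_mono)
      show "norm (g m z - g k z) \<le> d + (g m z - g k z)\<^sup>2 / d" for z
      proof (cases "\<bar>g m z - g k z\<bar> \<le> d")
        case True
        then show ?thesis using d by (simp add: add_increasing2)
      next
        case False
        then have "d * \<bar>g m z - g k z\<bar> \<le> \<bar>g m z - g k z\<bar> * \<bar>g m z - g k z\<bar>" by (intro mult_right_mono) auto
        then have "\<bar>g m z - g k z\<bar> \<le> (g m z - g k z)\<^sup>2 / d" using d by (simp add: field_simps power2_eq_square abs_mult[symmetric])
        then show ?thesis using d by simp
      qed
    qed (auto simp: power2_eq_square left_diff_distrib right_diff_distrib)
    also have "\<dots> = d * \<mu> + (B m - B k) / d"
    proof -
      have "integrable N (\<lambda>z. (g m z - g k z)\<^sup>2)" by (auto simp: power2_eq_square left_diff_distrib right_diff_distrib)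
      then show ?thesis using sq[OF that(2)] by (simp add: \<mu>_def mult.commute)
    qed
    also have "\<dots> < e / 2 + e / 2"
    proof (rule add_le_less_mono[OF d\<mu>])
      have "B m - B k < d * (e / 2)" using K[of m k] that unfolding dist_real_def by linarith
      then show "(B m - B k) / d < e / 2" using d by (simp add: field_simps)
    qed
    finally show ?thesis by simp
  qed
  then have "(LINT z|N. norm (g i z - g j z)) < e" if "i \<ge> K" "j \<ge> K" for i j
  proof (cases "i \<le> j")
    case True
    then show ?thesis
      using \<open>\<And>m k. K \<le> k \<Longrightarrow> k \<le> m \<Longrightarrow> (LINT z|N. norm (g m z - g k z)) < e\<close>[of i j] that
      by (simp only: norm_minus_commute[of "g i z" "g j z" for z])
  qed (use that \<open>\<And>m k. K \<le> k \<Longrightarrow> k \<le> m \<Longrightarrow> (LINT z|N. norm (g m z - g k z)) < e\<close> in auto)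
  then show ?thesis by blast
qed

section \<open>Densities of Lipschitz paths\<close>

lemma integral_Ico_bound:
  fixes f :: "real \<Rightarrow> real"
  assumes f: "f \<in> borel_measurable borel" "\<And>t. \<bar>f t\<bar> \<le> L" and st: "s \<le> t"
  shows "\<bar>LINT x|lborel. indicator {s..<t} x * f x\<bar> \<le> L * (t - s)"
proof -
  have "\<bar>LINT x|lborel. indicator {s..<t} x * f x\<bar> \<le> (LINT x|lborel. norm (indicator {s..<t} x * f x))"
    using integral_norm_bound[of lborel "\<lambda>x. indicator {s..<t} x * f x"] by simp
  also have "\<dots> \<le> (LINT x|lborel. indicator {s..<t} x * L)"
    using integrable_bounded_Ico[OF f, of s t] integrable_bounded_Ico[of "\<lambda>_. L" "\<bar>L\<bar>" s t] f
    by (intro integral_mono) (auto simp: indicator_def)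
  also have "\<dots> = L * (t - s)" using st by (simp add: mult.commute)
  finally show ?thesis .
qed

lemma AE_lborel_slice_snd:
  assumes "AE z in (lborel :: (real \<times> 'b::euclidean_space) measure). P z"
  shows "AE x in lborel. AE t in lborel. P (t, x)"
proof -
  obtain N where N: "{z. \<not> P z} \<subseteq> N" "N \<in> sets (borel :: (real \<times> 'b) measure)" "emeasure lborel N = 0"
    using assms by (auto elim!: AE_E)
  have Np: "N \<in> sets (lborel \<Otimes>\<^sub>M lborel)" using N(2) by (simp only: lborel_prod sets_lborel)
  have "(\<integral>\<^sup>+x. emeasure lborel ((\<lambda>t. (t, x)) -` N) \<partial>lborel) = 0"
    using lborel_pair.emeasure_pair_measure_alt2[OF Np] N(3) by (simp add: lborel_prod)
  then have "AE x in lborel. emeasure lborel ((\<lambda>t. (t, x)) -` N) = 0"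
    by (subst (asm) nn_integral_0_iff_AE) (use lborel_pair.measurable_emeasure_Pair2[OF Np] in auto)
  then show ?thesis
  proof eventually_elim
    case (elim x)
    have "(\<lambda>t. (t, x)) -` N \<in> sets lborel" using sets_Pair2[OF Np, of x] by simp
    with elim N(1) show ?case by (intro AE_I[of _ _ "(\<lambda>t. (t, x)) -` N"]) auto
  qed
qed

text \<open>A Radon-Nikodym property for a path whose Lipschitz bound holds only for almost every x,
  with an exceptional set depending on the two times. Dyadic times leave countably many such sets;
  off their union the dyadic slopes are bounded, a subsequence of them converges almost everywhere,
  and arbitrary times are reached by approximation from the grid.\<close>

lemma lipschitz_path_density:
  fixes u :: "real \<Rightarrow> real ^ 'n \<Rightarrow> real"
  assumes ab: "a < b" and L: "0 \<le> L"
    and um: "\<And>t. t \<in> {a..b} \<Longrightarrow> u t \<in> borel_measurable (lebesgue_on B1)"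
    and lip: "\<And>s t. a \<le> s \<Longrightarrow> s \<le> t \<Longrightarrow> t \<le> b \<Longrightarrow> AE x in lebesgue_on B1. \<bar>u t x - u s x\<bar> \<le> L * (t - s)"
  obtains g :: "real \<times> (real ^ 'n) \<Rightarrow> real" where "g \<in> borel_measurable borel" "\<And>z. \<bar>g z\<bar> \<le> L"
    "\<And>s t. a \<le> s \<Longrightarrow> s \<le> t \<Longrightarrow> t \<le> b \<Longrightarrow>
      AE x in lebesgue_on B1. u t x - u s x = (LINT r|lborel. indicator {s..<t} r * g (r, x))"
proof -
  define c where "c = b - a"
  have c: "0 < c" using ab by (simp add: c_def)
  \<comment> \<open>Dyadic indices run over all integers, so times are clamped to [a, b]; beyond it
    the path becomes constant and keeps its Lipschitz bound.\<close>
  define cl where "cl = (\<lambda>t. max a (min b t))"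
  have clr: "cl t \<in> {a..b}" for t using ab by (auto simp: cl_def)
  have cle: "cl t = t" if "t \<in> {a..b}" for t using that by (auto simp: cl_def)
  have clm: "s \<le> t \<Longrightarrow> cl s \<le> cl t \<and> cl t - cl s \<le> t - s" for s t using ab by (auto simp: cl_def)
  have "\<exists>U. U \<in> borel_measurable borel \<and> (AE x in lborel. indicator B1 x *\<^sub>R u (cl t) x = U x)" for t
    using um[OF clr[of t]] lebesgue_borel_rep[of "\<lambda>x. indicator B1 x *\<^sub>R u (cl t) x"]
    by (simp add: borel_measurable_restrict_space_iff) blast
  then obtain U where Um[measurable]: "\<And>t. U t \<in> borel_measurable borel"
    and Uae: "\<And>t. AE x in lborel. indicator B1 x *\<^sub>R u (cl t) x = U t x" by metis
  have B1b[measurable]: "B1 \<in> sets (borel :: (real ^ 'n) measure)" by auto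
  \<comment> \<open>The points at which all of the countably many grid increments obey the bound. W
    is set to zero elsewhere and so obeys it on the grid at every x.\<close>
  define X where "X = {x \<in> B1. \<forall>k i. \<bar>U (dyad a c k (i + 1)) x - U (dyad a c k i) x\<bar> \<le> L * (c / 2 ^ k)}"
  have Xm[measurable]: "X \<in> sets borel"
  proof -
    have "{x \<in> space borel. x \<in> B1 \<and> (\<forall>k i. \<bar>U (dyad a c k (i + 1)) x - U (dyad a c k i) x\<bar> \<le> L * (c / 2 ^ k))} \<in> sets (borel :: (real ^ 'n) measure)"
      by measurable
    then show ?thesis by (simp add: X_def)
  qed
  have Xae: "AE x in lborel. x \<in> B1 \<longrightarrow> x \<in> X"
  proof -
    have "AE x in lborel. x \<in> B1 \<longrightarrow> \<bar>U (dyad a c k (i + 1)) x - U (dyad a c k i) x\<bar> \<le> L * (c / 2 ^ k)" for k i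
    proof -
      let ?s = "dyad a c k i" and ?t = "dyad a c k (i + 1)"
      have st: "?s \<le> ?t" by (rule dyad_mono[OF c]) simp
      have "AE x in lebesgue_on B1. \<bar>u (cl ?t) x - u (cl ?s) x\<bar> \<le> L * (cl ?t - cl ?s)"
        using clm[OF st] clr[of ?s] clr[of ?t] by (intro lip) auto
      then have "AE x in lborel. x \<in> B1 \<longrightarrow> \<bar>u (cl ?t) x - u (cl ?s) x\<bar> \<le> L * (cl ?t - cl ?s)"
        by (simp add: AE_lebesgue_on_iff AE_completion_iff)
      with Uae[of ?s] Uae[of ?t] show ?thesis
      proof eventually_elim
        case (elim x)
        have "L * (cl ?t - cl ?s) \<le> L * (c / 2 ^ k)"
          using clm[OF st] L dyad_diff[of a c k i] by (intro mult_left_mono) auto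
        then show ?case using elim by auto
      qed
    qed
    then have "AE x in lborel. \<forall>k i. x \<in> B1 \<longrightarrow> \<bar>U (dyad a c k (i + 1)) x - U (dyad a c k i) x\<bar> \<le> L * (c / 2 ^ k)"
      unfolding AE_all_countable by blast
    then show ?thesis by eventually_elim (simp add: X_def)
  qed
  define W where "W = (\<lambda>t x. indicator X x * U t x)"
  have Wm[measurable]: "W t \<in> borel_measurable borel" for t unfolding W_def by measurable
  have Wl: "\<bar>W (dyad a c k (i + 1)) x - W (dyad a c k i) x\<bar> \<le> L * (c / 2 ^ k)" for k i x
    using L c by (auto simp: W_def X_def indicator_def)
  have Wu: "AE x in lebesgue_on B1. W t x = u t x" if "t \<in> {a..b}" for t
  proof -
    have "AE x in lborel. x \<in> B1 \<longrightarrow> W t x = u t x"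
      using Xae Uae[of t] by eventually_elim (auto simp: W_def cle[OF that])
    then show ?thesis by (simp add: AE_lebesgue_on_iff AE_completion_iff)
  qed
  define gk where "gk = (\<lambda>k z. dslope a c k (\<lambda>t. W t (snd z)) (fst z))"
  have gkm[measurable]: "gk k \<in> borel_measurable borel" for k unfolding gk_def by (rule dslope_measurable2) simp
  have gkb: "\<bar>gk k z\<bar> \<le> L" for k z unfolding gk_def by (rule dslope_bound[where v = "\<lambda>t. W t (snd z)", OF c Wl])
  let ?Q = "{a..<b} \<times> (B1 :: (real ^ 'n) set)"
  have Qm[measurable]: "?Q \<in> sets borel" by (simp add: borel_prod[symmetric])
  have Qfin: "emeasure lborel ?Q < \<infinity>"
    by (rule emeasure_bounded_finite) (auto intro: bounded_Times)
  define N where "N = restrict_space lborel ?Q"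
  have finN: "finite_measure N"
    unfolding N_def using Qfin by (intro finite_measureI) (auto simp: emeasure_restrict_space)
  have intN: "(LINT z|N. f z) = (LINT x|lborel. indicator B1 x * (LINT t|lborel. indicator {a..<b} t * f (t, x)))"
    if fm[measurable]: "f \<in> borel_measurable borel" and fb: "\<And>z. \<bar>f z\<bar> \<le> C" for f :: "real \<times> (real ^ 'n) \<Rightarrow> real" and C
  proof -
    have "integrable lborel (\<lambda>z. indicator ?Q z * f z)"
      by (rule integrable_bounded_mult[OF integrable_real_indicator, where B = C]) (use Qfin fm fb in auto)
    then have i: "integrable (lborel \<Otimes>\<^sub>M lborel) (\<lambda>(t, x). indicator ?Q (t, x) * f (t, x))"
      by (simp add: lborel_prod case_prod_beta')
    have "(LINT z|N. f z) = (LINT z|lborel. indicator ?Q z * f z)"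
      unfolding N_def by (subst integral_restrict_space) auto
    also have "\<dots> = (LINT x|lborel. LINT t|lborel. indicator ?Q (t, x) * f (t, x))"
      using lborel_pair.integral_snd[OF i] by (simp add: lborel_prod case_prod_beta')
    also have "\<dots> = (LINT x|lborel. LINT t|lborel. indicator B1 x * (indicator {a..<b} t * f (t, x)))"
      by (intro Bochner_Integration.integral_cong) (auto simp: indicator_def)
    finally show ?thesis by simp
  qed
  have "\<exists>K. \<forall>i\<ge>K. \<forall>j\<ge>K. (LINT z|N. norm (gk i z - gk j z)) < e" if e: "0 < e" for e
  proof (rule Cauchy_of_orthogonal_increments[OF finN _ gkb _ e])
    show "gk k \<in> borel_measurable N" for k unfolding N_def by (intro measurable_restrict_space1) simp
    fix k m :: nat assume km: "k \<le> m"
    have pb: "\<bar>gk i z * gk j z\<bar> \<le> L * L" for i j z unfolding abs_mult using gkb[of i z] gkb[of j z] by (intro mult_mono) auto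
    have ac: "a + c = b" by (simp add: c_def)
    have "(LINT t|lborel. indicator {a..<b} t * (gk k (t, x) * gk m (t, x))) = (LINT t|lborel. indicator {a..<b} t * (gk k (t, x) * gk k (t, x)))" for x
      using integral_dslope_orthogonal[where v = "\<lambda>t. W t x", OF c Wl km] by (simp add: gk_def ac)
    then show "(LINT z|N. gk k z * gk m z) = (LINT z|N. gk k z * gk k z)"
      by (subst (1 2) intN[OF _ pb]) (auto intro!: borel_measurable_times)
  qed
  then obtain r where r: "strict_mono r" "AE z in N. Cauchy (\<lambda>i. gk (r i) z)"
  proof (rule cauchy_L1_AE_cauchy_subseq[rotated 1])
    interpret N: finite_measure N by (rule finN)
    show "integrable N (gk n)" for n
      by (rule N.integrable_const_bound[where B = L]) (use gkb in \<open>auto simp: N_def intro!: measurable_restrict_space1\<close>)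
  qed
  \<comment> \<open>Clipped to [-L, L], because \<open>lim\<close> is arbitrary where the sequence
    diverges and the bound is wanted at every point.\<close>
  define g where "g = (\<lambda>z. max (- L) (min L (lim (\<lambda>i. gk (r i) z))))"
  have gm[measurable]: "g \<in> borel_measurable borel"
    unfolding g_def by (intro borel_measurable_max borel_measurable_min borel_measurable_lim_metric borel_measurable_const gkm)
  have gb: "\<bar>g z\<bar> \<le> L" for z using L by (auto simp: g_def)
  have "AE z in lborel. z \<in> ?Q \<longrightarrow> (\<lambda>i. gk (r i) z) \<longlonglongrightarrow> g z"
  proof -
    have "AE z in lborel. z \<in> ?Q \<longrightarrow> Cauchy (\<lambda>i. gk (r i) z)"
      using r(2) unfolding N_def by (subst (asm) AE_restrict_space_iff) auto
    then show ?thesis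
    proof eventually_elim
      case (elim z)
      show ?case
      proof
        assume "z \<in> ?Q"
        then have "(\<lambda>i. gk (r i) z) \<longlonglongrightarrow> lim (\<lambda>i. gk (r i) z)"
          using elim Cauchy_convergent convergent_LIMSEQ_iff by blast
        moreover have "\<bar>lim (\<lambda>i. gk (r i) z)\<bar> \<le> L"
          by (rule Lim_bounded[OF tendsto_rabs[OF calculation], of 0]) (simp add: gkb del: split_paired_All)
        then have "g z = lim (\<lambda>i. gk (r i) z)" unfolding g_def by linarith
        ultimately show "(\<lambda>i. gk (r i) z) \<longlonglongrightarrow> g z" by simp
      qed
    qed
  qed
  note AE_lborel_slice_snd[OF this]
  then have slice: "AE x in lborel. AE t in lborel. (t, x) \<in> ?Q \<longrightarrow> (\<lambda>i. gk (r i) (t, x)) \<longlonglongrightarrow> g (t, x)" .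
  have gs: "(\<lambda>t. g (t, x)) \<in> borel_measurable borel" for x by measurable
  have grid: "AE x in lborel. x \<in> B1 \<longrightarrow> (\<forall>k i j. 0 \<le> i \<longrightarrow> i \<le> j \<longrightarrow> j \<le> 2 ^ k \<longrightarrow>
      W (dyad a c k j) x - W (dyad a c k i) x = (LINT t|lborel. indicator {dyad a c k i..<dyad a c k j} t * g (t, x)))"
    using slice
  proof eventually_elim
    case (elim x)
    show ?case
    proof (intro impI allI)
      fix k and i j :: int assume x: "x \<in> B1" and ij: "0 \<le> i" "i \<le> j" "j \<le> 2 ^ k"
      let ?s = "dyad a c k i" and ?t = "dyad a c k j"
      have rng: "a \<le> ?s" "?t \<le> b"
      proof -
        have "dyad a c k 0 \<le> ?s" "?t \<le> dyad a c k (2 ^ k)" using ij by (auto intro: dyad_mono[OF c])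
        then show "a \<le> ?s" "?t \<le> b" by (simp_all add: dyad_def c_def)
      qed
      have "(\<lambda>n. LINT t|lborel. indicator {?s..<?t} t * gk (r n) (t, x)) \<longlonglongrightarrow> (LINT t|lborel. indicator {?s..<?t} t * g (t, x))"
      proof (rule integral_dominated_convergence[where w = "\<lambda>t. indicator {?s..<?t} t * L"])
        show "integrable lborel (\<lambda>t. indicator {?s..<?t} t * L)" by (rule integrable_bounded_Ico[of _ "\<bar>L\<bar>"]) auto
        show "AE t in lborel. (\<lambda>n. indicator {?s..<?t} t * gk (r n) (t, x)) \<longlonglongrightarrow> indicator {?s..<?t} t * g (t, x)"
          using elim
        proof eventually_elim
          case (elim t)
          then show ?case using rng x by (cases "t \<in> {?s..<?t}") (auto)
        qed
        show "AE t in lborel. norm (indicator {?s..<?t} t * gk (r n) (t, x)) \<le> indicator {?s..<?t} t * L" for n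
          using gkb by (intro AE_I2) (auto simp: indicator_def)
      qed measurable
      \<comment> \<open>Once the level r n has reached k the integral no longer depends on n, by the
        martingale property.\<close>
      moreover have ev: "\<forall>\<^sub>F n in sequentially. (LINT t|lborel. indicator {?s..<?t} t * gk (r n) (t, x)) = W ?t x - W ?s x"
        using eventually_ge_at_top[of k]
      proof eventually_elim
        case (elim n)
        then have "k \<le> r n" using seq_suble[OF r(1), of n] by simp
        then show ?case using integral_dslope[where v = "\<lambda>t. W t x", OF c Wl _ ij(2), of k "r n"] by (simp add: gk_def)
      qed
      ultimately show "W ?t x - W ?s x = (LINT t|lborel. indicator {?s..<?t} t * g (t, x))"
        by (intro LIMSEQ_unique[OF tendsto_eventually[OF ev]])
    qed
  qed
  show thesis
  proof (rule that[OF gm gb])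
    fix s t assume st: "a \<le> s" "s \<le> t" "t \<le> b"
    \<comment> \<open>Index of the grid point at or just below q. For q in [a, b] it lies between 0
      and 2^k, the latter attained at q = b.\<close>
    define dn where "dn = (\<lambda>k q. \<lfloor>(q - a) / (c / 2 ^ k)\<rfloor>)"
    have dn: "dyad a c k (dn k q) \<le> q" "q - dyad a c k (dn k q) \<le> c / 2 ^ k" for k q
    proof -
      have h: "0 < c / 2 ^ k" using c by simp
      have "of_int (dn k q) \<le> (q - a) / (c / 2 ^ k)" "(q - a) / (c / 2 ^ k) \<le> of_int (dn k q) + 1" unfolding dn_def by linarith+
      then have "of_int (dn k q) * (c / 2 ^ k) \<le> q - a" "q - a \<le> (of_int (dn k q) + 1) * (c / 2 ^ k)"
        using h by (simp_all only: pos_le_divide_eq pos_divide_le_eq)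
      then show "dyad a c k (dn k q) \<le> q" "q - dyad a c k (dn k q) \<le> c / 2 ^ k" by (auto simp: dyad_def algebra_simps add_divide_distrib)
    qed
    have dnr: "0 \<le> dn k q" "dn k q \<le> 2 ^ k" if "q \<in> {a..b}" for k q
    proof -
      show "0 \<le> dn k q" unfolding dn_def using that c by simp
      have "(q - a) / (c / 2 ^ k) \<le> 2 ^ k" using that c by (simp add: c_def field_simps)
      then have "real_of_int (dn k q) \<le> 2 ^ k" unfolding dn_def by linarith
      then show "dn k q \<le> 2 ^ k" by (metis of_int_le_iff of_int_numeral of_int_power)
    qed
    have dnm: "dn k s \<le> dn k t" for k unfolding dn_def using st c by (intro floor_mono divide_right_mono) auto
    define sk tk where "sk = (\<lambda>k. dyad a c k (dn k s))" and "tk = (\<lambda>k. dyad a c k (dn k t))"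
    have skr: "a \<le> sk k" "sk k \<le> s" "s - sk k \<le> c / 2 ^ k" and tkr: "a \<le> tk k" "tk k \<le> t" "t - tk k \<le> c / 2 ^ k" and stk: "sk k \<le> tk k" for k
    proof -
      have "dyad a c k 0 \<le> sk k" unfolding sk_def using dnr(1)[of s k] st by (intro dyad_mono[OF c]) auto
      then show "a \<le> sk k" by (simp add: dyad_def)
      moreover show "sk k \<le> tk k" unfolding sk_def tk_def by (rule dyad_mono[OF c dnm])
      ultimately show "a \<le> tk k" by simp
    qed (auto simp: sk_def tk_def dn)
    have lims: "(\<lambda>k. c / 2 ^ k) \<longlonglongrightarrow> 0"
      using LIMSEQ_inverse_realpow_zero[of 2] tendsto_mult_right_zero[of "\<lambda>k. inverse (2 ^ k)" sequentially c] by (simp add: divide_inverse)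
    have 1: "AE x in lebesgue_on B1. \<forall>k. \<bar>u s x - u (sk k) x\<bar> \<le> L * (s - sk k) \<and> \<bar>u t x - u (tk k) x\<bar> \<le> L * (t - tk k)
        \<and> W (sk k) x = u (sk k) x \<and> W (tk k) x = u (tk k) x"
      unfolding AE_all_countable
    proof
      fix k
      have e: "sk k \<in> {a..b}" "tk k \<in> {a..b}" using skr[of k] tkr[of k] st by auto
      show "AE x in lebesgue_on B1. \<bar>u s x - u (sk k) x\<bar> \<le> L * (s - sk k) \<and> \<bar>u t x - u (tk k) x\<bar> \<le> L * (t - tk k)
        \<and> W (sk k) x = u (sk k) x \<and> W (tk k) x = u (tk k) x"
        using lip[of "sk k" s] lip[of "tk k" t] Wu[OF e(1)] Wu[OF e(2)] skr[of k] tkr[of k] st by auto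
    qed
    have 2: "AE x in lebesgue_on B1. \<forall>k. W (tk k) x - W (sk k) x = (LINT r|lborel. indicator {sk k..<tk k} r * g (r, x))"
    proof -
      have "AE x in lborel. x \<in> B1 \<longrightarrow> (\<forall>k. W (tk k) x - W (sk k) x = (LINT r|lborel. indicator {sk k..<tk k} r * g (r, x)))"
        using grid
      proof eventually_elim
        case (elim x)
        then show ?case using dnr[of s] dnr[of t] dnm st by (auto simp: sk_def tk_def)
      qed
      then show ?thesis by (simp add: AE_lebesgue_on_iff AE_completion_iff)
    qed
    from 1 2 show "AE x in lebesgue_on B1. u t x - u s x = (LINT r|lborel. indicator {s..<t} r * g (r, x))"
    proof eventually_elim
      case (elim x)
      let ?J = "\<lambda>p q. LINT r|lborel. indicator {p..<q} r * g (r, x)"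
      \<comment> \<open>Four errors of at most L c / 2^k each: two for u between s, t and their grid
        neighbours, two for the integral over the same gaps.\<close>
      have bd: "\<bar>(u t x - u s x) - ?J s t\<bar> \<le> 4 * L * (c / 2 ^ k)" for k
      proof -
        have A: "?J (sk k) s + ?J s t = ?J (sk k) (tk k) + ?J (tk k) t"
          using integral_Ico_split[OF gs gb, of "sk k" s t x] integral_Ico_split[OF gs gb, of "sk k" "tk k" t x] skr[of k] tkr[of k] stk[of k] st by simp
        have B: "\<bar>?J (sk k) s\<bar> \<le> L * (s - sk k)" "\<bar>?J (tk k) t\<bar> \<le> L * (t - tk k)"
          by (rule integral_Ico_bound[OF gs gb]; use skr[of k] tkr[of k] in simp)+
        have C: "u (tk k) x - u (sk k) x = ?J (sk k) (tk k)" "\<bar>u s x - u (sk k) x\<bar> \<le> L * (s - sk k)" "\<bar>u t x - u (tk k) x\<bar> \<le> L * (t - tk k)"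
          using elim by auto
        have D: "L * (s - sk k) \<le> L * (c / 2 ^ k)" "L * (t - tk k) \<le> L * (c / 2 ^ k)"
          using L skr(3)[of k] tkr(3)[of k] by (simp_all only: mult_left_mono)
        show ?thesis using A B C D by linarith
      qed
      have "(\<lambda>k. 4 * L * (c / 2 ^ k)) \<longlonglongrightarrow> 4 * L * 0" by (intro tendsto_intros lims)
      then have "\<bar>(u t x - u s x) - ?J s t\<bar> \<le> 4 * L * 0" by (rule LIMSEQ_le_const) (use bd in auto)
      then show ?case by simp
    qed
  qed
qed

text \<open>Fubini on the triangle r < t: the inner integral of \<zeta>' from r to b is -\<zeta>(r)
  because \<zeta> vanishes at b, and the constant C contributes nothing because \<zeta> vanishes at
  both ends. The primitive of G itself is never differentiated.\<close>

lemma integral_by_parts_lipschitz: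
  fixes G \<zeta> \<zeta>' :: "real \<Rightarrow> real"
  assumes ab: "a \<le> b" and Gm[measurable]: "G \<in> borel_measurable borel" and Gb: "\<And>t. \<bar>G t\<bar> \<le> L"
    and der: "\<And>t. (\<zeta> has_real_derivative \<zeta>' t) (at t)" and cont: "continuous_on UNIV \<zeta>'"
    and bnd: "\<And>t. \<bar>\<zeta>' t\<bar> \<le> B" and z: "\<zeta> a = 0" "\<zeta> b = 0"
  shows "(LINT t|lborel. indicator {a..<b} t * ((C + (LINT r|lborel. indicator {a..<t} r * G r)) * \<zeta>' t))
    = - (LINT t|lborel. indicator {a..<b} t * (G t * \<zeta> t))"
proof -
  note [measurable] = borel_measurable_continuous_onI[OF cont]
  have ftc: "(LINT t|lborel. indicator {r..<b} t * \<zeta>' t) = \<zeta> b - \<zeta> r" if "r \<le> b" for r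
  proof -
    have "(LINT t|lborel. indicator {r..<b} t * \<zeta>' t) = (LINT t|lborel. indicator {r..b} t *\<^sub>R \<zeta>' t)"
    proof (rule integral_cong_AE)
      have "AE t in lborel. t \<noteq> b" by (rule AE_lborel_singleton)
      then show "AE t in lborel. indicator {r..<b} t * \<zeta>' t = indicator {r..b} t *\<^sub>R \<zeta>' t"
        by eventually_elim (auto simp: indicator_def less_le)
    qed measurable
    also have "\<dots> = \<zeta> b - \<zeta> r"
      using that der continuous_on_subset[OF cont]
      by (intro integral_FTC_Icc) (auto simp: has_real_derivative_iff_has_vector_derivative[symmetric] intro: DERIV_subset)
    finally show ?thesis .
  qed
  define F where "F = (\<lambda>t r. indicator {a..<b} t * (indicator {r. 0 < r} (t - r) * indicator {a..<b} r) * (G r * \<zeta>' t))"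
  have Fm: "(\<lambda>(t, r). F t r) \<in> borel_measurable (lborel \<Otimes>\<^sub>M lborel)" unfolding F_def by measurable
  have Fi: "integrable (lborel \<Otimes>\<^sub>M lborel) (\<lambda>(t, r). F t r)"
  proof -
    have "integrable lborel (\<lambda>z. indicator ({a..<b} \<times> {a..<b}) z * (L * B))"
    proof (rule integrable_bounded_mult[OF integrable_real_indicator, where B = "\<bar>L * B\<bar>"])
      show "emeasure lborel ({a..<b} \<times> {a..<b}) < \<infinity>" by (rule emeasure_bounded_finite) (auto intro: bounded_Times)
    qed (auto simp: borel_prod[symmetric])
    then have "integrable (lborel \<Otimes>\<^sub>M lborel) (\<lambda>z. indicator ({a..<b} \<times> {a..<b}) z * (L * B))" by (simp add: lborel_prod)
    then show ?thesis
    proof (rule Bochner_Integration.integrable_bound[OF _ Fm])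
      show "AE z in lborel \<Otimes>\<^sub>M lborel. norm (case z of (t, r) \<Rightarrow> F t r) \<le> norm (indicator ({a..<b} \<times> {a..<b}) z * (L * B))"
      proof (rule AE_I2)
        fix z :: "real \<times> real"
        obtain t r where z: "z = (t, r)" by (cases z)
        have "\<bar>G r * \<zeta>' t\<bar> \<le> L * B" unfolding abs_mult using Gb[of r] bnd[of t] by (intro mult_mono) auto
        then show "norm (case z of (t, r) \<Rightarrow> F t r) \<le> norm (indicator ({a..<b} \<times> {a..<b}) z * (L * B))"
          by (auto simp: z F_def indicator_def)
      qed
    qed
  qed
  let ?J = "\<lambda>t. LINT r|lborel. indicator {a..<t} r * G r"
  have Ft: "(LINT r|lborel. F t r) = indicator {a..<b} t * (?J t * \<zeta>' t)" for t
  proof (cases "t \<in> {a..<b}")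
    case True
    have "(LINT r|lborel. F t r) = (LINT r|lborel. \<zeta>' t * (indicator {a..<t} r * G r))"
      using True by (intro Bochner_Integration.integral_cong) (auto simp: F_def indicator_def)
    then show ?thesis using True by (simp add: mult.commute)
  qed (simp add: F_def)
  have Fr: "(LINT t|lborel. F t r) = indicator {a..<b} r * (G r * - \<zeta> r)" for r
  proof (cases "r \<in> {a..<b}")
    case True
    have "(LINT t|lborel. F t r) = (LINT t|lborel. G r * (indicator {r..<b} t * \<zeta>' t))"
    proof (rule integral_cong_AE)
      have "AE t in lborel. t \<noteq> r" by (rule AE_lborel_singleton)
      then show "AE t in lborel. F t r = G r * (indicator {r..<b} t * \<zeta>' t)"
        by eventually_elim (use True in \<open>auto simp: F_def indicator_def less_le\<close>)
    qed (auto simp: F_def)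
    then show ?thesis using True ftc[of r] z by simp
  qed (simp add: F_def)
  have "integrable lborel (\<lambda>t. LINT r|lborel. F t r)"
    using lborel_pair.integrable_fst'[OF Fi] by simp
  then have i2: "integrable lborel (\<lambda>t. indicator {a..<b} t * (?J t * \<zeta>' t))" by (simp add: Ft)
  have i1: "integrable lborel (\<lambda>t. C * (indicator {a..<b} t * \<zeta>' t))"
    by (intro integrable_mult_right integrable_bounded_Ico[OF _ bnd]) simp
  have "(LINT t|lborel. indicator {a..<b} t * ((C + ?J t) * \<zeta>' t))
     = (LINT t|lborel. C * (indicator {a..<b} t * \<zeta>' t) + indicator {a..<b} t * (?J t * \<zeta>' t))"
    by (intro Bochner_Integration.integral_cong) (auto simp: algebra_simps)
  also have "\<dots> = C * (LINT t|lborel. indicator {a..<b} t * \<zeta>' t) + (LINT t|lborel. indicator {a..<b} t * (?J t * \<zeta>' t))"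
    using i1 i2 by simp
  also have "(LINT t|lborel. indicator {a..<b} t * \<zeta>' t) = 0" using ftc[OF ab] z by simp
  also have "(LINT t|lborel. indicator {a..<b} t * (?J t * \<zeta>' t)) = (LINT t|lborel. LINT r|lborel. F t r)" by (simp add: Ft)
  also have "\<dots> = (LINT r|lborel. LINT t|lborel. F t r)" by (rule lborel_pair.Fubini_integral[symmetric]) (rule Fi)
  also have "\<dots> = - (LINT t|lborel. indicator {a..<b} t * (G t * \<zeta> t))" by (simp add: Fr)
  finally show ?thesis by simp
qed

text \<open>Up to null sets the path is a primitive of g on each line of fixed x, so integration by
  parts in t and Fubini apply. The bound on g may blow up towards t = -1, but the compact support of
  a test function stays away from there.\<close>

lemma weak_time_deriv_of_density:
  fixes u :: "real \<Rightarrow> real ^ 'n \<Rightarrow> real" and g :: "real \<times> (real ^ 'n) \<Rightarrow> real"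
  assumes u: "Lp_fun p (lebesgue_on Cyl) (\<lambda>z. u (fst z) (snd z))" and p: "1 < p"
    and um: "\<And>t. t \<in> {-1..0} \<Longrightarrow> u t \<in> borel_measurable (lebesgue_on B1)"
    and gm[measurable]: "g \<in> borel_measurable borel" and gb: "\<And>a. -1 < a \<Longrightarrow> \<exists>L. \<forall>z. a \<le> fst z \<longrightarrow> \<bar>g z\<bar> \<le> L"
    and inc: "\<And>s t. -1 < s \<Longrightarrow> s \<le> t \<Longrightarrow> t \<le> 0 \<Longrightarrow>
      AE x in lebesgue_on B1. u t x - u s x = (LINT r|lborel. indicator {s..<t} r * g (r, x))"
  shows "weak_time_deriv u (\<lambda>t x. g (t, x))"
  unfolding weak_time_deriv_def weak_deriv_def
proof (intro conjI allI impI)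
  have g_K: "set_integrable lebesgue K g" if K: "compact K" "K \<subseteq> Cyl" for K
  proof -
    obtain a where a: "-1 < a" "\<And>z. z \<in> K \<Longrightarrow> a \<le> fst z"
    proof (cases "K = {}")
      case False
      obtain z0 where "z0 \<in> K" "\<And>z. z \<in> K \<Longrightarrow> fst z0 \<le> fst z"
        using continuous_attains_inf[OF K(1) False continuous_on_fst[OF continuous_on_id]] by blast
      then show thesis using K by (intro that[of "fst z0"]) auto
    qed (auto intro: that[of 0])
    obtain L where L: "\<And>z. a \<le> fst z \<Longrightarrow> \<bar>g z\<bar> \<le> L" using gb[OF a(1)] by blast
    have Ks: "K \<in> sets borel" using K(1) by (simp add: borel_compact)
    have "integrable lborel (\<lambda>z. indicat_real K z * L)"
      by (rule integrable_bounded_mult[OF integrable_real_indicator, where B = "\<bar>L\<bar>"])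
        (use K(1) Ks emeasure_compact_finite in auto)
    then have "integrable lborel (\<lambda>z. indicat_real K z *\<^sub>R g z)"
    proof (rule Bochner_Integration.integrable_bound)
      show "(\<lambda>z. indicat_real K z *\<^sub>R g z) \<in> borel_measurable lborel" using Ks by measurable
      show "AE z in lborel. norm (indicat_real K z *\<^sub>R g z) \<le> norm (indicat_real K z * L)"
      proof (rule AE_I2)
        fix z show "norm (indicat_real K z *\<^sub>R g z) \<le> norm (indicat_real K z * L)"
          using L[of z] a(2)[of z] by (auto simp: indicator_def)
      qed
    qed
    then show ?thesis
      unfolding set_integrable_def by (simp add: integrable_completion borel_measurable_integrable)
  qed
  show "locally_integrable_on (\<lambda>(t, x). u t x) Cyl"
    using Lp_fun_locally_integrable[OF u] p by (simp add: case_prod_beta')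
  show "locally_integrable_on (\<lambda>(t, x). g (t, x)) Cyl"
    using g_K by (simp add: locally_integrable_on_def)
  fix \<zeta> :: "real \<times> (real ^ 'n) \<Rightarrow> real" assume \<zeta>: "test_fun Cyl \<zeta>"
  define K where "K = closure {z. \<zeta> z \<noteq> 0}"
  have K: "compact K" "K \<subseteq> Cyl" using \<zeta> by (auto simp: test_fun_def K_def)
  have s: "smooth \<zeta>" by (rule test_fun_smooth[OF \<zeta>])
  define D where "D = (\<lambda>z. frechet_derivative \<zeta> (at z) (1, 0))"
  have z0: "\<zeta> z = 0" "D z = 0" if "z \<notin> K" for z
    using that eq_0_outside_support test_fun_deriv_outside[OF \<zeta>] unfolding K_def D_def by blast+
  obtain Bd where Bd: "Bd > 0" "\<And>z. \<bar>\<zeta> z\<bar> \<le> Bd" "\<And>z. \<bar>D z\<bar> \<le> Bd"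
    using test_fun_bounds[OF \<zeta>, of "(1, 0)"] unfolding D_def by blast
  have Dc: "continuous_on UNIV D" unfolding D_def by (rule smooth_continuous[OF smooth_frechet_derivative[OF s]])
  note [measurable] = borel_measurable_continuous_onI[OF smooth_continuous[OF s]] borel_measurable_continuous_onI[OF Dc]
  \<comment> \<open>A time strictly between -1 and the support, so that \<zeta> vanishes at t = a;
    the midpoint between -1 and the earliest time of the support serves.\<close>
  obtain a where a: "-1 < a" "a \<le> 0" "\<And>z. z \<in> K \<Longrightarrow> a < fst z"
  proof (cases "K = {}")
    case False
    obtain y where y: "y \<in> K" "\<And>z. z \<in> K \<Longrightarrow> fst y \<le> fst z"
      using continuous_attains_inf[OF K(1) False continuous_on_fst[OF continuous_on_id]] by blast
    have "-1 < fst y" "fst y < 0" using y(1) K(2) by auto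
    then show thesis using y(2) by (intro that[of "(fst y - 1) / 2"]) force+
  qed (auto intro: that[of 0])
  obtain L where L: "\<And>z. a \<le> fst z \<Longrightarrow> \<bar>g z\<bar> \<le> L" using gb[OF a(1)] by blast
  \<comment> \<open>Discarding times before a makes the density bounded on all of space-time,
    without changing the integrals that start at a.\<close>
  define G where "G = (\<lambda>z. indicator {a..} (fst z) * g z)"
  have fstm[measurable]: "(fst :: real \<times> (real ^ 'n) \<Rightarrow> real) \<in> borel_measurable borel" "(snd :: real \<times> (real ^ 'n) \<Rightarrow> real ^ 'n) \<in> borel_measurable borel"
    by (intro borel_measurable_continuous_onI continuous_intros)+
  have Gm[measurable]: "G \<in> borel_measurable borel" unfolding G_def by measurable
  have Gb: "\<bar>G z\<bar> \<le> \<bar>L\<bar>" for z using L[of z] by (auto simp: G_def indicator_def)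
  have GJ: "(LINT r|lborel. indicator {a..<t} r * g (r, x)) = (LINT r|lborel. indicator {a..<t} r * G (r, x))" for t x
    by (intro Bochner_Integration.integral_cong) (auto simp: G_def indicator_def)
  have "(\<lambda>z. indicator Cyl z *\<^sub>R u (fst z) (snd z)) \<in> borel_measurable lebesgue"
    using Lp_fun_measurable[OF u] by (simp add: borel_measurable_restrict_space_iff)
  then obtain ub where ub[measurable]: "ub \<in> borel_measurable borel" and ubae: "AE z in lborel. indicator Cyl z *\<^sub>R u (fst z) (snd z) = ub z"
    using lebesgue_borel_rep by blast
  have "(\<lambda>x. indicator B1 x *\<^sub>R u a x) \<in> borel_measurable lebesgue"
    using um[of a] a by (simp add: borel_measurable_restrict_space_iff)
  then obtain ua where ua[measurable]: "ua \<in> borel_measurable borel" and uaae: "AE x in lborel. indicator B1 x *\<^sub>R u a x = ua x"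
    using lebesgue_borel_rep by blast
  \<comment> \<open>A jointly measurable version of u after time a: the slice at a plus the integral
    of the density. Indicators of r - a and t - r describe the interval [a, t) measurably in both
    variables.\<close>
  define w where "w = (\<lambda>z. ua (snd z) + (LINT r|lborel. indicator {0..} (r - a) * indicator {r. 0 < r} (fst z - r) * G (r, snd z)))"
  have Jeq: "(LINT r|lborel. indicator {0..} (r - a) * indicator {r. 0 < r} (t - r) * G (r, x)) = (LINT r|lborel. indicator {a..<t} r * G (r, x))" for t x
    by (intro Bochner_Integration.integral_cong) (auto simp: indicator_def)
  have wm[measurable]: "w \<in> borel_measurable borel"
  proof -
    have "(\<lambda>z. LINT r|lborel. (\<lambda>(z, r). indicator {0..} (r - a) * indicator {r. 0 < r} (fst z - r) * G (r, snd z)) (z, r)) \<in> borel_measurable (borel :: (real \<times> (real ^ 'n)) measure)"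
      by (rule lborel.borel_measurable_lebesgue_integral) measurable
    then show ?thesis unfolding w_def by (intro borel_measurable_add measurable_compose[OF fstm(2) ua]) simp
  qed
  let ?S = "{a..<0} \<times> (B1 :: (real ^ 'n) set)"
  have Sb[measurable]: "?S \<in> sets borel" by (simp add: borel_prod[symmetric])
  have KS: "K \<subseteq> ?S" using a(3) K(2) by force
  \<comment> \<open>For almost every t the identity holds for almost every x; both sides being Borel
    on space-time, it holds almost everywhere there.\<close>
  have ubw: "AE z in lborel. z \<in> ?S \<longrightarrow> ub z = w z"
  proof -
    have "AE t in lborel. AE x in lborel. (t, x) \<in> ?S \<longrightarrow> ub (t, x) = w (t, x)"
      using AE_lborel_slice[OF ubae] AE_lborel_singleton[of a]
    proof eventually_elim
      case (elim t)
      show ?case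
      proof (cases "t \<in> {a..<0}")
        case True
        have "AE x in lebesgue_on B1. u t x - u a x = (LINT r|lborel. indicator {a..<t} r * g (r, x))"
          using True a by (intro inc) auto
        then have "AE x in lborel. x \<in> B1 \<longrightarrow> u t x - u a x = (LINT r|lborel. indicator {a..<t} r * G (r, x))"
          by (simp add: AE_lebesgue_on_iff AE_completion_iff GJ)
        with elim(1) uaae show ?thesis
          by eventually_elim (use True a in \<open>auto simp: w_def Jeq\<close>)
      qed auto
    qed
    then have "AE z in lborel \<Otimes>\<^sub>M lborel. z \<in> ?S \<longrightarrow> ub z = w z"
    proof (rule lborel_pair.AE_pair_measure[rotated])
      have "{z \<in> space borel. z \<in> ?S \<longrightarrow> ub z = w z} \<in> sets borel" by measurable
      then show "{z \<in> space (lborel \<Otimes>\<^sub>M lborel). z \<in> ?S \<longrightarrow> ub z = w z} \<in> sets (lborel \<Otimes>\<^sub>M lborel)"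
        by (simp only: lborel_prod space_lborel sets_lborel space_borel)
    qed
    then show ?thesis unfolding lborel_prod .
  qed
  have iuD: "integrable lborel (\<lambda>z. ub z * D z)"
  proof -
    have "integrable (lebesgue_on Cyl) (\<lambda>z. u (fst z) (snd z))"
      using Lp_fun_integrable_norm[OF u] p by (simp add: finite_measure_lebesgue_on)
    then have "integrable lebesgue (\<lambda>z. indicator Cyl z *\<^sub>R u (fst z) (snd z))" by (simp add: integrable_restrict_space)
    then have "integrable lebesgue ub"
      by (rule integrable_cong_AE_imp) (use AE_completion[OF ubae] in \<open>auto intro: measurable_completion simp: eq_commute\<close>)
    then have "integrable lborel ub" by (simp add: integrable_completion)
    then show ?thesis by (rule integrable_bounded_mult[where B = Bd]) (use Bd(3) in \<open>simp_all del: split_paired_All\<close>)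
  qed
  have aeD: "AE z in lborel. ub z * D z = indicator ?S z * (w z * D z)"
    using ubw
  proof eventually_elim
    case (elim z)
    show ?case
    proof (cases "z \<in> K")
      case True
      then show ?thesis using elim KS by (auto simp: indicator_def)
    qed (simp add: z0)
  qed
  have iwD: "integrable lborel (\<lambda>z. indicator ?S z * (w z * D z))"
    by (rule integrable_cong_AE_imp[OF iuD _ aeD]) measurable
  have igz: "integrable lborel (\<lambda>z. indicator ?S z * (G z * \<zeta> z))"
  proof (rule integrable_bounded_mult[OF integrable_real_indicator, where B = "\<bar>L\<bar> * Bd"])
    show "emeasure lborel ?S < \<infinity>" by (rule emeasure_bounded_finite) (auto intro: bounded_Times)
    show "AE z in lborel. \<bar>G z * \<zeta> z\<bar> \<le> \<bar>L\<bar> * Bd"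
      unfolding abs_mult using Gb Bd by (intro AE_I2 mult_mono) auto
  qed auto
  have fub: "(LINT z|lborel. f z) = (LINT x|lborel. LINT t|lborel. f (t, x))" if "integrable lborel f" for f :: "real \<times> (real ^ 'n) \<Rightarrow> real"
    using lborel_pair.integral_snd[of "\<lambda>t x. f (t, x)"] that by (simp add: lborel_prod)
  have "(LINT z:Cyl|lebesgue. (case z of (t, x) \<Rightarrow> u t x) * D z) = (LINT z|lebesgue. ub z * D z)"
    unfolding set_lebesgue_integral_def
  proof (rule integral_cong_AE)
    have "(\<lambda>z. (indicator Cyl z *\<^sub>R u (fst z) (snd z)) * D z) \<in> borel_measurable lebesgue"
      using Lp_fun_measurable[OF u] by (intro borel_measurable_times) (auto simp: borel_measurable_restrict_space_iff intro: measurable_completion)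
    then show "(\<lambda>z. indicator Cyl z *\<^sub>R ((case z of (t, x) \<Rightarrow> u t x) * D z)) \<in> borel_measurable lebesgue"
      by (simp add: case_prod_beta' mult.assoc)
    show "(\<lambda>z. ub z * D z) \<in> borel_measurable lebesgue" by (intro measurable_completion) measurable
    show "AE z in lebesgue. indicator Cyl z *\<^sub>R ((case z of (t, x) \<Rightarrow> u t x) * D z) = ub z * D z"
      using AE_completion[OF ubae]
    proof eventually_elim
      case (elim z)
      have "indicator Cyl z *\<^sub>R ((case z of (t, x) \<Rightarrow> u t x) * D z) = (indicator Cyl z *\<^sub>R u (fst z) (snd z)) * D z"
        by (simp add: case_prod_beta')
      then show ?case by (simp only: elim)
    qed
  qed
  also have "\<dots> = (LINT z|lborel. ub z * D z)" by (rule integral_completion) measurable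
  also have "\<dots> = (LINT z|lborel. indicator ?S z * (w z * D z))" by (rule integral_cong_AE[OF _ _ aeD]) measurable
  also have "\<dots> = (LINT x|lborel. LINT t|lborel. indicator ?S (t, x) * (w (t, x) * D (t, x)))" by (rule fub[OF iwD])
  also have "\<dots> = (LINT x|lborel. - (LINT t|lborel. indicator ?S (t, x) * (G (t, x) * \<zeta> (t, x))))"
  proof (rule Bochner_Integration.integral_cong[OF refl])
    fix x :: "real ^ 'n"
    show "(LINT t|lborel. indicator ?S (t, x) * (w (t, x) * D (t, x))) = - (LINT t|lborel. indicator ?S (t, x) * (G (t, x) * \<zeta> (t, x)))"
    proof (cases "x \<in> B1")
      case True
      have "(LINT t|lborel. indicator {a..<0} t * ((ua x + (LINT r|lborel. indicator {a..<t} r * G (r, x))) * D (t, x)))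
        = - (LINT t|lborel. indicator {a..<0} t * (G (t, x) * \<zeta> (t, x)))"
      proof (rule integral_by_parts_lipschitz[where L = "\<bar>L\<bar>" and B = Bd])
        show "((\<lambda>t. \<zeta> (t, x)) has_real_derivative D (t, x)) (at t)" for t
          using smooth_has_derivative_line[OF s, of "(0, x)" "(1, 0)" t] by (simp add: D_def)
        show "continuous_on UNIV (\<lambda>t. D (t, x))" by (rule continuous_on_compose2[OF Dc]) (auto intro: continuous_intros)
        show "\<zeta> (a, x) = 0" using a(3)[of "(a, x)"] by (intro z0) auto
        show "\<zeta> (0, x) = 0" using K(2) by (intro z0) auto
        show "(\<lambda>t. G (t, x)) \<in> borel_measurable borel" by measurable
      qed (use a Gb Bd in auto)
      moreover have "indicator ?S (t, x) = (indicator {a..<0} t :: real)" for t using True by (simp add: indicator_def)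
      ultimately show ?thesis by (simp add: w_def Jeq)
    qed (simp add: indicator_def)
  qed
  also have "\<dots> = - (LINT x|lborel. LINT t|lborel. indicator ?S (t, x) * (G (t, x) * \<zeta> (t, x)))" by simp
  also have "\<dots> = - (LINT z|lborel. indicator ?S z * (G z * \<zeta> z))" by (simp only: fub[OF igz])
  also have "(LINT z|lborel. indicator ?S z * (G z * \<zeta> z)) = (LINT z:Cyl|lebesgue. (case z of (t, x) \<Rightarrow> g (t, x)) * \<zeta> z)"
  proof -
    have eq: "indicator ?S z * (G z * \<zeta> z) = indicator Cyl z *\<^sub>R ((case z of (t, x) \<Rightarrow> g (t, x)) * \<zeta> z)" for z
      using KS K(2) z0(1)[of z] by (cases "z \<in> K") (auto simp: indicator_def G_def)
    have "(LINT z|lborel. indicator ?S z * (G z * \<zeta> z)) = (LINT z|lebesgue. indicator ?S z * (G z * \<zeta> z))"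
      by (rule integral_completion[symmetric]) measurable
    then show ?thesis unfolding set_lebesgue_integral_def by (simp only: eq)
  qed
  finally show "(LINT z:Cyl|lebesgue. (case z of (t, x) \<Rightarrow> u t x) * frechet_derivative \<zeta> (at z) (1, 0))
    = - (LINT z:Cyl|lebesgue. (case z of (t, x) \<Rightarrow> g (t, x)) * \<zeta> z)" by (simp only: D_def)
qed

text \<open>The Lipschitz constant degenerates as \<open>s \<rightarrow> -1\<close>, so the time derivative is glued from the
  dyadic layers \<open>-1 + 2^(-N-1) \<le> t < -1 + 2^(-N)\<close>.\<close>

lemma weak_time_deriv_of_lipschitz:
  fixes u :: "real \<Rightarrow> real ^ 'n \<Rightarrow> real"
  assumes u: "Lp_fun p (lebesgue_on Cyl) (\<lambda>z. u (fst z) (snd z))" and p: "1 < p" and \<Lambda>: "0 \<le> \<Lambda>"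
    and um: "\<And>t. t \<in> {-1..0} \<Longrightarrow> u t \<in> borel_measurable (lebesgue_on B1)"
    and lip: "\<And>s t. -1 < s \<Longrightarrow> s < t \<Longrightarrow> t \<le> 0 \<Longrightarrow> AE x in lebesgue_on B1. \<bar>u t x - u s x\<bar> \<le> \<Lambda> * ((t - s) / (t + 1))"
  obtains g where "weak_time_deriv u (\<lambda>t x. g (t, x))" "\<And>t x. -3/4 < t \<Longrightarrow> t \<le> 0 \<Longrightarrow> \<bar>g (t, x)\<bar> \<le> 4 * \<Lambda>"
proof -
  define e where "e = (\<lambda>N::nat. -1 + (1 / 2) ^ N :: real)"
  have e0: "e 0 = 0" by (simp add: e_def)
  have em: "e (Suc N) < e N" and em1: "-1 < e N" and e_le0: "e N \<le> 0" for N by (auto simp: e_def power_le_one)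
  define P where "P = (\<lambda>N (g :: real \<times> (real ^ 'n) \<Rightarrow> real). g \<in> borel_measurable borel \<and> (\<forall>z. \<bar>g z\<bar> \<le> \<Lambda> * 2 ^ (Suc N)) \<and>
    (\<forall>s t. e (Suc N) \<le> s \<longrightarrow> s \<le> t \<longrightarrow> t \<le> e N \<longrightarrow>
      (AE x in lebesgue_on B1. u t x - u s x = (LINT r|lborel. indicator {s..<t} r * g (r, x)))))"
  have "\<exists>g. P N g" for N
  proof -
    have l: "AE x in lebesgue_on B1. \<bar>u t x - u s x\<bar> \<le> \<Lambda> * 2 ^ (Suc N) * (t - s)" if st: "e (Suc N) \<le> s" "s \<le> t" "t \<le> e N" for s t
    proof (cases "s = t")
      case False
      then have lt: "s < t" "-1 < s" "t \<le> 0" using st em1[of "Suc N"] e_le0[of N] by auto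
      \<comment> \<open>On layer N the distance t + 1 from the initial time is at least 2^(-N-1), so
        2^(N+1) is the Lipschitz factor of the layer.\<close>
      have "(1 / 2) ^ Suc N \<le> t + 1" using st by (simp add: e_def)
      then have "1 / (t + 1) \<le> 1 / (1 / 2) ^ Suc N" using lt by (intro divide_left_mono) auto
      also have "\<dots> = 2 ^ Suc N" by (simp add: power_one_over)
      finally have "1 / (t + 1) * (t - s) \<le> 2 ^ Suc N * (t - s)" using lt by (intro mult_right_mono) auto
      then have le: "\<Lambda> * ((t - s) / (t + 1)) \<le> \<Lambda> * 2 ^ (Suc N) * (t - s)"
        using mult_left_mono[OF _ \<Lambda>, of "1 / (t + 1) * (t - s)" "2 ^ Suc N * (t - s)"] by (simp add: mult.assoc)
      from lip[OF lt(2,1,3)] show ?thesis by eventually_elim (use le in linarith)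
    qed simp
    have m: "u t \<in> borel_measurable (lebesgue_on B1)" if "t \<in> {e (Suc N)..e N}" for t
      using that em1[of "Suc N"] e_le0[of N] by (intro um) auto
    have nn: "0 \<le> \<Lambda> * 2 ^ (Suc N)" using \<Lambda> by simp
    show ?thesis
    proof (rule lipschitz_path_density[OF em[of N] nn m l])
      fix g :: "real \<times> (real ^ 'n) \<Rightarrow> real"
      assume "g \<in> borel_measurable borel" "\<And>z. \<bar>g z\<bar> \<le> \<Lambda> * 2 ^ (Suc N)"
        "\<And>s t. e (Suc N) \<le> s \<Longrightarrow> s \<le> t \<Longrightarrow> t \<le> e N \<Longrightarrow>
          AE x in lebesgue_on B1. u t x - u s x = (LINT r|lborel. indicator {s..<t} r * g (r, x))"
      then show ?thesis unfolding P_def by (intro exI[of _ g] conjI allI impI)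
    qed
  qed
  then obtain gN where gN: "\<And>N. P N (gN N)" by metis
  have gNm: "gN N \<in> borel_measurable borel" and gNb: "\<bar>gN N z\<bar> \<le> \<Lambda> * 2 ^ (Suc N)" for N z
    using gN[of N] unfolding P_def by blast+
  have gNi: "AE x in lebesgue_on B1. u t x - u s x = (LINT r|lborel. indicator {s..<t} r * gN N (r, x))"
    if "e (Suc N) \<le> s" "s \<le> t" "t \<le> e N" for N s t
    using gN[of N] that unfolding P_def by blast
  define lay where "lay = (\<lambda>t. LEAST N. e (Suc N) \<le> t)"
  have edec: "e n \<le> e m" if "m \<le> n" for m n using that by (simp add: e_def power_decreasing)
  have exN: "\<exists>N. e (Suc N) \<le> t" if "-1 < t" for t
  proof -
    have "0 < t + 1" using that by simp
    then obtain N where "(1 / 2) ^ N < t + 1" using real_arch_pow_inv[of "t + 1" "1/2"] by auto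
    moreover have "(1 / 2) ^ Suc N \<le> (1 / 2 :: real) ^ N" by simp
    ultimately show ?thesis unfolding e_def by (intro exI[of _ N]) linarith
  qed
  have lay_le: "lay t \<le> N" if "e (Suc N) \<le> t" for t N unfolding lay_def using that by (rule Least_le)
  have lay_eq: "lay t = N" if "e (Suc N) \<le> t" "t < e N" for t N
  proof (rule antisym[OF lay_le[OF that(1)]])
    have "e (Suc (lay t)) \<le> t" unfolding lay_def by (rule LeastI[of _ N]) (rule that(1))
    then show "N \<le> lay t" using edec[of "Suc (lay t)" N] that(2) by (metis not_less_eq_eq order.trans not_le)
  qed
  \<comment> \<open>The value 0 outside the open time interval keeps the bounds valid for all
    arguments; at t = 0 it alters a null set only.\<close>
  define g where "g = (\<lambda>z. if -1 < fst z \<and> fst z < 0 then gN (lay (fst z)) z else 0)"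
  have fstm[measurable]: "(fst :: real \<times> (real ^ 'n) \<Rightarrow> real) \<in> borel_measurable borel"
    by (intro borel_measurable_continuous_onI continuous_intros)
  have laym: "lay \<in> borel \<rightarrow>\<^sub>M count_space UNIV" unfolding lay_def by measurable
  have gm: "g \<in> borel_measurable borel"
  proof -
    have "(\<lambda>z. gN (lay (fst z)) z) \<in> borel_measurable borel"
      by (rule measurable_compose_countable[OF gNm measurable_compose[OF fstm laym]])
    then show ?thesis unfolding g_def by measurable
  qed
  have gb: "\<bar>g z\<bar> \<le> \<Lambda> * 2 ^ Suc N" if "e (Suc N) \<le> fst z" for z N
  proof (cases "-1 < fst z \<and> fst z < 0")
    case True
    have "\<bar>g z\<bar> \<le> \<Lambda> * 2 ^ Suc (lay (fst z))" using True gNb by (simp add: g_def del: power_Suc)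
    also have "\<dots> \<le> \<Lambda> * 2 ^ Suc N" using lay_le[OF that] \<Lambda> by (intro mult_left_mono power_increasing) auto
    finally show ?thesis .
  qed (use \<Lambda> in \<open>auto simp: g_def\<close>)
  have gs: "(\<lambda>r. g (r, x)) \<in> borel_measurable borel" for x by (rule measurable_compose[OF _ gm]) measurable
  have layer: "AE x in lebesgue_on B1. u t x - u s x = (LINT r|lborel. indicator {s..<t} r * g (r, x))"
    if st: "e (Suc N) \<le> s" "s \<le> t" "t \<le> e N" for s t N
  proof -
    have "(LINT r|lborel. indicator {s..<t} r * g (r, x)) = (LINT r|lborel. indicator {s..<t} r * gN N (r, x))" for x
      using st em1[of "Suc N"] e_le0[of N] lay_eq[of N]
      by (intro Bochner_Integration.integral_cong) (auto simp: indicator_def g_def)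
    then show ?thesis using gNi[OF st] by simp
  qed
  \<comment> \<open>Induction over the layers from the latest one backwards. An interval crossing
    the time e N is split there, after truncating the density so that it is bounded on the whole
    line.\<close>
  have tail: "AE x in lebesgue_on B1. u t x - u s x = (LINT r|lborel. indicator {s..<t} r * g (r, x))"
    if "e N \<le> s" "s \<le> t" "t \<le> 0" for s t N
    using that
  proof (induction N arbitrary: s t)
    case 0
    then have "s = t" by (simp add: e0)
    then show ?case by simp
  next
    case (Suc N)
    consider "e N \<le> s" | "t \<le> e N" | "s < e N" "e N < t" by linarith
    then show ?case
    proof cases
      case 1 then show ?thesis using Suc by blast
    next
      case 2 then show ?thesis using Suc.prems layer by blast
    next
      case 3
      have A: "AE x in lebesgue_on B1. u (e N) x - u s x = (LINT r|lborel. indicator {s..<e N} r * g (r, x))"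
        using Suc.prems 3 by (intro layer[of N]) auto
      have B: "AE x in lebesgue_on B1. u t x - u (e N) x = (LINT r|lborel. indicator {e N..<t} r * g (r, x))"
        using Suc.prems 3 by (intro Suc.IH) auto
      from A B show ?thesis
      proof eventually_elim
        case (elim x)
        define G where "G = (\<lambda>r. indicator {e (Suc N)..} r * g (r, x))"
        have Gm: "G \<in> borel_measurable borel" unfolding G_def using gs[of x] by measurable
        have Gb: "\<bar>G r\<bar> \<le> \<Lambda> * 2 ^ Suc N" for r using gb[of N "(r, x)"] \<Lambda> by (auto simp: G_def indicator_def)
        have Geq: "(LINT r|lborel. indicator {p..<q} r * g (r, x)) = (LINT r|lborel. indicator {p..<q} r * G r)" if "e (Suc N) \<le> p" for p q
          using that by (intro Bochner_Integration.integral_cong) (auto simp: G_def indicator_def)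
        show ?case
          using elim integral_Ico_split[OF Gm Gb, of s "e N" t] 3 Suc.prems em[of N] by (simp add: Geq)
      qed
    qed
  qed
  show thesis
  proof (rule that)
    show "weak_time_deriv u (\<lambda>t x. g (t, x))"
    proof (rule weak_time_deriv_of_density[OF u p um gm])
      fix a :: real assume "-1 < a"
      then obtain N where "e (Suc N) \<le> a" using exN by blast
      then show "\<exists>L. \<forall>z. a \<le> fst z \<longrightarrow> \<bar>g z\<bar> \<le> L" using gb by (metis order.trans)
    next
      fix s t :: real assume "-1 < s" "s \<le> t" "t \<le> 0"
      then show "AE x in lebesgue_on B1. u t x - u s x = (LINT r|lborel. indicator {s..<t} r * g (r, x))"
        using exN tail by blast
    qed
    fix t :: real and x :: "real ^ 'n" assume "-3/4 < t" "t \<le> 0"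
    \<comment> \<open>Index 1 gives e 2 = -3/4 and the factor 2^2 = 4.\<close>
    then show "\<bar>g (t, x)\<bar> \<le> 4 * \<Lambda>" using gb[of 1 "(t, x)"] by (simp add: e_def power2_eq_square)
  qed
qed

section \<open>The Lipschitz estimate\<close>

lemma slab_sol_restrict:
  assumes sol: "slab_sol p b F \<phi> u G" and b': "b' \<le> b"
  shows "slab_sol p b' F \<phi> u G"
proof -
  have sub: "{-1..b'} \<subseteq> {-1..b}" "{-1<..<b'} \<times> B1 \<subseteq> {-1<..<b} \<times> (B1 :: (real ^ 'n) set)" using b' by auto
  have "(\<lambda>z. u (fst z) (snd z)) \<in> borel_measurable (lebesgue_on ({-1<..<b'} \<times> B1))"
  proof -
    have eq: "lebesgue_on ({-1<..<b'} \<times> B1) = restrict_space (lebesgue_on ({-1<..<b} \<times> B1)) ({-1<..<b'} \<times> (B1 :: (real ^ 'n) set))"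
      by (subst restrict_restrict_space) (simp_all add: Int_absorb1[OF sub(2)])
    show ?thesis
      by (subst eq, rule measurable_restrict_space1) (use sol in \<open>simp add: slab_sol_def\<close>)
  qed
  moreover have "Lp_fun p (lebesgue_on ({-1<..<b'} \<times> B1)) (\<lambda>z. G (fst z) (snd z))"
    using sol sub(2) unfolding slab_sol_def by (intro Lp_fun_subset[OF _ sub(2)]) auto
  moreover have "AE t in lebesgue_on {-1<..<b'}. has_trace p (u t) (G t) \<phi>"
  proof -
    have "AE t in lebesgue. t \<in> {-1<..<b} \<longrightarrow> has_trace p (u t) (G t) \<phi>"
      using sol unfolding slab_sol_def by (simp add: AE_lebesgue_on_iff)
    then have "AE t in lebesgue. t \<in> {-1<..<b'} \<longrightarrow> has_trace p (u t) (G t) \<phi>"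
      by eventually_elim (use b' in auto)
    then show ?thesis by (simp add: AE_lebesgue_on_iff)
  qed
  moreover have "((\<lambda>s. LINT x|lebesgue_on B1. (u s x - u t x)\<^sup>2) \<longlongrightarrow> 0) (at t within {-1..b'})" if "t \<in> {-1..b'}" for t
    using sol sub(1) that unfolding slab_sol_def by (meson subsetD tendsto_within_subset)
  ultimately show ?thesis
    using sol b' unfolding slab_sol_def by (auto intro: order.trans)
qed

section \<open>Essential suprema and bounds on time slices\<close>

lemma Linf_norm_AE: "AE x in M. ereal \<bar>g x\<bar> \<le> Linf_norm M g"
  unfolding Linf_norm_def by (rule esssup_AE)

lemma AE_abs_le_of_Linf_norm_le:
  assumes "Linf_norm M g \<le> ereal r" shows "AE x in M. \<bar>g x\<bar> \<le> r"
  using Linf_norm_AE[of g M] by eventually_elim (metis assms ereal_less_eq(3) order.trans)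

text \<open>The ball has positive measure, so the norm is at least some |g x| and cannot be
  negative; together with finiteness this makes the conversion to a real number faithful.\<close>

lemma Linf_norm_finite:
  fixes g :: "real ^ 'n \<Rightarrow> real"
  assumes fin: "Linf_norm (lebesgue_on B1) g < \<infinity>"
  shows "0 \<le> real_of_ereal (Linf_norm (lebesgue_on B1) g)"
    and "Linf_norm (lebesgue_on B1) g = ereal (real_of_ereal (Linf_norm (lebesgue_on B1) g))"
proof -
  let ?M = "lebesgue_on (B1 :: (real ^ 'n) set)"
  have "emeasure ?M (space ?M) \<noteq> 0"
    using content_ball_pos[of 1 "0 :: real ^ 'n"]
    by (auto simp: emeasure_restrict_space space_restrict_space measure_def)
  then have "ae_filter ?M \<noteq> bot" by (simp add: ae_filter_eq_bot_iff)
  from eventually_happens'[OF this Linf_norm_AE[of g]]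
  obtain x where "ereal \<bar>g x\<bar> \<le> Linf_norm ?M g" by blast
  then have 0: "0 \<le> Linf_norm ?M g" by (metis abs_ge_zero ereal_less_eq(5) order.trans)
  then show "0 \<le> real_of_ereal (Linf_norm ?M g)" by (rule real_of_ereal_pos)
  show "Linf_norm ?M g = ereal (real_of_ereal (Linf_norm ?M g))"
    using 0 fin by (cases "Linf_norm ?M g") auto
qed

text \<open>Finiteness of the norm yields measurability of |f| only; as f is nonnegative almost
  everywhere, it agrees with |f| off a null set.\<close>

lemma borel_measurable_of_Linf_norm:
  fixes f :: "real ^ 'n \<Rightarrow> real"
  assumes fin: "Linf_norm (lebesgue_on B1) f < \<infinity>" and pos: "AE x in lebesgue_on B1. 0 \<le> f x"
  shows "f \<in> borel_measurable (lebesgue_on B1)"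
proof -
  have "(\<lambda>x. ereal \<bar>f x\<bar>) \<in> borel_measurable (lebesgue_on B1)"
    using fin esssup_non_measurable unfolding Linf_norm_def by (metis less_irrefl top_ereal_def)
  then have "(\<lambda>x. \<bar>f x\<bar>) \<in> borel_measurable (lebesgue_on B1)" by simp
  then have "(\<lambda>x. indicator B1 x *\<^sub>R \<bar>f x\<bar>) \<in> borel_measurable lebesgue"
    by (simp add: borel_measurable_restrict_space_iff)
  moreover have "AE x in lebesgue. indicator B1 x *\<^sub>R \<bar>f x\<bar> = indicator B1 x *\<^sub>R f x"
  proof -
    have "AE x in lebesgue. x \<in> B1 \<longrightarrow> 0 \<le> f x" using pos by (simp add: AE_lebesgue_on_iff)
    then show ?thesis by eventually_elim (auto simp: indicator_def)
  qed
  ultimately have "(\<lambda>x. indicator B1 x *\<^sub>R f x) \<in> borel_measurable lebesgue" by (rule borel_measurable_AE)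
  then show ?thesis by (simp add: borel_measurable_restrict_space_iff)
qed

text \<open>Slicing gives the bound at almost every time. Every t is a limit of such times, and
  continuity in L^2 along an almost everywhere convergent subsequence carries the bound to t, the
  initial time included.\<close>

lemma slab_sol_slice_bound:
  fixes u :: "real \<Rightarrow> real ^ 'n \<Rightarrow> real"
  assumes sol: "slab_sol p 0 f \<phi> u G"
    and bd: "AE z in lebesgue_on ({-1<..0} \<times> B1). \<bar>u (fst z) (snd z)\<bar> \<le> K" and t: "t \<in> {-1..0}"
  shows "AE x in lebesgue_on B1. \<bar>u t x\<bar> \<le> K"
proof -
  let ?M = "lebesgue_on (B1 :: (real ^ 'n) set)"
  have "AE z in lborel. z \<in> {-1<..0} \<times> B1 \<longrightarrow> \<bar>u (fst z) (snd z)\<bar> \<le> K"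
    using bd by (simp add: AE_lebesgue_on_iff AE_completion_iff)
  from AE_lborel_slice[OF this]
  have good: "AE r in lborel. r \<in> {-1<..0} \<longrightarrow> (AE x in ?M. \<bar>u r x\<bar> \<le> K)"
  proof eventually_elim
    case (elim r)
    show ?case
    proof
      assume r: "r \<in> {-1<..0}"
      have "AE x in lborel. x \<in> B1 \<longrightarrow> \<bar>u r x\<bar> \<le> K" using elim by eventually_elim (use r in auto)
      then show "AE x in ?M. \<bar>u r x\<bar> \<le> K" by (simp add: AE_lebesgue_on_iff AE_completion_iff)
    qed
  qed
  have "\<exists>r\<in>{-1..0}. \<bar>r - t\<bar> \<le> 1 / (real k + 1) \<and> (AE x in ?M. \<bar>u r x\<bar> \<le> K)" for k
  proof (rule ccontr)
    assume contra: "\<not> ?thesis"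
    \<comment> \<open>The part of the neighbourhood of t inside [-1, 0] has positive length even
      when t is an endpoint, so it cannot consist of bad times.\<close>
    define l where "l = max (-1) (t - 1 / (real k + 1))"
    define h where "h = min 0 (t + 1 / (real k + 1))"
    have "0 < 1 / (real k + 1)" by simp
    then have lh: "l < h" using t unfolding l_def h_def atLeastAtMost_iff by linarith
    have "AE r in lborel. r \<notin> {l<..<h}"
      using good
    proof eventually_elim
      case (elim r)
      show ?case
      proof
        assume "r \<in> {l<..<h}"
        then have "r \<in> {-1<..0}" "r \<in> {-1..0}" "\<bar>r - t\<bar> \<le> 1 / (real k + 1)" by (auto simp: l_def h_def)
        with elim contra show False by blast
      qed
    qed
    then have "{l<..<h} \<in> null_sets lborel" by (subst AE_iff_null_sets) auto
    then have "emeasure lborel {l<..<h} = 0" by (rule null_setsD1)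
    then show False using lh by simp
  qed
  then obtain X where X: "\<And>k. X k \<in> {-1..0}" "\<And>k. \<bar>X k - t\<bar> \<le> 1 / (real k + 1)" "\<And>k. AE x in ?M. \<bar>u (X k) x\<bar> \<le> K" by metis
  have Xt: "X \<longlonglongrightarrow> t"
  proof -
    have "(\<lambda>k. 1 / (real k + 1)) \<longlonglongrightarrow> 0" using LIMSEQ_inverse_real_of_nat by (simp add: inverse_eq_divide add.commute)
    then have "(\<lambda>k. X k - t) \<longlonglongrightarrow> 0" by (rule Lim_null_comparison[rotated]) (use X(2) in auto)
    then show ?thesis by (rule LIM_zero_cancel)
  qed
  have "Lp_tendsto 2 ?M (\<lambda>k x. u (X k) x - 0) (\<lambda>x. u t x - 0)"
    by (rule L2_path_diff[where T = "{-1..0}" and v = "\<lambda>_ _. 0"]) (use sol X Xt t in \<open>auto simp: slab_sol_def\<close>)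
  then obtain r where r: "AE x in ?M. (\<lambda>k. u (X (r k)) x) \<longlonglongrightarrow> u t x"
    using Lp_tendsto_AE_subseq[of 2 ?M "\<lambda>k. u (X k)" "u t"] by auto
  have "AE x in ?M. \<forall>k. \<bar>u (X k) x\<bar> \<le> K" using X(3) by (simp add: AE_all_countable)
  with r show ?thesis
  proof eventually_elim
    case (elim x)
    then show ?case by (intro Lim_bounded[OF tendsto_rabs[OF elim(1)], of 0]) auto
  qed
qed

text \<open>In u(t) - u(s) = (1-j) u(t) - (u(s) - j u(t)) the first term is controlled by the bound
  on the slice u(t). The second is the difference at time s of u and its rescaling, to which the
  comparison principle applies in both directions.\<close>

lemma slab_sol_lipschitz:
  fixes u :: "real \<Rightarrow> real ^ 'n \<Rightarrow> real"
  assumes p: "1 < p" "p < 2" and sol: "slab_sol p 0 f \<phi> u G"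
    and f: "f \<in> borel_measurable (lebesgue_on B1)" "AE x in lebesgue_on B1. \<bar>f x\<bar> \<le> Kf"
    and \<phi>: "AE x in lebesgue_on B1. \<bar>\<phi> x\<bar> \<le> K\<phi>" "AE x in surface_measure. \<bar>\<phi> x\<bar> \<le> K\<phi>"
    and K: "0 \<le> Kf" "0 \<le> K\<phi>" "0 \<le> Ku"
    and s: "-1 < s" "s < t" "t \<le> 0"
    and ut: "AE x in lebesgue_on B1. \<bar>u t x\<bar> \<le> Ku"
  shows "AE x in lebesgue_on B1. \<bar>u t x - u s x\<bar> \<le> (K\<phi> + Kf + Ku) / (2 - p) * ((t - s) / (t + 1))"
proof -
  let ?M = "lebesgue_on (B1 :: (real ^ 'n) set)"
  define l where "l = (s + 1) / (t + 1)"
  have l: "0 < l" "l < 1" using s by (auto simp: l_def)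
  define j where "j = l powr (1 / (2 - p))"
  have j: "0 < j" "j < 1" using l p powr_less_mono2[of "1 / (2 - p)" l 1] by (auto simp: j_def)
  have jl: "j powr (2 - p) = l" using l p by (simp add: j_def powr_powr)
  define F2 where "F2 = (\<lambda>x. j powr (p - 1) * f x)"
  define w where "w = (\<lambda>r x. j * u ((r + 1) / l - 1) x)"
  \<comment> \<open>The rescaled solution lives up to time l - 1, and t \<le> 0 ensures that this is
    not before s.\<close>
  have sl: "s \<le> l - 1"
  proof -
    have "(s + 1) * (t + 1) \<le> (s + 1) * 1" using s by (intro mult_left_mono) auto
    then have "s + 1 \<le> (s + 1) / (t + 1)" using s by (simp add: pos_le_divide_eq)
    then show ?thesis by (simp add: l_def)
  qed
  obtain Gw where solw: "slab_sol p s F2 (\<lambda>x. j * \<phi> x) w Gw"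
    using slab_sol_restrict[OF slab_sol_rescale[OF p l j_def sol] sl] unfolding F2_def w_def by blast
  have solu: "slab_sol p s f \<phi> u G" by (rule slab_sol_restrict[OF sol]) (use s in auto)
  have ws: "w s x = j * u t x" for x
  proof -
    have "(s + 1) / l - 1 = t" using s by (simp add: l_def)
    then show ?thesis by (simp only: w_def)
  qed
  have ifu: "integrable ?M f"
    by (rule Lp_fun_integrable_norm[of 2, OF Lp_fun_bounded[OF finite_measure_B1 f(1)] _ finite_measure_B1]) (use f in auto)
  then have iF2: "integrable ?M F2" unfolding F2_def by simp
  \<comment> \<open>As 0 < p - 1 < 1, the power j^(p-1) lies between j and 1, so the source changes
    by at most 1 - j times its bound, just as the data do.\<close>
  have jp: "j \<le> j powr (p - 1)" "j powr (p - 1) \<le> 1"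
    using j p powr_mono'[of "p - 1" 1 j] powr_mono2[of "p - 1" j 1] by auto
  define c where "c = (1 - j) * Kf"
  define m where "m = (1 - j) * K\<phi>"
  have c0: "0 \<le> c" using j K by (simp add: c_def)
  have dF: "AE x in ?M. \<bar>f x - F2 x\<bar> \<le> c"
    using f(2)
  proof eventually_elim
    case (elim x)
    have "f x - F2 x = (1 - j powr (p - 1)) * f x" by (simp add: F2_def left_diff_distrib)
    then have "\<bar>f x - F2 x\<bar> = (1 - j powr (p - 1)) * \<bar>f x\<bar>" using jp by (simp add: abs_mult)
    also have "\<dots> \<le> c" unfolding c_def using jp elim K j by (intro mult_mono) auto
    finally show ?case .
  qed
  have d\<phi>: "AE x in N. \<bar>\<phi> x - j * \<phi> x\<bar> \<le> m" if "AE x in N. \<bar>\<phi> x\<bar> \<le> K\<phi>" for N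
    using that
  proof eventually_elim
    case (elim x)
    have "\<phi> x - j * \<phi> x = (1 - j) * \<phi> x" by (simp add: algebra_simps)
    then have "\<bar>\<phi> x - j * \<phi> x\<bar> = (1 - j) * \<bar>\<phi> x\<bar>" using j by (simp add: abs_mult)
    also have "\<dots> \<le> m" unfolding m_def using elim j by (intro mult_left_mono) auto
    finally show ?case .
  qed
  have le: "AE x in ?M. f x - F2 x \<le> c" "AE x in ?M. F2 x - f x \<le> c"
    using dF by (eventually_elim, simp add: abs_le_iff)+
  have le\<phi>: "AE x in N. \<phi> x - j * \<phi> x \<le> m" "AE x in N. j * \<phi> x - \<phi> x \<le> m" if "AE x in N. \<bar>\<phi> x\<bar> \<le> K\<phi>" for N
    using d\<phi>[OF that] by (eventually_elim, simp add: abs_le_iff)+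
  have up: "AE x in ?M. u s x - w s x \<le> m + c * (s + 1)"
    by (rule comparison[OF p(1) s(1) solu solw ifu iF2 le(1) c0 le\<phi>(1)[OF \<phi>(1)] le\<phi>(1)[OF \<phi>(2)]])
  have lo: "AE x in ?M. w s x - u s x \<le> m + c * (s + 1)"
    by (rule comparison[OF p(1) s(1) solw solu iF2 ifu le(2) c0 le\<phi>(2)[OF \<phi>(1)] le\<phi>(2)[OF \<phi>(2)]])
  have bern: "1 - j \<le> 1 / (2 - p) * ((t - s) / (t + 1))"
  proof -
    \<comment> \<open>Weighted arithmetic-geometric mean of j and 1 with weights 2 - p and p - 1;
      the left side is l.\<close>
    have "j powr (2 - p) * 1 powr (p - 1) \<le> (2 - p) * j + (p - 1) * 1"
      using Youngs_inequality_0[of "2 - p" "p - 1" j 1] p j by simp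
    then have "(2 - p) * (1 - j) \<le> 1 - l" by (simp add: jl algebra_simps)
    also have "1 - l = (t - s) / (t + 1)" using s by (simp add: l_def field_simps)
    finally have A: "(2 - p) * (1 - j) \<le> (t - s) / (t + 1)" .
    have "1 - j = 1 / (2 - p) * ((2 - p) * (1 - j))" using p by simp
    also have "\<dots> \<le> 1 / (2 - p) * ((t - s) / (t + 1))" using p by (intro mult_left_mono A) auto
    finally show ?thesis .
  qed
  show ?thesis
    using up lo ut
  proof eventually_elim
    case (elim x)
    have "c * (s + 1) \<le> c * 1" using c0 s by (intro mult_left_mono) auto
    then have 1: "\<bar>u s x - j * u t x\<bar> \<le> (1 - j) * (K\<phi> + Kf)" using elim(1,2) by (simp add: ws m_def c_def algebra_simps abs_le_iff)
    have 2: "\<bar>(1 - j) * u t x\<bar> \<le> (1 - j) * Ku" using elim(3) j by (simp add: abs_mult mult_left_mono)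
    have "u t x - u s x = (1 - j) * u t x - (u s x - j * u t x)" by (simp add: algebra_simps)
    then have "\<bar>u t x - u s x\<bar> \<le> (1 - j) * Ku + (1 - j) * (K\<phi> + Kf)" using 1 2 by linarith
    also have "\<dots> = (1 - j) * (K\<phi> + Kf + Ku)" by (simp add: algebra_simps)
    also have "\<dots> \<le> (1 / (2 - p) * ((t - s) / (t + 1))) * (K\<phi> + Kf + Ku)" using bern K by (intro mult_right_mono) auto
    finally show ?case by (simp add: mult.commute)
  qed
qed

theorem theorem4p1:
  fixes p C1 Q :: real
    and f \<phi> :: "real ^ 'n \<Rightarrow> real"
    and u :: "real \<Rightarrow> real ^ 'n \<Rightarrow> real"
  assumes p: "1 < p" "p < 2"
    and n: "2 \<le> CARD('n)"
    and C1_pos: "0 < C1"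
    and C1_bound: "\<forall>(g :: real ^ 'n \<Rightarrow> real) \<psi> w. admissible_data g \<psi> \<and> weak_solution p g \<psi> w \<longrightarrow>
          Linf_norm (lebesgue_on ({-1<..0} \<times> B1)) (\<lambda>(t, x). w t x)
          \<le> ereal (real_of_ereal (Linf_norm (lebesgue_on B1) \<psi>)
                   + C1 * real_of_ereal (Linf_norm (lebesgue_on B1) g)
                           powr ((CARD('n) + p) / ((p - 1) * (CARD('n) + 2))))"
    and data: "admissible_data f \<phi>"
    and sol: "weak_solution p f \<phi> u"
    and Q: "Q = 2 * real_of_ereal (Linf_norm (lebesgue_on B1) \<phi>)
                + real_of_ereal (Linf_norm (lebesgue_on B1) f)
                + C1 * real_of_ereal (Linf_norm (lebesgue_on B1) f)
                        powr ((CARD('n) + p) / ((p - 1) * (CARD('n) + 2)))"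
  shows "(\<forall>s t. -1 < s \<and> s < t \<and> t \<le> 0 \<longrightarrow>
            Linf_norm (lebesgue_on B1) (\<lambda>x. u t x - u s x)
            \<le> ereal (Q / (2 - p) * ((t - s) / (t + 1))))
       \<and> (\<exists>ut. weak_time_deriv u ut \<and>
            (AE (t, x) in lebesgue_on ({-3/4<..0} \<times> B1). \<bar>ut t x\<bar> \<le> 4 * Q / (2 - p)))"
proof -
  let ?M = "lebesgue_on (B1 :: (real ^ 'n) set)"
  define K\<phi> where "K\<phi> = real_of_ereal (Linf_norm ?M \<phi>)"
  define Kf where "Kf = real_of_ereal (Linf_norm ?M f)"
  \<comment> \<open>The global bound on |u|. It contains one of the two copies of the norm of \<phi>
    in Q; the other comes from comparing the data.\<close>
  define Ku where "Ku = K\<phi> + C1 * Kf powr ((CARD('n) + p) / ((p - 1) * (CARD('n) + 2)))"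
  have QK: "Q = K\<phi> + Kf + Ku" by (simp add: Q Ku_def K\<phi>_def Kf_def)
  have fpos: "AE x in ?M. 0 \<le> f x" and ffin: "Linf_norm ?M f < \<infinity>" and \<phi>fin: "Linf_norm ?M \<phi> < \<infinity>"
    and pa: "Linf_norm_pa \<phi> = Linf_norm ?M \<phi>"
    using data unfolding admissible_data_def by auto
  have K0: "0 \<le> K\<phi>" "0 \<le> Kf" unfolding K\<phi>_def Kf_def using Linf_norm_finite(1) ffin \<phi>fin by blast+
  have Ku0: "0 \<le> Ku" using K0 C1_pos by (simp add: Ku_def)
  have fm: "f \<in> borel_measurable ?M" by (rule borel_measurable_of_Linf_norm[OF ffin fpos])
  have fb: "AE x in ?M. \<bar>f x\<bar> \<le> Kf"
    using Linf_norm_finite(2)[OF ffin] unfolding Kf_def by (intro AE_abs_le_of_Linf_norm_le) auto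
  have \<phi>b: "AE x in ?M. \<bar>\<phi> x\<bar> \<le> K\<phi>"
    using Linf_norm_finite(2)[OF \<phi>fin] unfolding K\<phi>_def by (intro AE_abs_le_of_Linf_norm_le) auto
  \<comment> \<open>Admissibility equates the norm over the parabolic boundary with the norm over
    the ball, so the same constant bounds \<phi> on the sphere.\<close>
  have \<phi>s: "AE x in surface_measure. \<bar>\<phi> x\<bar> \<le> K\<phi>"
  proof (rule AE_abs_le_of_Linf_norm_le)
    have "Linf_norm surface_measure \<phi> \<le> Linf_norm ?M \<phi>" 
      by (rule order.trans[OF _ eq_refl[OF pa]]) (simp add: Linf_norm_pa_def)
    then show "Linf_norm surface_measure \<phi> \<le> ereal K\<phi>" using Linf_norm_finite(2)[OF \<phi>fin] by (simp add: K\<phi>_def)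
  qed
  obtain G where G: "slab_sol p 0 f \<phi> u G" by (rule weak_solution_slab_sol[OF p(1) fm fb sol])
  have "AE z in lebesgue_on ({-1<..0} \<times> B1). \<bar>case z of (t, x) \<Rightarrow> u t x\<bar> \<le> Ku"
    using C1_bound data sol unfolding Ku_def K\<phi>_def Kf_def by (intro AE_abs_le_of_Linf_norm_le) blast
  then have "AE z in lebesgue_on ({-1<..0} \<times> B1). \<bar>u (fst z) (snd z)\<bar> \<le> Ku" by (simp add: case_prod_beta')
  note slice = slab_sol_slice_bound[OF G this]
  have lip: "AE x in ?M. \<bar>u t x - u s x\<bar> \<le> Q / (2 - p) * ((t - s) / (t + 1))" if "-1 < s" "s < t" "t \<le> 0" for s t
    unfolding QK using that by (intro slab_sol_lipschitz[OF p G fm fb \<phi>b \<phi>s K0(2,1) Ku0] slice) auto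
  have L2: "Lp_fun 2 ?M (u t)" if "t \<in> {-1..0}" for t using G that by (simp add: slab_sol_def)
  have um: "u t \<in> borel_measurable ?M" if "t \<in> {-1..0}" for t by (rule Lp_fun_measurable[OF L2[OF that]])
  show ?thesis
  proof (intro conjI allI impI, elim conjE)
    fix s t :: real assume st: "-1 < s" "s < t" "t \<le> 0"
    show "Linf_norm ?M (\<lambda>x. u t x - u s x) \<le> ereal (Q / (2 - p) * ((t - s) / (t + 1)))"
      unfolding Linf_norm_def
    proof (rule esssup_I)
      have [measurable]: "u t \<in> borel_measurable ?M" "u s \<in> borel_measurable ?M" using st by (auto intro!: um)
      show "(\<lambda>x. ereal \<bar>u t x - u s x\<bar>) \<in> borel_measurable ?M" by measurable
      show "AE x in ?M. ereal \<bar>u t x - u s x\<bar> \<le> ereal (Q / (2 - p) * ((t - s) / (t + 1)))"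
        using lip[OF st] by simp
    qed
  next
    have uC: "Lp_fun p (lebesgue_on Cyl) (\<lambda>z. u (fst z) (snd z))"
      using sol unfolding weak_solution_def Lp_W1p_def by (auto simp: case_prod_beta')
    have \<Lambda>: "0 \<le> Q / (2 - p)" using K0 Ku0 p by (simp add: QK)
    obtain g where g: "weak_time_deriv u (\<lambda>t x. g (t, x))" "\<And>t x. -3/4 < t \<Longrightarrow> t \<le> 0 \<Longrightarrow> \<bar>g (t, x)\<bar> \<le> 4 * (Q / (2 - p))"
      using weak_time_deriv_of_lipschitz[OF uC p(1) \<Lambda> um lip] by blast
    show "\<exists>ut. weak_time_deriv u ut \<and>
            (AE (t, x) in lebesgue_on ({-3/4<..0} \<times> B1). \<bar>ut t x\<bar> \<le> 4 * Q / (2 - p))"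
    proof (intro exI conjI)
      show "AE (t, x) in lebesgue_on ({-3/4<..0} \<times> B1). \<bar>g (t, x)\<bar> \<le> 4 * Q / (2 - p)"
        using g(2) by (intro AE_I2) (auto simp: space_restrict_space)
    qed (rule g(1))
  qed
qed

end
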